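(* Let $n\ge1$ and $\mathfrak g=\mathrm{Der}(\mathbb C[t_1,\dots,t_n])$. Any simple smooth $\mathfrak g$-module is either isomorphic to one of the modules (1) $F(P_0,M)$, where $M$ is a simple $\mathfrak{gl}_n$-module with $M\not\cong V(\delta_r,r)$ for all $r\in\{0,1,\dots,n\}$; (2) $F(P_0,V(\delta_0,0))=P_0$; (3) $F(P_0,V(\delta_r,r))/\tilde L_n(P_0,r)$ for $r=1,\dots,n-1$; (4) $F(P_0,V(\delta_n,n))/L_n(P_0,n)$, which is a $1$-dimensional module; or isomorphic to an induced module $\mathrm{Ind}_{\mathfrak g_{\ge0}}^{\mathfrak g}E$ for some $\ell\ge2$ and some simple module $E$ over the finite-dimensional Lie algebra $\mathfrak g^{(\ell)}=\mathfrak g_{\ge0}/\mathfrak g_{\ge\ell}$ (regarded as a $\mathfrak g_{\ge0}$-module) with $\mathfrak g_{\ell-1}E\ne0$.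
   Context: All vector spaces are over $\mathbb C$; $\mathbb Z_+$ denotes the non-negative integers. Write $\partial_i=\partial/\partial t_i$, $t^\alpha=t_1^{\alpha_1}\cdots t_n^{\alpha_n}$, $|\alpha|=\alpha_1+\dots+\alpha_n$ for $\alpha\in\mathbb Z_+^n$. $\mathfrak g$ is $\mathbb Z$-graded: $\mathfrak g=\bigoplus_{k\ge-1}\mathfrak g_k$, $\mathfrak g_k=\mathrm{Span}\{t^\alpha\partial_i\mid |\alpha|=k+1,\ 1\le i\le n\}$, and $\mathfrak g_{\ge r}=\bigoplus_{k\ge r}\mathfrak g_k$. A $\mathfrak g$-module $V$ is smooth if for every $v\in V$ there is $m\in\mathbb Z_+$ with $\mathfrak g_i v=0$ for all $i\ge m$. $\mathrm{Ind}_{\mathfrak g_{\ge0}}^{\mathfrak g}E=U(\mathfrak g)\otimes_{U(\mathfrak g_{\ge0})}E$. $E_{ij}$ are the matrix units of $\mathfrak{gl}_n$. $\mathcal K_n^+=\mathbb C[t_1,\dots,t_n,\partial_1,\dots,\partial_n]$ is the Weyl algebra, and $P_0=\mathcal K_n^+/\sum_{i=1}^n\mathcal K_n^+t_i$, a (simple left) $\mathcal K_n^+$-module. For a $\mathcal K_n^+$-module $P$ and a $\mathfrak{gl}_n$-module $M$, $F(P,M)=P\otimes_{\mathbb C}M$ is the $\mathfrak g$-module with action $$(t^\alpha\partial_j)\circ(g\otimes v)=((t^\alpha\partial_j)g)\otimes v+\sum_{i=1}^n(\partial_i(t^\alpha)g)\otimes E_{ij}v$$ for $\alpha\in\mathbb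 Z_+^n$, $1\le j\le n$, $g\in P$, $v\in M$. For $h_i=E_{ii}-E_{i+1,i+1}$ ($1\le i\le n-1$) and $\mathfrak h=\mathrm{Span}\{h_i\}$, let $\delta_i\in\mathfrak h^*$ be given by $\delta_i(h_j)=\delta_{i,j}$ for $1\le i,j\le n-1$, and $\delta_0=\delta_n=0$. $V(\varphi,b)$ is the simple highest weight $\mathfrak{sl}_n$-module of highest weight $\varphi$, made into a $\mathfrak{gl}_n$-module by letting the identity matrix act as the scalar $b$. One has $V(\delta_r,r)\cong\bigwedge^r(\mathbb C^n)$ for $0\le r\le n$, and these are identified. Let $\epsilon_1,\dots,\epsilon_n$ be the standard basis of $\mathbb C^n$. Put $L_n(P_0,0)=0$, for $1\le r\le n$ $$L_n(P_0,r)=\mathrm{Span}\Big\{\sum_{k=1}^n(\partial_k p)\otimes(\epsilon_k\wedge\epsilon_{i_2}\wedge\cdots\wedge\epsilon_{i_r})\ \Big|\ p\in P_0,\ 1\le i_2,\dots,i_r\le n\Big\},$$ and for $0\le r\le n$, $\tilde L_n(P_0,r)=\{v\in F(P_0,V(\delta_r,r))\mid \mathfrak g v\subseteq L_n(P_0,r)\}$. *)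

theory Defs
  imports
    "HOL-Library.Poly_Mapping"
    "HOL-Library.FuncSet"
    "HOL-Algebra.Algebraic_Closure_Type"
    "HOL-Algebra.QuotRing"
    "Jordan_Normal_Form.Matrix"
begin

section \<open>Complex vector spaces, Lie algebras and their modules\<close>

text \<open>
  A vector space is a record \<open>V\<close> with \<^term>\<open>module CC V\<close> for the field \<open>CC\<close> of complex numbers.
  The record type \<^typ>\<open>(complex, 'v) module\<close> also has fields \<open>mult\<close> and \<open>one\<close>.
  For a Lie algebra, \<open>mult\<close> is the bracket; for an associative algebra it is the product;
  in all other cases these two fields carry no information.
\<close>

abbreviation CC :: "complex ring" where
  "CC \<equiv> ring_of_type_algebra"

definition vspan :: "(complex, 'v, 'e) module_scheme \<Rightarrow> 'v set \<Rightarrow> 'v set" where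
  "vspan V S = \<Inter>{N. submodule N CC V \<and> S \<subseteq> N}"

text \<open>\<^const>\<open>FactRing\<close> on additive structure and product, together with the induced scalar action.
  It is used for quotients of vector spaces, of Lie algebras and of associative algebras.\<close>

definition vquot :: "(complex, 'v, 'e) module_scheme \<Rightarrow> 'v set \<Rightarrow> (complex, 'v set) module" where
  "vquot V N =
     ring.extend (V Quot N) (module.fields (\<lambda>c A. \<Union>a\<in>A. N +>\<^bsub>V\<^esub> (c \<odot>\<^bsub>V\<^esub> a)))"

definition subalg :: "(complex, 'g) module \<Rightarrow> 'g set \<Rightarrow> (complex, 'g) module" where
  "subalg L S = L\<lparr>carrier := S\<rparr>"

text \<open>A vector space together with an action of the elements of some Lie or associative algebra.\<close>

record ('s, 'v) lmod = "(complex, 'v) module" +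
  act :: "'s \<Rightarrow> 'v \<Rightarrow> 'v"

locale lie_module = module "CC" V
  for L :: "(complex, 'g) module" and V :: "('g, 'v) lmod" +
  assumes act_closed: "\<lbrakk>x \<in> carrier L; v \<in> carrier V\<rbrakk> \<Longrightarrow> act V x v \<in> carrier V"
    and act_add: "\<lbrakk>x \<in> carrier L; v \<in> carrier V; w \<in> carrier V\<rbrakk> \<Longrightarrow>
      act V x (v \<oplus>\<^bsub>V\<^esub> w) = act V x v \<oplus>\<^bsub>V\<^esub> act V x w"
    and act_smult: "\<lbrakk>x \<in> carrier L; v \<in> carrier V\<rbrakk> \<Longrightarrow>
      act V x (c \<odot>\<^bsub>V\<^esub> v) = c \<odot>\<^bsub>V\<^esub> act V x v"
    and add_act: "\<lbrakk>x \<in> carrier L; y \<in> carrier L; v \<in> carrier V\<rbrakk> \<Longrightarrow>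
      act V (x \<oplus>\<^bsub>L\<^esub> y) v = act V x v \<oplus>\<^bsub>V\<^esub> act V y v"
    and smult_act: "\<lbrakk>x \<in> carrier L; v \<in> carrier V\<rbrakk> \<Longrightarrow>
      act V (c \<odot>\<^bsub>L\<^esub> x) v = c \<odot>\<^bsub>V\<^esub> act V x v"
    and bracket_act: "\<lbrakk>x \<in> carrier L; y \<in> carrier L; v \<in> carrier V\<rbrakk> \<Longrightarrow>
      act V (x \<otimes>\<^bsub>L\<^esub> y) v = act V x (act V y v) \<ominus>\<^bsub>V\<^esub> act V y (act V x v)"

definition lie_submodule :: "(complex, 'g) module \<Rightarrow> ('g, 'v) lmod \<Rightarrow> 'v set \<Rightarrow> bool" where
  "lie_submodule L V N \<longleftrightarrow>
     submodule N CC V \<and> (\<forall>x\<in>carrier L. \<forall>v\<in>N. act V x v \<in> N)"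

definition simple_lie_module :: "(complex, 'g) module \<Rightarrow> ('g, 'v) lmod \<Rightarrow> bool" where
  "simple_lie_module L V \<longleftrightarrow>
     lie_module L V \<and> carrier V \<noteq> {\<zero>\<^bsub>V\<^esub>} \<and>
     (\<forall>N. lie_submodule L V N \<longrightarrow> N = {\<zero>\<^bsub>V\<^esub>} \<or> N = carrier V)"

definition lie_module_iso ::
    "(complex, 'g) module \<Rightarrow> ('g, 'v) lmod \<Rightarrow> ('g, 'w) lmod \<Rightarrow> bool" where
  "lie_module_iso L V W \<longleftrightarrow> (\<exists>f. bij_betw f (carrier V) (carrier W) \<and>
     (\<forall>v\<in>carrier V. \<forall>w\<in>carrier V. f (v \<oplus>\<^bsub>V\<^esub> w) = f v \<oplus>\<^bsub>W\<^esub> f w) \<and>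
     (\<forall>c. \<forall>v\<in>carrier V. f (c \<odot>\<^bsub>V\<^esub> v) = c \<odot>\<^bsub>W\<^esub> f v) \<and>
     (\<forall>x\<in>carrier L. \<forall>v\<in>carrier V. f (act V x v) = act W x (f v)))"

definition one_dimensional :: "('s, 'v) lmod \<Rightarrow> bool" where
  "one_dimensional V \<longleftrightarrow>
     (\<exists>v\<in>carrier V. v \<noteq> \<zero>\<^bsub>V\<^esub> \<and> carrier V = {c \<odot>\<^bsub>V\<^esub> v | c. True})"

definition quot_module :: "('s, 'v) lmod \<Rightarrow> 'v set \<Rightarrow> ('s, 'v set) lmod" where
  "quot_module V N =
     module.extend (vquot V N) (lmod.fields (\<lambda>x A. \<Union>a\<in>A. N +>\<^bsub>V\<^esub> act V x a))"

text \<open>The pull-back of a module over \<open>L/I\<close> along the projection from \<open>L\<close>.\<close>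

definition inflate :: "(complex, 'g) module \<Rightarrow> 'g set \<Rightarrow> ('g set, 'v) lmod \<Rightarrow> ('g, 'v) lmod" where
  "inflate L I E = module.extend (module.truncate E) (lmod.fields (\<lambda>x. act E (I +>\<^bsub>L\<^esub> x)))"


section \<open>Free vector spaces and tensor products\<close>

definition pscale :: "complex \<Rightarrow> ('x \<Rightarrow>\<^sub>0 complex) \<Rightarrow> ('x \<Rightarrow>\<^sub>0 complex)" where
  "pscale c = Poly_Mapping.map ((*) c)"

abbreviation gen :: "'x \<Rightarrow> ('x \<Rightarrow>\<^sub>0 complex)" where
  "gen x \<equiv> Poly_Mapping.single x 1"

text \<open>The vector space with basis \<open>B\<close>; the operator of \<open>s\<close> is the linear extension of
  \<open>f s\<close> on basis elements.\<close>

definition free_module :: "'x set \<Rightarrow> ('s \<Rightarrow> 'x \<Rightarrow> ('x \<Rightarrow>\<^sub>0 complex)) \<Rightarrow> ('s, 'x \<Rightarrow>\<^sub>0 complex) lmod"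
  where "free_module B f = \<lparr>carrier = {p. Poly_Mapping.keys p \<subseteq> B},
     monoid.mult = (\<lambda>_ _. 0), one = 0, zero = 0, add = (+), module.smult = pscale,
     act = (\<lambda>s p. \<Sum>x\<in>Poly_Mapping.keys p. pscale (Poly_Mapping.lookup p x) (f s x))\<rparr>"

definition presented_module ::
    "'x set \<Rightarrow> ('x \<Rightarrow>\<^sub>0 complex) set \<Rightarrow> ('s \<Rightarrow> 'x \<Rightarrow> ('x \<Rightarrow>\<^sub>0 complex)) \<Rightarrow>
     ('s, ('x \<Rightarrow>\<^sub>0 complex) set) lmod" where
  "presented_module B R f = quot_module (free_module B f) (vspan (free_module B f) R)"

definition presented_class ::
    "'x set \<Rightarrow> ('x \<Rightarrow>\<^sub>0 complex) set \<Rightarrow> ('s \<Rightarrow> 'x \<Rightarrow> ('x \<Rightarrow>\<^sub>0 complex)) \<Rightarrow> 'x \<Rightarrow>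
     ('x \<Rightarrow>\<^sub>0 complex) set" where
  "presented_class B R f x = vspan (free_module B f) R +>\<^bsub>free_module B f\<^esub> gen x"

definition tensor_rels ::
    "(complex, 'a, 'e) module_scheme \<Rightarrow> (complex, 'b, 'f) module_scheme \<Rightarrow>
     ('a \<times> 'b \<Rightarrow>\<^sub>0 complex) set" where
  "tensor_rels A B =
     {gen (a \<oplus>\<^bsub>A\<^esub> a', b) - gen (a, b) - gen (a', b) | a a' b.
        a \<in> carrier A \<and> a' \<in> carrier A \<and> b \<in> carrier B} \<union>
     {gen (a, b \<oplus>\<^bsub>B\<^esub> b') - gen (a, b) - gen (a, b') | a b b'.
        a \<in> carrier A \<and> b \<in> carrier B \<and> b' \<in> carrier B} \<union>
     {gen (c \<odot>\<^bsub>A\<^esub> a, b) - pscale c (gen (a, b)) | c a b.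
        a \<in> carrier A \<and> b \<in> carrier B} \<union>
     {gen (a, c \<odot>\<^bsub>B\<^esub> b) - pscale c (gen (a, b)) | c a b.
        a \<in> carrier A \<and> b \<in> carrier B}"


section \<open>Enveloping algebras and induced modules\<close>

text \<open>The free associative unital algebra on the set \<open>B\<close>; its basis consists of the words in \<open>B\<close>.\<close>

definition free_alg :: "'g set \<Rightarrow> (complex, 'g list \<Rightarrow>\<^sub>0 complex) module" where
  "free_alg B = \<lparr>carrier = {p. \<forall>w\<in>Poly_Mapping.keys p. set w \<subseteq> B},
     monoid.mult = (\<lambda>p q. \<Sum>u\<in>Poly_Mapping.keys p. \<Sum>w\<in>Poly_Mapping.keys q.
        Poly_Mapping.single (u @ w) (Poly_Mapping.lookup p u * Poly_Mapping.lookup q w)),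
     one = gen [], zero = 0, add = (+), module.smult = pscale\<rparr>"

definition env_ideal :: "(complex, 'g) module \<Rightarrow> ('g list \<Rightarrow>\<^sub>0 complex) set" where
  "env_ideal L = Idl\<^bsub>free_alg (carrier L)\<^esub>
     ({gen [x \<oplus>\<^bsub>L\<^esub> y] - gen [x] - gen [y] | x y. x \<in> carrier L \<and> y \<in> carrier L} \<union>
      {gen [c \<odot>\<^bsub>L\<^esub> x] - pscale c (gen [x]) | c x. x \<in> carrier L} \<union>
      {gen [x, y] - gen [y, x] - gen [x \<otimes>\<^bsub>L\<^esub> y] | x y. x \<in> carrier L \<and> y \<in> carrier L})"

definition env_alg :: "(complex, 'g) module \<Rightarrow> (complex, ('g list \<Rightarrow>\<^sub>0 complex) set) module" where
  "env_alg L = vquot (free_alg (carrier L)) (env_ideal L)"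

definition env_emb :: "(complex, 'g) module \<Rightarrow> 'g \<Rightarrow> ('g list \<Rightarrow>\<^sub>0 complex) set" where
  "env_emb L x = env_ideal L +>\<^bsub>free_alg (carrier L)\<^esub> gen [x]"

text \<open>The homomorphism from \<open>U(H)\<close> to \<open>U(L)\<close> induced by the inclusion of a subalgebra \<open>H\<close> of \<open>L\<close>:
  it sends the class of a polynomial in words modulo \<open>env_ideal H\<close> to its class
  modulo \<open>env_ideal L\<close>.\<close>

definition env_incl ::
    "(complex, 'g) module \<Rightarrow> ('g list \<Rightarrow>\<^sub>0 complex) set \<Rightarrow> ('g list \<Rightarrow>\<^sub>0 complex) set" where
  "env_incl L A = env_ideal L <+>\<^bsub>free_alg (carrier L)\<^esub> A"

text \<open>The action of \<open>U(H)\<close> on an \<open>H\<close>-module: all representatives of a class act in the same way.\<close>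

definition word_act :: "('g, 'v) lmod \<Rightarrow> ('g list \<Rightarrow>\<^sub>0 complex) \<Rightarrow> 'v \<Rightarrow> 'v" where
  "word_act E p e =
     (\<Oplus>\<^bsub>E\<^esub> w \<in> Poly_Mapping.keys p. Poly_Mapping.lookup p w \<odot>\<^bsub>E\<^esub> foldr (act E) w e)"

definition env_act :: "('g, 'v) lmod \<Rightarrow> ('g list \<Rightarrow>\<^sub>0 complex) set \<Rightarrow> 'v \<Rightarrow> 'v" where
  "env_act E A e = the_elem ((\<lambda>a. word_act E a e) ` A)"

definition Ind ::
    "(complex, 'g) module \<Rightarrow> 'g set \<Rightarrow> ('g, 'v) lmod \<Rightarrow>
     ('g, (('g list \<Rightarrow>\<^sub>0 complex) set \<times> 'v \<Rightarrow>\<^sub>0 complex) set) lmod" where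
  "Ind L H E = presented_module (carrier (env_alg L) \<times> carrier E)
     (tensor_rels (env_alg L) E \<union>
      {gen (u \<otimes>\<^bsub>env_alg L\<^esub> env_incl L a, e) - gen (u, env_act E a e) | u a e.
         u \<in> carrier (env_alg L) \<and> a \<in> carrier (env_alg (subalg L H)) \<and> e \<in> carrier E})
     (\<lambda>x (u, e). gen (env_emb L x \<otimes>\<^bsub>env_alg L\<^esub> u, e))"


section \<open>Polynomials, derivations and the Weyl algebra\<close>

text \<open>The \<open>n\<close> variables are numbered from \<open>0\<close> to \<open>n - 1\<close>. Operators on the polynomial ring
  in these variables are extensional functions, i.e. fixed to \<^const>\<open>undefined\<close> outside of it.\<close>

type_synonym cpoly = "(nat \<Rightarrow>\<^sub>0 nat) \<Rightarrow>\<^sub>0 complex"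

type_synonym cop = "cpoly \<Rightarrow> cpoly"

definition exponents :: "nat \<Rightarrow> (nat \<Rightarrow>\<^sub>0 nat) set" where
  "exponents n = {\<alpha>. Poly_Mapping.keys \<alpha> \<subseteq> {..<n}}"

definition polys :: "nat \<Rightarrow> cpoly set" where
  "polys n = {p. Poly_Mapping.keys p \<subseteq> exponents n}"

definition pvar :: "nat \<Rightarrow> cpoly" where
  "pvar i = gen (Poly_Mapping.single i 1)"

definition pdiff :: "nat \<Rightarrow> cpoly \<Rightarrow> cpoly" where
  "pdiff i p = (\<Sum>\<alpha>\<in>Poly_Mapping.keys p. Poly_Mapping.single (\<alpha> - Poly_Mapping.single i 1)
     (of_nat (Poly_Mapping.lookup \<alpha> i) * Poly_Mapping.lookup p \<alpha>))"

definition mul_op :: "nat \<Rightarrow> cpoly \<Rightarrow> cop" where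
  "mul_op n q = (\<lambda>p\<in>polys n. q * p)"

definition diff_op :: "nat \<Rightarrow> nat \<Rightarrow> cop" where
  "diff_op n i = (\<lambda>p\<in>polys n. pdiff i p)"

definition op_space :: "nat \<Rightarrow> cop set \<Rightarrow> (cop \<Rightarrow> cop \<Rightarrow> cop) \<Rightarrow> cop \<Rightarrow> (complex, cop) module" where
  "op_space n B m e = \<lparr>carrier = B, monoid.mult = m, one = e,
     zero = (\<lambda>p\<in>polys n. 0), add = (\<lambda>S T. \<lambda>p\<in>polys n. S p + T p),
     module.smult = (\<lambda>c T. \<lambda>p\<in>polys n. pscale c (T p))\<rparr>"

definition Der :: "nat \<Rightarrow> (complex, cop) module" where
  "Der n = op_space n
     {D \<in> polys n \<rightarrow>\<^sub>E polys n.
        (\<forall>p\<in>polys n. \<forall>q\<in>polys n. D (p + q) = D p + D q) \<and>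
        (\<forall>c. \<forall>p\<in>polys n. D (pscale c p) = pscale c (D p)) \<and>
        (\<forall>p\<in>polys n. \<forall>q\<in>polys n. D (p * q) = D p * q + p * D q)}
     (\<lambda>D D'. \<lambda>p\<in>polys n. D (D' p) - D' (D p))
     (\<lambda>p\<in>polys n. 0)"

definition der_gen :: "nat \<Rightarrow> (nat \<Rightarrow>\<^sub>0 nat) \<Rightarrow> nat \<Rightarrow> cop" where
  "der_gen n \<alpha> i = (\<lambda>p\<in>polys n. gen \<alpha> * pdiff i p)"

definition grade :: "nat \<Rightarrow> int \<Rightarrow> cop set" where
  "grade n k = vspan (Der n) {der_gen n \<alpha> i | \<alpha> i.
     \<alpha> \<in> exponents n \<and> i < n \<and> int (\<Sum>j<n. Poly_Mapping.lookup \<alpha> j) = k + 1}"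

definition grade_ge :: "nat \<Rightarrow> int \<Rightarrow> cop set" where
  "grade_ge n r = vspan (Der n) (\<Union>k\<in>{r..}. grade n k)"

definition smooth :: "nat \<Rightarrow> (cop, 'v) lmod \<Rightarrow> bool" where
  "smooth n V \<longleftrightarrow> (\<forall>v\<in>carrier V. \<exists>m::nat. \<forall>i\<ge>int m. \<forall>x\<in>grade n i. act V x v = \<zero>\<^bsub>V\<^esub>)"

definition g_trunc :: "nat \<Rightarrow> nat \<Rightarrow> (complex, cop set) module" where
  "g_trunc n l = vquot (subalg (Der n) (grade_ge n 0)) (grade_ge n (int l))"

inductive_set weyl_ops :: "nat \<Rightarrow> cop set" for n where
  one: "(\<lambda>p\<in>polys n. p) \<in> weyl_ops n"
| var: "i < n \<Longrightarrow> mul_op n (pvar i) \<in> weyl_ops n"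
| diff: "i < n \<Longrightarrow> diff_op n i \<in> weyl_ops n"
| add: "\<lbrakk>S \<in> weyl_ops n; T \<in> weyl_ops n\<rbrakk> \<Longrightarrow> (\<lambda>p\<in>polys n. S p + T p) \<in> weyl_ops n"
| scale: "T \<in> weyl_ops n \<Longrightarrow> (\<lambda>p\<in>polys n. pscale c (T p)) \<in> weyl_ops n"
| comp: "\<lbrakk>S \<in> weyl_ops n; T \<in> weyl_ops n\<rbrakk> \<Longrightarrow> compose (polys n) S T \<in> weyl_ops n"

definition weyl :: "nat \<Rightarrow> (complex, cop) module" where
  "weyl n = op_space n (weyl_ops n) (compose (polys n)) (\<lambda>p\<in>polys n. p)"

text \<open>Since derivations are elements of the Weyl algebra (as operators), a module over the Weyl
  algebra restricts to one over \<^term>\<open>Der n\<close> without any change to the record.\<close>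

definition P0 :: "nat \<Rightarrow> (cop, cop set) lmod" where
  "P0 n = quot_module (module.extend (weyl n) (lmod.fields (monoid.mult (weyl n))))
     (vspan (weyl n) {T \<otimes>\<^bsub>weyl n\<^esub> mul_op n (pvar i) | T i. T \<in> carrier (weyl n) \<and> i < n})"


section \<open>Modules over the general linear Lie algebra\<close>

definition gl :: "nat \<Rightarrow> (complex, complex mat) module" where
  "gl n = (module_mat TYPE(complex) n n)\<lparr>monoid.mult := \<lambda>A B. A * B - B * A\<rparr>"

definition sl :: "nat \<Rightarrow> (complex, complex mat) module" where
  "sl n = subalg (gl n) {A \<in> carrier_mat n n. (\<Sum>i<n. A $$ (i, i)) = 0}"

definition mat_unit :: "nat \<Rightarrow> nat \<Rightarrow> nat \<Rightarrow> complex mat" where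
  "mat_unit n i j = mat n n (\<lambda>(k, l). if k = i \<and> l = j then 1 else 0)"

definition cartan :: "nat \<Rightarrow> nat \<Rightarrow> complex mat" where
  "cartan n j = mat_unit n j j - mat_unit n (Suc j) (Suc j)"

text \<open>The \<open>gl\<close>-module \<open>M\<close> is a \<open>V(\<phi>, b)\<close> (which is unique up to isomorphism). The weight \<open>\<phi>\<close> is given by
  its values \<open>\<phi> j\<close> on \<^term>\<open>cartan n j\<close>, \<open>j < n - 1\<close>. By simplicity, a highest weight vector
  generates \<open>M\<close>.\<close>

definition is_V :: "nat \<Rightarrow> (nat \<Rightarrow> complex) \<Rightarrow> complex \<Rightarrow> (complex mat, 'v) lmod \<Rightarrow> bool" where
  "is_V n \<phi> b M \<longleftrightarrow>
     lie_module (gl n) M \<and> simple_lie_module (sl n) M \<and>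
     (\<exists>v\<in>carrier M. v \<noteq> \<zero>\<^bsub>M\<^esub> \<and>
        (\<forall>j<n. \<forall>i<j. act M (mat_unit n i j) v = \<zero>\<^bsub>M\<^esub>) \<and>
        (\<forall>j. Suc j < n \<longrightarrow> act M (cartan n j) v = \<phi> j \<odot>\<^bsub>M\<^esub> v)) \<and>
     (\<forall>v\<in>carrier M. act M (1\<^sub>m n) v = b \<odot>\<^bsub>M\<^esub> v)"

text \<open>The weight \<open>\<delta>\<^sub>r\<close>. With indices starting at \<open>0\<close>, it is \<open>1\<close> on \<^term>\<open>cartan n (r - 1)\<close>; it vanishes
  on all \<^term>\<open>cartan n j\<close> with \<open>j < n - 1\<close> if \<open>r = 0\<close> or \<open>r = n\<close>.\<close>

definition fund_weight :: "nat \<Rightarrow> nat \<Rightarrow> complex" where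
  "fund_weight r j = (if Suc j = r then 1 else 0)"

text \<open>The \<open>r\<close>-th exterior power of \<open>\<complex>\<^sup>n\<close>: generators \<open>v\<^sub>1 \<and> \<dots> \<and> v\<^sub>r\<close>, subject to multilinearity and
  vanishing whenever two entries agree; matrices act as derivations.\<close>

definition ext_gens :: "nat \<Rightarrow> nat \<Rightarrow> complex vec list set" where
  "ext_gens n r = {vs. length vs = r \<and> set vs \<subseteq> carrier_vec n}"

definition ext_rels :: "nat \<Rightarrow> nat \<Rightarrow> (complex vec list \<Rightarrow>\<^sub>0 complex) set" where
  "ext_rels n r =
     {gen (vs[k := u + w]) - gen (vs[k := u]) - gen (vs[k := w]) | vs k u w.
        vs \<in> ext_gens n r \<and> k < r \<and> u \<in> carrier_vec n \<and> w \<in> carrier_vec n} \<union>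
     {gen (vs[k := c \<cdot>\<^sub>v u]) - pscale c (gen (vs[k := u])) | vs k c u.
        vs \<in> ext_gens n r \<and> k < r \<and> u \<in> carrier_vec n} \<union>
     {gen vs | vs i j. vs \<in> ext_gens n r \<and> i < j \<and> j < r \<and> vs ! i = vs ! j}"

definition ext_act :: "complex mat \<Rightarrow> complex vec list \<Rightarrow> (complex vec list \<Rightarrow>\<^sub>0 complex)" where
  "ext_act A vs = (\<Sum>k<length vs. gen (vs[k := A *\<^sub>v (vs ! k)]))"

definition ext_power ::
    "nat \<Rightarrow> nat \<Rightarrow> (complex mat, (complex vec list \<Rightarrow>\<^sub>0 complex) set) lmod" where
  "ext_power n r = presented_module (ext_gens n r) (ext_rels n r) ext_act"

definition wedge :: "nat \<Rightarrow> complex vec list \<Rightarrow> (complex vec list \<Rightarrow>\<^sub>0 complex) set" where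
  "wedge n vs = presented_class (ext_gens n (length vs)) (ext_rels n (length vs)) ext_act vs"


section \<open>Tensor modules\<close>

text \<open>The action of a derivation \<open>D\<close> on \<open>g \<otimes> v\<close>. As \<open>D = (\<Sum>j<n. D t\<^sub>j \<cdot> \<partial>\<^sub>j)\<close>, the formula below is the
  linear extension in \<open>D\<close> of
  \<open>(t\<^sup>\<alpha> \<partial>\<^sub>j) \<circ> (g \<otimes> v) = (t\<^sup>\<alpha> \<partial>\<^sub>j) g \<otimes> v + (\<Sum>i<n. \<partial>\<^sub>i(t\<^sup>\<alpha>) g \<otimes> E\<^sub>i\<^sub>j v)\<close>.\<close>

definition F_act ::
    "nat \<Rightarrow> (cop, 'p) lmod \<Rightarrow> (complex mat, 'm) lmod \<Rightarrow> cop \<Rightarrow> 'p \<times> 'm \<Rightarrow>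
     ('p \<times> 'm \<Rightarrow>\<^sub>0 complex)" where
  "F_act n P M D = (\<lambda>(g, v). gen (act P D g, v) +
     (\<Sum>j<n. \<Sum>i<n. gen (act P (mul_op n (pdiff i (D (pvar j)))) g, act M (mat_unit n i j) v)))"

definition F ::
    "nat \<Rightarrow> (cop, 'p) lmod \<Rightarrow> (complex mat, 'm) lmod \<Rightarrow> (cop, ('p \<times> 'm \<Rightarrow>\<^sub>0 complex) set) lmod" where
  "F n P M = presented_module (carrier P \<times> carrier M) (tensor_rels P M) (F_act n P M)"

definition F_tensor ::
    "nat \<Rightarrow> (cop, 'p) lmod \<Rightarrow> (complex mat, 'm) lmod \<Rightarrow> 'p \<Rightarrow> 'm \<Rightarrow> ('p \<times> 'm \<Rightarrow>\<^sub>0 complex) set" where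
  "F_tensor n P M g v =
     presented_class (carrier P \<times> carrier M) (tensor_rels P M) (F_act n P M) (g, v)"

text \<open>The module \<open>F(P\<^sub>0, V(\<delta>\<^sub>r, r))\<close>, where \<open>V(\<delta>\<^sub>r, r)\<close> is identified with the exterior power.\<close>

abbreviation F_ext ::
    "nat \<Rightarrow> nat \<Rightarrow> (cop, (cop set \<times> (complex vec list \<Rightarrow>\<^sub>0 complex) set \<Rightarrow>\<^sub>0 complex) set) lmod" where
  "F_ext n r \<equiv> F n (P0 n) (ext_power n r)"

definition Ln :: "nat \<Rightarrow> nat \<Rightarrow> (cop set \<times> (complex vec list \<Rightarrow>\<^sub>0 complex) set \<Rightarrow>\<^sub>0 complex) set set" where
  "Ln n r = (if r = 0 then {\<zero>\<^bsub>F_ext n r\<^esub>} else vspan (F_ext n r)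
     {\<Oplus>\<^bsub>F_ext n r\<^esub> k \<in> {..<n}. F_tensor n (P0 n) (ext_power n r) (act (P0 n) (diff_op n k) p)
          (wedge n (unit_vec n k # map (unit_vec n) is)) | p is.
        p \<in> carrier (P0 n) \<and> length is = r - 1 \<and> set is \<subseteq> {..<n}})"

definition Ln_tilde ::
    "nat \<Rightarrow> nat \<Rightarrow> (cop set \<times> (complex vec list \<Rightarrow>\<^sub>0 complex) set \<Rightarrow>\<^sub>0 complex) set set" where
  "Ln_tilde n r =
     {v \<in> carrier (F_ext n r). \<forall>x\<in>carrier (Der n). act (F_ext n r) x v \<in> Ln n r}"

end

theory Submission imports Defs
begin

text \<open>Realize a simple smooth module \<open>V\<close> on finitely supported functions and let \<open>V\<^sup>(\<^sup>k\<^sup>)\<close> (\<open>filt k\<close> below) be the subspace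
 killed by all vector fields whose coefficients vanish to order more than \<open>k\<close>. Smoothness makes some \<open>V\<^sup>(\<^sup>k\<^sup>)\<close> nonzero; each is
 stable under the vector fields vanishing at the origin, so by simplicity its translates under the monomials
 \<open>\<partial>\<^sup>\<alpha>\<close> span \<open>V\<close>. Let \<open>l\<close> be the least index with \<open>V\<^sup>(\<^sup>l\<^sup>)\<close> nonzero.

 If \<open>l \<ge> 2\<close>, the sum of these translates is direct: a relation of top degree \<open>d\<close>, hit with fields of degree \<open>l + d\<close>, is
 excluded by a McCoy-type argument. Hence \<open>V\<close> is induced from \<open>V\<^sup>(\<^sup>l\<^sup>)\<close>.

 If \<open>l \<le> 1\<close>, the space \<open>V\<^sup>(\<^sup>1\<^sup>)\<close> is a module of the general linear Lie algebra. The coefficients of any relation between translates are killed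
 by quadratic elements of its enveloping algebra (\<open>TT\<close> below). If no nonzero vector is killed, the
 sum is direct and \<open>V\<close> is a tensor module. Otherwise the killed vectors contain a highest weight
 vector with weight \<open>(1, \<dots>, 1, 0, \<dots>, 0)\<close>, hence an exterior power, and \<open>V\<close> is a quotient of a tensor module of de Rham
 type. The kernel is found from Cartan's formula, the exactness of the de Rham complex, and a leading term argument.\<close>

text \<open>For every space \<open>M\<close> killed to second order, the tensor formula gives a
  homomorphism from the tensor module onto the span of the \<open>\<partial>\<close>-translates of
  \<open>M\<close>; induced modules behave in the same way. Both constructions therefore come down
  to one question, whether the sum of the translates is direct, and the independence of normally
  ordered words in the enveloping algebra is read off inside \<open>V\<close>.

  The obstacle for \<open>l \<le> 1\<close> is that the module of the general linear algebra may be
  infinite-dimensional, so weights have to be produced by hand. The quadratic elements do this. They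
  are the values of an alternating sum of products of two vector fields whose commutator with a
  constant field differentiates only one argument, a free test function. On vectors killed by them
  every diagonal matrix unit is idempotent, and this yields weights with entries 0 and 1.

  \<open>P0\<close> consists of delta functions. In its polynomial model the de Rham differential
  becomes \<open>\<Sum> t_k \<epsilon>_k\<close>, and the Euler field is diagonal on monomials; its
  eigenvalues decide which closed forms are exact and which vectors lie at the top.\<close>

type_synonym 'x cv = "'x \<Rightarrow>\<^sub>0 complex"

abbreviation lookup :: "('a \<Rightarrow>\<^sub>0 'b::zero) => 'a => 'b" where "lookup \<equiv> Poly_Mapping.lookup"
abbreviation keys :: "('a \<Rightarrow>\<^sub>0 'b::zero) => 'a set" where "keys \<equiv> Poly_Mapping.keys"
abbreviation single :: "'a => 'b => 'a \<Rightarrow>\<^sub>0 'b::zero" where "single \<equiv> Poly_Mapping.single"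

section \<open>Linear algebra on finitely supported functions\<close>

lemma CC_simps [simp]: "carrier CC = UNIV" "\<zero>\<^bsub>CC\<^esub> = 0" "\<one>\<^bsub>CC\<^esub> = 1"
 "x \<oplus>\<^bsub>CC\<^esub> y = x + y" "x \<otimes>\<^bsub>CC\<^esub> y = x * y"
 by (auto simp: ring_of_type_algebra_def)

lemma cring_CC: "cring CC"
 by (rule cring_from_type_algebra)

lemma CC_minus [simp]: "\<ominus>\<^bsub>CC\<^esub> c = - c"
proof -
 interpret cring CC by (rule cring_CC)
 have "(- c) \<oplus>\<^bsub>CC\<^esub> c = \<zero>\<^bsub>CC\<^esub>" by simp
 then show ?thesis by (intro minus_equality) auto
qed

lemma lookup_pscale [simp]: "lookup (pscale c p) x = c * lookup p x"
 by (simp add: pscale_def Poly_Mapping.map.rep_eq when_def)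

lemma pscale_single [simp]: "pscale c (single x d) = single x (c * d)"
 by (simp add: pscale_def)

interpretation pm: vector_space "pscale :: complex => ('x cv) => 'x cv"
 by unfold_locales (auto intro!: poly_mapping_eqI simp: lookup_add algebra_simps)

lemmas pscale_simps = pm.scale_right_distrib pm.scale_left_distrib

lemma keys_pscale: "keys (pscale c p) <= keys p"
 by (auto simp: in_keys_iff)

definition plin :: "('x cv => 'y cv) => bool" where
 "plin f \<longleftrightarrow> (\<forall>p q. f (p + q) = f p + f q) & (\<forall>c p. f (pscale c p) = pscale c (f p))"

lemma plinI: "(!!p q. f (p + q) = f p + f q) ==> (!!c p. f (pscale c p) = pscale c (f p)) ==> plin f"
 by (simp add: plin_def)

lemma plin_add: "plin f ==> f (p + q) = f p + f q"
 and plin_scale: "plin f ==> f (pscale c p) = pscale c (f p)"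
 by (auto simp: plin_def)

lemma plin_0: "plin f ==> f 0 = 0"
 using plin_scale[of f 0 0] by simp

lemma plin_minus: "plin f ==> f (- p) = - f p"
 using plin_scale[of f "-1" p] by simp

lemma plin_diff: "plin f ==> f (p - q) = f p - f q"
 using plin_add[of f p "- q"] by (simp add: plin_minus)

lemma plin_sum: "plin f ==> f (\<Sum>x\<in>A. g x) = (\<Sum>x\<in>A. f (g x))"
 by (induction A rule: infinite_finite_induct) (auto simp: plin_0 plin_add)

lemmas plin_simps = plin_add plin_scale plin_0 plin_minus plin_diff plin_sum

lemma plin_comp: "plin f ==> plin g ==> plin (%x. f (g x))"
 by (simp add: plin_def)

lemma plin_plus: "plin f ==> plin g ==> plin (%x. f x + g x)"
 by (simp add: plin_def pscale_simps algebra_simps)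

lemma plin_scaled: "plin f ==> plin (%x. pscale c (f x))"
 by (simp add: plin_def pscale_simps mult.commute)

lemma plin_sumI: "(!!i. i : A ==> plin (f i)) ==> plin (%x. \<Sum>i\<in>A. f i x)"
 by (auto simp: plin_def sum.distrib pm.scale_sum_right)

lemma plin_id: "plin (%x. x)"
 by (simp add: plin_def)

definition lext :: "('x => 'y cv) => 'x cv => 'y cv" where
 "lext f p = (\<Sum>x\<in>keys p. pscale (lookup p x) (f x))"

lemma lext_superset: "finite A ==> keys p <= A ==> lext f p = (\<Sum>x\<in>A. pscale (lookup p x) (f x))"
 unfolding lext_def by (rule sum.mono_neutral_left) (auto simp: in_keys_iff)

lemma plin_lext: "plin (lext f)"
proof (rule plinI)
 fix p q :: "'a cv"
 let ?A = "keys p \<union> keys q"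
 have "lext f (p + q) = (\<Sum>x\<in>?A. pscale (lookup (p + q) x) (f x))"
  by (rule lext_superset) (auto simp: Poly_Mapping.keys_add)
 also have "... = lext f p + lext f q"
  by (subst (1 2) lext_superset[where A = ?A]) (auto simp: lookup_add pscale_simps sum.distrib)
 finally show "lext f (p + q) = lext f p + lext f q" .
next
 fix c p
 show "lext f (pscale c p) = pscale c (lext f p)"
  by (subst lext_superset[where A = "keys p"]) (auto simp: lext_def keys_pscale pm.scale_sum_right)
qed

lemma lext_gen [simp]: "lext f (gen x) = f x"
 by (simp add: lext_def)

lemma lext_single: "lext f (single x c) = pscale c (f x)"
 by (cases "c = 0") (simp_all add: lext_def)

lemma pm_expand: "(p :: 'x cv) = (\<Sum>x\<in>keys p. pscale (lookup p x) (gen x))"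
proof (rule poly_mapping_eqI)
 fix k
 have "lookup (\<Sum>x\<in>keys p. pscale (lookup p x) (gen x)) k = (\<Sum>x\<in>keys p. if x = k then lookup p x else 0)"
  by (simp add: lookup_sum lookup_single when_def)
 also have "... = lookup p k" by (auto simp: in_keys_iff)
 finally show "lookup p k = lookup (\<Sum>x\<in>keys p. pscale (lookup p x) (gen x)) k" by simp
qed

lemma lext_id: "lext gen p = p"
 unfolding lext_def by (rule pm_expand[symmetric])

lemma pm_sup_induct [consumes 1, case_names zero add scale gen]:
 assumes "keys p <= B" "P 0" "!!p q. P p ==> P q ==> P (p + q)"
  "!!c p. P p ==> P (pscale c p)" "!!x. x : B ==> P (gen x)"
 shows "P (p :: 'x cv)"
proof -
 have "P (\<Sum>x\<in>A. pscale (lookup p x) (gen x))" if "finite A" "A <= B" for A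
  using that by (induction A rule: finite_induct) (auto intro: assms simp del: pscale_single)
 then show ?thesis using assms(1) by (subst pm_expand) auto
qed

lemma plin_eqI:
 assumes "keys p <= B" "plin f" "plin g" "!!x. x : B ==> f (gen x) = g (gen x)"
 shows "f p = g p"
 using assms(1) by (induction rule: pm_sup_induct) (auto simp: assms plin_simps)

lemma subspace_keys: "pm.subspace {p :: 'x cv. keys p <= B}"
proof -
 have "keys (p + q) <= B" if "keys p <= B" "keys q <= B" for p q :: "'x cv"
  by (rule order_trans[OF Poly_Mapping.keys_add]) (use that in simp)
 moreover have "keys (pscale c p) <= B" if "keys p <= B" for c and p :: "'x cv"
  by (rule order_trans[OF keys_pscale that])
 ultimately show ?thesis by (simp add: pm.subspace_def)
qed

lemma subspace_plin_ker: "plin f ==> pm.subspace {p. f p = 0}"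
 by (auto simp: pm.subspace_def plin_simps)

lemma span_plin_image: "plin f ==> f ` pm.span S = pm.span (f ` S)"
proof
 assume f: "plin f"
 show "f ` pm.span S <= pm.span (f ` S)"
 proof clarify
  fix x assume "x : pm.span S"
  then show "f x : pm.span (f ` S)"
   by (induction rule: pm.span_induct_alt)
    (auto simp: plin_simps f intro: pm.span_zero pm.span_add pm.span_scale pm.span_base)
 qed
 show "pm.span (f ` S) <= f ` pm.span S"
 proof (rule pm.span_minimal)
  show "f ` S <= f ` pm.span S" by (auto intro: pm.span_base)
  have "\<exists>z\<in>pm.span S. f z = f x + f y" if "x : pm.span S" "y : pm.span S" for x y
   using that f by (intro bexI[of _ "x + y"]) (auto simp: plin_simps intro: pm.span_add)
  moreover have "\<exists>z\<in>pm.span S. f z = pscale c (f x)" if "x : pm.span S" for x c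
   using that f by (intro bexI[of _ "pscale c x"]) (auto simp: plin_simps intro: pm.span_scale)
  moreover have "0 : f ` pm.span S"
   using f by (auto simp: image_iff plin_0 intro!: bexI[of _ 0] pm.span_zero)
  ultimately show "pm.subspace (f ` pm.span S)"
   unfolding pm.subspace_def by (auto simp: image_iff) metis+
 qed
qed

lemma keys_span: "keys (p :: 'x cv) <= B ==> p : pm.span (gen ` B)"
 by (induction rule: pm_sup_induct) (auto intro: pm.span_zero pm.span_add pm.span_scale pm.span_base)

lemma span_gen: "pm.span (gen ` B) = {p :: 'x cv. keys p <= B}"
 using pm.span_minimal[OF _ subspace_keys, of "gen ` B" B] keys_span by fastforce

section \<open>Modules realized inside spaces of finitely supported functions\<close>

text \<open>The target is not a record but a space of finitely supported functions with operators
  \<open>a x\<close> defined on all of it. Modules of unrelated types thus become comparable: they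
  are isomorphic as soon as they are embedded with the same operators and the same image.\<close>

definition lmap :: "'s set => ('s, 'v) lmod => ('s => 'w cv => 'w cv) => ('v => 'w cv) => bool" where
 "lmap S V a fi \<longleftrightarrow> module CC V &
   (\<forall>v\<in>carrier V. \<forall>w\<in>carrier V. fi (v \<oplus>\<^bsub>V\<^esub> w) = fi v + fi w) &
   (\<forall>c. \<forall>v\<in>carrier V. fi (c \<odot>\<^bsub>V\<^esub> v) = pscale c (fi v)) &
   (\<forall>x\<in>S. \<forall>v\<in>carrier V. act V x v : carrier V & fi (act V x v) = a x (fi v))"

definition liso :: "'s set => ('s, 'v) lmod => ('s => 'w cv => 'w cv) => ('v => 'w cv) => 'w cv set => bool" where
 "liso S V a fi W \<longleftrightarrow> lmap S V a fi & bij_betw fi (carrier V) W"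

lemma lmap_module: "lmap S V a fi ==> module CC V"
 and lmap_add: "lmap S V a fi ==> v : carrier V ==> w : carrier V ==> fi (v \<oplus>\<^bsub>V\<^esub> w) = fi v + fi w"
 and lmap_smult: "lmap S V a fi ==> v : carrier V ==> fi (c \<odot>\<^bsub>V\<^esub> v) = pscale c (fi v)"
 and lmap_act: "lmap S V a fi ==> x : S ==> v : carrier V ==> fi (act V x v) = a x (fi v)"
 and lmap_closed: "lmap S V a fi ==> x : S ==> v : carrier V ==> act V x v : carrier V"
 unfolding lmap_def by blast+

lemma lmap_zero: assumes "lmap S V a fi" shows "fi \<zero>\<^bsub>V\<^esub> = 0"
proof -
 interpret module CC V using assms by (rule lmap_module)
 have "fi (\<zero>\<^bsub>V\<^esub> \<oplus>\<^bsub>V\<^esub> \<zero>\<^bsub>V\<^esub>) = fi \<zero>\<^bsub>V\<^esub> + fi \<zero>\<^bsub>V\<^esub>" by (rule lmap_add[OF assms]) auto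
 then show ?thesis by simp
qed

lemma lmap_minus: assumes "lmap S V a fi" "v : carrier V" shows "fi (\<ominus>\<^bsub>V\<^esub> v) = - fi v"
proof -
 interpret module CC V using assms(1) by (rule lmap_module)
 have "fi (v \<oplus>\<^bsub>V\<^esub> \<ominus>\<^bsub>V\<^esub> v) = fi v + fi (\<ominus>\<^bsub>V\<^esub> v)" by (rule lmap_add[OF assms(1)]) (use assms in auto)
 then show ?thesis using assms by (simp add: M.r_neg lmap_zero[OF assms(1)] eq_neg_iff_add_eq_0 add.commute)
qed

lemma lmap_diff: assumes "lmap S V a fi" "v : carrier V" "w : carrier V"
 shows "fi (v \<ominus>\<^bsub>V\<^esub> w) = fi v - fi w"
proof -
 interpret module CC V using assms(1) by (rule lmap_module)
 show ?thesis using assms by (simp add: a_minus_def lmap_add lmap_minus)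
qed

lemma lmap_finsum:
 assumes "lmap S V a fi" "finite A" "!!i. i : A ==> f i : carrier V"
 shows "fi (\<Oplus>\<^bsub>V\<^esub>i\<in>A. f i) = (\<Sum>i\<in>A. fi (f i))"
proof -
 interpret module CC V using assms(1) by (rule lmap_module)
 show ?thesis using assms(2,3)
 proof (induction A rule: finite_induct)
  case empty
  then show ?case by (simp add: lmap_zero[OF assms(1)])
 next
  case (insert x A)
  have "f : A \<rightarrow> carrier V" using insert by auto
  then show ?case
   using insert by (subst M.finsum_insert) (auto simp: lmap_add[OF assms(1)] M.finsum_closed)
 qed
qed

lemma liso_lmap: "liso S V a fi W ==> lmap S V a fi"
 and liso_bij: "liso S V a fi W ==> bij_betw fi (carrier V) W"
 by (auto simp: liso_def)

lemma liso_inj: "liso S V a fi W ==> v : carrier V ==> w : carrier V ==> fi v = fi w \<longleftrightarrow> v = w"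
 unfolding liso_def bij_betw_def inj_on_def by blast

lemma liso_image: "liso S V a fi W ==> fi ` carrier V = W"
 unfolding liso_def bij_betw_def by blast

lemma liso_in: "liso S V a fi W ==> v : carrier V ==> fi v : W"
 using liso_image by blast

text \<open>Every isomorphism in the final statement is obtained in this way: both modules are
  mapped onto the same subspace \<open>W\<close> with the same operators, and one map is followed by
  the inverse of the other.\<close>

lemma liso_trans:
 assumes "liso (carrier L) V a fi W" "liso (carrier L) V' a fi' W"
 shows "lie_module_iso L V V'"
 unfolding lie_module_iso_def
proof (intro exI conjI ballI allI)
 let ?g = "the_inv_into (carrier V') fi'"
 let ?f = "%v. ?g (fi v)"
 interpret V: module CC V using assms(1) liso_lmap lmap_module by blast
 interpret V': module CC V' using assms(2) liso_lmap lmap_module by blast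
 have inj: "inj_on fi' (carrier V')" and im: "fi' ` carrier V' = W"
  using liso_bij[OF assms(2)] by (auto simp: bij_betw_def)
 have fc: "?f v : carrier V'" if "v : carrier V" for v
  using the_inv_into_into[OF inj, of "fi v" "carrier V'"] im liso_in[OF assms(1) that] by auto
 have ff: "fi' (?f v) = fi v" if "v : carrier V" for v
  using f_the_inv_into_f[OF inj, of "fi v"] im liso_in[OF assms(1) that] by auto
 note l1 = liso_lmap[OF assms(1)] and l2 = liso_lmap[OF assms(2)]
 note inj' = liso_inj[OF assms(2), THEN iffD1]
 have "bij_betw (?g \<circ> fi) (carrier V) (carrier V')"
  using liso_bij[OF assms(1)] bij_betw_the_inv_into[OF liso_bij[OF assms(2)]] by (rule bij_betw_trans)
 then show "bij_betw ?f (carrier V) (carrier V')" by (simp add: comp_def)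
 show "?f (v \<oplus>\<^bsub>V\<^esub> w) = ?f v \<oplus>\<^bsub>V'\<^esub> ?f w" if "v : carrier V" "w : carrier V" for v w
  using that fc[of "v \<oplus>\<^bsub>V\<^esub> w"] ff[of "v \<oplus>\<^bsub>V\<^esub> w"]
  by (intro inj') (auto simp: fc ff lmap_add[OF l1] lmap_add[OF l2])
 show "?f (c \<odot>\<^bsub>V\<^esub> v) = c \<odot>\<^bsub>V'\<^esub> ?f v" if "v : carrier V" for v c
  using that fc[of "c \<odot>\<^bsub>V\<^esub> v"] ff[of "c \<odot>\<^bsub>V\<^esub> v"]
  by (intro inj') (auto simp: fc ff lmap_smult[OF l1] lmap_smult[OF l2])
 show "?f (act V x v) = act V' x (?f v)" if "v : carrier V" "x : carrier L" for v x
  using that fc[of "act V x v"] ff[of "act V x v"] lmap_closed[OF l1 that(2,1)]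
  by (intro inj') (auto simp: fc ff lmap_act[OF l1] lmap_act[OF l2] lmap_closed[OF l2])
qed

text \<open>The axioms are equations, so they can be checked after an injective map into a known
  vector space; negatives are supplied by the scalar -1.\<close>

lemma moduleI_inj:
 fixes fi :: "'v => 'w cv" and V :: "(complex, 'v, 'e) module_scheme"
 assumes inj: "inj_on fi (carrier V)"
  and add: "!!v w. v : carrier V ==> w : carrier V ==> v \<oplus>\<^bsub>V\<^esub> w : carrier V & fi (v \<oplus>\<^bsub>V\<^esub> w) = fi v + fi w"
  and zero: "\<zero>\<^bsub>V\<^esub> : carrier V" "fi \<zero>\<^bsub>V\<^esub> = 0"
  and smult: "!!c v. v : carrier V ==> c \<odot>\<^bsub>V\<^esub> v : carrier V & fi (c \<odot>\<^bsub>V\<^esub> v) = pscale c (fi v)"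
 shows "module CC V"
proof (rule moduleI)
 note eq = inj_onD[OF inj]
 show "cring CC" by (rule cring_CC)
 show "abelian_group V"
 proof (rule abelian_groupI)
  fix x assume x: "x : carrier V"
  have "((-1) \<odot>\<^bsub>V\<^esub> x) \<oplus>\<^bsub>V\<^esub> x = \<zero>\<^bsub>V\<^esub>"
   by (rule eq) (use x in \<open>auto simp: add smult zero\<close>)
  then show "\<exists>y\<in>carrier V. y \<oplus>\<^bsub>V\<^esub> x = \<zero>\<^bsub>V\<^esub>" using smult[OF x, of "-1"] by blast
 qed (auto simp: add zero intro!: inj_onD[OF inj])
qed (auto simp: add smult pscale_simps intro!: inj_onD[OF inj])

text \<open>Cosets of a kernel are fibres, which turns computations with cosets in
  \<open>quot_module\<close> into computations with values of \<open>fi\<close>.\<close>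

lemma coset_fibre:
 assumes "lmap S V a fi" "v : carrier V"
 shows "{v : carrier V. fi v = 0} +>\<^bsub>V\<^esub> v = {w : carrier V. fi w = fi v}"
proof -
 interpret module CC V using assms(1) by (rule lmap_module)
 show ?thesis
 proof (intro equalityI subsetI)
  fix w assume "w : {v : carrier V. fi v = 0} +>\<^bsub>V\<^esub> v"
  then show "w : {w : carrier V. fi w = fi v}"
   using assms by (auto simp: a_r_coset_def' lmap_add)
 next
  fix w assume "w : {w : carrier V. fi w = fi v}"
  then have w: "w : carrier V" "fi w = fi v" by auto
  have "w = (w \<ominus>\<^bsub>V\<^esub> v) \<oplus>\<^bsub>V\<^esub> v" using w assms(2)
   by (simp add: a_minus_def M.a_assoc M.l_neg)
  moreover have "w \<ominus>\<^bsub>V\<^esub> v : carrier V" "fi (w \<ominus>\<^bsub>V\<^esub> v) = 0"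
   using w assms by (auto simp: lmap_diff)
  ultimately show "w : {v : carrier V. fi v = 0} +>\<^bsub>V\<^esub> v"
   by (auto simp: a_r_coset_def')
 qed
qed

text \<open>Evaluates \<open>fi\<close> at an arbitrary representative; the value is meaningful when
  \<open>fi\<close> is constant on \<open>A\<close>, as on the fibres above.\<close>

definition cmap :: "('v => 'w) => 'v set => 'w" where
 "cmap fi A = fi (SOME v. v : A)"

text \<open>The first isomorphism theorem for the coset record. The auxiliary \<open>fib\<close>
  names a coset by its value, so that the unions over representatives in the scalar multiplication
  and in the action collapse.\<close>

lemma quot_liso:
 assumes l: "lmap S V a fi" and N: "N = {v : carrier V. fi v = 0}"
 shows "liso S (quot_module V N) a (cmap fi) (fi ` carrier V)"
  and "v : carrier V ==> N +>\<^bsub>V\<^esub> v : carrier (quot_module V N)"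
  and "v : carrier V ==> cmap fi (N +>\<^bsub>V\<^esub> v) = fi v"
  and "carrier (quot_module V N) = {N +>\<^bsub>V\<^esub> v | v. v : carrier V}"
proof -
 interpret module CC V using l by (rule lmap_module)
 let ?Q = "quot_module V N"
 define fib where "fib = (%y. {w : carrier V. fi w = y})"
 have cos: "N +>\<^bsub>V\<^esub> v = fib (fi v)" if "v : carrier V" for v
  using coset_fibre[OF l that] by (simp add: N fib_def)
 have carr: "carrier ?Q = {fib (fi v) | v. v : carrier V}"
  by (auto simp: quot_module_def vquot_def FactRing_def A_RCOSETS_def' ring.defs module.defs lmod.defs cos)
 have cm: "cmap fi (fib (fi v)) = fi v" if "v : carrier V" for v
 proof -
  have "(SOME w. w : fib (fi v)) : fib (fi v)" by (rule someI[of _ v]) (simp add: fib_def that)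
  then show ?thesis by (simp add: cmap_def fib_def)
 qed
 have fne: "v : fib (fi v)" if "v : carrier V" for v using that by (simp add: fib_def)
 have add: "fib (fi v) \<oplus>\<^bsub>?Q\<^esub> fib (fi w) = fib (fi (v \<oplus>\<^bsub>V\<^esub> w))" if "v : carrier V" "w : carrier V" for v w
 proof -
  have "fib (fi v) \<oplus>\<^bsub>?Q\<^esub> fib (fi w) = fib (fi v) <+>\<^bsub>V\<^esub> fib (fi w)"
   by (simp add: quot_module_def vquot_def FactRing_def ring.defs module.defs lmod.defs)
  also have "... = fib (fi (v \<oplus>\<^bsub>V\<^esub> w))"
  proof (intro equalityI subsetI)
   fix x assume "x : fib (fi v) <+>\<^bsub>V\<^esub> fib (fi w)"
   then show "x : fib (fi (v \<oplus>\<^bsub>V\<^esub> w))" using that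
    by (auto simp: set_add_def' fib_def lmap_add[OF l])
  next
   fix x assume "x : fib (fi (v \<oplus>\<^bsub>V\<^esub> w))"
   then have x: "x : carrier V" "fi x = fi v + fi w" using that by (auto simp: fib_def lmap_add[OF l])
   have "x = (x \<ominus>\<^bsub>V\<^esub> w) \<oplus>\<^bsub>V\<^esub> w" using x that
    by (simp add: a_minus_def M.a_assoc M.l_neg)
   moreover have "x \<ominus>\<^bsub>V\<^esub> w : fib (fi v)" using x that by (simp add: fib_def lmap_diff[OF l])
   ultimately show "x : fib (fi v) <+>\<^bsub>V\<^esub> fib (fi w)"
    using fne[OF that(2)] by (auto simp: set_add_def')
  qed
  finally show ?thesis .
 qed
 have sm: "c \<odot>\<^bsub>?Q\<^esub> fib (fi v) = fib (fi (c \<odot>\<^bsub>V\<^esub> v))" if "v : carrier V" for c v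
 proof -
  have "c \<odot>\<^bsub>?Q\<^esub> fib (fi v) = (\<Union>w\<in>fib (fi v). N +>\<^bsub>V\<^esub> (c \<odot>\<^bsub>V\<^esub> w))"
   by (simp add: quot_module_def vquot_def ring.defs module.defs lmod.defs)
  also have "... = (\<Union>w\<in>fib (fi v). fib (fi (c \<odot>\<^bsub>V\<^esub> v)))"
   by (rule SUP_cong) (auto simp: fib_def cos[unfolded fib_def] lmap_smult[OF l] that)
  finally show ?thesis using fne[OF that] by blast
 qed
 have ac: "act ?Q x (fib (fi v)) = fib (fi (act V x v))" if "v : carrier V" "x : S" for x v
 proof -
  have "act ?Q x (fib (fi v)) = (\<Union>w\<in>fib (fi v). N +>\<^bsub>V\<^esub> (act V x w))"
   by (simp add: quot_module_def lmod.defs module.defs)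
  also have "... = (\<Union>w\<in>fib (fi v). fib (fi (act V x v)))"
   by (rule SUP_cong) (auto simp: fib_def cos[unfolded fib_def] lmap_act[OF l] lmap_closed[OF l] that)
  finally show ?thesis using fne[OF that(1)] by blast
 qed
 have z: "\<zero>\<^bsub>?Q\<^esub> = fib (fi \<zero>\<^bsub>V\<^esub>)"
  by (simp add: quot_module_def vquot_def FactRing_def ring.defs module.defs lmod.defs N fib_def lmap_zero[OF l])
 have inj: "inj_on (cmap fi) (carrier ?Q)"
  by (rule inj_onI) (auto simp: carr cm)
 have "module CC ?Q"
 proof (rule moduleI_inj[OF inj])
  show "\<zero>\<^bsub>?Q\<^esub> : carrier ?Q" using z carr by auto
  show "cmap fi \<zero>\<^bsub>?Q\<^esub> = 0" using cm[of "\<zero>\<^bsub>V\<^esub>"] z by (simp add: lmap_zero[OF l])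
  show "v \<oplus>\<^bsub>?Q\<^esub> w : carrier ?Q & cmap fi (v \<oplus>\<^bsub>?Q\<^esub> w) = cmap fi v + cmap fi w"
   if vw: "v : carrier ?Q" "w : carrier ?Q" for v w
  proof -
   obtain v' w' where "v = fib (fi v')" "v' : carrier V" "w = fib (fi w')" "w' : carrier V"
    using vw unfolding carr by blast
   then show ?thesis using cm[of "v' \<oplus>\<^bsub>V\<^esub> w'"] unfolding carr
    by (auto simp: add cm lmap_add[OF l, symmetric] intro!: exI[of _ "v' \<oplus>\<^bsub>V\<^esub> w'"])
  qed
  show "c \<odot>\<^bsub>?Q\<^esub> v : carrier ?Q & cmap fi (c \<odot>\<^bsub>?Q\<^esub> v) = pscale c (cmap fi v)"
   if vw: "v : carrier ?Q" for c v
  proof -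
   obtain v' where "v = fib (fi v')" "v' : carrier V"
    using vw unfolding carr by blast
   then show ?thesis using cm[of "c \<odot>\<^bsub>V\<^esub> v'"] unfolding carr
    by (auto simp: sm cm lmap_smult[OF l, symmetric] intro!: exI[of _ "c \<odot>\<^bsub>V\<^esub> v'"])
  qed
 qed
 moreover have "cmap fi (fib (fi v) \<oplus>\<^bsub>?Q\<^esub> fib (fi w)) = fi v + fi w" if "v : carrier V" "w : carrier V" for v w
  using that cm[of "v \<oplus>\<^bsub>V\<^esub> w"] by (simp add: add lmap_add[OF l])
 moreover have "cmap fi (c \<odot>\<^bsub>?Q\<^esub> fib (fi v)) = pscale c (fi v)" if "v : carrier V" for c v
  using that cm[of "c \<odot>\<^bsub>V\<^esub> v"] by (simp add: sm lmap_smult[OF l])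
 moreover have "act ?Q x (fib (fi v)) : carrier ?Q & cmap fi (act ?Q x (fib (fi v))) = a x (fi v)"
  if "v : carrier V" "x : S" for x v
  using that cm[of "act V x v"] lmap_closed[OF l that(2,1)] unfolding carr
  by (auto simp: ac lmap_act[OF l that(2,1), symmetric])
 ultimately have "lmap S ?Q a (cmap fi)"
  unfolding lmap_def by (auto simp: carr cm)
 moreover have "cmap fi ` carrier ?Q = fi ` carrier V" unfolding carr by (auto simp: cm image_iff) (metis cm)
 ultimately show "liso S (quot_module V N) a (cmap fi) (fi ` carrier V)"
  using inj by (simp add: liso_def bij_betw_def)
 show "v : carrier V ==> N +>\<^bsub>V\<^esub> v : carrier ?Q" using cos carr by blast
 show "v : carrier V ==> cmap fi (N +>\<^bsub>V\<^esub> v) = fi v" by (simp add: cos cm)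
 show "carrier ?Q = {N +>\<^bsub>V\<^esub> v | v. v : carrier V}" unfolding carr using cos by (metis (no_types, lifting))
qed

section \<open>Submodules, spans, and modules given by generators and relations\<close>

lemma submodule_CC_iff:
 assumes "module CC V"
 shows "submodule N CC V \<longleftrightarrow> N <= carrier V & \<zero>\<^bsub>V\<^esub> : N &
  (\<forall>v\<in>N. \<forall>w\<in>N. v \<oplus>\<^bsub>V\<^esub> w : N) & (\<forall>c. \<forall>v\<in>N. c \<odot>\<^bsub>V\<^esub> v : N)"
proof -
 interpret module CC V by fact
 show ?thesis
 proof safe
  assume a: "N <= carrier V" "\<zero>\<^bsub>V\<^esub> : N" "\<forall>v\<in>N. \<forall>w\<in>N. v \<oplus>\<^bsub>V\<^esub> w : N" "\<forall>c. \<forall>v\<in>N. c \<odot>\<^bsub>V\<^esub> v : N"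
  show "submodule N CC V"
  proof (rule submoduleI)
   fix v assume v: "v : N"
   have "\<ominus>\<^bsub>V\<^esub> v = (-1) \<odot>\<^bsub>V\<^esub> v" using smult_l_minus[of 1 v] smult_one[of v] v a by (auto simp del: smult_one)
   then show "\<ominus>\<^bsub>V\<^esub> v : N" using v a by auto
  qed (use a in auto)
 next
  assume "submodule N CC V"
  then show "\<zero>\<^bsub>V\<^esub> : N" using subgroup.one_closed[OF submodule.axioms(1)] by force
 qed (use submoduleE[of N] in auto)
qed

lemma vspan_submodule:
 assumes "module CC V" "S <= carrier V" shows "submodule (vspan V S) CC V"
proof -
 have c: "submodule (carrier V) CC V" using assms(1) by (rule module.carrier_is_submodule)
 then show ?thesis using assms unfolding vspan_def submodule_CC_iff[OF assms(1)] by auto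
qed

lemma vspan_base: "x : S ==> x : vspan V S"
 by (auto simp: vspan_def)

lemma vspan_least: "submodule N CC V ==> S <= N ==> vspan V S <= N"
 by (auto simp: vspan_def)

lemma free_module_simps [simp]:
 "carrier (free_module B f) = {p. keys p <= B}" "\<zero>\<^bsub>free_module B f\<^esub> = 0"
 "p \<oplus>\<^bsub>free_module B f\<^esub> q = p + q" "c \<odot>\<^bsub>free_module B f\<^esub> p = pscale c p"
 "act (free_module B f) s p = lext (f s) p"
 by (auto simp: free_module_def lext_def)

lemma module_free: "module CC (free_module B f)"
 by (rule moduleI_inj[where fi = "%x. x"])
  (use pm.subspace_add[OF subspace_keys[of B]] pm.subspace_scale[OF subspace_keys[of B]] in \<open>auto simp: inj_on_def\<close>)

lemma submodule_free: "submodule N CC (free_module B f) \<longleftrightarrow> pm.subspace N & N <= {p. keys p <= B}"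
 unfolding submodule_CC_iff[OF module_free] by (auto simp: pm.subspace_def)

lemma vspan_free:
 assumes "R <= {p. keys p <= B}" shows "vspan (free_module B f) R = pm.span R"
proof
 have "pm.span R <= {p. keys p <= B}" using assms by (rule pm.span_minimal[OF _ subspace_keys])
 then show "vspan (free_module B f) R <= pm.span R"
  by (intro vspan_least) (auto simp: submodule_free pm.subspace_span intro: pm.span_base)
 show "pm.span R <= vspan (free_module B f) R"
  using vspan_submodule[OF module_free, of R B f] assms
  by (intro pm.span_minimal) (auto simp: submodule_free intro: vspan_base)
qed

text \<open>This identifies all presented modules: the linear extension of \<open>h\<close> must
  kill the relations and have no further kernel. The assumption \<open>ker\<close> is the
  substantial one; tensor products, exterior powers and induced modules each meet it by their own
  normal form argument.\<close>

lemma presented_liso: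
 assumes R: "R <= {p. keys p <= B}" "!!r. r : R ==> lext h r = 0"
  and ker: "!!p. keys p <= B ==> lext h p = 0 ==> p : pm.span R"
  and f: "!!s x. s : S ==> x : B ==> keys (f s x) <= B & lext h (f s x) = a s (h x)"
  and a: "!!s. s : S ==> plin (a s)"
 shows "liso S (presented_module B R f) a (cmap (lext h)) (pm.span (h ` B))"
  and "x : B ==> presented_class B R f x : carrier (presented_module B R f)"
  and "x : B ==> cmap (lext h) (presented_class B R f x) = h x"
  and "carrier (presented_module B R f) = {vspan (free_module B f) R +>\<^bsub>free_module B f\<^esub> p | p. keys p <= B}"
  and "keys p <= B ==> cmap (lext h) (vspan (free_module B f) R +>\<^bsub>free_module B f\<^esub> p) = lext h p"
proof -
 let ?V = "free_module B f"
 have N: "vspan ?V R = {v : carrier ?V. lext h v = 0}"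
 proof -
  have "pm.span R <= {v : carrier ?V. lext h v = 0}"
   using pm.subspace_inter[OF subspace_keys[of B] subspace_plin_ker[OF plin_lext[of h]]] R
   by (intro pm.span_minimal) (auto simp: Int_def)
  then show ?thesis using ker R by (auto simp: vspan_free)
 qed
 have "keys (lext (f s) p) <= B & lext h (lext (f s) p) = a s (lext h p)" if "s : S" "keys p <= B" for s p
 proof
  from that(2) show "keys (lext (f s) p) <= B"
  proof (induction rule: pm_sup_induct)
   case (add p q) then show ?case
    using pm.subspace_add[OF subspace_keys[of B]] by (auto simp: plin_simps plin_lext)
  next
   case (scale c p) then show ?case
    using pm.subspace_scale[OF subspace_keys[of B]] by (auto simp: plin_simps plin_lext)
  next
   case (gen x) then show ?case using f[OF that(1)] by auto
  qed (auto simp: plin_simps plin_lext)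
  show "lext h (lext (f s) p) = a s (lext h p)"
   by (rule plin_eqI[OF that(2) plin_comp[OF plin_lext plin_lext] plin_comp[OF a[OF that(1)] plin_lext]])
    (simp add: f[OF that(1)])
 qed
 then have l: "lmap S ?V a (lext h)"
  unfolding lmap_def by (auto simp: module_free plin_simps plin_lext)
 have im: "lext h ` carrier ?V = pm.span (h ` B)"
  using span_plin_image[OF plin_lext[of h], of "gen ` B"] by (simp add: span_gen image_image)
 show "liso S (presented_module B R f) a (cmap (lext h)) (pm.span (h ` B))"
  using quot_liso(1)[OF l N] im by (simp add: presented_module_def)
 show "x : B ==> presented_class B R f x : carrier (presented_module B R f)"
  using quot_liso(2)[OF l N] by (simp add: presented_module_def presented_class_def)
 show "x : B ==> cmap (lext h) (presented_class B R f x) = h x"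
  using quot_liso(3)[OF l N] by (simp add: presented_class_def)
 show "carrier (presented_module B R f) = {vspan ?V R +>\<^bsub>?V\<^esub> p | p. keys p <= B}"
  using quot_liso(4)[OF l N] by (simp add: presented_module_def)
 show "keys p <= B ==> cmap (lext h) (vspan ?V R +>\<^bsub>?V\<^esub> p) = lext h p"
  using quot_liso(3)[OF l N] by simp
qed

lemma liso_vspan:
 assumes l: "liso S V a fi W" and G: "G <= carrier V"
 shows "fi ` vspan V G = pm.span (fi ` G)"
proof
 note lm = liso_lmap[OF l]
 note m = lmap_module[OF lm]
 interpret module CC V by (rule m)
 have "submodule {v : carrier V. fi v : pm.span (fi ` G)} CC V"
  unfolding submodule_CC_iff[OF m]
  by (auto simp: lmap_zero[OF lm] lmap_add[OF lm] lmap_smult[OF lm] intro: pm.span_zero pm.span_add pm.span_scale)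
 then have "vspan V G <= {v : carrier V. fi v : pm.span (fi ` G)}"
  by (rule vspan_least) (use G in \<open>auto intro: pm.span_base\<close>)
 then show "fi ` vspan V G <= pm.span (fi ` G)" by auto
 have s: "submodule (vspan V G) CC V" by (rule vspan_submodule[OF m G])
 note s' = s[unfolded submodule_CC_iff[OF m]]
 have "\<exists>z\<in>vspan V G. fi z = fi x + fi y" if "x : vspan V G" "y : vspan V G" for x y
  using that s' lmap_add[OF lm] by (intro bexI[of _ "x \<oplus>\<^bsub>V\<^esub> y"]) auto
 moreover have "\<exists>z\<in>vspan V G. fi z = pscale c (fi x)" if "x : vspan V G" for x c
  using that s' lmap_smult[OF lm] by (intro bexI[of _ "c \<odot>\<^bsub>V\<^esub> x"]) auto
 moreover have "\<exists>z\<in>vspan V G. fi z = 0"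
  using s' lmap_zero[OF lm] by (intro bexI[of _ "\<zero>\<^bsub>V\<^esub>"]) auto
 ultimately have "pm.subspace (fi ` vspan V G)"
  unfolding pm.subspace_def by (auto simp: image_iff) metis+
 then show "pm.span (fi ` G) <= fi ` vspan V G"
  by (rule pm.span_minimal[rotated]) (auto intro: vspan_base)
qed

section \<open>Polynomials acting through commuting operators\<close>

declare One_nat_def [simp del]

section \<open>Exponents, polynomials and formal derivatives\<close>

abbreviation ex :: "nat => (nat \<Rightarrow>\<^sub>0 nat)" where "ex i \<equiv> single i 1"

definition deg :: "nat => (nat \<Rightarrow>\<^sub>0 nat) => nat" where
 "deg n al = (\<Sum>i<n. lookup al i)"

lemma pm_keys_add: "keys (p + q) <= keys p \<union> keys (q :: 'a \<Rightarrow>\<^sub>0 'b::monoid_add)"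
 by (rule Poly_Mapping.keys_add)

lemma exponents_add [intro]: "al : exponents n ==> be : exponents n ==> al + be : exponents n"
 using pm_keys_add[of al be] unfolding exponents_def by blast

lemma exponents_0 [simp, intro]: "0 : exponents n"
 and exponents_ex [simp]: "ex i : exponents n \<longleftrightarrow> i < n"
 by (auto simp: exponents_def)

lemma exponents_minus [intro]: "al : exponents n ==> al - be : exponents n"
 unfolding exponents_def subset_iff in_keys_iff mem_Collect_eq lookup_minus by (metis diff_0_eq_0)

lemma exponents_lookup: "al : exponents n ==> \<not> i < n ==> lookup al i = 0"
 by (auto simp: exponents_def in_keys_iff subset_iff)

lemma deg_0 [simp]: "deg n 0 = 0"
 and deg_add: "deg n (al + be) = deg n al + deg n be"
 by (simp_all add: deg_def lookup_add sum.distrib)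

lemma deg_ex [simp]: "i < n ==> deg n (ex i) = 1"
 by (simp add: deg_def lookup_single when_def)

lemma ex_minus_add: "lookup al i ~= 0 ==> al - ex i + ex i = al"
 by (rule poly_mapping_eqI) (auto simp: lookup_add lookup_minus lookup_single when_def)

lemma deg_eq_0: "al : exponents n ==> deg n al = 0 \<longleftrightarrow> al = 0"
proof
 assume "al : exponents n" "deg n al = 0"
 then show "al = 0"
  by (intro poly_mapping_eqI) (metis deg_def exponents_lookup finite_lessThan lessThan_iff lookup_zero sum_eq_0_iff)
qed simp

lemma exponents_cases:
 assumes "al : exponents n" "al ~= 0"
 obtains i be where "i < n" "be : exponents n" "al = be + ex i"
proof -
 obtain i where i: "lookup al i ~= 0" using assms(2) by (metis lookup_zero poly_mapping_eqI)
 then have "i < n" using exponents_lookup[OF assms(1)] by metis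
 then show thesis using that[of i "al - ex i"] ex_minus_add[OF i] assms(1) by auto
qed

lemma exponents_induct [consumes 1, case_names zero add]:
 assumes "al : exponents n" "P 0" "!!al i. al : exponents n ==> i < n ==> P al ==> P (al + ex i)"
 shows "P al"
 using assms(1)
proof (induction "deg n al" arbitrary: al rule: less_induct)
 case less
 show ?case
 proof (cases "al = 0")
  case False
  then obtain i be where "i < n" "be : exponents n" "al = be + ex i"
   using less.prems exponents_cases by blast
  then show ?thesis using less.hyps[of be] assms(3) by (auto simp: deg_add)
 qed (use assms(2) in simp)
qed

lemma pscale_mult: "pscale c (p :: cpoly) * q = pscale c (p * q)" "p * pscale c q = pscale c (p * q)"
 by (simp_all add: pscale_def mult_map_scale_conv_mult algebra_simps)

lemma plin_times: "plin (%p. (p :: cpoly) * q)" "plin (%p. (q :: cpoly) * p)"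
 by (auto simp: plin_def algebra_simps pscale_mult)

lemma gen_times: "(gen al :: cpoly) * gen be = gen (al + be)"
 by (simp add: mult_single)

lemma gen_0: "(gen 0 :: cpoly) = 1"
 by simp

lemma pdiff_lext: "pdiff i = lext (%al. single (al - ex i) (of_nat (lookup al i)))"
 by (rule ext) (simp add: pdiff_def lext_def mult.commute)

lemma plin_pdiff: "plin (pdiff i)"
 by (simp add: pdiff_lext plin_lext)

lemmas pdiff_simps = plin_simps[OF plin_pdiff]

lemma pdiff_gen: "pdiff i (gen al) = single (al - ex i) (of_nat (lookup al i))"
 by (simp add: pdiff_lext)

lemma pdiff_mult: "pdiff i (p * q) = pdiff i p * q + p * pdiff i q"
proof -
 have g: "pdiff i (gen al * gen be) = pdiff i (gen al) * gen be + gen al * pdiff i (gen be)" for al be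
 proof -
  \<comment> \<open>Subtraction of exponents is truncated, so it is compatible with addition only if
    the variable really occurs; otherwise the coefficient vanishes.\<close>
  have "al - ex i + be = al + be - ex i" if "lookup al i ~= 0"
   using that by (intro poly_mapping_eqI) (auto simp: lookup_add lookup_minus lookup_single when_def)
  moreover have "al + (be - ex i) = al + be - ex i" if "lookup be i ~= 0"
   using that by (intro poly_mapping_eqI) (auto simp: lookup_add lookup_minus lookup_single when_def)
  ultimately show ?thesis
   by (cases "lookup al i = 0"; cases "lookup be i = 0")
    (simp_all add: gen_times pdiff_gen mult_single lookup_add single_add)
 qed
 have "pdiff i (gen al * q) = pdiff i (gen al) * q + gen al * pdiff i q" for al
  by (rule plin_eqI[of q UNIV]) (auto intro!: plin_comp[OF plin_pdiff] plin_times plin_plus plin_pdiff plin_comp[OF plin_times(2)] simp: g)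
 then show ?thesis
  by (intro plin_eqI[of p UNIV "%p. pdiff i (p * q)" "%p. pdiff i p * q + p * pdiff i q"])
   (auto intro!: plin_comp[OF plin_pdiff] plin_times plin_plus plin_pdiff plin_comp[OF plin_times(1)])
qed

lemma pdiff_commute: "pdiff i (pdiff j p) = pdiff j (pdiff i p)"
proof (rule plin_eqI[of p UNIV])
 fix al
 have "al - ex j - ex i = al - ex i - ex j"
  by (rule poly_mapping_eqI) (auto simp: lookup_minus)
 then show "pdiff i (pdiff j (gen al)) = pdiff j (pdiff i (gen al))"
  by (cases "i = j") (auto simp: pdiff_lext lext_single lookup_minus lookup_single when_def mult.commute)
qed (auto intro: plin_comp[OF plin_pdiff plin_pdiff])

lemma pdiff_pvar: "pdiff i (pvar j) = (if i = j then 1 else 0)"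
 by (simp add: pvar_def pdiff_gen lookup_single when_def)

lemma pdiff_1 [simp]: "pdiff i 1 = 0"
 using pdiff_gen[of i 0] by simp

lemma pdiff_0 [simp]: "pdiff i 0 = 0"
 by (simp add: pdiff_simps)

lemma polys_gen [simp]: "gen al : polys n \<longleftrightarrow> al : exponents n"
 by (simp add: polys_def)

lemma subspace_polys: "pm.subspace (polys n)"
 unfolding polys_def by (rule subspace_keys)

lemma polys_closed [simp, intro]: "0 : polys n" "p : polys n ==> q : polys n ==> p + q : polys n"
 "p : polys n ==> pscale c p : polys n" "p : polys n ==> q : polys n ==> p - q : polys n"
 "p : polys n ==> - p : polys n" "(!!i. i : A ==> f i : polys n) ==> sum f A : polys n"
 using subspace_polys by (auto simp: pm.subspace_0 pm.subspace_add pm.subspace_scale pm.subspace_diff pm.subspace_neg intro: pm.subspace_sum)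

lemma polys_1 [simp, intro]: "1 : polys n"
 by (simp add: polys_def)

lemma polys_pvar [simp]: "pvar i : polys n \<longleftrightarrow> i < n"
 by (simp add: pvar_def)

lemma polys_mult [simp, intro]: "p : polys n ==> q : polys n ==> p * q : polys n"
 unfolding polys_def using Poly_Mapping.keys_mult[of p q] by fastforce

lemma polys_single: "al : exponents n ==> single al c : polys n"
 by (cases "c = 0") (auto simp: polys_def)

lemma polys_pdiff [simp, intro]: assumes "p : polys n" shows "pdiff i p : polys n"
proof -
 have "keys p <= exponents n" using assms by (simp add: polys_def)
 then show ?thesis
  by (induction rule: pm_sup_induct) (auto simp: pdiff_simps pdiff_gen intro!: polys_single)
qed

lemma polys_induct [consumes 1, case_names one times add scale]:
 assumes "p : polys n" "P 1" "!!i p. i < n ==> p : polys n ==> P p ==> P (pvar i * p)"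
  "!!p q. P p ==> P q ==> P (p + q)" "!!c p. P p ==> P (pscale c p)"
 shows "P p"
proof -
 have "P (gen al)" if "al : exponents n" for al
  using that
 proof (induction rule: exponents_induct)
  case (add al i)
  then show ?case using assms(3)[of i "gen al"] by (simp add: pvar_def gen_times add.commute)
 qed (use assms(2) in simp)
 moreover have "P 0" using assms(5)[OF assms(2), of 0] by simp
 ultimately show ?thesis
  using assms(1) unfolding polys_def
  by (auto intro: pm_sup_induct[of p "exponents n" P] assms)
qed

section \<open>Polynomials in commuting operators and the Fourier transform\<close>

definition opow :: "nat => (nat => 'u => 'u) => (nat \<Rightarrow>\<^sub>0 nat) => 'u => 'u" where
 "opow n A al u = foldr (%i. A i ^^ lookup al i) [0..<n] u"

lemma opow_0 [simp]: "opow n A 0 u = u"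
proof -
 have "foldr (%i. A i ^^ 0) xs u = u" for xs :: "nat list" by (induction xs) auto
 then show ?thesis by (simp add: opow_def)
qed

definition comm_ops :: "nat => (nat => 'x cv => 'x cv) => bool" where
 "comm_ops n A \<longleftrightarrow> (\<forall>i<n. plin (A i)) & (\<forall>i<n. \<forall>j<n. \<forall>u. A i (A j u) = A j (A i u))"

lemma opow_add:
 assumes "comm_ops n A" "i < n" shows "opow n A (al + ex i) u = A i (opow n A al u)"
proof -
 have c: "A i (A j u) = A j (A i u)" if "j < n" for j u using assms that by (auto simp: comm_ops_def)
 have p: "A i ((A j ^^ m) u) = (A j ^^ m) (A i u)" if "j < n" for j m u
  using that by (induction m) (auto simp: c)
 have f: "A i (foldr (%j. A j ^^ lookup al j) xs u) = foldr (%j. A j ^^ lookup al j) xs (A i u)"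
  if "set xs <= {..<n}" for xs
  using that by (induction xs) (auto simp: p)
 have ne: "foldr (%j. A j ^^ lookup (al + ex i) j) xs u = foldr (%j. A j ^^ lookup al j) xs u"
  if "i ~: set xs" for xs u
  using that by (induction xs) (auto simp: lookup_add lookup_single when_def)
 have "foldr (%j. A j ^^ lookup (al + ex i) j) xs u = A i (foldr (%j. A j ^^ lookup al j) xs u)"
  if "distinct xs" "i : set xs" "set xs <= {..<n}" for xs
  using that
 proof (induction xs)
  case (Cons a xs)
  show ?case
  proof (cases "a = i")
   case True
   then show ?thesis using Cons.prems ne[of xs u] by (simp add: lookup_add lookup_single when_def Suc_eq_plus1[symmetric])
  next
   case False
   then show ?thesis using Cons by (auto simp: lookup_add lookup_single when_def p)
  qed
 qed simp
 from this[of "[0..<n]"] show ?thesis using assms(2) by (auto simp: opow_def atLeast0LessThan)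
qed

lemma opow_in:
 assumes "comm_ops n A" "!!i u. i < n ==> u : W ==> A i u : W" "u : W" "al : exponents n"
 shows "opow n A al u : W"
 using assms(4) by (induction rule: exponents_induct) (auto simp: assms opow_add[OF assms(1)])

lemma plin_opow: assumes "comm_ops n A" "al : exponents n" shows "plin (opow n A al)"
 using assms(2)
proof (induction rule: exponents_induct)
 case zero
 then show ?case by (simp add: plin_id)
next
 case (add al i)
 have "plin (%u. A i (opow n A al u))"
  by (rule plin_comp) (use add assms in \<open>auto simp: comm_ops_def\<close>)
 moreover have "opow n A (al + ex i) = (%u. A i (opow n A al u))"
  using add assms by (intro HOL.ext) (simp add: opow_add)
 ultimately show ?case by simp
qed

text \<open>The value of the polynomial \<open>p\<close> at the operators \<open>A i\<close>,
  applied to \<open>u\<close>. It is used for the partial derivatives, for their negatives, and for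
  the constant vector fields of a representation.\<close>

definition evp :: "nat => (nat => 'x cv => 'x cv) => cpoly => 'x cv => 'x cv" where
 "evp n A p u = lext (%al. opow n A al u) p"

lemma plin_evp: "plin (%p. evp n A p u)"
 unfolding evp_def by (rule plin_lext)

lemmas evp_simps = plin_simps[OF plin_evp]

lemma evp_gen: "evp n A (gen al) u = opow n A al u"
 by (simp add: evp_def)

lemma evp_1 [simp]: "evp n A 1 u = u"
 using evp_gen[of n A 0 u] by simp

lemma evp_0 [simp]: "evp n A 0 u = 0"
 by (simp add: evp_simps)

lemma evp_pvar_times:
 assumes "comm_ops n A" "i < n" shows "evp n A (pvar i * p) u = A i (evp n A p u)"
proof (rule plin_eqI[of p UNIV "%p. evp n A (pvar i * p) u"])
 show "plin (%p. evp n A (pvar i * p) u)" by (rule plin_comp[OF plin_evp plin_times(2)])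
 have "plin (A i)" using assms by (auto simp: comm_ops_def)
 then show "plin (%p. A i (evp n A p u))" by (rule plin_comp[OF _ plin_evp])
qed (use assms in \<open>auto simp: pvar_def gen_times evp_gen add.commute[of "ex i"] opow_add\<close>)

lemma evp_pvar: "comm_ops n A ==> i < n ==> evp n A (pvar i) u = A i u"
 using evp_pvar_times[of n A i 1 u] by simp

lemma evp_in:
 assumes "comm_ops n A" "!!i u. i < n ==> u : W ==> A i u : W" "u : W" "p : polys n" "pm.subspace W"
 shows "evp n A p u : W"
 using assms(4)
 by (induction rule: polys_induct)
  (auto simp: evp_pvar_times assms evp_simps pm.subspace_add pm.subspace_scale)

lemma plin_evp2: assumes "comm_ops n A" "p : polys n" shows "plin (evp n A p)"
 using assms(2)
proof (induction rule: polys_induct)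
 case one then show ?case by (simp add: plin_def)
next
 case (times i p)
 then show ?case using assms(1) by (auto simp: evp_pvar_times comm_ops_def plin_def)
next
 case (add p q) then show ?case using plin_plus[of "evp n A p" "evp n A q"] by (simp add: evp_simps plin_def)
next
 case (scale c p) then show ?case using plin_scaled[of "evp n A p" c] by (simp add: evp_simps plin_def)
qed

lemma comm_ops_pdiff: "comm_ops n pdiff"
 by (simp add: comm_ops_def plin_pdiff pdiff_commute)

lemma comm_ops_neg_pdiff: "comm_ops n (%i p. - pdiff i p)"
 by (auto simp: comm_ops_def plin_def pdiff_simps pdiff_commute)

text \<open>The operator \<open>f(-\<partial>)\<close>: what multiplication by \<open>f\<close>
  becomes when \<open>t_i\<close> is replaced by \<open>-\<partial>_i\<close>.\<close>

definition fT :: "nat => cpoly => cpoly => cpoly" where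
 "fT n f = evp n (%i p. - pdiff i p) f"

lemma fT_1 [simp]: "fT n 1 p = p"
 and fT_0 [simp]: "fT n 0 p = 0"
 and fT_add: "fT n (f + g) p = fT n f p + fT n g p"
 and fT_scale: "fT n (pscale c f) p = pscale c (fT n f p)"
 by (simp_all add: fT_def evp_simps)

lemma fT_pvar_times: "i < n ==> fT n (pvar i * f) p = - pdiff i (fT n f p)"
 by (simp add: fT_def evp_pvar_times comm_ops_neg_pdiff)

lemma fT_pvar: "i < n ==> fT n (pvar i) p = - pdiff i p"
 by (simp add: fT_def evp_pvar comm_ops_neg_pdiff)

lemma plin_fT: "f : polys n ==> plin (fT n f)"
 by (simp add: fT_def plin_evp2 comm_ops_neg_pdiff)

lemma fT_polys [intro]: "f : polys n ==> p : polys n ==> fT n f p : polys n"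
 unfolding fT_def by (rule evp_in[OF comm_ops_neg_pdiff]) (auto simp: subspace_polys)

text \<open>The commutator of \<open>f(-\<partial>)\<close> with \<open>t_k\<close> is
  \<open>-(\<partial>_k f)(-\<partial>)\<close>. It mirrors the rule by which a vector field passes
  a constant vector field, and this agreement is what lets the tensor formula propagate from
  generators to translates.\<close>

lemma fT_commute:
 assumes "f : polys n" "k < n" shows "fT n f (pvar k * p) = pvar k * fT n f p - fT n (pdiff k f) p"
 using assms(1)
proof (induction rule: polys_induct)
 case (times i f)
 then show ?case
  by (cases "k = i"; simp add: fT_pvar_times pdiff_mult pdiff_pvar pdiff_simps fT_add mult.assoc)
next
 case (scale c f)
 then show ?case by (simp add: fT_scale pdiff_simps pscale_mult pm.scale_right_diff_distrib)
qed (auto simp: fT_add pdiff_simps algebra_simps)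

section \<open>Derivations of the polynomial ring\<close>

abbreviation cDer :: "nat => cop set" where "cDer n \<equiv> carrier (Der n)"

lemma op_space_simps [simp]: "carrier (op_space n B m e) = B" "\<zero>\<^bsub>op_space n B m e\<^esub> = (\<lambda>p\<in>polys n. 0)"
 "S \<oplus>\<^bsub>op_space n B m e\<^esub> T = (\<lambda>p\<in>polys n. S p + T p)"
 "c \<odot>\<^bsub>op_space n B m e\<^esub> T = (\<lambda>p\<in>polys n. pscale c (T p))"
 "S \<otimes>\<^bsub>op_space n B m e\<^esub> T = m S T"
 by (auto simp: op_space_def)

lemma module_op_space:
 assumes "(\<lambda>p\<in>polys n. 0) : B" "!!S T. S : B ==> T : B ==> (\<lambda>p\<in>polys n. S p + T p) : B"
  "!!c T. T : B ==> (\<lambda>p\<in>polys n. pscale c (T p)) : B" "B <= extensional (polys n)"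
 shows "module CC (op_space n B m e)"
proof (rule moduleI)
 show "cring CC" by (rule cring_CC)
 have e: "(\<lambda>p\<in>polys n. T p) = T" if "T : B" for T
  using that assms(4) by (auto simp: extensional_restrict)
 have u: "T p = undefined" if "T : B" "p ~: polys n" for T p
  using that assms(4) by (auto simp: extensional_def)
 show "abelian_group (op_space n B m e)"
 proof (rule abelian_groupI)
  fix x assume "x : carrier (op_space n B m e)"
  then show "\<exists>y\<in>carrier (op_space n B m e). y \<oplus>\<^bsub>op_space n B m e\<^esub> x = \<zero>\<^bsub>op_space n B m e\<^esub>"
   using assms(3)[of x "-1"] by (auto intro!: bexI[of _ "\<lambda>p\<in>polys n. pscale (-1) (x p)"] simp: fun_eq_iff)
 qed (auto simp: assms fun_eq_iff algebra_simps u cong: if_cong)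
 show "x : carrier (op_space n B m e) ==> \<one>\<^bsub>CC\<^esub> \<odot>\<^bsub>op_space n B m e\<^esub> x = x" for x
  by (auto simp: e)
qed (auto simp: assms fun_eq_iff pscale_simps)

definition vf :: "nat => (nat => cpoly) => cop" where
 "vf n c = (\<lambda>p\<in>polys n. \<Sum>j<n. c j * pdiff j p)"

lemma Der_iff: "D : cDer n \<longleftrightarrow> D : polys n \<rightarrow>\<^sub>E polys n &
    (\<forall>p\<in>polys n. \<forall>q\<in>polys n. D (p + q) = D p + D q) &
    (\<forall>c. \<forall>p\<in>polys n. D (pscale c p) = pscale c (D p)) &
    (\<forall>p\<in>polys n. \<forall>q\<in>polys n. D (p * q) = D p * q + p * D q)"
 by (simp add: Der_def)

lemma vf_Der: "(!!j. j < n ==> c j : polys n) ==> vf n c : cDer n"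
 unfolding Der_iff vf_def
 by (auto simp: pdiff_simps pdiff_mult algebra_simps sum.distrib sum_distrib_left pscale_mult pm.scale_sum_right)

lemma Der_zero: "(\<lambda>p\<in>polys n. 0) : cDer n"
 by (auto simp: Der_iff)

lemma Der_module: "module CC (Der n)"
 unfolding Der_def
 by (rule module_op_space) (auto simp: algebra_simps pscale_simps pscale_mult PiE_def)

lemma Der_polys: "D : cDer n ==> p : polys n ==> D p : polys n"
 by (auto simp: Der_iff)

text \<open>The Leibniz rule at \<open>1 * 1\<close> kills constants; then multiplication by
  variables determines the derivation from its coefficients.\<close>

lemma Der_eq_vf: assumes "D : cDer n" shows "D = vf n (%j. D (pvar j))"
proof
 fix p
 have D1: "D 1 = 0"
 proof -
  have "D (1 * 1) = D 1 * 1 + 1 * D 1" using assms polys_1 unfolding Der_iff by blast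
  then show ?thesis by simp
 qed
 show "D p = vf n (%j. D (pvar j)) p"
 proof (cases "p : polys n")
  case True
  then have "p : polys n & D p = (\<Sum>j<n. D (pvar j) * pdiff j p)"
  proof (induction rule: polys_induct)
   case one then show ?case by (simp add: D1)
  next
   case (times i p)
   have "D (pvar i * p) = D (pvar i) * p + pvar i * D p"
    using assms times unfolding Der_iff by auto
   moreover have "(\<Sum>j<n. D (pvar j) * pdiff j (pvar i * p)) = D (pvar i) * p + pvar i * (\<Sum>j<n. D (pvar j) * pdiff j p)"
   proof -
    have "(\<Sum>j<n. D (pvar j) * pdiff j (pvar i * p)) = (\<Sum>j<n. (if j = i then D (pvar j) * p else 0) + pvar i * (D (pvar j) * pdiff j p))"
     by (rule sum.cong) (auto simp: pdiff_mult pdiff_pvar algebra_simps)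
    then show ?thesis using times by (simp add: sum.distrib sum_distrib_left)
   qed
   ultimately show ?case using times by simp
  next
   case (add p q)
   then show ?case using assms unfolding Der_iff by (simp add: pdiff_simps algebra_simps sum.distrib)
  next
   case (scale c p)
   then show ?case using assms unfolding Der_iff by (simp add: pdiff_simps pscale_mult pm.scale_sum_right)
  qed
  then show ?thesis by (simp add: vf_def)
 next
  case False
  then have "D p = undefined" using assms unfolding Der_iff PiE_def extensional_def by blast
  with False show ?thesis by (simp add: vf_def)
 qed
qed

lemma vf_pvar: "j < n ==> vf n c (pvar j) = c j"
 by (simp add: vf_def pdiff_pvar if_distrib[of "(*) _"] cong: if_cong)

lemma Der_eqI:
 assumes "D : cDer n" "D' : cDer n" "!!j. j < n ==> D (pvar j) = D' (pvar j)"
 shows "D = D'"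
proof -
 have "vf n (%j. D (pvar j)) = vf n (%j. D' (pvar j))" unfolding vf_def using assms(3) by (auto simp: fun_eq_iff intro!: sum.cong)
 then show ?thesis using Der_eq_vf[OF assms(1)] Der_eq_vf[OF assms(2)] by simp
qed

lemma Der_simps: "D \<oplus>\<^bsub>Der n\<^esub> D' = (\<lambda>p\<in>polys n. D p + D' p)" "c \<odot>\<^bsub>Der n\<^esub> D = (\<lambda>p\<in>polys n. pscale c (D p))"
 "D \<otimes>\<^bsub>Der n\<^esub> D' = (\<lambda>p\<in>polys n. D (D' p) - D' (D p))" "\<zero>\<^bsub>Der n\<^esub> = (\<lambda>p\<in>polys n. 0)"
 by (auto simp: Der_def)

definition dop :: "nat => cpoly => nat => cop" where
 "dop n f j = vf n (%i. if i = j then f else 0)"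

lemma dop_Der [simp, intro]: "f : polys n ==> dop n f j : cDer n"
 unfolding dop_def by (rule vf_Der) auto

lemma dop_apply: "j < n ==> p : polys n ==> dop n f j p = f * pdiff j p"
 by (simp add: dop_def vf_def if_distrib[of "%x. x * _"] cong: if_cong)

lemma dop_pvar: "i < n ==> dop n f j (pvar i) = (if i = j then f else 0)"
 unfolding dop_def by (rule vf_pvar)

lemma der_gen_dop: "i < n ==> der_gen n al i = dop n (gen al) i"
 by (auto simp: der_gen_def dop_def vf_def fun_eq_iff if_distrib[of "%x. x * _"] cong: if_cong)

lemma Der_add_closed: "D : cDer n ==> D' : cDer n ==> D \<oplus>\<^bsub>Der n\<^esub> D' : cDer n"
proof -
 interpret module CC "Der n" by (rule Der_module)
 show "D : cDer n ==> D' : cDer n ==> D \<oplus>\<^bsub>Der n\<^esub> D' : cDer n" by simp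
qed

lemma Der_smult_closed: "D : cDer n ==> c \<odot>\<^bsub>Der n\<^esub> D : cDer n"
proof -
 interpret module CC "Der n" by (rule Der_module)
 show "D : cDer n ==> c \<odot>\<^bsub>Der n\<^esub> D : cDer n" by simp
qed

lemma Der_bracket_closed:
 assumes "D : cDer n" "D' : cDer n" shows "D \<otimes>\<^bsub>Der n\<^esub> D' : cDer n"
proof -
 have D: "D p : polys n" "D' p : polys n" if "p : polys n" for p using that assms by (auto simp: Der_polys)
 have a: "D (p + q) = D p + D q" "D' (p + q) = D' p + D' q" "D (pscale c p) = pscale c (D p)"
  "D' (pscale c p) = pscale c (D' p)" "D (p * q) = D p * q + p * D q" "D' (p * q) = D' p * q + p * D' q"
  if "p : polys n" "q : polys n" for p q c
  using that assms unfolding Der_iff by blast+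
 show ?thesis unfolding Der_iff Der_simps
  by (auto simp: D a algebra_simps pm.scale_right_diff_distrib)
qed

lemma dop_bracket:
 assumes "f : polys n" "g : polys n" "i < n" "j < n"
 shows "dop n f i \<otimes>\<^bsub>Der n\<^esub> dop n g j = dop n (f * pdiff i g) j \<oplus>\<^bsub>Der n\<^esub> ((-1) \<odot>\<^bsub>Der n\<^esub> dop n (g * pdiff j f) i)"
 by (rule Der_eqI[OF Der_bracket_closed[OF dop_Der dop_Der] Der_add_closed[OF dop_Der Der_smult_closed[OF dop_Der]]])
  (use assms in \<open>auto simp: Der_simps dop_pvar dop_apply pdiff_mult pdiff_pvar mult.assoc\<close>)

lemma dop_out: "p ~: polys n ==> dop n f j p = undefined"
 by (simp add: dop_def vf_def)

lemma dop_add: "j < n ==> dop n (f + g) j = dop n f j \<oplus>\<^bsub>Der n\<^esub> dop n g j"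
 and dop_scale: "j < n ==> dop n (pscale c f) j = c \<odot>\<^bsub>Der n\<^esub> dop n f j"
 and dop_0: "j < n ==> dop n 0 j = \<zero>\<^bsub>Der n\<^esub>"
 by (auto simp: Der_simps fun_eq_iff dop_apply dop_out distrib_right pscale_mult)

text \<open>A fold rather than a sum, so that additivity of a representation or closure of a span
  can be applied one summand at a time.\<close>

lemma Der_sum_dop:
 assumes "D : cDer n"
 shows "D = foldr (%j E. dop n (D (pvar j)) j \<oplus>\<^bsub>Der n\<^esub> E) [0..<n] \<zero>\<^bsub>Der n\<^esub>"
proof -
 let ?F = "%xs. foldr (%j E. dop n (D (pvar j)) j \<oplus>\<^bsub>Der n\<^esub> E) xs \<zero>\<^bsub>Der n\<^esub>"
 have c: "?F xs : cDer n" if "set xs <= {..<n}" for xs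
  using that Der_polys[OF assms] by (induction xs) (auto intro!: Der_add_closed simp: Der_simps(4) Der_zero)
 have v: "?F xs (pvar i) = (if i : set xs then D (pvar i) else 0)" if "set xs <= {..<n}" "i < n" "distinct xs" for xs i
  using that by (induction xs) (auto simp: Der_simps dop_pvar)
 show ?thesis by (rule Der_eqI[OF assms c]) (auto simp: v[of "[0..<n]"] atLeast0LessThan)
qed

text \<open>One notion for the homogeneous parts, for the filtration and, with the constantly true
  predicate, for the whole algebra. A field of degree \<open>k\<close> in the grading has
  coefficients of degree \<open>k + 1\<close>.\<close>

definition gr :: "nat => (nat => bool) => cop set" where
 "gr n P = {D : cDer n. \<forall>j<n. \<forall>al\<in>keys (D (pvar j)). P (deg n al)}"

lemma gr_submodule: "submodule (gr n P) CC (Der n)"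
proof -
 have "D \<oplus>\<^bsub>Der n\<^esub> D' : gr n P" if "D : gr n P" "D' : gr n P" for D D'
 proof -
  have "(D \<oplus>\<^bsub>Der n\<^esub> D') (pvar j) = D (pvar j) + D' (pvar j)" if "j < n" for j using that by (simp add: Der_simps)
  then show ?thesis using that pm_keys_add[of "D (pvar _)" "D' (pvar _)"] unfolding gr_def
   by (auto simp: Der_add_closed) blast
 qed
 moreover have "c \<odot>\<^bsub>Der n\<^esub> D : gr n P" if "D : gr n P" for c D
 proof -
  have "(c \<odot>\<^bsub>Der n\<^esub> D) (pvar j) = pscale c (D (pvar j))" if "j < n" for j using that by (simp add: Der_simps)
  then show ?thesis using that unfolding gr_def
   by (auto simp: Der_smult_closed dest!: set_mp[OF keys_pscale])
 qed
 moreover have "\<zero>\<^bsub>Der n\<^esub> : gr n P" by (simp add: gr_def Der_simps Der_zero)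
 moreover have "gr n P <= cDer n" by (auto simp: gr_def)
 ultimately show ?thesis
  unfolding submodule_CC_iff[OF Der_module] by blast
qed

lemma gr_span:
 "gr n P = vspan (Der n) {der_gen n al i | al i. al : exponents n & i < n & P (deg n al)}" (is "_ = vspan _ ?G")
proof
 interpret module CC "Der n" by (rule Der_module)
 have G: "?G <= gr n P" by (auto simp: der_gen_dop gr_def dop_pvar split: if_splits)
 then show "vspan (Der n) ?G <= gr n P" by (rule vspan_least[OF gr_submodule])
 have "submodule (vspan (Der n) ?G) CC (Der n)"
  by (rule vspan_submodule[OF Der_module]) (use G in \<open>auto simp: gr_def\<close>)
 note sub = this[unfolded submodule_CC_iff[OF Der_module]]
 show "gr n P <= vspan (Der n) ?G"
 proof
  fix D assume D: "D : gr n P"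
  then have Dc: "D : cDer n" by (simp add: gr_def)
  have d: "dop n p j : vspan (Der n) ?G" if "keys p <= {al : exponents n. P (deg n al)}" "j < n" for p j
   using that(1)
  proof (induction rule: pm_sup_induct)
   case zero
   have "dop n 0 j = \<zero>\<^bsub>Der n\<^esub>" using that(2) by (rule dop_0)
   then show ?case using sub by auto
  next
   case (add p q)
   have "dop n (p + q) j = dop n p j \<oplus>\<^bsub>Der n\<^esub> dop n q j"
    using that(2) by (rule dop_add)
   then show ?case using add sub by auto
  next
   case (scale c p)
   have "dop n (pscale c p) j = c \<odot>\<^bsub>Der n\<^esub> dop n p j"
    using that(2) by (rule dop_scale)
   then show ?case using scale sub by auto
  next
   case (gen al)
   then show ?case using that(2) by (intro vspan_base) (auto simp: der_gen_dop[symmetric])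
  qed
  have "foldr (%j E. dop n (D (pvar j)) j \<oplus>\<^bsub>Der n\<^esub> E) xs \<zero>\<^bsub>Der n\<^esub> : vspan (Der n) ?G" if "set xs <= {..<n}" for xs
   using that
  proof (induction xs)
   case (Cons j xs)
   have "D (pvar j) : polys n" using Der_polys[OF Dc] Cons by simp
   then have "dop n (D (pvar j)) j : vspan (Der n) ?G"
    using D Cons by (intro d) (auto simp: gr_def polys_def)
   then show ?case using Cons sub by auto
  qed (use sub in simp)
  then show "D : vspan (Der n) ?G" by (subst Der_sum_dop[OF Dc]) (auto simp: atLeast0LessThan)
 qed
qed

lemma grade_gr: "grade n k = gr n (%d. int d = k + 1)"
 unfolding grade_def gr_span deg_def ..

lemma grade_ge_gr: "grade_ge n r = gr n (%d. r + 1 <= int d)"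
proof
 have "(\<Union>k\<in>{r..}. grade n k) <= gr n (%d. r + 1 <= int d)" by (auto simp: grade_gr gr_def)
 then show "grade_ge n r <= gr n (%d. r + 1 <= int d)"
  unfolding grade_ge_def by (rule vspan_least[OF gr_submodule])
 have s: "submodule (grade_ge n r) CC (Der n)"
  unfolding grade_ge_def by (rule vspan_submodule[OF Der_module]) (auto simp: grade_gr gr_def)
 have "der_gen n al i : grade_ge n r" if "al : exponents n" "i < n" "r + 1 <= int (deg n al)" for al i
 proof -
  have "der_gen n al i : grade n (int (deg n al) - 1)"
   unfolding grade_gr gr_span using that by (intro vspan_base) auto
  then show ?thesis unfolding grade_ge_def using that by (intro vspan_base) auto
 qed
 then show "gr n (%d. r + 1 <= int d) <= grade_ge n r"
  unfolding gr_span by (intro vspan_least[OF s]) auto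
qed

text \<open>The divided power \<open>t^\<alpha> / \<alpha>!\<close>. With this normalization
  differentiation shifts exponents without numerical factors, so leading coefficients can be read
  off exactly.\<close>

definition mono :: "nat => (nat \<Rightarrow>\<^sub>0 nat) => cpoly" where
 "mono n al = single al (1 / (\<Prod>i<n. fact (lookup al i)))"

lemma mono_0 [simp]: "mono n 0 = 1"
 by (simp add: mono_def)

lemma mono_nz [simp]: "mono n al ~= 0"
 by (simp add: mono_def poly_mapping_eq_iff fun_eq_iff lookup_single when_def exI[of _ al])

lemma mono_polys [simp, intro]: "al : exponents n ==> mono n al : polys n"
 by (simp add: mono_def polys_single)

lemma pdiff_single: "pdiff i (single al c) = single (al - ex i) (c * of_nat (lookup al i))"
 by (simp add: pdiff_lext lext_single)

lemma pdiff_mono_trivial: "lookup al i = 0 ==> pdiff i (mono n al) = 0"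
 by (simp add: mono_def pdiff_single)

lemma pdiff_mono: assumes "i < n" shows "pdiff i (mono n (al + ex i)) = mono n al"
proof -
 have "(\<Prod>k<n. fact (lookup (al + ex i) k) :: complex) = (\<Prod>k<n. (if k = i then of_nat (lookup al i + 1) else 1) * fact (lookup al k))"
  by (rule prod.cong) (auto simp: lookup_add lookup_single when_def Suc_eq_plus1[symmetric] simp del: Suc_eq_plus1)
 also have "... = of_nat (lookup al i + 1) * (\<Prod>k<n. fact (lookup al k))"
  using assms by (simp add: prod.distrib)
 finally show ?thesis
  by (simp add: mono_def pdiff_single lookup_add del: of_nat_add)
qed

lemma opow_pdiff_mono: "ga : exponents n ==> opow n pdiff ga (mono n (ga + de)) = mono n de"
 by (induction arbitrary: de rule: exponents_induct)
  (auto simp: opow_add[OF comm_ops_pdiff] pdiff_mono add.assoc add.commute[of "ex _"])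

lemma opow_pdiff_mono_0: "ga : exponents n ==> (!!de. be ~= ga + de) ==> opow n pdiff ga (mono n be) = 0"
proof (induction rule: exponents_induct)
 case zero
 then show ?case by (metis add_0)
next
 case (add ga i)
 show ?case
 proof (cases "\<exists>de. be = ga + de")
  case True
  then obtain de where de: "be = ga + de" by blast
  have "lookup de i = 0"
  proof (rule ccontr)
   assume "lookup de i ~= 0"
   then have "be = ga + ex i + (de - ex i)" using de ex_minus_add[of de i] by (simp add: algebra_simps)
   then show False using add.prems by blast
  qed
  then show ?thesis using add.hyps by (simp add: opow_add[OF comm_ops_pdiff] de opow_pdiff_mono pdiff_mono_trivial)
 next
  case False
  then show ?thesis using add by (simp add: opow_add[OF comm_ops_pdiff])
 qed
qed

section \<open>The Weyl algebra and the module of delta functions\<close>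

text \<open>The Fourier transform \<open>t\<^sub>i \<mapsto> -\<partial>\<^sub>i\<close>, \<open>\<partial>\<^sub>i \<mapsto> t\<^sub>i\<close> as a relation between operators; it makes the
 polynomial ring a model of the module \<^const>\<open>P0\<close>.\<close>

inductive fourier :: "nat => cop => (cpoly => cpoly) => bool" for n where
 one: "fourier n (\<lambda>p\<in>polys n. p) (%p. p)"
| var: "i < n ==> fourier n (mul_op n (pvar i)) (%p. - pdiff i p)"
| diff: "i < n ==> fourier n (diff_op n i) (%p. pvar i * p)"
| add: "fourier n S S' ==> fourier n T T' ==> fourier n (\<lambda>p\<in>polys n. S p + T p) (%p. S' p + T' p)"
| scale: "fourier n T T' ==> fourier n (\<lambda>p\<in>polys n. pscale c (T p)) (%p. pscale c (T' p))"
| comp: "fourier n S S' ==> fourier n T T' ==> fourier n (compose (polys n) S T) (%p. S' (T' p))"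

lemma fourier_ex: "T : weyl_ops n \<longleftrightarrow> (\<exists>S. fourier n T S)"
proof
 assume "T : weyl_ops n"
 then show "\<exists>S. fourier n T S"
  by induction (auto simp del: restrict_apply intro: fourier.one fourier.var fourier.diff
    dest: fourier.add fourier.comp fourier.scale)
next
 assume "\<exists>S. fourier n T S"
 then obtain S where "fourier n T S" ..
 then show "T : weyl_ops n" by induction (auto simp del: restrict_apply intro: weyl_ops.intros)
qed

lemma fourier_ext: "fourier n T S ==> T : extensional (polys n)"
 by (induction rule: fourier.induct) (auto simp: mul_op_def diff_op_def compose_def extensional_def)

lemma fourier_plin: "fourier n T S ==> plin S"
 by (induction rule: fourier.induct)
  (auto simp: plin_def pdiff_simps algebra_simps pscale_mult pscale_simps)

lemma fourier_polys: "fourier n T S ==> p : polys n ==> S p : polys n & T p : polys n"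
 by (induction arbitrary: p rule: fourier.induct) (auto simp: mul_op_def diff_op_def compose_def)

text \<open>Sums of normally ordered operators \<open>f \<partial>^\<beta>\<close>, paired with
  their transforms. An operator can be built from generators in many ways, but its coefficients in
  normal order are unique; this is how the transform is shown to depend on the operator
  alone.\<close>

inductive nform :: "nat => cop => (cpoly => cpoly) => bool" for n where
 base: "f : polys n ==> be : exponents n ==>
  nform n (\<lambda>p\<in>polys n. f * opow n pdiff be p) (%p. fT n f (gen be * p))"
| add: "nform n S S' ==> nform n T T' ==> nform n (\<lambda>p\<in>polys n. S p + T p) (%p. S' p + T' p)"

lemma opow_pdiff_polys: "be : exponents n ==> p : polys n ==> opow n pdiff be p : polys n"
 by (rule opow_in[OF comm_ops_pdiff]) auto

lemma nform_polys: "nform n T S ==> p : polys n ==> T p : polys n"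
 by (induction rule: nform.induct) (auto simp: opow_pdiff_polys)

lemma nform_var:
 assumes "nform n T S" "i < n" shows "nform n (\<lambda>p\<in>polys n. pvar i * T p) (%p. - pdiff i (S p))"
 using assms(1)
proof (induction rule: nform.induct)
 case (base f be)
 have "(\<lambda>p\<in>polys n. pvar i * (\<lambda>p\<in>polys n. f * opow n pdiff be p) p) = (\<lambda>p\<in>polys n. (pvar i * f) * opow n pdiff be p)"
  by (auto simp: fun_eq_iff algebra_simps)
 moreover have "(%p. - pdiff i (fT n f (gen be * p))) = (%p. fT n (pvar i * f) (gen be * p))"
  by (simp add: fT_pvar_times assms)
 ultimately show ?case using nform.base[of "pvar i * f" n be] base assms
  by (simp only: polys_mult polys_pvar)
next
 case (add S S' T T')
 have "(\<lambda>p\<in>polys n. pvar i * (\<lambda>p\<in>polys n. S p + T p) p) = (\<lambda>p\<in>polys n. (\<lambda>p\<in>polys n. pvar i * S p) p + (\<lambda>p\<in>polys n. pvar i * T p) p)"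
  by (auto simp: fun_eq_iff algebra_simps)
 then show ?case using nform.add[OF add.IH] by (simp add: pdiff_simps del: restrict_apply)
qed

lemma nform_diff:
 assumes "nform n T S" "i < n" shows "nform n (\<lambda>p\<in>polys n. pdiff i (T p)) (%p. pvar i * S p)"
 using assms(1)
proof (induction rule: nform.induct)
 case (base f be)
 have "(\<lambda>p\<in>polys n. pdiff i ((\<lambda>p\<in>polys n. f * opow n pdiff be p) p)) =
  (\<lambda>p\<in>polys n. (\<lambda>p\<in>polys n. pdiff i f * opow n pdiff be p) p + (\<lambda>p\<in>polys n. f * opow n pdiff (be + ex i) p) p)"
  using assms by (auto simp: fun_eq_iff pdiff_mult opow_add[OF comm_ops_pdiff])
 moreover have "(%p. pvar i * fT n f (gen be * p)) = (%p. fT n (pdiff i f) (gen be * p) + fT n f (gen (be + ex i) * p))"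
 proof
  fix p
  have "gen (be + ex i) * p = pvar i * (gen be * p)" unfolding pvar_def gen_times[symmetric] by (simp only: ac_simps)
  then show "pvar i * fT n f (gen be * p) = fT n (pdiff i f) (gen be * p) + fT n f (gen (be + ex i) * p)"
   using fT_commute[OF base(1) assms(2), of "gen be * p"] by (simp only:) simp
 qed
 ultimately show ?case
  using nform.add[OF nform.base[of "pdiff i f" n be] nform.base[of f n "be + ex i"]] base assms
  by (simp only: exponents_add exponents_ex polys_pdiff)
next
 case (add S S' T T')
 have "(\<lambda>p\<in>polys n. pdiff i ((\<lambda>p\<in>polys n. S p + T p) p)) = (\<lambda>p\<in>polys n. (\<lambda>p\<in>polys n. pdiff i (S p)) p + (\<lambda>p\<in>polys n. pdiff i (T p)) p)"
  by (auto simp: fun_eq_iff pdiff_simps)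
 then show ?case using nform.add[OF add.IH] by (simp only: distrib_left)
qed

lemma nform_scale:
 assumes "nform n T S" shows "nform n (\<lambda>p\<in>polys n. pscale c (T p)) (%p. pscale c (S p))"
 using assms
proof (induction rule: nform.induct)
 case (base f be)
 have "(\<lambda>p\<in>polys n. pscale c ((\<lambda>p\<in>polys n. f * opow n pdiff be p) p)) = (\<lambda>p\<in>polys n. pscale c f * opow n pdiff be p)"
  by (auto simp: fun_eq_iff pscale_mult)
 then show ?case using nform.base[of "pscale c f" n be] base by (simp only: fT_scale polys_closed)
next
 case (add S S' T T')
 have "(\<lambda>p\<in>polys n. pscale c ((\<lambda>p\<in>polys n. S p + T p) p)) = (\<lambda>p\<in>polys n. (\<lambda>p\<in>polys n. pscale c (S p)) p + (\<lambda>p\<in>polys n. pscale c (T p)) p)"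
  by (auto simp: fun_eq_iff pscale_simps)
 then show ?case using nform.add[OF add.IH] by (simp only: pscale_simps)
qed

text \<open>Normal forms are preserved by left multiplication with any transformed operator; with
  the identity as right factor this puts every operator into normal form.\<close>

lemma fourier_nform_comp:
 assumes "fourier n A A'" "nform n T S"
 shows "nform n (compose (polys n) A T) (%p. A' (S p))"
 using assms
proof (induction arbitrary: T S rule: fourier.induct)
 case one
 have "compose (polys n) (\<lambda>p\<in>polys n. p) T = (\<lambda>p\<in>polys n. pscale 1 (T p))"
  using nform_polys[OF one] by (auto simp: compose_def fun_eq_iff)
 then show ?case using nform_scale[OF one, of 1] by (simp only: pm.scale_one)
next
 case (var i)
 have "compose (polys n) (mul_op n (pvar i)) T = (\<lambda>p\<in>polys n. pvar i * T p)"
  using nform_polys[OF var(2)] by (auto simp: compose_def fun_eq_iff mul_op_def)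
 then show ?case using nform_var[OF var(2,1)] by (simp only:)
next
 case (diff i)
 have "compose (polys n) (diff_op n i) T = (\<lambda>p\<in>polys n. pdiff i (T p))"
  using nform_polys[OF diff(2)] by (auto simp: compose_def fun_eq_iff diff_op_def)
 then show ?case using nform_diff[OF diff(2,1)] by (simp only:)
next
 case (add A A' B B')
 have "compose (polys n) (\<lambda>p\<in>polys n. A p + B p) T = (\<lambda>p\<in>polys n. compose (polys n) A T p + compose (polys n) B T p)"
  using nform_polys[OF add(5)] by (auto simp: compose_def fun_eq_iff)
 then show ?case using nform.add[OF add(3,4)[OF add(5)]] by (simp only:)
next
 case (scale A A' c)
 have "compose (polys n) (\<lambda>p\<in>polys n. pscale c (A p)) T = (\<lambda>p\<in>polys n. pscale c (compose (polys n) A T p))"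
  using nform_polys[OF scale(3)] by (auto simp: compose_def fun_eq_iff)
 then show ?case using nform_scale[OF scale(2)[OF scale(3)]] by (simp only:)
next
 case (comp A A' B B')
 have "compose (polys n) (compose (polys n) A B) T = compose (polys n) A (compose (polys n) B T)"
  using nform_polys[OF comp(5)] by (auto simp: compose_def fun_eq_iff)
 then show ?case using comp(3)[OF comp(4)[OF comp(5)]] by (simp only:)
qed

lemma fourier_nform: assumes "fourier n A A'" shows "nform n A A'"
proof -
 have "nform n (\<lambda>p\<in>polys n. p) (%p. p)"
  using nform.base[of 1 n 0] by (simp only: polys_1 exponents_0 opow_0 mult_1 gen_0 fT_1)
 then have "nform n (compose (polys n) A (\<lambda>p\<in>polys n. p)) A'"
  by (rule fourier_nform_comp[OF assms])
 moreover have "compose (polys n) A (\<lambda>p\<in>polys n. p) = A"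
  using fourier_ext[OF assms] by (auto simp: compose_def fun_eq_iff extensional_def)
 ultimately show ?thesis by (simp only:)
qed

lemma nform_explicit:
 "nform n T S ==> \<exists>A F. finite A & A <= exponents n & (\<forall>p\<in>polys n. T p = (\<Sum>be\<in>A. F be * opow n pdiff be p)) &
   (\<forall>p. S p = (\<Sum>be\<in>A. fT n (F be) (gen be * p)))"
proof (induction rule: nform.induct)
 case (base f be)
 then show ?case by (intro exI[of _ "{be}"] exI[of _ "%_. f"]) auto
next
 case (add S S' T T')
 from add.IH obtain A F B G where AF: "finite A" "A <= exponents n"
  "\<forall>p\<in>polys n. S p = (\<Sum>be\<in>A. F be * opow n pdiff be p)" "\<forall>p. S' p = (\<Sum>be\<in>A. fT n (F be) (gen be * p))"
  and BG: "finite B" "B <= exponents n"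
  "\<forall>p\<in>polys n. T p = (\<Sum>be\<in>B. G be * opow n pdiff be p)" "\<forall>p. T' p = (\<Sum>be\<in>B. fT n (G be) (gen be * p))"
  by blast
 define F' where "F' = (%be. if be : A then F be else 0)"
 define G' where "G' = (%be. if be : B then G be else 0)"
 have 1: "(\<Sum>be\<in>A. F be * h be) = (\<Sum>be\<in>A \<union> B. F' be * h be)" "(\<Sum>be\<in>A. fT n (F be) (h be)) = (\<Sum>be\<in>A \<union> B. fT n (F' be) (h be))" for h
  using AF BG by (auto simp: F'_def intro!: sum.mono_neutral_cong_left)
 have 2: "(\<Sum>be\<in>B. G be * h be) = (\<Sum>be\<in>A \<union> B. G' be * h be)" "(\<Sum>be\<in>B. fT n (G be) (h be)) = (\<Sum>be\<in>A \<union> B. fT n (G' be) (h be))" for h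
  using AF BG by (auto simp: G'_def intro!: sum.mono_neutral_cong_left)
 show ?case
  using AF BG by (intro exI[of _ "A \<union> B"] exI[of _ "%be. F' be + G' be"])
   (auto simp: 1 2 distrib_right sum.distrib fT_add)
qed

lemma nform_zero:
 assumes "nform n T S" "!!p. p : polys n ==> T p = 0" shows "S p = 0"
proof -
 obtain A F where AF: "finite A" "A <= exponents n"
  "\<forall>p\<in>polys n. T p = (\<Sum>be\<in>A. F be * opow n pdiff be p)" "\<forall>p. S p = (\<Sum>be\<in>A. fT n (F be) (gen be * p))"
  using nform_explicit[OF assms(1)] by blast
 \<comment> \<open>Evaluate at the divided power of exponent \<open>be\<close>: exponents that do
   not divide it contribute nothing, proper divisors have smaller degree and are covered by
   induction, and the remaining term is \<open>F be\<close> itself.\<close>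
 have "F be = 0" if "be : A" for be
  using that
 proof (induction "deg n be" arbitrary: be rule: less_induct)
  case less
  have be: "be : exponents n" using less AF by auto
  have "F ga * opow n pdiff ga (mono n be) = (if ga = be then F be else 0)" if "ga : A" for ga
  proof (cases "\<exists>de. be = ga + de")
   case True
   then obtain de where de: "be = ga + de" by blast
   have ga: "ga : exponents n" using that AF by auto
   have "de : exponents n" using exponents_minus[OF be, of ga] de by simp
   then have "ga ~= be ==> deg n ga < deg n be" using de deg_eq_0[of de n] by (auto simp: deg_add)
   then show ?thesis using less.hyps[of ga] that de opow_pdiff_mono[OF ga, of de] by auto
  next
   case False
   then have "ga ~= be" by (metis add.right_neutral)
   then show ?thesis using opow_pdiff_mono_0[of ga n be] False that AF by auto
  qed
  then have "(\<Sum>ga\<in>A. F ga * opow n pdiff ga (mono n be)) = F be"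
   using AF less.prems by (simp cong: sum.cong)
  then show ?case using AF(3) assms(2)[of "mono n be"] be by auto
 qed
 then show ?thesis using AF(4) by (auto intro: sum.neutral)
qed

definition hat :: "nat => cop => cpoly => cpoly" where
 "hat n T = (THE S. fourier n T S)"

text \<open>The two candidates differ by a transform of the zero operator, all of whose coefficients
  in normal order vanish.\<close>

lemma fourier_unique: assumes "fourier n T S" "fourier n T S'" shows "S = S'"
proof
 fix p
 have "fourier n (\<lambda>p\<in>polys n. T p + (\<lambda>p\<in>polys n. pscale (-1) (T p)) p) (%p. S p + pscale (-1) (S' p))"
  by (intro fourier.add fourier.scale assms)
 from nform_zero[OF fourier_nform[OF this], of p] show "S p = S' p" by simp
qed

lemma hat_eq: "fourier n T S ==> hat n T = S"
 unfolding hat_def using fourier_unique by blast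

lemma fourier_hat: "T : weyl_ops n ==> fourier n T (hat n T)"
 using fourier_ex hat_eq by metis

lemma hat_comp: "S : weyl_ops n ==> T : weyl_ops n ==> hat n (compose (polys n) S T) p = hat n S (hat n T p)"
 by (subst hat_eq[OF fourier.comp[OF fourier_hat fourier_hat]]) auto

lemma hat_add: "S : weyl_ops n ==> T : weyl_ops n ==> hat n (\<lambda>p\<in>polys n. S p + T p) p = hat n S p + hat n T p"
 by (subst hat_eq[OF fourier.add[OF fourier_hat fourier_hat]]) auto

lemma hat_scale: "T : weyl_ops n ==> hat n (\<lambda>p\<in>polys n. pscale c (T p)) p = pscale c (hat n T p)"
 by (subst hat_eq[OF fourier.scale[OF fourier_hat]]) auto

lemma fourier_zero: "fourier n (\<lambda>p\<in>polys n. 0) (%p. 0)"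
 using fourier.scale[OF fourier.one, of n 0] by (simp only: pm.scale_zero_left)

lemma weyl_zero: "(\<lambda>p\<in>polys n. 0) : weyl_ops n"
 using fourier_zero fourier_ex by blast

lemma fourier_mul: assumes "f : polys n" shows "fourier n (mul_op n f) (fT n f)"
proof -
 have "f : polys n & fourier n (mul_op n f) (fT n f)"
  using assms
 proof (induction rule: polys_induct)
  case one
  have "mul_op n 1 = (\<lambda>p\<in>polys n. p)" "fT n 1 = (%p. p)" by (auto simp: mul_op_def)
  then show ?case using fourier.one[of n] by (simp only: polys_1)
 next
  case (times i f)
  have "mul_op n (pvar i * f) = compose (polys n) (mul_op n (pvar i)) (mul_op n f)"
   using times by (auto simp: mul_op_def compose_def fun_eq_iff mult.assoc)
  moreover have "fT n (pvar i * f) = (%p. - pdiff i (fT n f p))" using times by (auto simp: fT_pvar_times)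
  ultimately show ?case using fourier.comp[OF fourier.var[of i n], of "mul_op n f" "fT n f"] times by (simp del: restrict_apply)
 next
  case (add f g)
  have "mul_op n (f + g) = (\<lambda>p\<in>polys n. mul_op n f p + mul_op n g p)"
   by (auto simp: mul_op_def fun_eq_iff distrib_right)
  moreover have "fT n (f + g) = (%p. fT n f p + fT n g p)" by (auto simp: fT_add)
  ultimately show ?case using fourier.add[of n "mul_op n f" "fT n f" "mul_op n g" "fT n g"] add by (simp del: restrict_apply)
 next
  case (scale c f)
  have "mul_op n (pscale c f) = (\<lambda>p\<in>polys n. pscale c (mul_op n f p))"
   by (auto simp: mul_op_def fun_eq_iff pscale_mult)
  moreover have "fT n (pscale c f) = (%p. pscale c (fT n f p))" by (auto simp: fT_scale)
  ultimately show ?case using fourier.scale[of n "mul_op n f" "fT n f" c] scale by (simp del: restrict_apply)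
 qed
 then show ?thesis by blast
qed

lemma fourier_vf:
 assumes "!!j. j < n ==> c j : polys n"
 shows "fourier n (vf n c) (%p. \<Sum>j<n. fT n (c j) (pvar j * p))"
proof -
 have "fourier n (\<lambda>p\<in>polys n. \<Sum>j\<in>A. c j * pdiff j p) (%p. \<Sum>j\<in>A. fT n (c j) (pvar j * p))"
  if "finite A" "A <= {..<n}" for A
  using that
 proof (induction A rule: finite_induct)
  case empty
  then show ?case using fourier_zero by (simp only: sum.empty)
 next
  case (insert j A)
  have "fourier n (compose (polys n) (mul_op n (c j)) (diff_op n j)) (%p. fT n (c j) (pvar j * p))"
   using insert by (intro fourier.comp fourier_mul fourier.diff assms) auto
  from fourier.add[OF this insert.IH[OF order_trans[OF subset_insertI insert.prems]]]
  have "fourier n (\<lambda>p\<in>polys n. compose (polys n) (mul_op n (c j)) (diff_op n j) p + (\<lambda>p\<in>polys n. \<Sum>j\<in>A. c j * pdiff j p) p)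
   (%p. \<Sum>j\<in>insert j A. fT n (c j) (pvar j * p))" by (simp only: sum.insert[OF insert(1,2)])
  moreover have "(\<lambda>p\<in>polys n. compose (polys n) (mul_op n (c j)) (diff_op n j) p + (\<lambda>p\<in>polys n. \<Sum>j\<in>A. c j * pdiff j p) p)
   = (\<lambda>p\<in>polys n. \<Sum>j\<in>insert j A. c j * pdiff j p)"
   using insert by (auto simp: fun_eq_iff compose_def mul_op_def diff_op_def)
  ultimately show ?case by (simp only:)
 qed
 from this[of "{..<n}"] show ?thesis unfolding vf_def by simp
qed

lemma mul_op_weyl: "f : polys n ==> mul_op n f : weyl_ops n"
 and hat_mul_op: "f : polys n ==> hat n (mul_op n f) = fT n f"
 using fourier_mul fourier_ex hat_eq by blast+

lemma diff_op_weyl: "k < n ==> diff_op n k : weyl_ops n"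
 and hat_diff_op: "k < n ==> hat n (diff_op n k) = (%p. pvar k * p)"
 using fourier.diff fourier_ex hat_eq by blast+

lemma assumes "D : cDer n" shows Der_weyl: "D : weyl_ops n"
 and hat_Der: "hat n D = (%p. \<Sum>j<n. fT n (D (pvar j)) (pvar j * p))"
proof -
 have "fourier n D (%p. \<Sum>j<n. fT n (D (pvar j)) (pvar j * p))"
  by (subst Der_eq_vf[OF assms], rule fourier_vf) (use Der_polys[OF assms] in auto)
 then show "D : weyl_ops n" "hat n D = (%p. \<Sum>j<n. fT n (D (pvar j)) (pvar j * p))"
  using fourier_ex hat_eq by blast+
qed

lemma plin_hat: "T : weyl_ops n ==> plin (hat n T)"
 using fourier_plin fourier_hat by blast

section \<open>The polynomial ring as a model of \<open>P0\<close>\<close>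

lemma weyl_module: "module CC (weyl n)"
 unfolding weyl_def
proof (rule module_op_space)
 show "(\<lambda>p\<in>polys n. 0) : weyl_ops n" using fourier_zero fourier_ex by blast
 show "weyl_ops n <= extensional (polys n)" using fourier_ext fourier_ex by blast
qed (auto intro: weyl_ops.intros)

lemma weyl_simps: "carrier (weyl n) = weyl_ops n" "\<zero>\<^bsub>weyl n\<^esub> = (\<lambda>p\<in>polys n. 0)"
 "S \<oplus>\<^bsub>weyl n\<^esub> T = (\<lambda>p\<in>polys n. S p + T p)" "c \<odot>\<^bsub>weyl n\<^esub> T = (\<lambda>p\<in>polys n. pscale c (T p))"
 "S \<otimes>\<^bsub>weyl n\<^esub> T = compose (polys n) S T"
 by (simp_all add: weyl_def)

text \<open>The operators \<open>q(\<partial>)\<close> with constant coefficients, chosen as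
  representatives modulo the left ideal generated by the variables.\<close>

definition Qop :: "nat => cpoly => cop" where
 "Qop n q = (\<lambda>p\<in>polys n. evp n pdiff q p)"

lemma evp_pdiff_polys: "q : polys n ==> p : polys n ==> evp n pdiff q p : polys n"
 by (rule evp_in[OF comm_ops_pdiff]) (auto simp: subspace_polys)

lemma evp_pdiff_commute:
 assumes "i < n" "q : polys n"
 shows "evp n pdiff q (pvar i * p) = pvar i * evp n pdiff q p + evp n pdiff (pdiff i q) p"
 using assms(2)
proof (induction rule: polys_induct)
 case (times k q)
 then show ?case
  by (cases "k = i"; simp add: evp_pvar_times comm_ops_pdiff evp_simps pdiff_mult pdiff_pvar pdiff_simps)
next
 case (scale c f)
 then show ?case by (simp add: evp_simps pdiff_simps pscale_mult pscale_simps)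
qed (auto simp: evp_simps pdiff_simps algebra_simps)

lemma fourier_Qop: "q : polys n ==> fourier n (Qop n q) (%p. q * p)"
proof (induction rule: polys_induct)
 case one
 then show ?case using fourier.one by (simp only: Qop_def evp_1 mult_1)
next
 case (times i q)
 have "Qop n (pvar i * q) = compose (polys n) (diff_op n i) (Qop n q)"
  using times by (auto simp: Qop_def compose_def fun_eq_iff diff_op_def evp_pvar_times comm_ops_pdiff evp_pdiff_polys)
 then show ?case using fourier.comp[OF fourier.diff times(3)] times by (simp only: mult.assoc)
next
 case (add p q)
 have "Qop n (p + q) = (\<lambda>x\<in>polys n. Qop n p x + Qop n q x)"
  by (auto simp: Qop_def fun_eq_iff evp_simps)
 then show ?case using fourier.add[OF add] by (simp only: distrib_right)
next
 case (scale c q)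
 have "Qop n (pscale c q) = (\<lambda>x\<in>polys n. pscale c (Qop n q x))"
  by (auto simp: Qop_def fun_eq_iff evp_simps)
 then show ?case using fourier.scale[OF scale] by (simp only: pscale_mult)
qed

text \<open>The class of \<open>T\<close> goes to the transform of \<open>T\<close> applied to 1;
  variables transform into derivatives and hence kill 1.\<close>

definition psi :: "nat => cop set => cpoly" where
 "psi n = cmap (%T. hat n T 1)"

text \<open>The point is that the kernel of \<open>?phi\<close> is no larger than the left ideal.
  Each operator reduces modulo the ideal to some \<open>q(\<partial>)\<close>, and
  \<open>?phi\<close> takes the value \<open>q\<close> there; so value zero means membership in the
  ideal.\<close>

lemma P0_liso: "liso (weyl_ops n) (P0 n) (hat n) (psi n) (polys n)"
proof -
 let ?K = "module.extend (weyl n) (lmod.fields (monoid.mult (weyl n))) :: (cop, cop) lmod"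
 let ?G = "{T \<otimes>\<^bsub>weyl n\<^esub> mul_op n (pvar i) | T i. T : carrier (weyl n) & i < n}"
 let ?N = "vspan (weyl n) ?G"
 let ?phi = "%T. hat n T 1"
 have K: "carrier ?K = weyl_ops n" "\<zero>\<^bsub>?K\<^esub> = \<zero>\<^bsub>weyl n\<^esub>" "S \<oplus>\<^bsub>?K\<^esub> T = S \<oplus>\<^bsub>weyl n\<^esub> T"
  "c \<odot>\<^bsub>?K\<^esub> T = c \<odot>\<^bsub>weyl n\<^esub> T" "act ?K S T = S \<otimes>\<^bsub>weyl n\<^esub> T" for S T c
  by (auto simp: weyl_def op_space_def module.defs lmod.defs)
 have mK: "module CC ?K"
 proof -
  interpret module CC "weyl n" by (rule weyl_module)
  note [simp] = K
  show ?thesis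
  proof (rule moduleI)
   show "cring CC" by (rule cring_CC)
   show "abelian_group ?K"
    by (rule abelian_groupI) (use M.a_assoc M.a_comm M.l_zero M.a_inv_closed M.l_neg in \<open>auto simp: weyl_simps(1)[symmetric] simp del: weyl_simps(1)\<close>)
  qed (use smult_closed smult_l_distr smult_r_distr smult_assoc1 smult_one in \<open>auto simp: weyl_simps(1)[symmetric] simp del: weyl_simps(1)\<close>)
 qed
 have l: "lmap (weyl_ops n) ?K (hat n) ?phi"
  unfolding lmap_def by (intro conjI mK) (auto simp: K weyl_simps hat_add hat_scale hat_comp weyl_ops.comp)
 have G: "?G <= carrier (weyl n)"
  by (auto simp: weyl_simps intro: weyl_ops.intros)
 have sub: "submodule ?N CC (weyl n)" by (rule vspan_submodule[OF weyl_module G])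
 note sub' = sub[unfolded submodule_CC_iff[OF weyl_module]]
 have hz: "hat n (\<lambda>p\<in>polys n. 0) p = 0" for p using hat_eq[OF fourier_zero] by simp
 have "submodule {T : weyl_ops n. ?phi T = 0} CC (weyl n)"
  unfolding submodule_CC_iff[OF weyl_module]
  using weyl_zero by (auto simp: weyl_simps hat_add hat_scale hz simp del: restrict_apply intro: weyl_ops.add weyl_ops.scale)
 then have N1: "?N <= {T : weyl_ops n. ?phi T = 0}"
 proof (rule vspan_least)
  have "hat n (mul_op n (pvar i)) 1 = 0" if "i < n" for i
   using that by (simp add: hat_mul_op fT_pvar)
  then show "?G <= {T : weyl_ops n. ?phi T = 0}"
   by (auto simp: weyl_simps hat_comp weyl_ops.intros plin_0[OF plin_hat])
 qed
 \<comment> \<open>The generating set is closed under left multiplication; its linear span has to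
   inherit this.\<close>
 have left: "compose (polys n) A U : ?N" if "A : weyl_ops n" "U : ?N" for A U
 proof -
  have A: "A (p + q) = A p + A q" "A (pscale c p) = pscale c (A p)" if "p : polys n" "q : polys n" for p q c
  proof -
   have "fourier n A (hat n A)" using \<open>A : weyl_ops n\<close> by (rule fourier_hat)
   then have "(\<forall>p\<in>polys n. \<forall>q\<in>polys n. A (p + q) = A p + A q) & (\<forall>c. \<forall>p\<in>polys n. A (pscale c p) = pscale c (A p))"
    by (induction rule: fourier.induct)
     (auto simp: mul_op_def diff_op_def compose_def pdiff_simps distrib_left distrib_right pscale_mult pscale_simps fourier_polys algebra_simps)
   then show "A (p + q) = A p + A q" "A (pscale c p) = pscale c (A p)" using that by auto
  qed
  have pol: "T p : polys n" if "T : weyl_ops n" "p : polys n" for T p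
   using that fourier_polys fourier_hat by blast
  have A0: "A 0 = 0" using A(2)[of 0 0 0] by simp
  have "submodule {U : ?N. compose (polys n) A U : ?N} CC (weyl n)"
   unfolding submodule_CC_iff[OF weyl_module]
  proof (intro conjI ballI allI)
   show "{U : ?N. compose (polys n) A U : ?N} <= carrier (weyl n)" using sub' by auto
   have "compose (polys n) A \<zero>\<^bsub>weyl n\<^esub> = \<zero>\<^bsub>weyl n\<^esub>" by (auto simp: compose_def weyl_simps A0)
   then show "\<zero>\<^bsub>weyl n\<^esub> : {U : ?N. compose (polys n) A U : ?N}" using sub' by simp
  next
   fix v w assume "v : {U : ?N. compose (polys n) A U : ?N}" "w : {U : ?N. compose (polys n) A U : ?N}"
   then have vw: "v : ?N" "w : ?N" "compose (polys n) A v : ?N" "compose (polys n) A w : ?N" by auto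
   have "v : weyl_ops n" "w : weyl_ops n" using vw N1 by auto
   then have "compose (polys n) A (v \<oplus>\<^bsub>weyl n\<^esub> w) = compose (polys n) A v \<oplus>\<^bsub>weyl n\<^esub> compose (polys n) A w"
    by (auto simp: compose_def weyl_simps fun_eq_iff A pol)
   then show "v \<oplus>\<^bsub>weyl n\<^esub> w : {U : ?N. compose (polys n) A U : ?N}" using sub' vw by auto
  next
   fix c v assume "v : {U : ?N. compose (polys n) A U : ?N}"
   then have vw: "v : ?N" "compose (polys n) A v : ?N" by auto
   have "v : weyl_ops n" using vw N1 by auto
   then have "compose (polys n) A (c \<odot>\<^bsub>weyl n\<^esub> v) = c \<odot>\<^bsub>weyl n\<^esub> compose (polys n) A v"
    by (auto simp: compose_def weyl_simps fun_eq_iff A(2) pol)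
   then show "c \<odot>\<^bsub>weyl n\<^esub> v : {U : ?N. compose (polys n) A U : ?N}" using sub' vw by auto
  qed
  moreover have "?G <= {U : ?N. compose (polys n) A U : ?N}"
  proof
   fix U assume U: "U : ?G"
   then obtain T i where T: "U = compose (polys n) T (mul_op n (pvar i))" "T : weyl_ops n" "i < n"
    by (auto simp: weyl_simps)
   have "compose (polys n) A U = compose (polys n) (compose (polys n) A T) (mul_op n (pvar i))"
    using T(3) unfolding T(1) by (auto simp: compose_def fun_eq_iff mul_op_def)
   moreover have "compose (polys n) A T : weyl_ops n" using that T by (auto intro: weyl_ops.intros)
   ultimately have "compose (polys n) A U : ?G" using T(3) by (auto simp: weyl_simps)
   then show "U : {U : ?N. compose (polys n) A U : ?N}" using U by (simp add: vspan_base)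
  qed
  ultimately show ?thesis using vspan_least[of "{U : ?N. compose (polys n) A U : ?N}"] that by blast
 qed
 have Qw: "Qop n q : weyl_ops n" if "q : polys n" for q using fourier_Qop[OF that] fourier_ex by blast
 \<comment> \<open>Reduction modulo the left ideal. A variable is moved to the right past
   \<open>q(\<partial>)\<close>, which leaves \<open>-(\<partial>_i q)(\<partial>)\<close>.\<close>
 have red: "\<exists>q'\<in>polys n. \<exists>U\<in>?N. compose (polys n) A (Qop n q) = U \<oplus>\<^bsub>weyl n\<^esub> Qop n q'"
  if "fourier n A A'" "q : polys n" for A A' q
  using that
 proof (induction arbitrary: q rule: fourier.induct)
  case one
  have "compose (polys n) (\<lambda>p\<in>polys n. p) (Qop n q) = \<zero>\<^bsub>weyl n\<^esub> \<oplus>\<^bsub>weyl n\<^esub> Qop n q"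
   using one by (auto simp: compose_def weyl_simps Qop_def fun_eq_iff evp_pdiff_polys)
  then show ?case using one sub' by blast
 next
  case (var i)
  have "compose (polys n) (Qop n q) (mul_op n (pvar i)) : ?N"
   using var Qw[OF var(2)] by (intro vspan_base) (auto simp: weyl_simps)
  moreover have "compose (polys n) (mul_op n (pvar i)) (Qop n q) =
   compose (polys n) (Qop n q) (mul_op n (pvar i)) \<oplus>\<^bsub>weyl n\<^esub> Qop n (- pdiff i q)"
   using var by (auto simp: compose_def weyl_simps Qop_def fun_eq_iff evp_pdiff_polys mul_op_def evp_pdiff_commute evp_simps)
  moreover have "- pdiff i q : polys n" using var by auto
  ultimately show ?case by blast
 next
  case (diff i)
  have "compose (polys n) (diff_op n i) (Qop n q) = \<zero>\<^bsub>weyl n\<^esub> \<oplus>\<^bsub>weyl n\<^esub> Qop n (pvar i * q)"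
   using diff by (auto simp: compose_def weyl_simps Qop_def fun_eq_iff evp_pdiff_polys diff_op_def evp_pvar_times comm_ops_pdiff)
  moreover have "pvar i * q : polys n" using diff by auto
  ultimately show ?case using sub' by blast
 next
  case (add S S' T T')
  obtain q1 U1 q2 U2 where 1: "q1 : polys n" "U1 : ?N" "compose (polys n) S (Qop n q) = U1 \<oplus>\<^bsub>weyl n\<^esub> Qop n q1"
   and 2: "q2 : polys n" "U2 : ?N" "compose (polys n) T (Qop n q) = U2 \<oplus>\<^bsub>weyl n\<^esub> Qop n q2"
   using add.IH[OF add.prems] by blast
  have "compose (polys n) (\<lambda>p\<in>polys n. S p + T p) (Qop n q) = compose (polys n) S (Qop n q) \<oplus>\<^bsub>weyl n\<^esub> compose (polys n) T (Qop n q)"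
   using add.prems by (auto simp: compose_def weyl_simps Qop_def fun_eq_iff evp_pdiff_polys)
  also have "... = (U1 \<oplus>\<^bsub>weyl n\<^esub> U2) \<oplus>\<^bsub>weyl n\<^esub> Qop n (q1 + q2)"
   unfolding 1 2 by (auto simp: weyl_simps Qop_def fun_eq_iff evp_simps)
  finally show ?case using 1 2 sub' by (intro bexI[of _ "q1 + q2"] bexI[of _ "U1 \<oplus>\<^bsub>weyl n\<^esub> U2"]) (auto simp del: restrict_apply)
 next
  case (scale T T' c)
  obtain q1 U1 where 1: "q1 : polys n" "U1 : ?N" "compose (polys n) T (Qop n q) = U1 \<oplus>\<^bsub>weyl n\<^esub> Qop n q1"
   using scale.IH[OF scale.prems] by blast
  have "compose (polys n) (\<lambda>p\<in>polys n. pscale c (T p)) (Qop n q) = c \<odot>\<^bsub>weyl n\<^esub> compose (polys n) T (Qop n q)"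
   using scale.prems by (auto simp: compose_def weyl_simps Qop_def fun_eq_iff evp_pdiff_polys)
  also have "... = (c \<odot>\<^bsub>weyl n\<^esub> U1) \<oplus>\<^bsub>weyl n\<^esub> Qop n (pscale c q1)"
   unfolding 1 by (auto simp: weyl_simps Qop_def fun_eq_iff evp_simps pscale_simps)
  finally show ?case using 1 sub' by (intro bexI[of _ "pscale c q1"] bexI[of _ "c \<odot>\<^bsub>weyl n\<^esub> U1"]) (auto simp del: restrict_apply)
 next
  case (comp S S' T T')
  obtain q1 U1 where 1: "q1 : polys n" "U1 : ?N" "compose (polys n) T (Qop n q) = U1 \<oplus>\<^bsub>weyl n\<^esub> Qop n q1"
   using comp.IH(2)[OF comp.prems] by blast
  obtain q2 U2 where 2: "q2 : polys n" "U2 : ?N" "compose (polys n) S (Qop n q1) = U2 \<oplus>\<^bsub>weyl n\<^esub> Qop n q2"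
   using comp.IH(1)[OF 1(1)] by blast
  have S: "S : weyl_ops n" using comp fourier_ex by blast
  have SU: "compose (polys n) S U1 : ?N" by (rule left[OF S 1(2)])
  have "compose (polys n) (compose (polys n) S T) (Qop n q) = compose (polys n) S (compose (polys n) T (Qop n q))"
   using comp.prems by (auto simp: compose_def Qop_def fun_eq_iff evp_pdiff_polys)
  also have "... = compose (polys n) S U1 \<oplus>\<^bsub>weyl n\<^esub> compose (polys n) S (Qop n q1)"
  proof -
   have "fourier n S (hat n S)" by (rule fourier_hat[OF S])
   then have "\<forall>p\<in>polys n. \<forall>q\<in>polys n. S (p + q) = S p + S q"
    by (induction rule: fourier.induct)
     (auto simp: mul_op_def diff_op_def compose_def pdiff_simps pscale_simps fourier_polys algebra_simps)
   moreover have "U1 p : polys n" if "p : polys n" for p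
    using that 1(2) N1 fourier_polys[OF fourier_hat] by blast
   ultimately show ?thesis unfolding 1(3) using 1(1)
    by (auto simp: compose_def weyl_simps Qop_def fun_eq_iff evp_pdiff_polys)
  qed
  also have "... = (compose (polys n) S U1 \<oplus>\<^bsub>weyl n\<^esub> U2) \<oplus>\<^bsub>weyl n\<^esub> Qop n q2"
   unfolding 2(3) by (auto simp: weyl_simps fun_eq_iff add.assoc)
  finally show ?case using 2(1,2) SU sub'
   by (intro bexI[of _ q2] bexI[of _ "compose (polys n) S U1 \<oplus>\<^bsub>weyl n\<^esub> U2"]) auto
 qed
 have "T : ?N" if T0: "T : weyl_ops n" "?phi T = 0" for T
 proof -
  obtain q U where qU: "q : polys n" "U : ?N" "compose (polys n) T (Qop n 1) = U \<oplus>\<^bsub>weyl n\<^esub> Qop n q"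
   using red[OF fourier_hat[OF T0(1)] polys_1] by blast
  have "compose (polys n) T (Qop n 1) = T"
   using fourier_ext[OF fourier_hat[OF that(1)]] by (auto simp: compose_def fun_eq_iff extensional_def Qop_def)
  with qU have T: "T = U \<oplus>\<^bsub>weyl n\<^esub> Qop n q" by simp
  have "?phi T = ?phi U + ?phi (Qop n q)"
   unfolding T using qU(1,2) N1 Qw by (simp add: weyl_simps hat_add subset_iff)
  also have "... = q" using qU(1,2) N1 hat_eq[OF fourier_Qop[OF qU(1)]] by auto
  finally have "q = 0" using that by simp
  then have "T = U \<oplus>\<^bsub>weyl n\<^esub> \<zero>\<^bsub>weyl n\<^esub>" using T by (simp add: Qop_def weyl_simps)
  moreover have "U \<oplus>\<^bsub>weyl n\<^esub> \<zero>\<^bsub>weyl n\<^esub> : ?N" using qU(2) sub' by blast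
  ultimately show ?thesis by simp
 qed
 then have N: "?N = {T : carrier ?K. ?phi T = 0}" using N1 K(1) by auto
 have im: "?phi ` carrier ?K = polys n"
 proof
  show "?phi ` carrier ?K <= polys n" unfolding K using fourier_polys[OF fourier_hat] by auto
  show "polys n <= ?phi ` carrier ?K"
  proof
   fix q assume q: "q : polys n"
   show "q : ?phi ` carrier ?K" unfolding K
    by (rule image_eqI[of _ _ "Qop n q"]) (use q Qw hat_eq[OF fourier_Qop[OF q]] in auto)
  qed
 qed
 show ?thesis unfolding P0_def psi_def using quot_liso(1)[OF l N] im by simp
qed

section \<open>Tensor modules generated by singular vectors\<close>

lemma lookup_pvar_times_0: "lookup (pvar i * g) 0 = 0"
proof -
 have "keys (pvar i * g) <= {a + b | a b. a : keys (pvar i) & b : keys g}" by (rule Poly_Mapping.keys_mult)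
 moreover have "0 ~= ex i + b" for b
 proof
  assume "0 = ex i + b"
  then have "lookup 0 i = lookup (ex i + b) i" by simp
  then show False by (simp add: lookup_add)
 qed
 ultimately show ?thesis by (auto simp: pvar_def in_keys_iff subset_iff)
qed

text \<open>Every variable turns into a derivative and kills 1, so only the constant term of
  \<open>g\<close> survives.\<close>

lemma fT_one: "g : polys n ==> fT n g 1 = pscale (lookup g 0) 1"
 by (induction rule: polys_induct)
  (auto simp: fT_pvar_times pdiff_simps lookup_pvar_times_0 fT_add fT_scale lookup_add pscale_simps)

lemma lookup_pdiff_0: "lookup (pdiff i f) 0 = lookup f (ex i)"
proof -
 have "lookup (pdiff i (gen al)) 0 = lookup (gen al) (ex i)" for al
 proof (cases "lookup al i = 0")
  case True
  then have "al ~= ex i" by (metis lookup_single_eq zero_neq_one)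
  then show ?thesis by (simp add: pdiff_gen True lookup_single)
 next
  case False
  have "al - ex i = 0 \<longleftrightarrow> al = ex i" using ex_minus_add[OF False] by (metis add_0 diff_self_eq_0 cancel_comm_monoid_add_class.diff_cancel)
  then show ?thesis using False by (auto simp: pdiff_gen lookup_single when_def)
 qed
 then show ?thesis
  by (intro pm_sup_induct[of f UNIV "%f. lookup (pdiff i f) 0 = lookup f (ex i)"]) (auto simp: pdiff_simps lookup_add)
qed

text \<open>\<open>R f j\<close> is the action of \<open>f \<partial>_j\<close>. The axioms record
  linearity and the commutators with the constant fields, which is what the passage from generators
  to their translates uses. The abstract representation and the explicit model \<open>FR\<close> are
  both instances.\<close>

locale vrep =
 fixes n :: nat and R :: "cpoly => nat => 'x cv => 'x cv"
 assumes R_plin: "!!f j. f : polys n ==> j < n ==> plin (R f j)"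
  and R_add: "!!f g j u. f : polys n ==> g : polys n ==> j < n ==> R (f + g) j u = R f j u + R g j u"
  and R_scale: "!!f c j u. f : polys n ==> j < n ==> R (pscale c f) j u = pscale c (R f j u)"
  and R_comm: "!!f j s u. f : polys n ==> j < n ==> s < n ==> R f j (R 1 s u) = R 1 s (R f j u) - R (pdiff s f) j u"
begin

lemma R_0: "j < n ==> R 0 j u = 0"
 using R_scale[of 0 j 0 u] by simp

lemma R_minus: "f : polys n ==> j < n ==> R (- f) j u = - R f j u"
 using R_scale[of f j "-1" u] by simp

lemma R_diff: "f : polys n ==> g : polys n ==> j < n ==> R (f - g) j u = R f j u - R g j u"
 using R_add[of f "- g" j u] by (simp add: R_minus)

lemmas R_simps = plin_simps[OF R_plin]

lemma comm_R: "comm_ops n (R 1)"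
 unfolding comm_ops_def using R_plin R_comm[of 1] by (auto simp: R_0)

abbreviation "Dp \<equiv> opow n (R 1)"
abbreviation "Psi \<equiv> evp n (R 1)"

lemma Dp_add: "i < n ==> Dp (al + ex i) u = R 1 i (Dp al u)"
 by (rule opow_add[OF comm_R])

lemma Psi_pvar: "i < n ==> Psi (pvar i * p) u = R 1 i (Psi p u)"
 by (rule evp_pvar_times[OF comm_R])

lemma plin_Dp: "al : exponents n ==> plin (Dp al)"
 by (rule plin_opow[OF comm_R])

lemma plin_Psi: "p : polys n ==> plin (Psi p)"
 by (rule plin_evp2[OF comm_R])

text \<open>\<open>M\<close> carries a representation of the general linear Lie algebra with \<open>t\<^sub>i\<partial>\<^sub>j\<close> acting as
 \<open>E\<^sub>i\<^sub>j - \<delta>\<^sub>i\<^sub>j\<close>; this shift matches the action of \<open>t\<^sub>i\<partial>\<^sub>j\<close> on the generator of \<^const>\<open>P0\<close>.\<close>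

definition singular :: "(nat => nat => 'x cv => 'x cv) => 'x cv set => bool" where
 "singular e M \<longleftrightarrow> pm.subspace M & (\<forall>i<n. \<forall>j<n. \<forall>m\<in>M. e i j m : M) &
   (\<forall>f\<in>polys n. \<forall>j<n. \<forall>m\<in>M. R f j m = pscale (lookup f 0) (R 1 j m) +
    (\<Sum>i<n. pscale (lookup f (ex i)) (e i j m - (if i = j then m else 0))))"

text \<open>Multiplying \<open>p\<close> by a variable applies a constant field, and
  \<open>R_comm\<close> on one side corresponds to \<open>fT_commute\<close> on the other. So the
  formula on the generators extends to all translates, where it is the action on a tensor
  module.\<close>

lemma Psi_R:
 assumes M: "singular e M" "m : M" and p: "p : polys n" and f: "f : polys n" "j < n"
 shows "R f j (Psi p m) = Psi (fT n f (pvar j * p)) m + (\<Sum>i<n. Psi (fT n (pdiff i f) p) (e i j m))"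
 using p f(1)
proof (induction arbitrary: f rule: polys_induct)
 case (one f)
 have "R f j m = pscale (lookup f 0) (R 1 j m) + (\<Sum>i<n. pscale (lookup f (ex i)) (e i j m - (if i = j then m else 0)))"
  using M one f unfolding singular_def by blast
 \<comment> \<open>The origin of the shift by \<open>\<delta>_ij\<close> in \<open>singular\<close>:
   moving \<open>t_j\<close> past \<open>f(-\<partial>)\<close> leaves an extra derivative of
   \<open>f\<close>.\<close>
 moreover have "Psi (fT n f (pvar j * 1)) m = pscale (lookup f 0) (R 1 j m) - pscale (lookup f (ex j)) m"
  using one f fT_commute[OF one f(2), of 1] Psi_pvar[OF f(2), of 1 m]
  by (simp add: fT_one evp_simps lookup_pdiff_0 pscale_mult)
 moreover have "(\<Sum>i<n. pscale (lookup f (ex i)) (if i = j then m else 0)) = pscale (lookup f (ex j)) m"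
  using f(2) by (simp add: if_distrib[of "pscale _"] cong: if_cong)
 moreover have "Psi (fT n (pdiff i f) 1) (e i j m) = pscale (lookup f (ex i)) (e i j m)" for i
  using one by (simp add: fT_one evp_simps lookup_pdiff_0)
 ultimately show ?case
  by (simp add: pm.scale_right_diff_distrib sum_subtractf)
next
 case (times s p)
 have IH: "R g j (Psi p m) = Psi (fT n g (pvar j * p)) m + (\<Sum>i<n. Psi (fT n (pdiff i g) p) (e i j m))" if "g : polys n" for g
  using times.IH[OF that] .
 have a: "Psi (fT n g (pvar s * q)) w = R 1 s (Psi (fT n g q) w) - Psi (fT n (pdiff s g) q) w" if "g : polys n" for g q w
  using that times by (simp add: fT_commute evp_simps Psi_pvar)
 have "R f j (Psi (pvar s * p) m) = R 1 s (R f j (Psi p m)) - R (pdiff s f) j (Psi p m)"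
  using times f by (simp add: Psi_pvar R_comm)
 also have "... = R 1 s (Psi (fT n f (pvar j * p)) m) + (\<Sum>i<n. R 1 s (Psi (fT n (pdiff i f) p) (e i j m)))
   - (Psi (fT n (pdiff s f) (pvar j * p)) m + (\<Sum>i<n. Psi (fT n (pdiff i (pdiff s f)) p) (e i j m)))"
  using times by (simp add: IH R_simps)
 also have "... = Psi (fT n f (pvar s * (pvar j * p))) m + (\<Sum>i<n. Psi (fT n (pdiff i f) (pvar s * p)) (e i j m))"
  using times by (simp add: a sum_subtractf pdiff_commute[of _ s])
 also have "pvar s * (pvar j * p) = pvar j * (pvar s * p)" by (rule mult.left_commute)
 finally show ?case .
next
 case (add p q)
 then show ?case using R_plin[OF add.prems f(2)]
  by (simp add: evp_simps plin_simps distrib_left plin_add[OF plin_fT] sum.distrib algebra_simps)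
next
 case (scale c p)
 then show ?case using R_plin[OF scale.prems f(2)]
  by (simp add: evp_simps plin_simps plin_scale[OF plin_fT] pscale_mult pm.scale_sum_right pscale_simps)
qed

text \<open>\<open>M\<close> generates its translates freely: the map from polynomials tensor
  \<open>M\<close> to the ambient space is injective.\<close>

definition indep :: "'x cv set => bool" where
 "indep M \<longleftrightarrow> (\<forall>A x. finite A --> A <= exponents n --> (\<forall>al\<in>A. x al : M) -->
   (\<Sum>al\<in>A. Dp al (x al)) = 0 --> (\<forall>al\<in>A. x al = 0))"

lemma indepD: "indep M ==> finite A ==> A <= exponents n ==> (!!al. al : A ==> x al : M) ==>
  (\<Sum>al\<in>A. Dp al (x al)) = 0 ==> al : A ==> x al = 0"
 unfolding indep_def by blast

definition dact :: "cop => 'x cv => 'x cv" where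
 "dact D u = (\<Sum>j<n. R (D (pvar j)) j u)"

lemma plin_dact: "D : cDer n ==> plin (dact D)"
 unfolding dact_def using Der_polys by (intro plin_sumI R_plin) auto

text \<open>The element \<open>g \<otimes> m\<close> goes to the polynomial of \<open>g\<close>
  evaluated at the constant fields and applied to the image of \<open>m\<close>.\<close>

definition tmap :: "('m => 'x cv) => cop set \<times> 'm => 'x cv" where
 "tmap \<mu> = (%(g, m). Psi (psi n g) (\<mu> m))"

text \<open>Singularity makes \<open>tmap\<close> compatible with the action, independence makes it
  injective. For the kernel, every element is brought modulo the tensor relations to a sum of
  tensors \<open>\<partial>^\<alpha> \<otimes> x_\<alpha>\<close>; only the first factor is expanded
  in a basis.\<close>

lemma F_liso:
 fixes M :: "(complex mat, 'm) lmod"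
 assumes sing: "singular e (\<mu> ` carrier M)"
  and M: "liso SM M ea \<mu> (\<mu> ` carrier M)"
  and e: "!!i j m. i < n ==> j < n ==> m : carrier M ==> mat_unit n i j : SM & ea (mat_unit n i j) (\<mu> m) = e i j (\<mu> m)"
  and ind: "indep (\<mu> ` carrier M)"
 defines "Phi \<equiv> cmap (lext (tmap \<mu>))"
 shows "liso (cDer n) (F n (P0 n) M) dact Phi
   (pm.span {Psi p m | p m. p : polys n & m : \<mu> ` carrier M})"
  and "g : carrier (P0 n) ==> m : carrier M ==> F_tensor n (P0 n) M g m : carrier (F n (P0 n) M)"
  and "g : carrier (P0 n) ==> m : carrier M ==> Phi (F_tensor n (P0 n) M g m) = Psi (psi n g) (\<mu> m)"
proof -
 let ?B = "carrier (P0 n) \<times> carrier M" and ?R = "tensor_rels (P0 n) M" and ?h = "tmap \<mu>"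
 note P = P0_liso[of n]
 note lP = liso_lmap[OF P] and lM = liso_lmap[OF M]
 interpret P: module CC "P0 n" by (rule lmap_module[OF lP])
 interpret M: module CC M by (rule lmap_module[OF lM])
 have sub: "pm.subspace (\<mu> ` carrier M)" using sing by (simp add: singular_def)
 have pin: "psi n g : polys n" if "g : carrier (P0 n)" for g using liso_in[OF P that] .
 have h: "?h (g, m) = Psi (psi n g) (\<mu> m)" for g m by (simp add: tmap_def)
 have RB: "?R <= {p. keys p <= ?B}"
 proof -
  show ?thesis unfolding tensor_rels_def
   by (auto simp: in_keys_iff lookup_minus lookup_single when_def split: if_splits)
 qed
 have Rz: "lext ?h r = 0" if "r : ?R" for r
  using that unfolding tensor_rels_def
  by (auto simp: plin_simps[OF plin_lext] h lmap_add[OF lP] lmap_add[OF lM] lmap_smult[OF lP] lmap_smult[OF lM]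
    evp_simps plin_simps[OF plin_Psi] pin lext_single)
 let ?S = "pm.span ?R"
 have R1: "gen (a \<oplus>\<^bsub>P0 n\<^esub> a', b) - gen (a, b) - gen (a', b) : ?S"
  if "a : carrier (P0 n)" "a' : carrier (P0 n)" "b : carrier M" for a a' b
  by (rule pm.span_base) (use that in \<open>auto simp: tensor_rels_def\<close>)
 have R2: "gen (a, b \<oplus>\<^bsub>M\<^esub> b') - gen (a, b) - gen (a, b') : ?S"
  if "a : carrier (P0 n)" "b : carrier M" "b' : carrier M" for a b b'
  by (rule pm.span_base) (use that in \<open>auto simp: tensor_rels_def\<close>)
 have R3: "gen (c \<odot>\<^bsub>P0 n\<^esub> a, b) - pscale c (gen (a, b)) : ?S"
  if "a : carrier (P0 n)" "b : carrier M" for a b c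
  by (rule pm.span_base) (use that in \<open>auto simp: tensor_rels_def\<close>)
 have R4: "gen (a, c \<odot>\<^bsub>M\<^esub> b) - pscale c (gen (a, b)) : ?S"
  if "a : carrier (P0 n)" "b : carrier M" for a b c
  by (rule pm.span_base) (use that in \<open>auto simp: tensor_rels_def\<close>)
 have Z1: "gen (\<zero>\<^bsub>P0 n\<^esub>, b) : ?S" if "b : carrier M" for b
  using R3[of "\<zero>\<^bsub>P0 n\<^esub>" b 0] that P.smult_l_null[of "\<zero>\<^bsub>P0 n\<^esub>"] by simp
 have Z2: "gen (a, \<zero>\<^bsub>M\<^esub>) : ?S" if "a : carrier (P0 n)" for a
  using R4[of a "\<zero>\<^bsub>M\<^esub>" 0] that M.smult_l_null[of "\<zero>\<^bsub>M\<^esub>"] by simp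
 define pinv where "pinv = the_inv_into (carrier (P0 n)) (psi n)"
 have pinv: "pinv p : carrier (P0 n)" "psi n (pinv p) = p" if "p : polys n" for p
  using liso_bij[OF P] that unfolding pinv_def bij_betw_def
  by (auto intro!: the_inv_into_into f_the_inv_into_f)
 \<comment> \<open>Expands a pure tensor along the monomials of \<open>psi n g\<close>. The element
   \<open>g\<close> is generalized because splitting off a monomial changes it.\<close>
 have gm: "\<exists>x. (\<forall>al\<in>K. x al : carrier M) & gen (g, m) - (\<Sum>al\<in>K. gen (pinv (gen al), x al)) : ?S"
  if "finite K" "K <= exponents n" "g : carrier (P0 n)" "m : carrier M" "psi n g = (\<Sum>al\<in>K. pscale (c al) (gen al))" for K g m c
  using that
 proof (induction K arbitrary: g rule: finite_induct)
  case empty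
  then have "g = \<zero>\<^bsub>P0 n\<^esub>" using liso_inj[OF P, of g "\<zero>\<^bsub>P0 n\<^esub>"] lmap_zero[OF lP] by simp
  then show ?case using Z1 empty by simp
 next
  case (insert be K)
  let ?q = "\<Sum>al\<in>K. pscale (c al) (gen al)" and ?b = "pinv (gen be)"
  have q: "?q : polys n" using insert.prems(1) by (intro polys_closed(6) polys_closed(3)) auto
  have b: "?b : carrier (P0 n)" "psi n ?b = gen be" using pinv[of "gen be"] insert by auto
  obtain x where x: "\<forall>al\<in>K. x al : carrier M" "gen (pinv ?q, m) - (\<Sum>al\<in>K. gen (pinv (gen al), x al)) : ?S"
   using insert.IH[OF _ pinv(1)[OF q] insert.prems(3) pinv(2)[OF q]] insert.prems(1) by blast
  have g: "g = (c be \<odot>\<^bsub>P0 n\<^esub> ?b) \<oplus>\<^bsub>P0 n\<^esub> pinv ?q"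
   using pinv[OF q] b insert
   by (intro liso_inj[OF P, THEN iffD1]) (auto simp: lmap_add[OF lP] lmap_smult[OF lP] simp del: pscale_single)
  define x' where "x' = x(be := c be \<odot>\<^bsub>M\<^esub> m)"
  have s: "(\<Sum>al\<in>K. gen (pinv (gen al), x' al)) = (\<Sum>al\<in>K. gen (pinv (gen al), x al))"
   by (rule sum.cong) (use insert in \<open>auto simp: x'_def\<close>)
  have u1: "gen (g, m) - gen (c be \<odot>\<^bsub>P0 n\<^esub> ?b, m) - gen (pinv ?q, m) : ?S"
   unfolding g using b pinv[OF q] insert by (intro R1) auto
  have u2: "gen (c be \<odot>\<^bsub>P0 n\<^esub> ?b, m) - pscale (c be) (gen (?b, m)) : ?S" using b insert by (intro R3)
  have u3: "gen (?b, x' be) - pscale (c be) (gen (?b, m)) : ?S" unfolding x'_def using b insert by (simp del: pscale_single add: R4)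
  have "(gen (g, m) - gen (c be \<odot>\<^bsub>P0 n\<^esub> ?b, m) - gen (pinv ?q, m)) + (gen (c be \<odot>\<^bsub>P0 n\<^esub> ?b, m) - pscale (c be) (gen (?b, m)))
    - (gen (?b, x' be) - pscale (c be) (gen (?b, m))) + (gen (pinv ?q, m) - (\<Sum>al\<in>K. gen (pinv (gen al), x al))) : ?S" (is "?E : _")
   by (rule pm.span_add[OF pm.span_diff[OF pm.span_add[OF u1 u2] u3] x(2)])
  moreover have "?E = gen (g, m) - (\<Sum>al\<in>insert be K. gen (pinv (gen al), x' al))"
   using insert(1,2) s by (simp del: pscale_single)
  ultimately have "gen (g, m) - (\<Sum>al\<in>insert be K. gen (pinv (gen al), x' al)) : ?S" by (simp only:)
  moreover have "\<forall>al\<in>insert be K. x' al : carrier M" using x(1) insert by (auto simp: x'_def)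
  ultimately show ?case by blast
 qed
 define Q where "Q = (%p. \<exists>A x. finite A & A <= exponents n & (\<forall>al\<in>A. x al : carrier M) &
   p - (\<Sum>al\<in>A. gen (pinv (gen al), x al)) : ?S)"
 have Qall: "Q p" if "keys p <= ?B" for p
  using that
 proof (induction rule: pm_sup_induct)
  case zero
  then show ?case unfolding Q_def by (intro exI[of _ "{}"]) (simp add: pm.span_zero)
 next
  case (gen y)
  then obtain g m where y: "y = (g, m)" "g : carrier (P0 n)" "m : carrier M" by auto
  have e: "psi n g = (\<Sum>al\<in>keys (psi n g). pscale (lookup (psi n g) al) (gen al))" by (rule pm_expand)
  have K: "keys (psi n g) <= exponents n" using pin[OF y(2)] by (simp add: polys_def)
  obtain x where "\<forall>al\<in>keys (psi n g). x al : carrier M"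
   "gen (g, m) - (\<Sum>al\<in>keys (psi n g). gen (pinv (gen al), x al)) : ?S"
   using gm[OF finite_keys K y(2,3) e] by blast
  then show ?case unfolding Q_def y using K by (intro exI[of _ "keys (psi n g)"] exI[of _ x]) auto
 next
  case (scale c p)
  then obtain A x where A: "finite A" "A <= exponents n" "\<forall>al\<in>A. x al : carrier M" "p - (\<Sum>al\<in>A. gen (pinv (gen al), x al)) : ?S"
   unfolding Q_def by blast
  have "(\<Sum>al\<in>A. gen (pinv (gen al), c \<odot>\<^bsub>M\<^esub> x al) - pscale c (gen (pinv (gen al), x al))) : ?S"
   using A pinv by (intro pm.span_sum R4) auto
  from pm.span_diff[OF pm.span_scale[OF A(4), of c] this]
  have "pscale c p - (\<Sum>al\<in>A. gen (pinv (gen al), c \<odot>\<^bsub>M\<^esub> x al)) : ?S"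
   by (simp add: pm.scale_right_diff_distrib pm.scale_sum_right sum_subtractf del: pscale_single)
  then show ?case unfolding Q_def using A by (intro exI[of _ A] exI[of _ "%al. c \<odot>\<^bsub>M\<^esub> x al"]) auto
 next
  case (add p q)
  then obtain A x A' x' where A: "finite A" "A <= exponents n" "\<forall>al\<in>A. x al : carrier M" "p - (\<Sum>al\<in>A. gen (pinv (gen al), x al)) : ?S"
   and A': "finite A'" "A' <= exponents n" "\<forall>al\<in>A'. x' al : carrier M" "q - (\<Sum>al\<in>A'. gen (pinv (gen al), x' al)) : ?S"
   unfolding Q_def by blast
  \<comment> \<open>The two expansions live on different sets of exponents. Padding with zero
    vectors costs tensors with second factor zero, which lie in the span by
    \<open>Z2\<close>.\<close>
  define y where "y = (%al. if al : A then x al else \<zero>\<^bsub>M\<^esub>)"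
  define y' where "y' = (%al. if al : A' then x' al else \<zero>\<^bsub>M\<^esub>)"
  let ?g = "%al m. gen (pinv (gen al), m) :: (cop set \<times> 'm) cv"
  have yc: "y al : carrier M" "y' al : carrier M" for al using A A' by (auto simp: y_def y'_def)
  have s1: "(\<Sum>al\<in>A \<union> A'. ?g al (y al)) = (\<Sum>al\<in>A. ?g al (x al)) + (\<Sum>al\<in>A' - A. ?g al \<zero>\<^bsub>M\<^esub>)"
  proof -
   have "A \<union> A' = A \<union> (A' - A)" by auto
   moreover have "(\<Sum>al\<in>A \<union> (A' - A). ?g al (y al)) = (\<Sum>al\<in>A. ?g al (y al)) + (\<Sum>al\<in>A' - A. ?g al (y al))"
    by (rule sum.union_disjoint) (use A(1) A'(1) in auto)
   ultimately have "(\<Sum>al\<in>A \<union> A'. ?g al (y al)) = (\<Sum>al\<in>A. ?g al (y al)) + (\<Sum>al\<in>A' - A. ?g al (y al))"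
    by (simp only:)
   then show ?thesis by (simp add: y_def)
  qed
  have s2: "(\<Sum>al\<in>A \<union> A'. ?g al (y' al)) = (\<Sum>al\<in>A'. ?g al (x' al)) + (\<Sum>al\<in>A - A'. ?g al \<zero>\<^bsub>M\<^esub>)"
  proof -
   have "A \<union> A' = A' \<union> (A - A')" by auto
   moreover have "(\<Sum>al\<in>A' \<union> (A - A'). ?g al (y' al)) = (\<Sum>al\<in>A'. ?g al (y' al)) + (\<Sum>al\<in>A - A'. ?g al (y' al))"
    by (rule sum.union_disjoint) (use A(1) A'(1) in auto)
   ultimately have "(\<Sum>al\<in>A \<union> A'. ?g al (y' al)) = (\<Sum>al\<in>A'. ?g al (y' al)) + (\<Sum>al\<in>A - A'. ?g al (y' al))"
    by (simp only:)
   then show ?thesis by (simp add: y'_def)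
  qed
  have z: "(\<Sum>al\<in>A' - A. ?g al \<zero>\<^bsub>M\<^esub>) : ?S" "(\<Sum>al\<in>A - A'. ?g al \<zero>\<^bsub>M\<^esub>) : ?S"
   using A A' pinv by (auto intro!: pm.span_sum Z2)
  have "(\<Sum>al\<in>A \<union> A'. ?g al (y al \<oplus>\<^bsub>M\<^esub> y' al) - ?g al (y al) - ?g al (y' al)) : ?S"
   using A A' pinv yc by (intro pm.span_sum R2) auto
  then have "(\<Sum>al\<in>A \<union> A'. ?g al (y al \<oplus>\<^bsub>M\<^esub> y' al)) - (\<Sum>al\<in>A. ?g al (x al)) - (\<Sum>al\<in>A' - A. ?g al \<zero>\<^bsub>M\<^esub>) -
   (\<Sum>al\<in>A'. ?g al (x' al)) - (\<Sum>al\<in>A - A'. ?g al \<zero>\<^bsub>M\<^esub>) : ?S"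
   by (simp only: sum_subtractf sum.distrib s1 s2 diff_diff_eq add.assoc)
  from pm.span_diff[OF pm.span_diff[OF pm.span_diff[OF pm.span_add[OF A(4) A'(4)] this] z(1)] z(2)]
  have "(p + q) - (\<Sum>al\<in>A \<union> A'. ?g al (y al \<oplus>\<^bsub>M\<^esub> y' al)) : ?S" by (simp add: algebra_simps)
  then show ?case unfolding Q_def using A A' yc
   by (intro exI[of _ "A \<union> A'"] exI[of _ "%al. y al \<oplus>\<^bsub>M\<^esub> y' al"]) auto
 qed
 have S0: "lext ?h p = 0" if "p : ?S" for p
 proof -
  have "?S <= {p. lext ?h p = 0}" by (rule pm.span_minimal[OF _ subspace_plin_ker[OF plin_lext]]) (use Rz in auto)
  then show ?thesis using that by auto
 qed
 have ker: "p : ?S" if p: "keys p <= ?B" "lext ?h p = 0" for p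
 proof -
  obtain A x where A: "finite A" "A <= exponents n" "\<forall>al\<in>A. x al : carrier M" "p - (\<Sum>al\<in>A. gen (pinv (gen al), x al)) : ?S"
   using Qall[OF p(1)] unfolding Q_def by blast
  have "(\<Sum>al\<in>A. Dp al (\<mu> (x al))) = (\<Sum>al\<in>A. ?h (pinv (gen al), x al))"
  proof (rule sum.cong)
   fix al assume "al : A"
   then have "psi n (pinv (gen al)) = gen al" using A(2) by (intro pinv) auto
   then show "Dp al (\<mu> (x al)) = ?h (pinv (gen al), x al)" by (simp add: h evp_gen)
  qed simp
  also have "... = 0"
   using S0[OF A(4)] p(2) by (simp add: plin_simps[OF plin_lext])
  finally have "\<forall>al\<in>A. \<mu> (x al) = 0" using indepD[OF ind A(1,2), of "%al. \<mu> (x al)"] A(3) by blast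
  then have "x al = \<zero>\<^bsub>M\<^esub>" if "al : A" for al
   using that liso_inj[OF M, of "x al" "\<zero>\<^bsub>M\<^esub>"] A(3) lmap_zero[OF lM] by auto
  then have "(\<Sum>al\<in>A. gen (pinv (gen al), x al)) : ?S"
   using A(2) pinv by (intro pm.span_sum) (auto intro!: Z2)
  from pm.span_add[OF A(4) this] show ?thesis by simp
 qed
 have fact: "keys (F_act n (P0 n) M D x) <= ?B & lext ?h (F_act n (P0 n) M D x) = dact D (?h x)"
  if D: "D : cDer n" and x: "x : ?B" for D x
 proof -
  obtain g m where gm: "x = (g, m)" "g : carrier (P0 n)" "m : carrier M" using x by auto
  have Dp: "D (pvar j) : polys n" if "j < n" for j using Der_polys[OF D] that by simp
  have Pa: "act (P0 n) T g : carrier (P0 n)" "psi n (act (P0 n) T g) = hat n T (psi n g)" if "T : weyl_ops n" for T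
   using lmap_closed[OF lP that gm(2)] lmap_act[OF lP that gm(2)] by auto
  have Ma: "act M (mat_unit n i j) m : carrier M" "\<mu> (act M (mat_unit n i j) m) = e i j (\<mu> m)" if "i < n" "j < n" for i j
   using e[OF that gm(3)] lmap_closed[OF lM _ gm(3)] lmap_act[OF lM _ gm(3)] by auto
  have mu: "mul_op n (pdiff i (D (pvar j))) : weyl_ops n" if "j < n" for i j
   using Dp[OF that] by (intro mul_op_weyl) auto
  have F: "F_act n (P0 n) M D x = gen (act (P0 n) D g, m) +
   (\<Sum>j<n. \<Sum>i<n. gen (act (P0 n) (mul_op n (pdiff i (D (pvar j)))) g, act M (mat_unit n i j) m))"
   by (simp add: F_act_def gm)
  have "F_act n (P0 n) M D x : {p. keys p <= ?B}"
   unfolding F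
   by (intro pm.subspace_add[OF subspace_keys] pm.subspace_sum[OF subspace_keys])
    (use Pa[OF Der_weyl[OF D]] Pa[OF mu] Ma gm in auto)
  moreover have "lext ?h (F_act n (P0 n) M D x) = Psi (hat n D (psi n g)) (\<mu> m) +
   (\<Sum>j<n. \<Sum>i<n. Psi (fT n (pdiff i (D (pvar j))) (psi n g)) (e i j (\<mu> m)))"
   unfolding F by (simp add: plin_simps[OF plin_lext] h Pa[OF Der_weyl[OF D]] Pa[OF mu] Ma hat_mul_op Dp)
  moreover have "... = (\<Sum>j<n. R (D (pvar j)) j (Psi (psi n g) (\<mu> m)))"
   using gm by (simp add: hat_Der[OF D] evp_simps Psi_R[OF sing] pin Dp sum.distrib)
  ultimately show ?thesis by (simp add: dact_def h gm)
 qed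
 have im: "tmap \<mu> ` ?B = {Psi p m | p m. p : polys n & m : \<mu> ` carrier M}"
 proof -
  have "Psi p (\<mu> m) : tmap \<mu> ` ?B" if "p : polys n" "m : carrier M" for p m
   using pinv[OF that(1)] that(2) by (intro image_eqI[of _ _ "(pinv p, m)"]) (auto simp: h)
  moreover have "tmap \<mu> (g, m) : {Psi p m | p m. p : polys n & m : \<mu> ` carrier M}"
   if "g : carrier (P0 n)" "m : carrier M" for g m
   unfolding h using pin[OF that(1)] that(2) by blast
  ultimately show ?thesis by auto
 qed
 note solve = presented_liso[OF RB, where h = ?h and S = "cDer n" and f = "F_act n (P0 n) M" and a = dact]
 show "liso (cDer n) (F n (P0 n) M) dact Phi
   (pm.span {Psi p m | p m. p : polys n & m : \<mu> ` carrier M})"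
  unfolding F_def Phi_def im[symmetric]
  by (rule solve(1)) (erule Rz | erule (1) ker | erule (1) fact | erule plin_dact)+
 show "F_tensor n (P0 n) M g m : carrier (F n (P0 n) M)" if "g : carrier (P0 n)" "m : carrier M"
  unfolding F_tensor_def F_def
  by (rule solve(2)) (erule Rz | erule (1) ker | erule (1) fact | erule plin_dact | rule SigmaI that)+
 have "Phi (F_tensor n (P0 n) M g m) = tmap \<mu> (g, m)" if "g : carrier (P0 n)" "m : carrier M"
  unfolding F_tensor_def Phi_def
  by (rule solve(3)) (erule Rz | erule (1) ker | erule (1) fact | erule plin_dact | rule SigmaI that)+
 then show "g : carrier (P0 n) ==> m : carrier M ==> Phi (F_tensor n (P0 n) M g m) = Psi (psi n g) (\<mu> m)"
  by (simp only: h)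
qed

end

section \<open>Coordinates on a vector space\<close>

text \<open>A basis from Zorn's lemma, for a vector space that is only a record. The map
  \<open>ev\<close> is total: coordinates outside the basis are ignored, so that every finitely
  supported function has a value in the carrier.\<close>

lemma vector_space_coordinates:
 assumes "module CC (V :: (complex, 'v, 'e) module_scheme)"
 obtains B :: "'v set" and j :: "'v => 'v cv" and ev :: "'v cv => 'v" where
  "!!p. ev p : carrier V" "!!p q. ev (p + q) = ev p \<oplus>\<^bsub>V\<^esub> ev q" "!!c p. ev (pscale c p) = c \<odot>\<^bsub>V\<^esub> ev p"
  "!!v. v : carrier V ==> keys (j v) <= B & ev (j v) = v" "!!p. keys p <= B ==> j (ev p) = p"
proof -
 interpret module CC V by fact
 define evs where "evs = (%S (p :: 'v cv). (\<Oplus>\<^bsub>V\<^esub>b\<in>keys p \<inter> S. lookup p b \<odot>\<^bsub>V\<^esub> b))"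
 have sup: "evs S p = (\<Oplus>\<^bsub>V\<^esub>b\<in>A. lookup p b \<odot>\<^bsub>V\<^esub> b)"
  if "S <= carrier V" "finite A" "keys p \<inter> S <= A" "A <= S" for S A p
  unfolding evs_def
 proof (rule M.add.finprod_mono_neutral_cong_left[OF that(2,3)])
  fix b assume "b : A - keys p \<inter> S"
  then have "lookup p b = 0" "b : carrier V" using that by (auto simp: in_keys_iff)
  then show "lookup p b \<odot>\<^bsub>V\<^esub> b = \<zero>\<^bsub>V\<^esub>" using smult_l_null[of b] by simp
 qed (use that in auto)
 have evc: "evs S p : carrier V" if "S <= carrier V" for S p
  unfolding evs_def using that by (intro M.finsum_closed) auto
 have eva: "evs S (p + q) = evs S p \<oplus>\<^bsub>V\<^esub> evs S q" if S: "S <= carrier V" for S p q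
 proof -
  let ?A = "(keys p \<union> keys q) \<inter> S"
  have "evs S (p + q) = (\<Oplus>\<^bsub>V\<^esub>b\<in>?A. lookup (p + q) b \<odot>\<^bsub>V\<^esub> b)"
   using pm_keys_add[of p q] S by (intro sup) auto
  also have "... = (\<Oplus>\<^bsub>V\<^esub>b\<in>?A. lookup p b \<odot>\<^bsub>V\<^esub> b \<oplus>\<^bsub>V\<^esub> lookup q b \<odot>\<^bsub>V\<^esub> b)"
   using S smult_l_distr by (intro M.finsum_cong') (auto simp: lookup_add subset_iff)
  also have "... = (\<Oplus>\<^bsub>V\<^esub>b\<in>?A. lookup p b \<odot>\<^bsub>V\<^esub> b) \<oplus>\<^bsub>V\<^esub> (\<Oplus>\<^bsub>V\<^esub>b\<in>?A. lookup q b \<odot>\<^bsub>V\<^esub> b)"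
   using S by (intro M.finsum_addf) auto
  also have "... = evs S p \<oplus>\<^bsub>V\<^esub> evs S q"
   by (subst (1 2) sup[of S ?A]) (use S in auto)
  finally show ?thesis .
 qed
 have evm: "evs S (pscale c p) = c \<odot>\<^bsub>V\<^esub> evs S p" if S: "S <= carrier V" for S p c
 proof -
  have fs: "c \<odot>\<^bsub>V\<^esub> (\<Oplus>\<^bsub>V\<^esub>b\<in>A. f b) = (\<Oplus>\<^bsub>V\<^esub>b\<in>A. c \<odot>\<^bsub>V\<^esub> f b)" if "finite A" "!!b. b : A ==> f b : carrier V" for A and f :: "'v => 'v"
   using that
  proof (induction A rule: finite_induct)
   case empty
   then show ?case using smult_r_null[of c] by simp
  next
   case (insert x A)
   have f: "f : A \<rightarrow> carrier V" "(%b. c \<odot>\<^bsub>V\<^esub> f b) : A \<rightarrow> carrier V" using insert by auto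
   then show ?case using insert smult_r_distr[of c] by (simp add: M.finsum_insert M.finsum_closed)
  qed
  have "evs S (pscale c p) = (\<Oplus>\<^bsub>V\<^esub>b\<in>keys p \<inter> S. lookup (pscale c p) b \<odot>\<^bsub>V\<^esub> b)"
   using keys_pscale[of c p] S by (intro sup) auto
  also have "... = (\<Oplus>\<^bsub>V\<^esub>b\<in>keys p \<inter> S. c \<odot>\<^bsub>V\<^esub> (lookup p b \<odot>\<^bsub>V\<^esub> b))"
   using S smult_assoc1 by (intro M.finsum_cong') (auto simp: subset_iff)
  also have "... = c \<odot>\<^bsub>V\<^esub> evs S p" unfolding evs_def using S by (subst fs) auto
  finally show ?thesis .
 qed
 let ?C = "carrier V"
 note eC = eva[OF subset_refl] evm[OF subset_refl]
 have eg: "evs ?C (gen v) = v" if "v : ?C" for v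
  unfolding evs_def using that smult_one[of v] by (simp add: M.finsum_insert del: smult_one)
 \<comment> \<open>The linearly independent subsets; finiteness of supports makes them closed under
   unions of chains.\<close>
 define I where "I = {S. S <= ?C & (\<forall>p. keys p <= S --> evs ?C p = \<zero>\<^bsub>V\<^esub> --> p = 0)}"
 have "\<Union>K : I" if K: "subset.chain I K" for K
 proof -
  have "p = 0" if p: "keys p <= \<Union>K" "evs ?C p = \<zero>\<^bsub>V\<^esub>" for p
  proof (cases "K = {}")
   case True
   then show ?thesis using p by (auto simp: poly_mapping_eq_iff fun_eq_iff in_keys_iff)
  next
   case False
   then obtain S where "S : K" "keys p <= S"
    using finite_subset_Union_chain[OF finite_keys p(1) _ K] by blast
   then show ?thesis using K p(2) unfolding subset.chain_def I_def by auto
  qed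
  moreover have "\<Union>K <= ?C" using K unfolding subset.chain_def I_def by auto
  ultimately show ?thesis by (simp add: I_def)
 qed
 then obtain B where B: "B : I" and max: "!!Y. Y : I ==> B <= Y ==> Y = B"
  using subset_Zorn'[of I] by metis
 have BC: "B <= ?C" and ind: "!!p. keys p <= B ==> evs ?C p = \<zero>\<^bsub>V\<^esub> ==> p = 0" using B by (auto simp: I_def)
 have neg: "evs ?C (p - q) = evs ?C p \<ominus>\<^bsub>V\<^esub> evs ?C q" for p q
 proof -
  have "evs ?C (p - q) \<oplus>\<^bsub>V\<^esub> evs ?C q = evs ?C p" by (simp add: eC(1)[symmetric])
  then show ?thesis using evc[OF subset_refl, of "p - q"] evc[OF subset_refl, of q]
   by (metis M.add.inv_solve_right' evc a_minus_def subset_refl)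
 qed
 have kd: "keys (p - q) <= B" if "keys p <= B" "keys q <= B" for p q :: "'v cv"
  using pm.subspace_diff[OF subspace_keys[of B]] that by auto
 have ex1: "\<exists>!q. keys q <= B & evs ?C q = v" if v: "v : ?C" for v
 proof (rule ex_ex1I)
  show "\<exists>q. keys q <= B & evs ?C q = v"
  proof (cases "v : B")
   case True
   then show ?thesis using eg[OF v] by (intro exI[of _ "gen v"]) auto
  next
   case False
   then have "insert v B ~: I" using max[of "insert v B"] by auto
   then obtain p where p: "keys p <= insert v B" "evs ?C p = \<zero>\<^bsub>V\<^esub>" "p ~= 0"
    using v BC unfolding I_def by auto
   let ?c = "lookup p v"
   have c: "?c ~= 0"
   proof
    assume "?c = 0"
    then have "keys p <= B" using p(1) by (auto simp: in_keys_iff)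
    then show False using ind p by blast
   qed
   \<comment> \<open>Solves the relation for \<open>v\<close>, whose coefficient is nonzero because
     \<open>B\<close> is independent.\<close>
   define a where "a = -1 / ?c"
   define q where "q = pscale a (p - single v ?c)"
   have "keys q <= B"
    using p(1) unfolding q_def subset_iff in_keys_iff
     by (auto simp: lookup_minus lookup_single when_def split: if_splits)
   moreover have "evs ?C q = v"
   proof -
    have "evs ?C (single v ?c) = ?c \<odot>\<^bsub>V\<^esub> v" using eC(2)[of ?c "gen v"] eg[OF v] by simp
    then have "evs ?C q = a \<odot>\<^bsub>V\<^esub> (\<ominus>\<^bsub>V\<^esub> (?c \<odot>\<^bsub>V\<^esub> v))"
     unfolding q_def using v p(2) by (simp add: eC neg a_minus_def)
    also have "\<ominus>\<^bsub>V\<^esub> (?c \<odot>\<^bsub>V\<^esub> v) = (- ?c) \<odot>\<^bsub>V\<^esub> v" using smult_l_minus[of ?c v] v by simp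
    also have "a \<odot>\<^bsub>V\<^esub> ((- ?c) \<odot>\<^bsub>V\<^esub> v) = (a * (- ?c)) \<odot>\<^bsub>V\<^esub> v"
     using smult_assoc1[of a "- ?c" v] v by simp
    finally show ?thesis using c smult_one[OF v] by (simp add: a_def del: smult_one)
   qed
   ultimately show ?thesis by blast
  qed
  show "q = q'" if q: "keys q <= B & evs ?C q = v" "keys q' <= B & evs ?C q' = v" for q q'
  proof -
   have "evs ?C (q - q') = \<zero>\<^bsub>V\<^esub>" using q v by (simp add: neg a_minus_def M.r_neg)
   then show ?thesis using ind[OF kd] q by fastforce
  qed
 qed
 define j where "j = (%v. THE q. keys q <= B & evs ?C q = v)"
 have j: "keys (j v) <= B & evs ?C (j v) = v" if "v : ?C" for v
  unfolding j_def by (rule theI') (rule ex1[OF that])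
 have BB: "evs B p = evs ?C p" if "keys p <= B" for p
  using that BC by (simp add: evs_def Int_absorb2 subset_trans[OF that BC])
 show thesis
 proof (rule that[of "evs B" j B])
  show "evs B p : carrier V" "evs B (p + q) = evs B p \<oplus>\<^bsub>V\<^esub> evs B q" "evs B (pscale c p) = c \<odot>\<^bsub>V\<^esub> evs B p" for p q c
   using evc[OF BC] eva[OF BC] evm[OF BC] by auto
  show "keys (j v) <= B & evs B (j v) = v" if "v : ?C" for v using j[OF that] BB by auto
  show "j (evs B p) = p" if "keys p <= B" for p
   using j[OF evc[OF BC], of p] ex1[OF evc[OF BC], of p] that BB[OF that] by (metis evc order_refl)
 qed
qed

section \<open>Representations of the Lie algebra of derivations\<close>

text \<open>Vanishing order at the origin; the zero polynomial has every order.\<close>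

definition ordge :: "nat => nat => cpoly => bool" where
 "ordge n k f \<longleftrightarrow> f : polys n & (\<forall>al\<in>keys f. k <= deg n al)"

lemma ordge_polys: "ordge n k f ==> f : polys n"
 by (simp add: ordge_def)

lemma ordge_mono: "ordge n k f ==> l <= k ==> ordge n l f"
 by (auto simp: ordge_def)

lemma ordge_0 [simp]: "ordge n 0 f \<longleftrightarrow> f : polys n"
 by (auto simp: ordge_def)

lemma ordge_gen: "al : exponents n ==> k <= deg n al ==> ordge n k (gen al)"
 and ordge_mono_poly: "al : exponents n ==> k <= deg n al ==> ordge n k (mono n al)"
 by (auto simp: ordge_def mono_def polys_def)

lemma ordge_pvar: "i < n ==> ordge n 1 (pvar i)"
 by (auto simp: pvar_def intro: ordge_gen)

lemma ordge_mult: assumes "ordge n k f" "ordge n l g" shows "ordge n (k + l) (f * g)"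
proof -
 have "k + l <= deg n ga" if ga: "ga : keys (f * g)" for ga
 proof -
  obtain a b where "ga = a + b" "a : keys f" "b : keys g" using ga Poly_Mapping.keys_mult[of f g] by blast
  then show ?thesis using assms by (auto simp: ordge_def deg_add intro: add_mono)
 qed
 then show ?thesis using assms by (auto simp: ordge_def)
qed

lemma ordge_pdiff: assumes "ordge n k f" shows "ordge n (k - 1) (pdiff i f)"
proof -
 have "keys f <= {al : exponents n. k <= deg n al}" using assms by (auto simp: ordge_def polys_def)
 then have "pdiff i f : {f. keys f <= {al : exponents n. k - 1 <= deg n al}}"
 proof (induction rule: pm_sup_induct)
  case zero then show ?case by simp
 next
  case (add p q) then show ?case unfolding pdiff_simps by (rule pm.subspace_add[OF subspace_keys])
 next
  case (scale c p) then show ?case unfolding pdiff_simps by (rule pm.subspace_scale[OF subspace_keys])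
 next
  case (gen al)
  have "k - 1 <= deg n (al - ex i)" if "lookup al i ~= 0"
  proof -
   have "i < n" using that gen exponents_lookup by (metis (no_types, lifting) mem_Collect_eq)
   moreover have "deg n al = deg n (al - ex i) + deg n (ex i)" by (metis deg_add ex_minus_add that)
   ultimately show ?thesis using gen by (simp add: le_diff_conv)
  qed
  then show ?case using gen by (auto simp: pdiff_gen split: if_splits)
 qed
 then show ?thesis using assms by (auto simp: ordge_def)
qed

lemma ordge_opow_pdiff: "al : exponents n ==> ordge n (k + deg n al) f ==> ordge n k (opow n pdiff al f)"
proof (induction arbitrary: k rule: exponents_induct)
 case (add al i)
 then have "ordge n (k + 1) (opow n pdiff al f)" by (intro add.IH) (simp add: deg_add add_ac)
 from ordge_pdiff[OF this] show ?case using add by (simp add: opow_add[OF comm_ops_pdiff])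
qed simp

lemma finite_exponents_deg: "finite {al : exponents n. deg n al <= k}"
proof (induction k)
 case 0
 have "{al : exponents n. deg n al <= 0} <= {0}" using deg_eq_0 by auto
 then show ?case by (rule finite_subset) simp
next
 case (Suc k)
 have "{al : exponents n. deg n al <= Suc k} <= insert 0 (\<Union>i<n. (%al. al + ex i) ` {al : exponents n. deg n al <= k})"
 proof
  fix al assume a: "al : {al : exponents n. deg n al <= Suc k}"
  show "al : insert 0 (\<Union>i<n. (%al. al + ex i) ` {al : exponents n. deg n al <= k})"
  proof (cases "al = 0")
   case False
   then obtain i be where "i < n" "be : exponents n" "al = be + ex i" using a exponents_cases by blast
   then show ?thesis using a by (auto simp: deg_add)
  qed simp
 qed
 then show ?case by (rule finite_subset) (use Suc in auto)
qed

lemma opow_commute: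
 assumes "comm_ops n A" "al : exponents n" "i < n" shows "opow n A al (A i u) = A i (opow n A al u)"
 using assms(2) by (induction rule: exponents_induct) (use assms in \<open>auto simp: opow_add[OF assms(1)] comm_ops_def\<close>)

locale drep =
 fixes n :: nat and \<rho> :: "cop => 'x cv => 'x cv"
 assumes rho_plin: "!!D. D : cDer n ==> plin (\<rho> D)"
  and rho_add: "!!D D' u. D : cDer n ==> D' : cDer n ==> \<rho> (D \<oplus>\<^bsub>Der n\<^esub> D') u = \<rho> D u + \<rho> D' u"
  and rho_smult: "!!D c u. D : cDer n ==> \<rho> (c \<odot>\<^bsub>Der n\<^esub> D) u = pscale c (\<rho> D u)"
  and rho_bracket: "!!D D' u. D : cDer n ==> D' : cDer n ==>
   \<rho> (D \<otimes>\<^bsub>Der n\<^esub> D') u = \<rho> D (\<rho> D' u) - \<rho> D' (\<rho> D u)"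
begin

definition R :: "cpoly => nat => 'x cv => 'x cv" where
 "R f j = \<rho> (dop n f j)"

lemma R_bracket:
 assumes "f : polys n" "g : polys n" "i < n" "j < n"
 shows "R f i (R g j u) = R g j (R f i u) + R (f * pdiff i g) j u - R (g * pdiff j f) i u"
proof -
 have "R f i (R g j u) - R g j (R f i u) = R (f * pdiff i g) j u - R (g * pdiff j f) i u"
  unfolding R_def using assms
  by (subst rho_bracket[symmetric]) (auto simp: dop_bracket rho_add rho_smult Der_smult_closed)
 then show ?thesis by (simp add: algebra_simps)
qed

sublocale vrep n R
proof
 show "plin (R f j)" if "f : polys n" for f j using that unfolding R_def by (intro rho_plin) auto
 show "R (f + g) j u = R f j u + R g j u" if "f : polys n" "g : polys n" "j < n" for f g j u
  using that by (simp add: R_def dop_add rho_add)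
 show sc: "R (pscale c f) j u = pscale c (R f j u)" if "f : polys n" "j < n" for f c j u
  using that by (simp add: R_def dop_scale rho_smult)
 show "R f j (R 1 s u) = R 1 s (R f j u) - R (pdiff s f) j u" if "f : polys n" "j < n" "s < n" for f j s u
  using R_bracket[of f 1 j s u] sc[of 0 s 0 u] that by simp
qed

lemma rho_R: assumes "D : cDer n" shows "\<rho> D u = dact D u"
proof -
 let ?F = "%xs. foldr (%j E. dop n (D (pvar j)) j \<oplus>\<^bsub>Der n\<^esub> E) xs \<zero>\<^bsub>Der n\<^esub>"
 have z: "\<zero>\<^bsub>Der n\<^esub> : cDer n" by (simp add: Der_simps Der_zero)
 have c: "?F xs : cDer n" if "set xs <= {..<n}" for xs
  using that Der_polys[OF assms] z by (induction xs) (auto intro!: Der_add_closed)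
 have rz: "\<rho> \<zero>\<^bsub>Der n\<^esub> u = 0"
 proof -
  have "0 \<odot>\<^bsub>Der n\<^esub> \<zero>\<^bsub>Der n\<^esub> = \<zero>\<^bsub>Der n\<^esub>" by (auto simp: Der_simps)
  then show ?thesis using rho_smult[OF z, of 0 u] by simp
 qed
 have "\<rho> (?F xs) u = (\<Sum>j\<in>set xs. R (D (pvar j)) j u)" if "set xs <= {..<n}" "distinct xs" for xs
  using that
 proof (induction xs)
  case Nil
  then show ?case by (simp add: rz)
 next
  case (Cons a xs)
  then show ?case using c[of xs] Der_polys[OF assms, of "pvar a"] by (simp add: rho_add R_def)
 qed
 from this[of "[0..<n]"] show ?thesis
  using Der_sum_dop[OF assms] by (simp add: dact_def atLeast0LessThan)
qed

text \<open>For \<open>k = 0\<close> these are the submodules, for \<open>k = 1\<close> the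
  subspaces stable under all fields vanishing at the origin.\<close>

definition stable :: "nat => 'x cv set => bool" where
 "stable k N \<longleftrightarrow> pm.subspace N & (\<forall>f j u. ordge n k f --> j < n --> u : N --> R f j u : N)"

lemma stableD: "stable k N ==> ordge n k f ==> j < n ==> u : N ==> R f j u : N"
 by (simp add: stable_def)

lemma stable_subspace: "stable k N ==> pm.subspace N"
 by (simp add: stable_def)

text \<open>A field passes \<open>\<partial>_s\<close> at the price of a differentiated coefficient.
  On \<open>E\<close> itself the constant term of the coefficient produces a translate, and the rest
  of the field maps \<open>E\<close> to itself.\<close>

lemma span_Dp_stable:
 assumes E: "stable 1 E" shows "stable 0 (pm.span {Dp al e | al e. al : exponents n & e : E})" (is "stable 0 (pm.span ?G)")
proof -
 have D1: "R 1 s u : pm.span ?G" if "u : pm.span ?G" "s < n" for s u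
  using that(1)
 proof (induction rule: pm.span_induct_alt)
  case base
  then show ?case using that(2) by (simp add: R_simps pm.span_zero)
 next
  case (step c x y)
  then obtain al e where "x = Dp al e" "al : exponents n" "e : E" by blast
  then have "R 1 s x : pm.span ?G" using that(2) Dp_add[OF that(2), of al e, symmetric]
   by (intro pm.span_base) (auto intro!: exI[of _ "al + ex s"] exI[of _ e])
  then show ?case using step that(2) by (simp add: R_simps pm.span_add pm.span_scale)
 qed
 have g: "R f j (Dp al e) : pm.span ?G" if "al : exponents n" "e : E" "f : polys n" "j < n" for f j al e
  using that(1,3)
 proof (induction arbitrary: f rule: exponents_induct)
  case zero
  define c where "c = lookup f 0"
  have "ordge n 1 (f - pscale c 1)"
  proof -
   have k: "keys (f - pscale c 1) <= exponents n" using polys_closed(4)[OF zero(1) polys_closed(3)[OF polys_1], of c] by (simp add: polys_def)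
   have "1 <= deg n al" if "al : keys (f - pscale c 1)" for al
   proof -
    have "al ~= 0" using that by (auto simp: in_keys_iff lookup_minus c_def lookup_one)
    moreover have "al : exponents n" using that k by blast
    ultimately have "deg n al ~= 0" using deg_eq_0 by blast
    then show ?thesis by linarith
   qed
   then show ?thesis using k by (simp add: ordge_def polys_def)
  qed
  then have "R (f - pscale c 1) j e : E" using E that(2,4) unfolding stable_def by blast
  then have 1: "R (f - pscale c 1) j e : pm.span ?G"
   by (intro pm.span_base) (auto intro!: exI[of _ 0] exI[of _ "R (f - pscale c 1) j e"])
  have "e : pm.span ?G" using that(2) by (intro pm.span_base) (auto intro!: exI[of _ 0] exI[of _ e])
  from D1[OF this that(4)] have 2: "pscale c (R 1 j e) : pm.span ?G" by (rule pm.span_scale)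
  have "R f j e = R (f - pscale c 1) j e + pscale c (R 1 j e)"
   using zero that(4) by (simp add: R_diff R_scale)
  then show ?case using pm.span_add[OF 1 2] by simp
 next
  case (add al s)
  have "R f j (Dp (al + ex s) e) = R 1 s (R f j (Dp al e)) - R (pdiff s f) j (Dp al e)"
   using add that(4) by (simp add: Dp_add R_comm)
  then show ?case using add D1 by (auto intro!: pm.span_diff)
 qed
 have "R f j u : pm.span ?G" if "u : pm.span ?G" "f : polys n" "j < n" for f j u
  using that(1)
  by (induction rule: pm.span_induct_alt)
   (use that(2,3) g in \<open>auto simp: R_simps pm.span_zero intro!: pm.span_add pm.span_scale\<close>)
 then show ?thesis by (simp add: stable_def)
qed

text \<open>Each factor \<open>\<partial>_s\<close> must be spent on differentiating
  \<open>f\<close>: if one is left over, the remaining coefficient still has order above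
  \<open>l\<close> and kills \<open>e\<close>. The sign counts the commutators.\<close>

lemma R_Dp_high:
 assumes "al : exponents n" "ordge n (l + deg n al) f" "j < n"
  "!!g. ordge n (l + 1) g ==> R g j e = 0"
 shows "R f j (Dp al e) = pscale ((- 1) ^ deg n al) (R (opow n pdiff al f) j e)"
 using assms(1,2)
proof (induction arbitrary: f rule: exponents_induct)
 case (add al s)
 have f: "ordge n (l + 1 + deg n al) f" using add by (simp add: deg_add add_ac)
 have fp: "f : polys n" using f by (rule ordge_polys)
 have "R f j (Dp al e) = pscale ((- 1) ^ deg n al) (R (opow n pdiff al f) j e)"
  using f by (intro add.IH ordge_mono[OF f]) simp
 also have "... = 0" using assms(4) ordge_opow_pdiff[OF add.hyps(1) f] by simp
 finally have 1: "R f j (Dp al e) = 0" .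
 have "ordge n (l + deg n al) (pdiff s f)" using ordge_pdiff[OF f] by simp
 from add.IH[OF this] have 2: "R (pdiff s f) j (Dp al e) = pscale ((- 1) ^ deg n al) (R (opow n pdiff al (pdiff s f)) j e)" .
 have "opow n pdiff al (pdiff s f) = opow n pdiff (al + ex s) f"
  using add.hyps by (simp add: opow_add[OF comm_ops_pdiff] opow_commute[OF comm_ops_pdiff])
 then show ?case using 1 2 add.hyps fp assms(3)
  by (simp add: Dp_add R_comm R_simps deg_add power_add)
qed simp

end

locale smooth_drep = drep n \<rho> for n and \<rho> :: "cop => 'x cv => 'x cv" +
 fixes W :: "'x cv set"
 assumes W: "stable 0 W" "W ~= {0}"
  and W_simple: "!!N. stable 0 N ==> N <= W ==> N = {0} \<or> N = W"
  and W_smooth: "!!u. u : W ==> \<exists>m. \<forall>f j. ordge n m f --> j < n --> R f j u = 0"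
begin

definition filt :: "nat => 'x cv set" where
 "filt k = {u : W. \<forall>f j. ordge n (k + 1) f --> j < n --> R f j u = 0}"

lemma W_sub: "pm.subspace W" and W_stable: "f : polys n ==> j < n ==> u : W ==> R f j u : W"
 using W unfolding stable_def by auto

lemma W_0: "0 : W" using W_sub by (rule pm.subspace_0)

lemma filt_W: "filt k <= W" by (auto simp: filt_def)

lemma filt_kill: "u : filt k ==> ordge n (k + 1) f ==> j < n ==> R f j u = 0"
 by (auto simp: filt_def)

text \<open>The bracket of a field of order \<open>k + 1\<close> with a field of order 1 again has
  order \<open>k + 1\<close>.\<close>

lemma filt_stable: "stable 1 (filt k)"
proof -
 have "pm.subspace (filt k)"
  using W_sub unfolding filt_def pm.subspace_def
  by (auto simp: R_simps[OF ordge_polys])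
 moreover have "R f j u : filt k" if "ordge n 1 f" "j < n" "u : filt k" for f j u
 proof -
  have f: "f : polys n" using that(1) by (rule ordge_polys)
  have "R g i (R f j u) = 0" if g: "ordge n (k + 1) g" "i < n" for g i
  proof -
   have gp: "g : polys n" using g(1) by (rule ordge_polys)
   have "ordge n (k + 1 + (1 - 1)) (g * pdiff i f)" "ordge n (1 + (k + 1 - 1)) (f * pdiff j g)"
    using ordge_mult[OF g(1) ordge_pdiff[OF \<open>ordge n 1 f\<close>]] ordge_mult[OF \<open>ordge n 1 f\<close> ordge_pdiff[OF g(1)]] by auto
   then have "R (g * pdiff i f) j u = 0" "R (f * pdiff j g) i u = 0" "R g i u = 0"
    using filt_kill[OF \<open>u : filt k\<close>] g \<open>j < n\<close> by (auto simp: add.commute)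
   then show ?thesis using R_bracket[OF gp f g(2) \<open>j < n\<close>, of u] R_plin[OF f \<open>j < n\<close>]
    by (simp add: plin_0)
  qed
  moreover have "R f j u : W" using that filt_W f W_stable by blast
  ultimately show ?thesis by (simp add: filt_def)
 qed
 ultimately show ?thesis by (simp add: stable_def)
qed

lemma filt_nonzero: "\<exists>k. filt k ~= {0}"
proof -
 obtain u where u: "u : W" "u ~= 0" using W(2) W_0 by blast
 obtain m where "\<forall>f j. ordge n m f --> j < n --> R f j u = 0" using W_smooth[OF u(1)] by blast
 then have "u : filt m" using u ordge_mono[of n "m + 1" _ m] by (auto simp: filt_def)
 then show ?thesis using u by blast
qed

lemma span_Dp_W:
 assumes "stable 1 E" "E <= W" "E ~= {0}"
 shows "pm.span {Dp al e | al e. al : exponents n & e : E} = W"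
proof -
 let ?G = "{Dp al e | al e. al : exponents n & e : E}"
 have E: "E <= ?G" by (auto intro: exI[of _ 0])
 have "?G <= W"
  using assms(2) W_stable by (auto intro!: opow_in[OF comm_R])
 then have "pm.span ?G <= W" by (rule pm.span_minimal[OF _ W_sub])
 moreover have "pm.span ?G ~= {0}"
  using assms(3) E pm.span_superset[of ?G] pm.subspace_0[OF stable_subspace[OF assms(1)]] by blast
 ultimately show ?thesis using W_simple[OF span_Dp_stable[OF assms(1)]] by blast
qed

lemma span_Dp_sum:
 assumes E: "pm.subspace E" and u: "u : pm.span {Dp al e | al e. al : exponents n & e : E}"
 obtains A x where "finite A" "A <= exponents n" "!!al. x al : E" "u = (\<Sum>al\<in>A. Dp al (x al))"
proof -
 have "\<exists>A x. finite A & A <= exponents n & (\<forall>al. x al : E) & (\<forall>al. al ~: A --> x al = 0) & u = (\<Sum>al\<in>A. Dp al (x al))"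
  using u
 proof (induction rule: pm.span_induct_alt)
  case base
  then show ?case using pm.subspace_0[OF E] by (intro exI[of _ "{}"] exI[of _ "%_. 0"]) auto
 next
  case (step c y v)
  then obtain be e A x where y: "y = Dp be e" "be : exponents n" "e : E"
   and A: "finite A" "A <= exponents n" "\<forall>al. x al : E" "\<forall>al. al ~: A --> x al = 0" "v = (\<Sum>al\<in>A. Dp al (x al))" by blast
  define x' where "x' = x(be := x be + pscale c e)"
  have "(\<Sum>al\<in>insert be A. Dp al (x' al)) = (\<Sum>al\<in>insert be A. (if al = be then pscale c y else 0) + Dp al (x al))"
   using A(2) y plin_Dp[OF y(2)] by (intro sum.cong) (auto simp: x'_def plin_simps)
  also have "... = pscale c y + (\<Sum>al\<in>insert be A. Dp al (x al))"
   using A(1) by (simp add: sum.distrib)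
  also have "(\<Sum>al\<in>insert be A. Dp al (x al)) = v"
   unfolding A(5) using A y plin_0[OF plin_Dp[OF y(2)]] by (intro sum.mono_neutral_right) auto
  finally show ?case using A y pm.subspace_add[OF E] pm.subspace_scale[OF E]
   by (intro exI[of _ "insert be A"] exI[of _ x']) (auto simp: x'_def)
 qed
 then show thesis using that by blast
qed

text \<open>Between two neighbouring steps of the filtration only coefficients of degree exactly
  \<open>Suc k\<close> remain to be tested, and monomials suffice.\<close>

lemma mono_zero_filt:
 assumes u: "u : filt (Suc k)" and z: "!!\<mu> j. \<mu> : exponents n ==> deg n \<mu> = Suc k ==> j < n ==> R (mono n \<mu>) j u = 0"
 shows "u : filt k"
proof -
 have "R f j u = 0" if f: "ordge n (Suc k) f" and j: "j < n" for f j
 proof -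
  have "keys f <= {al : exponents n. Suc k <= deg n al}" using f by (auto simp: ordge_def polys_def)
  then have "f : polys n & R f j u = 0"
  proof (induction rule: pm_sup_induct)
   case (gen al)
   show ?case
   proof (cases "deg n al = Suc k")
    case True
    have "gen al = pscale (\<Prod>i<n. fact (lookup al i)) (mono n al)" by (simp add: mono_def)
    then show ?thesis using gen z[OF _ True j] j by (simp add: R_scale)
   next
    case False
    then have "ordge n (Suc k + 1) (gen al)" using gen by (intro ordge_gen) auto
    then show ?thesis using filt_kill[OF u _ j] gen by auto
   qed
  qed (use j in \<open>auto simp: R_0 R_add R_scale\<close>)
  then show ?thesis by blast
 qed
 then show ?thesis using u by (auto simp: filt_def Suc_eq_plus1[symmetric] simp del: Suc_eq_plus1)
qed

text \<open>A variant of McCoy's theorem on zero divisors in polynomial rings: the operators of degree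
 \<open>l - 1\<close> commute on the filtration step because \<open>l \<ge> 2\<close>, and the family \<open>x\<close> is the coefficient
 family of a polynomial annihilated by the generic linear combination of these operators.\<close>

lemma mccoy:
 assumes l: "l \<ge> 2" "filt (l - 1) = {0}"
  and A: "finite A" "A <= {al : exponents n. deg n al = d}"
  and x: "!!al. al : A ==> x al : filt l"
  and z: "!!be j. be : exponents n ==> deg n be = l + d ==> j < n ==>
   (\<Sum>al\<in>A. R (opow n pdiff al (mono n be)) j (x al)) = 0"
 shows "\<forall>al\<in>A. x al = 0"
 using x z
proof (induction "card {al\<in>A. x al ~= 0}" arbitrary: x rule: less_induct)
 case (less x)
 let ?S = "{al\<in>A. x al ~= 0}"
 show ?case
 proof (rule ccontr)
  assume "\<not> (\<forall>al\<in>A. x al = 0)"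
  then have ne: "?S ~= {}" by auto
  have fS: "finite ?S" using A(1) by simp
  \<comment> \<open>The maximum is taken for a total order on exponents that is compatible with
    addition, so \<open>x al0\<close> is the leading coefficient of the polynomial with coefficients
    \<open>x\<close>.\<close>
  define al0 where "al0 = Max ?S"
  have al0: "al0 : A" "x al0 ~= 0" and max: "!!al. al : ?S ==> al <= al0"
   using Max_in[OF fS ne] Max_ge[OF fS] by (auto simp: al0_def)
  have Aex: "al : exponents n" "deg n al = d" if "al : A" for al using that A by auto
  \<comment> \<open>If some operator does not kill the whole family, the one with the largest
    exponent \<open>\<nu>\<close> is applied to the family.\<close>
  have all0: "R (mono n \<mu>) j (x al) = 0" if \<mu>: "\<mu> : exponents n" "deg n \<mu> = l" "j < n" and al: "al : A" for \<mu> j al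
  proof (rule ccontr)
   assume nz: "R (mono n \<mu>) j (x al) ~= 0"
   let ?M = "{\<mu> : exponents n. deg n \<mu> = l & (\<exists>al\<in>A. R (mono n \<mu>) j (x al) ~= 0)}"
   have fM: "finite ?M" by (rule finite_subset[OF _ finite_exponents_deg[of n l]]) auto
   have M: "Max ?M : ?M" using nz \<mu> al by (intro Max_in[OF fM]) auto
   define \<nu> where "\<nu> = Max ?M"
   have \<nu>: "\<nu> : exponents n" "deg n \<nu> = l" "\<exists>al\<in>A. R (mono n \<nu>) j (x al) ~= 0" using M by (auto simp: \<nu>_def)
   define y where "y = (%al. R (mono n \<nu>) j (x al))"
   have mo: "ordge n l (mono n \<nu>)" using \<nu> by (intro ordge_mono_poly) auto
   \<comment> \<open>The relation of exponent \<open>\<nu> + al0\<close> reduces to this term: any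
     other pair of exponents with the same sum has either a zero coefficient or an operator beyond
     \<open>\<nu>\<close>, which kills.\<close>
   have lead: "y al0 = 0"
   proof -
    have t: "R (opow n pdiff al (mono n (\<nu> + al0))) j (x al) = (if al = al0 then y al0 else 0)" if a: "al : A" for al
    proof (cases "al = al0")
     case True
     then show ?thesis using opow_pdiff_mono[OF Aex(1)[OF a], of \<nu>] by (simp add: y_def add.commute)
    next
     case ne: False
     show ?thesis
     proof (cases "x al = 0 \<or> (\<forall>de. \<nu> + al0 ~= al + de)")
      case True
      then show ?thesis
      proof
       assume "x al = 0"
       moreover have "opow n pdiff al (mono n (\<nu> + al0)) : polys n"
        using Aex al0(1) a \<nu> by (intro opow_pdiff_polys mono_polys exponents_add) auto
       ultimately show ?thesis using ne \<mu>(3) by (simp add: R_simps)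
      next
       assume "\<forall>de. \<nu> + al0 ~= al + de"
       then have "opow n pdiff al (mono n (\<nu> + al0)) = 0" by (intro opow_pdiff_mono_0[OF Aex(1)[OF a]]) auto
       then show ?thesis using ne \<mu>(3) by (simp add: R_0)
      qed
     next
      case False
      then obtain de where de: "\<nu> + al0 = al + de" and xa: "x al ~= 0" by blast
      have "al < al0" using max[of al] a xa ne by auto
      have "\<nu> < de"
      proof (rule ccontr)
       assume "\<not> \<nu> < de"
       then have "al + de < al0 + \<nu>" using \<open>al < al0\<close> by (intro add_less_le_mono) auto
       then show False using de by (simp add: add.commute)
      qed
      have dee: "de : exponents n"
       using exponents_minus[OF exponents_add[OF \<nu>(1) Aex(1)[OF al0(1)]], of al] de by simp
      have "deg n de = l" using arg_cong[OF de, of "deg n"] \<nu> Aex[OF a] Aex[OF al0(1)] by (simp add: deg_add)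
      have "de ~: ?M"
      proof
       assume "de : ?M"
       from Max_ge[OF fM this] have "de <= \<nu>" by (simp only: \<nu>_def)
       then show False using \<open>\<nu> < de\<close> by simp
      qed
      then have "R (mono n de) j (x al) = 0" using dee \<open>deg n de = l\<close> a by blast
      then show ?thesis using ne opow_pdiff_mono[OF Aex(1)[OF a], of de] de by simp
     qed
    qed
    have "(\<Sum>al\<in>A. R (opow n pdiff al (mono n (\<nu> + al0))) j (x al)) = 0"
     using less.prems(2)[of "\<nu> + al0" j] \<nu> \<mu>(3) Aex[OF al0(1)] by (auto simp: deg_add)
    then show ?thesis using A(1) al0(1) by (simp add: t cong: sum.cong)
   qed
   have yz: "y al = 0" if "x al = 0" for al using that mo \<mu>(3) by (simp add: y_def R_simps[OF ordge_polys])
   have sub: "{al\<in>A. y al ~= 0} \<subset> ?S" using al0 lead yz by auto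
   \<comment> \<open>The new family satisfies the same relations and has fewer nonzero members,
     since \<open>al0\<close> has dropped out; so the induction applies and contradicts the choice
     of \<open>\<nu>\<close>.\<close>
   have "\<forall>al\<in>A. y al = 0"
   proof (rule less.hyps)
    show "card {al\<in>A. y al ~= 0} < card ?S" by (rule psubset_card_mono[OF fS sub])
    show "y al : filt l" if "al : A" for al
     unfolding y_def using filt_stable mo l(1) \<mu>(3) less.prems(1)[OF that] by (auto intro!: stableD[OF filt_stable] ordge_mono[OF mo])
    show "(\<Sum>al\<in>A. R (opow n pdiff al (mono n be)) i (y al)) = 0" if be: "be : exponents n" "deg n be = l + d" "i < n" for be i
    proof -
     have "R (opow n pdiff al (mono n be)) i (y al) = R (mono n \<nu>) j (R (opow n pdiff al (mono n be)) i (x al))" if a: "al : A" for al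
     proof -
      let ?g = "opow n pdiff al (mono n be)"
      have g: "ordge n l ?g" using be Aex[OF a] by (intro ordge_opow_pdiff ordge_mono_poly) auto
      \<comment> \<open>Both products have order \<open>2 l - 1\<close>, which exceeds
        \<open>l\<close> because \<open>l \<ge> 2\<close>; hence the two operators commute on
        \<open>filt l\<close>.\<close>
      have "ordge n (l + 1) (?g * pdiff i (mono n \<nu>))" "ordge n (l + 1) (mono n \<nu> * pdiff j ?g)"
       using l(1) by (auto intro: ordge_mono[OF ordge_mult[OF g ordge_pdiff[OF mo]]] ordge_mono[OF ordge_mult[OF mo ordge_pdiff[OF g]]])
      then have "R (?g * pdiff i (mono n \<nu>)) j (x al) = 0" "R (mono n \<nu> * pdiff j ?g) i (x al) = 0"
       using filt_kill[OF less.prems(1)[OF a]] \<mu>(3) be(3) by auto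
      then show ?thesis unfolding y_def
       using R_bracket[OF ordge_polys[OF g] ordge_polys[OF mo] be(3) \<mu>(3), of "x al"] by simp
     qed
     then have "(\<Sum>al\<in>A. R (opow n pdiff al (mono n be)) i (y al)) = R (mono n \<nu>) j (\<Sum>al\<in>A. R (opow n pdiff al (mono n be)) i (x al))"
      using mo \<mu>(3) by (simp add: R_simps[OF ordge_polys])
     then show ?thesis using less.prems(2)[OF be] mo \<mu>(3) by (simp add: R_simps[OF ordge_polys])
    qed
   qed
   then show False using \<nu>(3) by (auto simp: y_def)
  qed
  \<comment> \<open>All monomial fields with coefficient of degree \<open>l\<close> kill
    \<open>x al0\<close>, so it drops to the previous step of the filtration, which is zero.\<close>
  have "x al0 : filt (l - 1)"
   by (rule mono_zero_filt) (use l(1) less.prems(1)[OF al0(1)] all0[OF _ _ _ al0(1)] in auto)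
  then show False using l(2) al0(2) by auto
 qed
qed

text \<open>Apply fields with coefficients of degree \<open>l + d\<close>, where \<open>d\<close> is
  the top degree in the relation. Translates of lower degree die, those of degree \<open>d\<close>
  lose all their derivatives, and what remains is the system of equations in
  \<open>mccoy\<close>.\<close>

lemma indep_filt:
 assumes l: "l \<ge> 2" "filt (l - 1) = {0}" shows "indep (filt l)"
 unfolding indep_def
proof (intro allI impI ballI, rule ccontr)
 fix A x be assume A: "finite A" "A <= exponents n" "\<forall>al\<in>A. x al : filt l" "(\<Sum>al\<in>A. Dp al (x al)) = 0"
  and be: "be : A" "x be ~= 0"
 define d where "d = Max (deg n ` {al\<in>A. x al ~= 0})"
 have fin: "finite (deg n ` {al\<in>A. x al ~= 0})" using A(1) by simp
 have d: "d : deg n ` {al\<in>A. x al ~= 0}" unfolding d_def using be by (intro Max_in[OF fin]) auto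
 have dmax: "deg n al <= d" if "al : A" "x al ~= 0" for al unfolding d_def using that by (intro Max_ge[OF fin]) auto
 let ?A = "{al\<in>A. deg n al = d}"
 have "\<forall>al\<in>?A. x al = 0"
 proof (rule mccoy[OF l])
  fix ga j assume ga: "ga : exponents n" "deg n ga = l + d" "j < n"
  have o: "ordge n (l + d) (mono n ga)" using ga by (intro ordge_mono_poly) auto
  have t: "R (mono n ga) j (Dp al (x al)) =
    (if al : ?A then pscale ((- 1) ^ d) (R (opow n pdiff al (mono n ga)) j (x al)) else 0)" if a: "al : A" for al
  proof (cases "deg n al <= d")
   case True
   have ae: "al : exponents n" using a A(2) by auto
   have kill: "R g j (x al) = 0" if "ordge n (l + 1) g" for g
    using filt_kill[OF _ that ga(3)] A(3) a by blast
   have 1: "R (mono n ga) j (Dp al (x al)) = pscale ((- 1) ^ deg n al) (R (opow n pdiff al (mono n ga)) j (x al))"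
    by (rule R_Dp_high[OF ae _ ga(3) kill]) (use True ordge_mono[OF o] in auto)
   show ?thesis
   proof (cases "deg n al = d")
    case True then show ?thesis using 1 a by simp
   next
    case False
    have "ordge n (l + 1 + deg n al) (mono n ga)" using True False by (intro ordge_mono[OF o]) auto
    then have "R (opow n pdiff al (mono n ga)) j (x al) = 0" by (intro kill ordge_opow_pdiff ae)
    then show ?thesis using 1 False by simp
   qed
  next
   case False
   then have "x al = 0" using dmax a by blast
   then show ?thesis using False ga A(2) a plin_0[OF plin_Dp[of al]] by (auto simp: R_simps)
  qed
  have "0 = R (mono n ga) j (\<Sum>al\<in>A. Dp al (x al))" using A(4) ga by (simp add: R_simps)
  also have "... = (\<Sum>al\<in>A. R (mono n ga) j (Dp al (x al)))" using ga by (simp add: R_simps)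
  also have "... = (\<Sum>al\<in>?A. pscale ((- 1) ^ d) (R (opow n pdiff al (mono n ga)) j (x al)))"
   using A(1) by (simp add: t sum.inter_filter[symmetric] cong: sum.cong)
  finally show "(\<Sum>al\<in>?A. R (opow n pdiff al (mono n ga)) j (x al)) = 0"
   by (simp add: pm.scale_sum_right[symmetric])
 qed (use A in auto)
 then show False using d by auto
qed

end

section \<open>Exterior powers\<close>

text \<open>\<open>gen S\<close> stands for the wedge of the basis vectors with index in
  \<open>S\<close> in increasing order, and \<open>sg k S\<close> is the sign of moving the vector
  \<open>k\<close> into its place. Then \<open>eps\<close> is exterior multiplication and
  \<open>iot\<close> contraction.\<close>

definition sg :: "nat => nat set => complex" where
 "sg k S = (- 1) ^ card {s : S. s < k}"

definition eps :: "nat => nat set cv => nat set cv" where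
 "eps k = lext (%S. if k : S then 0 else single (insert k S) (sg k S))"

definition iot :: "nat => nat set cv => nat set cv" where
 "iot k = lext (%S. if k : S then single (S - {k}) (sg k S) else 0)"

lemma plin_eps: "plin (eps k)" and plin_iot: "plin (iot k)"
 by (simp_all add: eps_def iot_def plin_lext)

lemmas eps_simps = plin_simps[OF plin_eps]
lemmas iot_simps = plin_simps[OF plin_iot]

lemma sg_sq: "sg k S * sg k S = 1"
 by (simp add: sg_def power_add[symmetric] mult_2[symmetric])

lemma sg_insert: "l ~: S ==> sg k (insert l S) = (if l < k then - sg k S else sg k S)"
proof -
 assume "l ~: S"
 have "{s : insert l S. s < k} = (if l < k then insert l {s : S. s < k} else {s : S. s < k})" by auto
 moreover have "finite {s : S. s < k}" by simp
 ultimately show ?thesis using \<open>l ~: S\<close> by (simp add: sg_def)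
qed

lemma sg_remove: "l : S ==> sg k (S - {l}) = (if l < k then - sg k S else sg k S)"
 using sg_insert[of l "S - {l}" k] by (auto simp: insert_absorb split: if_splits)

lemma eps_single: "eps k (single S c) = (if k : S then 0 else single (insert k S) (c * sg k S))"
 and iot_single: "iot k (single S c) = (if k : S then single (S - {k}) (c * sg k S) else 0)"
 by (simp_all add: eps_def iot_def lext_single)

lemma eps_eps: "eps k (eps l w) = - eps l (eps k w)"
proof (rule plin_eqI[of w UNIV])
 show "eps k (eps l (gen S)) = - eps l (eps k (gen S))" for S
  by (cases "k = l"; cases "k < l"; auto simp: eps_single eps_simps sg_insert insert_commute single_uminus mult.commute)
qed (auto simp: plin_def eps_simps)

lemma iot_iot: "iot k (iot l w) = - iot l (iot k w)"
proof (rule plin_eqI[of w UNIV])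
 show "iot k (iot l (gen S)) = - iot l (iot k (gen S))" for S
 proof (cases "k = l")
  case False
  have "S - {k} - {l} = S - {l} - {k}" by auto
  with False show ?thesis
   by (cases "k < l") (auto simp: iot_single iot_simps sg_remove single_uminus mult.commute)
 qed (auto simp: iot_single iot_simps)
qed (auto simp: plin_def iot_simps)

text \<open>With the two anticommutation rules above these are the Clifford relations. The brackets
  of the operators \<open>eps i (iot j w)\<close> and Cartan's formula follow from them
  formally.\<close>

lemma eps_iot: "eps k (iot l w) = (if k = l then w else 0) - iot l (eps k w)"
proof (rule plin_eqI[of w UNIV])
 show "eps k (iot l (gen S)) = (if k = l then gen S else 0) - iot l (eps k (gen S))" for S
 proof (cases "k = l")
  case False
  have "insert k S - {l} = insert k (S - {l})" using False by auto
  with False show ?thesis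
   by (cases "k < l") (auto simp: iot_single eps_single eps_simps iot_simps sg_insert sg_remove single_uminus mult.commute)
 next
  case True
  then show ?thesis
   by (auto simp: iot_single eps_single eps_simps iot_simps sg_insert sg_remove insert_absorb sg_sq)
 qed
 show "plin (%w. (if k = l then w else 0) - iot l (eps k w))"
  by (auto simp: plin_def eps_simps iot_simps pm.scale_right_diff_distrib)
qed (auto simp: plin_def eps_simps iot_simps)

definition Lam :: "nat => nat => nat set cv set" where
 "Lam n r = {w. keys w <= {S. S <= {..<n} & card S = r}}"

lemma subspace_Lam: "pm.subspace (Lam n r)"
 unfolding Lam_def by (rule subspace_keys)

lemma Lam_gen: "gen S : Lam n r \<longleftrightarrow> S <= {..<n} & card S = r"
 by (simp add: Lam_def)

lemma Lam_induct [consumes 1, case_names zero add scale gen]: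
 assumes "w : Lam n r" "P 0" "!!p q. P p ==> P q ==> P (p + q)" "!!c p. P p ==> P (pscale c p)"
  "!!S. S <= {..<n} ==> card S = r ==> P (gen S)"
 shows "P w"
 using assms unfolding Lam_def by (auto intro: pm_sup_induct[of w "{S. S <= {..<n} & card S = r}" P])

lemma Lam_single: "S <= {..<n} ==> card S = r ==> single S c : Lam n r"
 by (auto simp: Lam_def)

lemma Lam_0: "0 : Lam n r"
 by (simp add: Lam_def)

lemma eps_Lam: "w : Lam n r ==> k < n ==> eps k w : Lam n (Suc r)"
proof (induction rule: Lam_induct)
 case (gen S)
 have "finite S" using gen finite_subset by blast
 then show ?case using gen
  by (auto simp: eps_single Lam_0 intro!: Lam_single)
qed (auto simp: eps_simps intro: Lam_0 pm.subspace_add[OF subspace_Lam] pm.subspace_scale[OF subspace_Lam])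

lemma iot_Lam: "w : Lam n (Suc r) ==> iot k w : Lam n r"
proof (induction rule: Lam_induct)
 case (gen S)
 have "finite S" using gen finite_subset by blast
 then show ?case using gen
  by (auto simp: iot_single Lam_0 intro!: Lam_single)
qed (auto simp: iot_simps intro: Lam_0 pm.subspace_add[OF subspace_Lam] pm.subspace_scale[OF subspace_Lam])

lemma iot_Lam_0: "w : Lam n 0 ==> iot k w = 0"
proof (induction rule: Lam_induct)
 case (gen S)
 then have "S = {}" using finite_subset by fastforce
 then show ?case by (simp add: iot_single)
qed (auto simp: iot_simps)

lemma eps_iot_Lam: "w : Lam n r ==> k < n ==> eps k (iot l w) : Lam n r"
 by (cases r) (auto simp: iot_Lam_0 eps_simps Lam_0 intro!: eps_Lam iot_Lam)

text \<open>The sum of the operators \<open>eps k (iot k w)\<close> counts the degree, so a nonzero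
  form of positive degree has a nonzero contraction.\<close>

lemma iot_all_zero:
 assumes "w : Lam n (Suc r)" "!!k. k < n ==> iot k w = 0" shows "w = 0"
proof -
 have "(\<Sum>k<n. eps k (iot k w)) = pscale (of_nat (Suc r)) w"
  using assms(1)
 proof (induction rule: Lam_induct)
  case (gen S)
  have "(\<Sum>k<n. eps k (iot k (gen S))) = (\<Sum>k<n. if k : S then gen S else 0)"
   by (rule sum.cong) (auto simp: iot_single eps_single eps_simps sg_remove sg_sq insert_absorb)
  also have "... = (\<Sum>k\<in>S. gen S)" using gen by (subst sum.inter_restrict[symmetric]) (auto simp: Int_absorb1)
  also have "... = pscale (of_nat (Suc r)) (gen S)" using gen(2)
   by (intro poly_mapping_eqI) (simp add: lookup_sum lookup_single when_def)
  finally show ?case .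
 qed (auto simp: eps_simps iot_simps sum.distrib pscale_simps pm.scale_sum_right[symmetric] mult.commute simp del: of_nat_Suc)
 moreover have "(\<Sum>k<n. eps k (iot k w)) = 0" using assms(2) by (simp add: eps_simps)
 ultimately show ?thesis by (simp del: of_nat_Suc)
qed

section \<open>Wedges of vectors and the matrix action\<close>

definition epsv :: "nat => complex vec => nat set cv => nat set cv" where
 "epsv n v w = (\<Sum>k<n. pscale (v $ k) (eps k w))"

definition wedgev :: "nat => complex vec list => nat set cv" where
 "wedgev n vs = foldr (epsv n) vs (gen {})"

text \<open>The extension of a matrix to a derivation of the exterior algebra, written through
  multiplications and contractions.\<close>

definition gact :: "nat => complex mat => nat set cv => nat set cv" where
 "gact n A w = (\<Sum>i<n. \<Sum>j<n. pscale (A $$ (i, j)) (eps i (iot j w)))"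

lemma plin_epsv: "plin (epsv n v)"
 unfolding epsv_def by (intro plin_sumI plin_scaled plin_eps)

lemma plin_gact: "plin (gact n A)"
 unfolding gact_def by (intro plin_sumI plin_scaled plin_comp[OF plin_eps plin_iot])

lemma epsv_add: "u : carrier_vec n ==> v : carrier_vec n ==> epsv n (u + v) w = epsv n u w + epsv n v w"
 by (simp add: epsv_def pscale_simps sum.distrib)

lemma epsv_smult: "u : carrier_vec n ==> epsv n (c \<cdot>\<^sub>v u) w = pscale c (epsv n u w)"
 by (simp add: epsv_def pm.scale_sum_right)

lemma epsv_unit: "k < n ==> epsv n (unit_vec n k) w = eps k w"
proof -
 assume k: "k < n"
 have "epsv n (unit_vec n k) w = (\<Sum>j<n. if j = k then eps k w else 0)"
  unfolding epsv_def using k by (intro sum.cong) auto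
 then show ?thesis using k by simp
qed

lemma epsv_epsv: "epsv n u (epsv n v w) = - epsv n v (epsv n u w)"
proof -
 have "epsv n u (epsv n v w) = (\<Sum>k<n. \<Sum>l<n. pscale (u $ k * v $ l) (eps k (eps l w)))"
  by (simp add: epsv_def eps_simps pm.scale_sum_right)
 also have "... = (\<Sum>l<n. \<Sum>k<n. pscale (u $ k * v $ l) (eps k (eps l w)))" by (rule sum.swap)
 also have "... = (\<Sum>l<n. \<Sum>k<n. - pscale (v $ l * u $ k) (eps l (eps k w)))"
  by (intro sum.cong refl) (metis eps_eps mult.commute pm.scale_minus_right)
 also have "... = - epsv n v (epsv n u w)"
  by (simp add: epsv_def eps_simps pm.scale_sum_right sum_negf)
 finally show ?thesis .
qed

lemma epsv_same: "epsv n u (epsv n u w) = 0"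
proof -
 have "epsv n u (epsv n u w) + epsv n u (epsv n u w) = 0" using epsv_epsv[of n u u w] by (simp add: eq_neg_iff_add_eq_0)
 then have "pscale 2 (epsv n u (epsv n u w)) = 0" by (simp add: poly_mapping_eq_iff fun_eq_iff lookup_add)
 then show ?thesis by simp
qed

lemma wedgev_append: "wedgev n (xs @ ys) = foldr (epsv n) xs (wedgev n ys)"
 by (simp add: wedgev_def)

lemma plin_foldr_epsv: "plin (foldr (epsv n) xs)"
 by (induction xs) (auto simp: plin_def plin_simps[OF plin_epsv])

lemma wedgev_rep: "v : set vs ==> epsv n v (wedgev n vs) = 0"
 by (induction vs) (auto simp: wedgev_def epsv_same epsv_epsv[of n v] plin_simps[OF plin_epsv])

lemma wedgev_not_distinct: "\<not> distinct vs ==> wedgev n vs = 0"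
 by (induction vs) (auto simp: wedgev_rep[unfolded wedgev_def] wedgev_def plin_simps[OF plin_epsv])

text \<open>Contraction either removes the new vector, which yields \<open>A *\<^sub>v v\<close>, or
  passes it with a sign that the exchange with the multiplication cancels.\<close>

lemma gact_epsv:
 assumes "A : carrier_mat n n" "v : carrier_vec n"
 shows "gact n A (epsv n v w) = epsv n (A *\<^sub>v v) w + epsv n v (gact n A w)"
proof -
 have e: "eps i (iot j (eps k w)) = (if j = k then eps i w else 0) + eps k (eps i (iot j w))" for i j k
 proof -
  have "iot j (eps k w) = (if k = j then w else 0) - eps k (iot j w)" using eps_iot[of k j w] by simp
  then show ?thesis using eps_eps[of i k "iot j w"] by (simp add: eps_simps)
 qed
 have e': "pscale c (eps i (iot j (eps k w))) = (if k = j then pscale c (eps i w) else 0) + pscale c (eps k (eps i (iot j w)))" for c i j k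
  by (simp add: e pscale_simps)
 have "gact n A (epsv n v w) = (\<Sum>i<n. \<Sum>j<n. \<Sum>k<n. pscale (A $$ (i, j) * v $ k) (eps i (iot j (eps k w))))"
  by (simp add: gact_def epsv_def eps_simps iot_simps pm.scale_sum_right)
 also have "... = (\<Sum>i<n. \<Sum>j<n. \<Sum>k<n. (if k = j then pscale (A $$ (i, j) * v $ k) (eps i w) else 0))
   + (\<Sum>i<n. \<Sum>j<n. \<Sum>k<n. pscale (A $$ (i, j) * v $ k) (eps k (eps i (iot j w))))"
  by (simp only: e' sum.distrib)
 also have "(\<Sum>i<n. \<Sum>j<n. \<Sum>k<n. (if k = j then pscale (A $$ (i, j) * v $ k) (eps i w) else 0)) = epsv n (A *\<^sub>v v) w"
  using assms by (simp add: epsv_def scalar_prod_def pm.scale_sum_left atLeast0LessThan)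
 also have "(\<Sum>i<n. \<Sum>j<n. \<Sum>k<n. pscale (A $$ (i, j) * v $ k) (eps k (eps i (iot j w)))) = epsv n v (gact n A w)"
 proof -
  have "(\<Sum>i<n. \<Sum>j<n. \<Sum>k<n. pscale (A $$ (i, j) * v $ k) (eps k (eps i (iot j w)))) =
   (\<Sum>i<n. \<Sum>k<n. \<Sum>j<n. pscale (A $$ (i, j) * v $ k) (eps k (eps i (iot j w))))"
   by (intro sum.cong refl sum.swap)
  also have "... = (\<Sum>k<n. \<Sum>i<n. \<Sum>j<n. pscale (A $$ (i, j) * v $ k) (eps k (eps i (iot j w))))" by (rule sum.swap)
  finally show ?thesis
   by (simp add: gact_def epsv_def eps_simps pm.scale_sum_right mult.commute)
 qed
 finally show ?thesis .
qed

lemma gact_wedgev: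
 assumes "A : carrier_mat n n" "set vs <= carrier_vec n"
 shows "gact n A (wedgev n vs) = (\<Sum>k<length vs. wedgev n (vs[k := A *\<^sub>v (vs ! k)]))"
 using assms(2)
proof (induction vs)
 case Nil
 then show ?case by (simp add: wedgev_def gact_def iot_single eps_simps)
next
 case (Cons v vs)
 have "gact n A (wedgev n (v # vs)) = epsv n (A *\<^sub>v v) (wedgev n vs) + epsv n v (gact n A (wedgev n vs))"
  using gact_epsv[OF assms(1), of v "wedgev n vs"] Cons by (simp add: wedgev_def)
 also have "... = epsv n (A *\<^sub>v v) (wedgev n vs) + (\<Sum>k<length vs. epsv n v (wedgev n (vs[k := A *\<^sub>v (vs ! k)])))"
  using Cons by (simp add: plin_simps[OF plin_epsv])
 also have "... = (\<Sum>k<length (v # vs). wedgev n ((v # vs)[k := A *\<^sub>v ((v # vs) ! k)]))"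
  unfolding length_Cons sum.lessThan_Suc_shift by (simp add: wedgev_def)
 finally show ?case .
qed

lemma wedgev_Lam: "set vs <= carrier_vec n ==> wedgev n vs : Lam n (length vs)"
proof (induction vs)
 case Nil
 then show ?case by (simp add: wedgev_def Lam_gen)
next
 case (Cons v vs)
 then show ?case by (auto simp: wedgev_def epsv_def
   intro!: pm.subspace_sum[OF subspace_Lam] pm.subspace_scale[OF subspace_Lam] eps_Lam)
qed

lemma wedgev_sorted:
 "sorted is ==> distinct is ==> set is <= {..<n} ==> wedgev n (map (unit_vec n) is) = gen (set is)"
proof (induction "is")
 case (Cons i "is")
 have e: "{s : set is. s < i} = {}" using Cons.prems by auto
 have "sg i (set is) = 1" unfolding sg_def e by simp
 then show ?case using Cons by (simp add: wedgev_def epsv_unit eps_single)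
qed (simp add: wedgev_def)

section \<open>Presentation of the exterior powers\<close>

lemma ext_rels_gens: "ext_rels n r <= {p. keys p <= ext_gens n r}"
proof -
 have "vs[k := u] : ext_gens n r" if "vs : ext_gens n r" "u : carrier_vec n" for vs k u
  using that set_update_subset_insert[of vs k u] by (auto simp: ext_gens_def)
 then show ?thesis unfolding ext_rels_def
  by (auto simp: in_keys_iff lookup_minus lookup_single when_def split: if_splits)
qed

lemma ext_rels_zero: assumes "p : ext_rels n r" shows "lext (wedgev n) p = 0"
proof -
 have up: "wedgev n (vs[k := u]) = foldr (epsv n) (take k vs) (epsv n u (wedgev n (drop (Suc k) vs)))" if "k < length vs" for vs k u
  using that by (simp add: upd_conv_take_nth_drop wedgev_append) (simp add: wedgev_def)
 have "\<not> distinct vs" if "i < j" "j < length vs" "vs ! i = vs ! j" for i j and vs :: "complex vec list"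
  using that nth_eq_iff_index_eq[of vs i j] by auto
 then show ?thesis using assms unfolding ext_rels_def ext_gens_def
  by (auto simp: plin_simps[OF plin_lext] up epsv_add epsv_smult plin_simps[OF plin_foldr_epsv] lext_single wedgev_not_distinct)
qed

context
 fixes n r :: nat
begin

abbreviation "XS \<equiv> pm.span (ext_rels n r)"

lemma ext_addrel:
 assumes "length pre + length post + 1 = r" "set pre <= carrier_vec n" "set post <= carrier_vec n"
  "u : carrier_vec n" "w : carrier_vec n"
 shows "gen (pre @ (u + w) # post) - gen (pre @ u # post) - gen (pre @ w # post) : XS"
proof (rule pm.span_base)
 have "gen ((pre @ u # post)[length pre := u + w]) - gen ((pre @ u # post)[length pre := u]) - gen ((pre @ u # post)[length pre := w]) : ext_rels n r"
  unfolding ext_rels_def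
  by (rule UnI1, rule UnI1, rule CollectI, rule exI[of _ "pre @ u # post"], rule exI[of _ "length pre"], rule exI[of _ u], rule exI[of _ w])
   (use assms in \<open>auto simp: ext_gens_def\<close>)
 then show "gen (pre @ (u + w) # post) - gen (pre @ u # post) - gen (pre @ w # post) : ext_rels n r" by simp
qed

lemma ext_scalerel:
 assumes "length pre + length post + 1 = r" "set pre <= carrier_vec n" "set post <= carrier_vec n" "u : carrier_vec n"
 shows "gen (pre @ (c \<cdot>\<^sub>v u) # post) - pscale c (gen (pre @ u # post)) : XS"
proof (rule pm.span_base)
 have "gen ((pre @ u # post)[length pre := c \<cdot>\<^sub>v u]) - pscale c (gen ((pre @ u # post)[length pre := u])) : ext_rels n r"
  unfolding ext_rels_def
  by (rule UnI1, rule UnI2, rule CollectI, rule exI[of _ "pre @ u # post"], rule exI[of _ "length pre"], rule exI[of _ c], rule exI[of _ u])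
   (use assms in \<open>auto simp: ext_gens_def\<close>)
 then show "gen (pre @ (c \<cdot>\<^sub>v u) # post) - pscale c (gen (pre @ u # post)) : ext_rels n r" by (simp del: pscale_single)
qed

lemma ext_altrel: "vs : ext_gens n r ==> \<not> distinct vs ==> gen vs : XS"
proof (rule pm.span_base)
 assume a: "vs : ext_gens n r" "\<not> distinct vs"
 then obtain i j where "i < length vs" "j < length vs" "i ~= j" "vs ! i = vs ! j" by (auto simp: distinct_conv_nth)
 then obtain i j where "i < j" "j < length vs" "vs ! i = vs ! j" by (metis nat_neq_iff)
 then show "gen vs : ext_rels n r"
  unfolding ext_rels_def using a by (intro UnI2) (auto simp: ext_gens_def)
qed

text \<open>Polarization: expand the vanishing word with \<open>x + y\<close> in both
  places.\<close>

lemma ext_swap: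
 assumes "length pre + length post + 2 = r" "set pre <= carrier_vec n" "set post <= carrier_vec n"
  "x : carrier_vec n" "y : carrier_vec n"
 shows "gen (pre @ x # y # post) + gen (pre @ y # x # post) : XS"
proof -
 let ?g = "%a b. gen (pre @ a # b # post)"
 have alt: "?g a a : XS" if "a : carrier_vec n" for a
  by (rule ext_altrel) (use assms that in \<open>auto simp: ext_gens_def\<close>)
 have l: "?g (x + y) b - ?g x b - ?g y b : XS" if "b : carrier_vec n" for b
  by (rule ext_addrel) (use assms that in auto)
 have rr: "?g a (x + y) - ?g a x - ?g a y : XS" if "a : carrier_vec n" for a
  using ext_addrel[of "pre @ [a]" post x y] assms that by simp
 have c: "x + y : carrier_vec n" using assms by simp
 have "?g (x + y) (x + y) - (?g (x + y) (x + y) - ?g x (x + y) - ?g y (x + y)) - (?g x (x + y) - ?g x x - ?g x y)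
  - (?g y (x + y) - ?g y x - ?g y y) - ?g x x - ?g y y : XS"
  by (rule pm.span_diff[OF pm.span_diff[OF pm.span_diff[OF pm.span_diff[OF pm.span_diff[OF alt[OF c] l[OF c]] rr[OF assms(4)]] rr[OF assms(5)]] alt[OF assms(4)]] alt[OF assms(5)]])
 then show ?thesis by simp
qed

text \<open>The relations together with the increasing words in unit vectors. That \<open>XQ\<close>
  contains every generator is the spanning half of the basis theorem for exterior powers.\<close>

definition XQ :: "(complex vec list) cv set" where
 "XQ = pm.span (ext_rels n r \<union> {gen (map (unit_vec n) (sorted_list_of_set S)) | S. S <= {..<n} & card S = r})"

lemma XS_XQ: "p : XS ==> p : XQ"
 unfolding XQ_def using pm.span_mono[of "ext_rels n r"] by blast

lemma XQ_sub: "pm.subspace XQ"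
 unfolding XQ_def by (rule pm.subspace_span)

abbreviation "ug is \<equiv> gen (map (unit_vec n) is)"

lemma XQ_swap:
 assumes "length pre + length post + 2 = r" "ug (pre @ y # x # post) : XQ"
 shows "ug (pre @ x # y # post) : XQ"
proof -
 have c: "set (map (unit_vec n) zs) <= carrier_vec n" for zs by auto
 have "ug (pre @ x # y # post) + ug (pre @ y # x # post) : XQ"
  using ext_swap[of "map (unit_vec n) pre" "map (unit_vec n) post" "unit_vec n x" "unit_vec n y"] assms(1) c
  by (intro XS_XQ) auto
 from pm.subspace_diff[OF XQ_sub this assms(2)] show ?thesis by simp
qed

text \<open>Insertion sort by means of the exchange relation; \<open>pre\<close> may grow, so that
  the exchange can be made at any position.\<close>

lemma XQ_insort:
 "length pre + length ys + 1 = r ==> ug (pre @ insort x ys) : XQ ==> ug (pre @ x # ys) : XQ"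
proof (induction ys arbitrary: pre)
 case (Cons y ys)
 show ?case
 proof (cases "x <= y")
  case False
  then have "ug ((pre @ [y]) @ insort x ys) : XQ" using Cons.prems by simp
  then have "ug ((pre @ [y]) @ x # ys) : XQ" using Cons.prems by (intro Cons.IH) auto
  then show ?thesis using Cons.prems by - (rule XQ_swap, auto)
 qed (use Cons.prems in simp)
qed simp

lemma XQ_sort: "length pre + length xs = r ==> ug (pre @ sort xs) : XQ ==> ug (pre @ xs) : XQ"
proof (induction xs arbitrary: pre)
 case (Cons x xs)
 have "ug (pre @ x # sort xs) : XQ" using Cons.prems by (intro XQ_insort) auto
 then have "ug ((pre @ [x]) @ xs) : XQ" using Cons.prems by (intro Cons.IH) auto
 then show ?case by simp
qed simp

lemma XQ_unit: assumes "length is = r" "set is <= {..<n}" shows "ug is : XQ"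
proof (cases "distinct is")
 case True
 have "sort is = sorted_list_of_set (set is)" using True by (simp add: sorted_list_of_set_sort_remdups distinct_remdups_id)
 moreover have "card (set is) = r" using True assms distinct_card by blast
 ultimately have "ug ([] @ sort is) : XQ" unfolding XQ_def using assms by (intro pm.span_base) auto
 then show ?thesis using XQ_sort[of "[]" "is"] assms by simp
next
 case False
 then have "\<not> distinct (map (unit_vec n :: nat => complex vec) is)" by (simp add: distinct_map)
 moreover have "map (unit_vec n) is : ext_gens n r" using assms by (auto simp: ext_gens_def)
 ultimately show ?thesis by (intro XS_XQ ext_altrel)
qed

text \<open>Entries are expanded into unit vectors one after the other from the right;
  \<open>pre\<close> holds the entries that are still arbitrary.\<close>

lemma XQ_all: assumes "vs : ext_gens n r" shows "gen vs : XQ"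
proof -
 have "gen (pre @ map (unit_vec n) is) : XQ"
  if "length pre + length is = r" "set pre <= carrier_vec n" "set is <= {..<n}" for pre "is"
  using that
 proof (induction pre arbitrary: "is" rule: rev_induct)
  case Nil
  then show ?case by (simp add: XQ_unit)
 next
  case (snoc v pre)
  let ?post = "map (unit_vec n) is"
  \<comment> \<open>The first \<open>K\<close> coordinates of \<open>v\<close>. Adding one
    coordinate at a time needs only the relation for two summands.\<close>
  define u where "u = (%K. vec n (%i. if i < K then v $ i else (0::complex)))"
  have v: "v : carrier_vec n" and pre: "set pre <= carrier_vec n" using snoc by auto
  have po: "set ?post <= carrier_vec n" by auto
  have len: "length pre + length ?post + 1 = r" using snoc by simp
  have uc: "u K : carrier_vec n" for K by (simp add: u_def)
  have "gen (pre @ u K # ?post) : XQ" if "K <= n" for K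
   using that
  proof (induction K)
   case 0
   have "u 0 = 0 \<cdot>\<^sub>v u 0" by (intro eq_vecI) (auto simp: u_def)
   then show ?case using XS_XQ[OF ext_scalerel[OF len pre po uc, of 0 0]] by (metis diff_zero pm.scale_zero_left)
  next
   case (Suc K)
   have e: "u (Suc K) = u K + (v $ K) \<cdot>\<^sub>v unit_vec n K"
    using Suc.prems by (intro eq_vecI) (auto simp: u_def less_Suc_eq)
   have 1: "gen (pre @ u (Suc K) # ?post) - gen (pre @ u K # ?post) - gen (pre @ (v $ K \<cdot>\<^sub>v unit_vec n K) # ?post) : XQ"
    unfolding e by (rule XS_XQ[OF ext_addrel[OF len pre po uc]]) simp
   have 2: "gen (pre @ (v $ K \<cdot>\<^sub>v unit_vec n K) # ?post) - pscale (v $ K) (gen (pre @ unit_vec n K # ?post)) : XQ"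
    by (rule XS_XQ[OF ext_scalerel[OF len pre po]]) simp
   have 3: "gen (pre @ unit_vec n K # ?post) : XQ"
    using snoc.IH[of "K # is"] snoc.prems Suc.prems by simp
   have 4: "gen (pre @ u K # ?post) : XQ" using Suc by simp
   from pm.subspace_add[OF XQ_sub pm.subspace_add[OF XQ_sub 1 4] pm.subspace_add[OF XQ_sub 2 pm.subspace_scale[OF XQ_sub 3, of "v $ K"]]]
   show ?case by (simp del: pscale_single)
  qed
  moreover have "u n = v" using v by (intro eq_vecI) (auto simp: u_def)
  ultimately show ?case by force
 qed
 from this[of vs "[]"] show ?thesis using assms by (auto simp: ext_gens_def)
qed

text \<open>\<open>th\<close> sends a basis form back to its increasing word, so it inverts the
  evaluation on the span of these words; the component of \<open>p\<close> in this span is therefore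
  zero.\<close>

lemma ext_kernel: assumes "keys p <= ext_gens n r" "lext (wedgev n) p = 0" shows "p : XS"
proof -
 let ?B = "{gen (map (unit_vec n) (sorted_list_of_set S)) | S. S <= {..<n} & card S = r}"
 have "p : XQ" using assms(1)
  by (induction rule: pm_sup_induct) (auto intro: XQ_all pm.subspace_0[OF XQ_sub] pm.subspace_add[OF XQ_sub] pm.subspace_scale[OF XQ_sub])
 then obtain a b where ab: "p = a + b" "a : XS" "b : pm.span ?B"
  unfolding XQ_def pm.span_Un by blast
 have a0: "lext (wedgev n) a = 0"
 proof -
  have "XS <= {p. lext (wedgev n) p = 0}"
   by (rule pm.span_minimal[OF _ subspace_plin_ker[OF plin_lext]]) (auto simp: ext_rels_zero)
  then show ?thesis using ab(2) by blast
 qed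
 define th where "th = lext (%S. gen (map (unit_vec n) (sorted_list_of_set S)) :: (complex vec list) cv)"
 have "th (lext (wedgev n) b) = b" using ab(3)
 proof (induction rule: pm.span_induct_alt)
  case (step c x y)
  then obtain S where S: "x = gen (map (unit_vec n) (sorted_list_of_set S))" "S <= {..<n}" by blast
  have "finite S" using S(2) finite_subset by blast
  then have "lext (wedgev n) x = gen S" using S by (simp add: wedgev_sorted)
  then have "th (lext (wedgev n) x) = x" using S(1) by (simp add: th_def)
  then show ?case using step plin_lext[of "%S. gen (map (unit_vec n) (sorted_list_of_set S)) :: (complex vec list) cv"]
   by (simp add: plin_simps[OF plin_lext] th_def[symmetric] plin_simps del: pscale_single)
 qed (simp add: th_def plin_simps[OF plin_lext])
 moreover have "lext (wedgev n) b = 0" using assms(2) ab(1) a0 by (simp add: plin_simps[OF plin_lext])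
 ultimately have "b = 0" by (simp add: th_def plin_simps[OF plin_lext])
 then show ?thesis using ab by simp
qed

end

definition extmap :: "nat => (complex vec list) cv set => nat set cv" where
 "extmap n = cmap (lext (wedgev n))"

lemma ext_liso: "liso (carrier_mat n n) (ext_power n r) (gact n) (extmap n) (Lam n r)"
 and wedge_carrier: "vs : ext_gens n r ==> wedge n vs : carrier (ext_power n r)"
 and extmap_wedge: "vs : ext_gens n r ==> extmap n (wedge n vs) = wedgev n vs"
proof -
 have act: "keys (ext_act A vs) <= ext_gens n r & lext (wedgev n) (ext_act A vs) = gact n A (wedgev n vs)"
  if "A : carrier_mat n n" "vs : ext_gens n r" for A vs
 proof
  have "ext_act A vs : {p. keys p <= ext_gens n r}"
   unfolding ext_act_def
  proof (rule pm.subspace_sum[OF subspace_keys])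
   fix k assume k: "k : {..<length vs}"
   have "set (vs[k := A *\<^sub>v vs ! k]) <= insert (A *\<^sub>v vs ! k) (set vs)" by (rule set_update_subset_insert)
   moreover have "vs ! k : carrier_vec n" using k that by (auto simp: ext_gens_def)
   ultimately show "gen (vs[k := A *\<^sub>v vs ! k]) : {p. keys p <= ext_gens n r}"
    using that by (auto simp: ext_gens_def)
  qed
  then show "keys (ext_act A vs) <= ext_gens n r" by simp
  show "lext (wedgev n) (ext_act A vs) = gact n A (wedgev n vs)"
   using that by (simp add: ext_act_def plin_simps[OF plin_lext] gact_wedgev ext_gens_def)
 qed
 have im: "pm.span (wedgev n ` ext_gens n r) = Lam n r"
 proof
  show "pm.span (wedgev n ` ext_gens n r) <= Lam n r"
   by (rule pm.span_minimal[OF _ subspace_Lam]) (auto simp: ext_gens_def dest: wedgev_Lam)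
  have "gen S : wedgev n ` ext_gens n r" if "S <= {..<n}" "card S = r" for S
  proof (rule image_eqI)
   have "finite S" using that finite_subset by blast
   then show "gen S = wedgev n (map (unit_vec n) (sorted_list_of_set S))" using that by (simp add: wedgev_sorted)
   show "map (unit_vec n) (sorted_list_of_set S) : ext_gens n r" using that \<open>finite S\<close> by (auto simp: ext_gens_def)
  qed
  then have "gen ` {S. S <= {..<n} & card S = r} <= wedgev n ` ext_gens n r" by auto
  from pm.span_mono[OF this] show "Lam n r <= pm.span (wedgev n ` ext_gens n r)"
   by (simp add: span_gen Lam_def)
 qed
 note solve = presented_liso[OF ext_rels_gens, where h = "wedgev n" and S = "carrier_mat n n" and f = ext_act and a = "gact n"]
 show "liso (carrier_mat n n) (ext_power n r) (gact n) (extmap n) (Lam n r)"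
  unfolding ext_power_def extmap_def im[symmetric]
  by (rule solve(1)) (erule ext_rels_zero | erule (1) ext_kernel | erule (1) act | rule plin_gact)+
 show "wedge n vs : carrier (ext_power n r)" if vs: "vs : ext_gens n r"
 proof -
  have l: "length vs = r" using vs by (simp add: ext_gens_def)
  show ?thesis unfolding ext_power_def wedge_def l
   by (rule solve(2)) (erule ext_rels_zero | erule (1) ext_kernel | erule (1) act | rule plin_gact | rule vs)+
 qed
 show "extmap n (wedge n vs) = wedgev n vs" if vs: "vs : ext_gens n r"
 proof -
  have l: "length vs = r" using vs by (simp add: ext_gens_def)
  show ?thesis unfolding extmap_def wedge_def l
   by (rule solve(3)) (erule ext_rels_zero | erule (1) ext_kernel | erule (1) act | rule plin_gact | rule vs)+
 qed
qed

section \<open>The tensor modules with exterior powers\<close>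

type_synonym mix = "(nat \<Rightarrow>\<^sub>0 nat) \<times> nat set"

text \<open>Polynomials tensor exterior algebra, with basis the pairs of an exponent and an index
  set.\<close>

definition tns :: "cpoly => nat set cv => mix cv" where
 "tns p w = lext (%al. lext (%S. gen (al, S)) w) p"

lemma plin_tns1: "plin (%p. tns p w)"
 unfolding tns_def by (rule plin_lext)

lemma plin_tns2: "plin (tns p)"
 unfolding tns_def lext_def[of _ p] by (intro plin_sumI plin_scaled plin_lext)

lemmas tns_simps1 = plin_simps[OF plin_tns1]
lemmas tns_simps2 = plin_simps[OF plin_tns2]

lemma tns_gen: "tns (gen al) (gen S) = gen (al, S)"
 by (simp add: tns_def)

lemma subspace_plin_image: assumes "plin f" "pm.subspace S" shows "pm.subspace (f ` S)"
proof -
 have e: "pm.span S = S" using assms(2) by simp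
 have "f ` S = pm.span (f ` S)" using span_plin_image[OF assms(1), of S] unfolding e .
 then show ?thesis using pm.subspace_span[of "f ` S"] by (simp only:)
qed

lemma tns_eqI:
 assumes "plin h" "plin h'" "!!p w. h (tns p w) = h' (tns p w)" shows "h z = h' z"
 by (rule plin_eqI[OF subset_UNIV assms(1,2)]) (use assms(3) tns_gen in \<open>metis surj_pair\<close>)

definition op2 :: "(cpoly => cpoly) => (nat set cv => nat set cv) => mix cv => mix cv" where
 "op2 A B = lext (%(al, S). tns (A (gen al)) (B (gen S)))"

lemma plin_op2: "plin (op2 A B)"
 unfolding op2_def by (rule plin_lext)

lemma op2_tns:
 assumes A: "plin A" and B: "plin B" shows "op2 A B (tns p w) = tns (A p) (B w)"
proof -
 have "op2 A B (tns (gen al) w) = tns (A (gen al)) (B w)" for al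
 proof (rule plin_eqI[of w UNIV])
  show "op2 A B (tns (gen al) (gen S)) = tns (A (gen al)) (B (gen S))" for S
   by (simp add: tns_gen op2_def)
 qed (auto intro: plin_comp[OF plin_op2 plin_tns2] plin_comp[OF plin_tns2 B])
 then show ?thesis
  by (intro plin_eqI[of p UNIV "%p. op2 A B (tns p w)" "%p. tns (A p) (B w)"])
   (auto intro!: plin_comp[OF plin_op2 plin_tns1] plin_comp[OF plin_tns1 A])
qed

lemma lookup_tns: "lookup (tns p w) (al, S) = lookup p al * lookup w S"
proof -
 have a: "lookup (lext (%S. gen (be, S)) w) (al, S) = (if be = al then lookup w S else 0)" for be
  by (rule pm_sup_induct[of w UNIV "%w. lookup (lext (%S. gen (be, S)) w) (al, S) = (if be = al then lookup w S else 0)"])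
   (auto simp: plin_simps[OF plin_lext] lookup_add lookup_single when_def)
 show ?thesis unfolding tns_def
  by (rule pm_sup_induct[of p UNIV "%p. lookup (lext (%al. lext (%S. gen (al, S)) w) p) (al, S) = lookup p al * lookup w S"])
   (auto simp: plin_simps[OF plin_lext] lookup_add lookup_single when_def a algebra_simps)
qed

text \<open>The right hand side of \<open>Psi_R\<close> with \<open>P0\<close> replaced by
  polynomials and \<open>M\<close> by the exterior algebra: an explicit model for the tensor modules
  with exterior powers.\<close>

definition FR :: "nat => cpoly => nat => mix cv => mix cv" where
 "FR n f j z = op2 (%p. fT n f (pvar j * p)) (%w. w) z + (\<Sum>i<n. op2 (fT n (pdiff i f)) (%w. eps i (iot j w)) z)"

lemma plin_FR: "plin (FR n f j)"
 unfolding FR_def by (intro plin_plus plin_sumI plin_op2)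

lemma plin_ei: "plin (%w. eps i (iot j w))"
 by (rule plin_comp[OF plin_eps plin_iot])

lemma FR_tns:
 assumes "f : polys n"
 shows "FR n f j (tns p w) = tns (fT n f (pvar j * p)) w + (\<Sum>i<n. tns (fT n (pdiff i f) p) (eps i (iot j w)))"
proof -
 have "plin (%p. fT n f (pvar j * p))" by (rule plin_comp[OF plin_fT[OF assms] plin_times(2)])
 moreover have "plin (fT n (pdiff i f))" for i using assms by (intro plin_fT) auto
 ultimately show ?thesis by (simp add: FR_def op2_tns plin_id plin_ei)
qed

lemma FR_1_tns: "FR n 1 j (tns p w) = tns (pvar j * p) w"
 by (simp add: FR_tns tns_simps1)

interpretation fm: vrep n "FR n" for n
proof
 show "plin (FR n f j)" for f j by (rule plin_FR)
 show "FR n (f + g) j z = FR n f j z + FR n g j z" if "f : polys n" "g : polys n" "j < n" for f g j z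
  by (rule tns_eqI[OF plin_FR plin_plus[OF plin_FR plin_FR]])
   (use that in \<open>simp add: FR_tns fT_add tns_simps1 pdiff_simps sum.distrib algebra_simps\<close>)
 show "FR n (pscale c f) j z = pscale c (FR n f j z)" if "f : polys n" "j < n" for f c j z
  by (rule tns_eqI[OF plin_FR plin_scaled[OF plin_FR]])
   (use that in \<open>simp add: FR_tns fT_scale tns_simps1 pdiff_simps pscale_simps pm.scale_sum_right\<close>)
 show "FR n f j (FR n 1 s z) = FR n 1 s (FR n f j z) - FR n (pdiff s f) j z"
  if f: "f : polys n" "j < n" "s < n" for f j s z
 proof (rule tns_eqI[where h = "%z. FR n f j (FR n 1 s z)" and h' = "%z. FR n 1 s (FR n f j z) - FR n (pdiff s f) j z"])
  show "plin (%z. FR n f j (FR n 1 s z))" by (rule plin_comp[OF plin_FR plin_FR])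
  show "plin (%z. FR n 1 s (FR n f j z) - FR n (pdiff s f) j z)"
   by (auto simp: plin_def plin_simps[OF plin_FR] pm.scale_right_diff_distrib)
  fix p w
  have c: "fT n g (pvar s * q) = pvar s * fT n g q - fT n (pdiff s g) q" if "g : polys n" for g q
   using fT_commute[OF that f(3)] .
  have 1: "pvar j * (pvar s * p) = pvar s * (pvar j * p)" by (rule mult.left_commute)
  show "FR n f j (FR n 1 s (tns p w)) = FR n 1 s (FR n f j (tns p w)) - FR n (pdiff s f) j (tns p w)"
   using f by (simp add: FR_1_tns FR_tns 1 c tns_simps1 plin_simps[OF plin_FR] sum_subtractf pdiff_commute[of _ s] add_diff_add)
 qed
qed

lemma Psi_tns: "p : polys n ==> fm.Psi n p (tns q w) = tns (p * q) w"
 by (induction rule: polys_induct)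
  (auto simp: fm.Psi_pvar FR_1_tns evp_simps tns_simps1 distrib_right pscale_mult mult.assoc)

definition FS :: "nat => nat => mix cv set" where
 "FS n r = {z. keys z <= exponents n \<times> {S. S <= {..<n} & card S = r}}"

lemma subspace_FS: "pm.subspace (FS n r)"
 unfolding FS_def by (rule subspace_keys)

lemma FS_tns: "p : polys n ==> w : Lam n r ==> tns p w : FS n r"
 by (auto simp: FS_def polys_def Lam_def in_keys_iff lookup_tns subset_iff)

lemma FS_induct [consumes 1, case_names zero add scale tns]:
 assumes "z : FS n r" "P 0" "!!p q. P p ==> P q ==> P (p + q)" "!!c p. P p ==> P (pscale c p)"
  "!!p w. p : polys n ==> w : Lam n r ==> P (tns p w)"
 shows "P z"
proof -
 have "P (gen x)" if "x : exponents n \<times> {S. S <= {..<n} & card S = r}" for x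
  using that assms(5)[of "gen (fst x)" "gen (snd x)"] by (auto simp: tns_gen Lam_gen)
 then show ?thesis using assms unfolding FS_def
  by (auto intro: pm_sup_induct[of z "exponents n \<times> {S. S <= {..<n} & card S = r}" P])
qed

lemma tns_1_inj: "tns 1 w = tns 1 w' \<longleftrightarrow> w = w'"
proof
 assume a: "tns 1 w = tns 1 w'"
 show "w = w'"
 proof (rule poly_mapping_eqI)
  fix S
  have "lookup (tns 1 w) (0, S) = lookup (tns 1 w') (0, S)" using a by simp
  then show "lookup w S = lookup w' S" by (simp add: lookup_tns lookup_one)
 qed
qed simp

abbreviation ein :: "nat => nat => mix cv => mix cv" where
 "ein i j \<equiv> op2 (%p. p) (%w. eps i (iot j w))"

lemma ein_tns: "ein i j (tns p w) = tns p (eps i (iot j w))"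
 by (simp add: op2_tns plin_id plin_ei)

lemma singular_Lam: "fm.singular n ein (tns 1 ` Lam n r)"
 unfolding fm.singular_def
proof (intro conjI allI impI ballI)
 show "pm.subspace (tns 1 ` Lam n r)"
  by (rule subspace_plin_image[OF plin_tns2 subspace_Lam])
 show "ein i j m : tns 1 ` Lam n r" if "i < n" "j < n" "m : tns 1 ` Lam n r" for i j m
  using that by (auto simp: ein_tns intro!: imageI eps_iot_Lam)
 show "FR n f j m = pscale (lookup f 0) (FR n 1 j m) + (\<Sum>i<n. pscale (lookup f (ex i)) (ein i j m - (if i = j then m else 0)))"
  if f: "f : polys n" "j < n" and m: "m : tns 1 ` Lam n r" for f j m
 proof -
  obtain w where w: "m = tns 1 w" using m by blast
  have "(\<Sum>i<n. pscale (lookup f (ex i)) (if i = j then m else 0)) = pscale (lookup f (ex j)) m"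
   using f by (simp add: if_distrib[of "pscale _"] cong: if_cong)
  moreover have "FR n f j m = pscale (lookup f 0) (tns (pvar j) w) - pscale (lookup f (ex j)) m + (\<Sum>i<n. pscale (lookup f (ex i)) (ein i j m))"
   using f fT_commute[OF f, of 1]
   by (simp add: w FR_tns ein_tns fT_one tns_simps1 lookup_pdiff_0 pscale_mult)
  ultimately show ?thesis
   by (simp add: w FR_1_tns pm.scale_right_diff_distrib sum_subtractf)
 qed
qed

lemma indep_Lam: "fm.indep n (tns 1 ` Lam n r)"
 unfolding fm.indep_def
proof (intro allI impI ballI)
 fix A x be assume A: "finite A" "A <= exponents n" "\<forall>al\<in>A. x al : tns 1 ` Lam n r" "(\<Sum>al\<in>A. fm.Dp n al (x al)) = 0" and be: "be : A"
 have "\<forall>al\<in>A. \<exists>w. x al = tns 1 w" using A(3) by auto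
 from bchoice[OF this] obtain w where w: "!!al. al : A ==> x al = tns 1 (w al)" by blast
 have "fm.Dp n al (x al) = tns (gen al) (w al)" if "al : A" for al
  using Psi_tns[of "gen al" n 1 "w al"] that A(2) by (auto simp: w evp_gen)
 then have s: "(\<Sum>al\<in>A. tns (gen al) (w al)) = 0" using A(4) by simp
 have "lookup (w be) S = 0" for S
 proof -
  have "lookup (\<Sum>al\<in>A. tns (gen al) (w al)) (be, S) = (\<Sum>al\<in>A. if al = be then lookup (w be) S else 0)"
   unfolding lookup_sum by (rule sum.cong) (auto simp: lookup_tns lookup_single when_def)
  then show ?thesis using s A(1) be by simp
 qed
 then have "w be = 0" by (intro poly_mapping_eqI) simp
 then show "x be = 0" using w[OF be] by (simp add: tns_simps2)
qed

lemma liso_comp: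
 assumes l: "liso S V a fi W" and f: "plin f" "inj_on f W" "!!x w. x : S ==> w : W ==> f (a x w) = b x (f w)"
 shows "liso S V b (%v. f (fi v)) (f ` W)"
proof -
 note lm = liso_lmap[OF l]
 have "bij_betw f W (f ` W)" using f(2) by (rule inj_on_imp_bij_betw)
 from bij_betw_trans[OF liso_bij[OF l] this] have "bij_betw (%v. f (fi v)) (carrier V) (f ` W)" by (simp add: comp_def)
 moreover have "lmap S V b (%v. f (fi v))"
  unfolding lmap_def using lmap_module[OF lm]
  by (auto simp: lmap_add[OF lm] lmap_smult[OF lm] lmap_act[OF lm] lmap_closed[OF lm] plin_simps[OF f(1)] f(3) liso_in[OF l])
 ultimately show ?thesis by (simp add: liso_def)
qed

lemma liso_mono: "liso S V a fi W ==> S' <= S ==> liso S' V a fi W"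
 unfolding liso_def lmap_def by blast

lemma liso_cong: "liso S V a fi W ==> (!!x w. x : S ==> w : W ==> a x w = b x w) ==> liso S V b fi W"
 using liso_in[of S V a fi W] unfolding liso_def lmap_def by (auto simp: bij_betw_def)

lemma mat_unit_carrier [simp]: "mat_unit n i j : carrier_mat n n"
 by (simp add: mat_unit_def)

lemma gact_mat_unit: assumes "i < n" "j < n" shows "gact n (mat_unit n i j) w = eps i (iot j w)"
proof -
 have "gact n (mat_unit n i j) w = (\<Sum>k<n. \<Sum>l<n. if k = i then (if l = j then eps i (iot j w) else 0) else 0)"
  unfolding gact_def by (intro sum.cong refl) (auto simp: mat_unit_def)
 also have "... = (\<Sum>k<n. if k = i then eps i (iot j w) else 0)"
  by (intro sum.cong refl) (use assms in auto)
 finally show ?thesis using assms by simp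
qed

abbreviation Fact :: "nat => cop => mix cv => mix cv" where
 "Fact n \<equiv> fm.dact n"

definition Fmap :: "nat => (cop set \<times> (complex vec list) cv set) cv set => mix cv" where
 "Fmap n = cmap (lext (fm.tmap n (%m. tns 1 (extmap n m))))"

text \<open>\<open>F_liso\<close> applied inside the model: the space
  \<open>1 \<otimes> \<Lambda>^r\<close> is singular and independent there, and its translates span
  all of \<open>FS n r\<close>.\<close>

lemma F_ext_liso: "liso (cDer n) (F_ext n r) (Fact n) (Fmap n) (FS n r)"
 and F_ext_tensor: "g : carrier (P0 n) ==> m : carrier (ext_power n r) ==> F_tensor n (P0 n) (ext_power n r) g m : carrier (F_ext n r)"
 and Fmap_tensor: "g : carrier (P0 n) ==> m : carrier (ext_power n r) ==> Fmap n (F_tensor n (P0 n) (ext_power n r) g m) = tns (psi n g) (extmap n m)"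
proof -
 let ?mu = "%m. tns 1 (extmap n m)"
 note E = ext_liso[of n r]
 have im: "?mu ` carrier (ext_power n r) = tns 1 ` Lam n r" using liso_image[OF E] by (metis image_image)
 have l: "liso (carrier_mat n n) (ext_power n r) (%A. op2 (%p. p) (gact n A)) ?mu (tns 1 ` Lam n r)"
  by (rule liso_comp[OF E plin_tns2]) (auto simp: inj_on_def tns_1_inj op2_tns plin_id plin_gact)
 have sing: "fm.singular n ein (?mu ` carrier (ext_power n r))" unfolding im by (rule singular_Lam)
 have l': "liso (carrier_mat n n) (ext_power n r) (%A. op2 (%p. p) (gact n A)) ?mu (?mu ` carrier (ext_power n r))" unfolding im by (rule l)
 have e: "mat_unit n i j : carrier_mat n n & op2 (%p. p) (gact n (mat_unit n i j)) (?mu m) = ein i j (?mu m)"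
  if "i < n" "j < n" "m : carrier (ext_power n r)" for i j m
  using that by (simp add: op2_tns plin_id plin_gact plin_ei gact_mat_unit)
 have ind: "fm.indep n (?mu ` carrier (ext_power n r))" unfolding im by (rule indep_Lam)
 have FL1: "liso (cDer n) (F_ext n r) (Fact n) (Fmap n) (pm.span {fm.Psi n p m |p m. p : polys n & m : ?mu ` carrier (ext_power n r)})"
  unfolding Fmap_def by (rule fm.F_liso(1)[OF sing l' _ ind]) (erule (2) e)
 have FL2: "F_tensor n (P0 n) (ext_power n r) g m : carrier (F_ext n r)" if "g : carrier (P0 n)" "m : carrier (ext_power n r)" for g m
  by (rule fm.F_liso(2)[OF sing l' _ ind that]) (erule (2) e)
 have FL3: "Fmap n (F_tensor n (P0 n) (ext_power n r) g m) = fm.Psi n (psi n g) (?mu m)" if "g : carrier (P0 n)" "m : carrier (ext_power n r)" for g m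
  unfolding Fmap_def by (rule fm.F_liso(3)[OF sing l' _ ind that]) (erule (2) e)
 have span: "pm.span {fm.Psi n p m |p m. p : polys n & m : ?mu ` carrier (ext_power n r)} = FS n r" (is "pm.span ?X = _")
 proof
  show "pm.span ?X <= FS n r" unfolding im
   by (rule pm.span_minimal[OF _ subspace_FS]) (auto simp: Psi_tns FS_tns)
  have t: "tns p w : ?X" if "p : polys n" "w : Lam n r" for p w
   unfolding im using that Psi_tns[OF that(1), of 1 w] by (intro CollectI exI[of _ p] exI[of _ "tns 1 w"]) auto
  have "z : pm.span ?X" if "z : FS n r" for z
   using that by (induction rule: FS_induct) (auto intro: pm.span_zero pm.span_add pm.span_scale pm.span_base[OF t])
  then show "FS n r <= pm.span ?X" by blast
 qed
 show "liso (cDer n) (F_ext n r) (Fact n) (Fmap n) (FS n r)"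
  using FL1 unfolding span .
 show "g : carrier (P0 n) ==> m : carrier (ext_power n r) ==> F_tensor n (P0 n) (ext_power n r) g m : carrier (F_ext n r)"
  by (rule FL2)
 show "Fmap n (F_tensor n (P0 n) (ext_power n r) g m) = tns (psi n g) (extmap n m)" if gm: "g : carrier (P0 n)" "m : carrier (ext_power n r)"
  using FL3[OF gm] Psi_tns[of "psi n g" n 1 "extmap n m"] liso_in[OF P0_liso gm(1)] by simp
qed

section \<open>The de Rham complex after Fourier transform\<close>

definition dd :: "nat => mix cv => mix cv" where
 "dd n z = (\<Sum>k<n. op2 (%p. pvar k * p) (eps k) z)"

text \<open>Contraction with the field \<open>f \<partial>_j\<close>. In \<open>dd\<close>,
  multiplication by \<open>t_k\<close> is the transform of \<open>\<partial>_k\<close>, so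
  \<open>dd\<close> is the exterior derivative.\<close>

definition inn :: "nat => cpoly => nat => mix cv => mix cv" where
 "inn n f j = op2 (fT n f) (iot j)"

lemma plin_dd: "plin (dd n)"
 unfolding dd_def by (intro plin_sumI plin_op2)

lemma plin_inn: "plin (inn n f j)"
 unfolding inn_def by (rule plin_op2)

lemma dd_tns: "dd n (tns p w) = (\<Sum>k<n. tns (pvar k * p) (eps k w))"
 by (simp add: dd_def op2_tns plin_times plin_eps)

lemma inn_tns: "f : polys n ==> inn n f j (tns p w) = tns (fT n f p) (iot j w)"
 by (simp add: inn_def op2_tns plin_fT plin_iot)

lemma dd_dd: "dd n (dd n z) = 0"
proof (rule tns_eqI[where h = "%z. dd n (dd n z)" and h' = "%z. 0"])
 fix p w
 let ?t = "%k l. tns (pvar k * (pvar l * p)) (eps k (eps l w))"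
 have A: "dd n (dd n (tns p w)) = (\<Sum>l<n. \<Sum>k<n. ?t k l)"
  by (simp add: dd_tns plin_simps[OF plin_dd])
 have e: "?t k l = - ?t l k" for k l
  using eps_eps[of k l w] by (simp add: mult.left_commute tns_simps2)
 have "(\<Sum>l<n. \<Sum>k<n. ?t k l) = (\<Sum>l<n. \<Sum>k<n. - ?t l k)" by (intro sum.cong refl e)
 also have "... = - (\<Sum>l<n. \<Sum>k<n. ?t l k)" by (simp only: sum_negf)
 also have "(\<Sum>l<n. \<Sum>k<n. ?t l k) = (\<Sum>l<n. \<Sum>k<n. ?t k l)" by (rule sum.swap)
 finally have "dd n (dd n (tns p w)) = - dd n (dd n (tns p w))" unfolding A .
 then have "pscale 2 (dd n (dd n (tns p w))) = 0" by (simp add: poly_mapping_eq_iff fun_eq_iff)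
 then show "dd n (dd n (tns p w)) = 0" by simp
qed (auto simp: plin_def plin_simps[OF plin_dd])

text \<open>Cartan's formula for the Lie derivative. Moving \<open>t_k\<close> past
  \<open>f(-\<partial>)\<close> yields the terms with \<open>\<partial>_k f\<close>; the term
  \<open>k = j\<close> of the anticommutator yields the first summand of \<open>FR\<close>.\<close>

lemma cartan:
 assumes "f : polys n" "j < n" shows "FR n f j z = dd n (inn n f j z) + inn n f j (dd n z)"
proof (rule tns_eqI[OF plin_FR])
 show "plin (%z. dd n (inn n f j z) + inn n f j (dd n z))"
  by (intro plin_plus plin_comp[OF plin_dd plin_inn] plin_comp[OF plin_inn plin_dd])
 fix p w
 have i: "iot j (eps k w) = (if k = j then w else 0) - eps k (iot j w)" for k
  using eps_iot[of k j w] by simp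
 have "inn n f j (dd n (tns p w)) = (\<Sum>k<n. tns (pvar k * fT n f p - fT n (pdiff k f) p) ((if k = j then w else 0) - eps k (iot j w)))"
  using assms by (simp add: dd_tns plin_simps[OF plin_inn] inn_tns fT_commute i)
 also have "... = (\<Sum>k<n. (if k = j then tns (pvar j * fT n f p - fT n (pdiff j f) p) w else 0)
   - tns (pvar k * fT n f p) (eps k (iot j w)) + tns (fT n (pdiff k f) p) (eps k (iot j w)))"
  by (rule sum.cong) (auto simp: tns_simps1 tns_simps2)
 also have "... = tns (fT n f (pvar j * p)) w - (\<Sum>k<n. tns (pvar k * fT n f p) (eps k (iot j w)))
   + (\<Sum>k<n. tns (fT n (pdiff k f) p) (eps k (iot j w)))"
  using assms by (simp add: sum.distrib sum_subtractf fT_commute)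
 finally show "FR n f j (tns p w) = dd n (inn n f j (tns p w)) + inn n f j (dd n (tns p w))"
  using assms by (simp add: FR_tns inn_tns dd_tns)
qed

lemma dd_FS: "z : FS n r ==> dd n z : FS n (Suc r)"
 by (induction rule: FS_induct)
  (auto simp: plin_simps[OF plin_dd] dd_tns eps_Lam intro: pm.subspace_0[OF subspace_FS] pm.subspace_add[OF subspace_FS]
   pm.subspace_scale[OF subspace_FS] intro!: pm.subspace_sum[OF subspace_FS] FS_tns)

lemma inn_FS: "z : FS n (Suc r) ==> f : polys n ==> inn n f j z : FS n r"
 by (induction rule: FS_induct)
  (auto simp: plin_simps[OF plin_inn] inn_tns iot_Lam fT_polys intro: pm.subspace_0[OF subspace_FS] pm.subspace_add[OF subspace_FS]
   pm.subspace_scale[OF subspace_FS] intro!: FS_tns)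

lemma FR_FS: "z : FS n r ==> f : polys n ==> j < n ==> FR n f j z : FS n r"
 by (induction rule: FS_induct)
  (auto simp: plin_simps[OF plin_FR] FR_tns fT_polys eps_iot_Lam intro: pm.subspace_0[OF subspace_FS] pm.subspace_add[OF subspace_FS]
   pm.subspace_scale[OF subspace_FS] intro!: FS_tns pm.subspace_sum[OF subspace_FS] pm.subspace_add[OF subspace_FS])

lemma Fact_FR: "Fact n D z = (\<Sum>j<n. FR n (D (pvar j)) j z)"
 by (simp add: fm.dact_def)

lemma Fact_dop: "j < n ==> Fact n (dop n f j) z = FR n f j z"
proof -
 assume j: "j < n"
 have "Fact n (dop n f j) z = (\<Sum>k<n. if k = j then FR n f j z else 0)"
  unfolding Fact_FR using j by (intro sum.cong refl) (auto simp: dop_pvar fm.R_0)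
 then show ?thesis using j by simp
qed

lemma dd_image_subspace: "pm.subspace (dd n ` FS n r)"
 by (rule subspace_plin_image[OF plin_dd subspace_FS])

lemma FR_dd_image: assumes "z : dd n ` FS n r" "f : polys n" "j < n" shows "FR n f j z : dd n ` FS n r"
proof -
 obtain y where y: "z = dd n y" "y : FS n r" using assms(1) by blast
 have "FR n f j z = dd n (inn n f j z)"
  using cartan[OF assms(2,3), of z] by (simp add: y dd_dd plin_simps[OF plin_inn])
 then show ?thesis using inn_FS[OF dd_FS[OF y(2)] assms(2), of j] y by blast
qed

text \<open>On a closed form Cartan's formula leaves only the exact term.\<close>

lemma FR_ker_dd: assumes "z : FS n (Suc r)" "dd n z = 0" "f : polys n" "j < n" shows "FR n f j z : dd n ` FS n r"
 using cartan[OF assms(3,4), of z] inn_FS[OF assms(1,3)] assms(2) by (simp add: plin_simps[OF plin_inn])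

text \<open>The spanning elements of \<open>Ln\<close> are differentials of pure tensors with a
  wedge of unit vectors, and these tensors span \<open>FS n (r - 1)\<close>; so \<open>Ln\<close> is
  the image of the differential.\<close>

lemma Ln_carrier: "Ln n r <= carrier (F_ext n r)"
 and Ln_image: "0 < r ==> Fmap n ` Ln n r = dd n ` FS n (r - 1)"
proof -
 note l = F_ext_liso[of n r] and lP = P0_liso[of n]
 note lm = liso_lmap[OF l]
 interpret M: module CC "F_ext n r" by (rule lmap_module[OF lm])
 define G where "G = (%p is. \<Oplus>\<^bsub>F_ext n r\<^esub> k \<in> {..<n}. F_tensor n (P0 n) (ext_power n r) (act (P0 n) (diff_op n k) p)
     (wedge n (unit_vec n k # map (unit_vec n) is)))"
 have G: "G p is : carrier (F_ext n r) & Fmap n (G p is) = dd n (tns (psi n p) (wedgev n (map (unit_vec n) is)))"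
  if "0 < r" "p : carrier (P0 n)" "length is = r - 1" "set is <= {..<n}" for p "is"
 proof -
  have g: "unit_vec n k # map (unit_vec n) is : ext_gens n r" if "k < n" for k
   using that \<open>0 < r\<close> \<open>length is = r - 1\<close> by (auto simp: ext_gens_def)
  have a: "act (P0 n) (diff_op n k) p : carrier (P0 n)" "psi n (act (P0 n) (diff_op n k) p) = pvar k * psi n p" if "k < n" for k
   using lmap_closed[OF liso_lmap[OF lP] diff_op_weyl[OF that] \<open>p : _\<close>] lmap_act[OF liso_lmap[OF lP] diff_op_weyl[OF that] \<open>p : _\<close>]
   by (auto simp: hat_diff_op[OF that])
  have c: "F_tensor n (P0 n) (ext_power n r) (act (P0 n) (diff_op n k) p) (wedge n (unit_vec n k # map (unit_vec n) is)) : carrier (F_ext n r)"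
   if "k < n" for k using F_ext_tensor[OF a(1)[OF that] wedge_carrier[OF g[OF that]]] .
  have "Fmap n (G p is) = (\<Sum>k<n. tns (pvar k * psi n p) (eps k (wedgev n (map (unit_vec n) is))))"
   unfolding G_def by (subst lmap_finsum[OF lm]) (auto simp: c Fmap_tensor[OF a(1) wedge_carrier[OF g]] a extmap_wedge[OF g] wedgev_def epsv_unit)
  moreover have "G p is : carrier (F_ext n r)" unfolding G_def using c by (intro M.finsum_closed) auto
  ultimately show ?thesis by (simp add: dd_tns)
 qed
 let ?G = "{G p is | p is. p : carrier (P0 n) & length is = r - 1 & set is <= {..<n}}"
 have Ln: "Ln n r = (if r = 0 then {\<zero>\<^bsub>F_ext n r\<^esub>} else vspan (F_ext n r) ?G)"
  by (simp add: Ln_def G_def)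
 have Gc: "?G <= carrier (F_ext n r)" if "0 < r" using G[OF that] by auto
 show "Ln n r <= carrier (F_ext n r)"
  using vspan_submodule[OF lmap_module[OF lm] Gc] M.zero_closed unfolding Ln submodule_CC_iff[OF lmap_module[OF lm]]
  by (cases "r = 0") simp_all
 show "Fmap n ` Ln n r = dd n ` FS n (r - 1)" if r: "0 < r"
 proof -
  let ?T = "{tns q (wedgev n (map (unit_vec n) is)) | q is. q : polys n & length is = r - 1 & set is <= {..<n}}"
  have "Fmap n ` ?G = dd n ` ?T"
  proof (intro equalityI subsetI)
   fix z assume "z : Fmap n ` ?G"
   then show "z : dd n ` ?T" using G[OF r] liso_in[OF lP] by fastforce
  next
   fix z assume "z : dd n ` ?T"
   then obtain q "is" where q: "z = dd n (tns q (wedgev n (map (unit_vec n) is)))" "q : polys n" "length is = r - 1" "set is <= {..<n}" by blast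
   have "q : psi n ` carrier (P0 n)" using q(2) liso_image[OF lP] by simp
   then obtain p where "p : carrier (P0 n)" "psi n p = q" by auto
   then show "z : Fmap n ` ?G" using G[OF r, of p "is"] q by (intro image_eqI[of _ _ "G p is"]) auto
  qed
  moreover have "pm.span ?T = FS n (r - 1)"
  proof
   show "pm.span ?T <= FS n (r - 1)"
   proof (rule pm.span_minimal[OF _ subspace_FS])
    have "wedgev n (map (unit_vec n) is) : Lam n (r - 1)" if "length is = r - 1" for "is"
    proof -
     have "set (map (unit_vec n) is :: complex vec list) <= carrier_vec n" by auto
     from wedgev_Lam[OF this] that show ?thesis by simp
    qed
    then show "?T <= FS n (r - 1)" by (auto intro!: FS_tns)
   qed
   have "gen x : ?T" if "x : exponents n \<times> {S. S <= {..<n} & card S = r - 1}" for x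
   proof -
    have fin: "finite (snd x)" using that finite_subset[of "snd x" "{..<n}"] by auto
    have "gen x = tns (gen (fst x)) (wedgev n (map (unit_vec n) (sorted_list_of_set (snd x))))"
     using that fin by (subst wedgev_sorted) (auto simp: tns_gen)
    then show ?thesis using that fin by (intro CollectI exI[of _ "gen (fst x)"] exI[of _ "sorted_list_of_set (snd x)"]) auto
   qed
   then have "gen ` (exponents n \<times> {S. S <= {..<n} & card S = r - 1}) <= ?T" by blast
   from pm.span_mono[OF this] show "FS n (r - 1) <= pm.span ?T" by (simp only: span_gen FS_def)
  qed
  ultimately show ?thesis
   using liso_vspan[OF l Gc[OF r]] span_plin_image[OF plin_dd, of n ?T] r by (simp add: Ln)
 qed
qed

lemma FS_0_bij: "tns p (gen {}) = tns q (gen {}) \<longleftrightarrow> p = q"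
proof
 assume a: "tns p (gen {}) = tns q (gen {})"
 show "p = q"
 proof (rule poly_mapping_eqI)
  fix al
  have "lookup (tns p (gen {})) (al, {}) = lookup (tns q (gen {})) (al, {})" using a by simp
  then show "lookup p al = lookup q al" by (simp add: lookup_tns)
 qed
qed simp

lemma F_ext_0_P0: "lie_module_iso (Der n) (F_ext n 0) (P0 n)"
proof (rule liso_trans)
 show "liso (cDer n) (F_ext n 0) (Fact n) (Fmap n) (FS n 0)" by (rule F_ext_liso)
 have im: "(%p. tns p (gen {})) ` polys n = FS n 0"
 proof
  show "(%p. tns p (gen {})) ` polys n <= FS n 0" by (auto intro!: FS_tns simp: Lam_gen)
  have s: "pm.subspace ((%p. tns p (gen {})) ` polys n)"
   by (rule subspace_plin_image[OF plin_tns1 subspace_polys])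
  have t: "tns p w : (%p. tns p (gen {})) ` polys n" if "p : polys n" "w : Lam n 0" for p w
   using that(2)
  proof (induction rule: Lam_induct)
   case (gen S)
   then have "S = {}" using finite_subset by fastforce
   then show ?case using that(1) by blast
  qed (auto simp: tns_simps2 intro: pm.subspace_0[OF s] pm.subspace_add[OF s] pm.subspace_scale[OF s])
  have "z : (%p. tns p (gen {})) ` polys n" if "z : FS n 0" for z
   using that by (induction rule: FS_induct) (auto intro: t pm.subspace_0[OF s] pm.subspace_add[OF s] pm.subspace_scale[OF s])
  then show "FS n 0 <= (%p. tns p (gen {})) ` polys n" by blast
 qed
 have "liso (cDer n) (P0 n) (Fact n) (%g. tns (psi n g) (gen {})) ((%p. tns p (gen {})) ` polys n)"
 proof (rule liso_comp[OF liso_mono[OF P0_liso] plin_tns1])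
  show "cDer n <= weyl_ops n" by (auto intro: Der_weyl)
  show "inj_on (%p. tns p (gen {})) (polys n)" by (auto simp: inj_on_def FS_0_bij)
  show "tns (hat n D p) (gen {}) = Fact n D (tns p (gen {}))" if "D : cDer n" "p : polys n" for D p
   using that Der_polys[OF that(1)]
   by (simp add: hat_Der Fact_FR FR_tns iot_single eps_simps tns_simps1 tns_simps2)
 qed
 then show "liso (cDer n) (P0 n) (Fact n) (%g. tns (psi n g) (gen {})) (FS n 0)" by (simp only: im)
qed

lemma lookup_dd_0: "lookup (dd n z) (0, S) = 0"
proof (rule pm_sup_induct[of z UNIV "%z. lookup (dd n z) (0, S) = 0"])
 fix x :: mix
 obtain al T where x: "x = (al, T)" by force
 show "lookup (dd n (gen x)) (0, S) = 0"
  unfolding x tns_gen[symmetric] dd_tns lookup_sum by (intro sum.neutral) (simp add: lookup_tns lookup_pvar_times_0)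
qed (auto simp: plin_simps[OF plin_dd] lookup_add)

text \<open>In top degree only the volume form with constant coefficient is missed: a monomial of
  nonzero exponent contains some \<open>t_i\<close>, and removing \<open>i\<close> from the volume
  form gives a preimage up to sign.\<close>

lemma top_dd:
 assumes "n \<ge> 1" shows "dd n ` FS n (n - 1) = {z : FS n n. lookup z (0, {..<n}) = 0}"
proof
 show "dd n ` FS n (n - 1) <= {z : FS n n. lookup z (0, {..<n}) = 0}"
  using dd_FS[of _ n "n - 1"] assms by (auto simp: lookup_dd_0)
 show "{z : FS n n. lookup z (0, {..<n}) = 0} <= dd n ` FS n (n - 1)"
 proof clarify
  fix z assume z: "z : FS n n" "lookup z (0, {..<n}) = 0"
  have full: "S = {..<n}" if "S <= {..<n}" "card S = n" for S
   using that card_subset_eq[of "{..<n}" S] by simp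
  have "keys z <= {(al, {..<n}) | al. al : exponents n & al ~= 0}"
  proof
   fix x assume x: "x : keys z"
   obtain al S where xs: "x = (al, S)" by force
   have "al : exponents n" "S <= {..<n}" "card S = n" using z(1) x xs by (auto simp: FS_def)
   then have "S = {..<n}" by (intro full)
   with xs \<open>al : exponents n\<close> show "x : {(al, {..<n}) | al. al : exponents n & al ~= 0}" using x z(2) by (auto simp: in_keys_iff)
  qed
  then show "z : dd n ` FS n (n - 1)"
  proof (induction rule: pm_sup_induct)
   case (gen x)
   then obtain al where al: "x = (al, {..<n})" "al : exponents n" "al ~= 0" by blast
   then obtain i be where i: "i < n" "be : exponents n" "al = be + ex i" using exponents_cases by blast
   let ?T = "{..<n} - {i}"
   have t: "tns (pvar k * gen be) (eps k (gen ?T)) = (if k = i then pscale (sg i {..<n}) (gen x) else 0)" if "k < n" for k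
   proof (cases "k = i")
    case True
    have "eps i (gen ?T) = pscale (sg i {..<n}) (gen {..<n})"
     using i(1) by (simp add: eps_single sg_remove insert_absorb)
    moreover have "pvar i * gen be = gen al" by (simp add: pvar_def gen_times i(3) add.commute)
    ultimately show ?thesis using True al(1) by (simp add: tns_simps2 tns_gen del: pscale_single)
   next
    case False
    then show ?thesis using that by (simp add: eps_single tns_simps2)
   qed
   have "dd n (tns (gen be) (gen ?T)) = pscale (sg i {..<n}) (gen x)"
    using i(1) by (simp add: dd_tns t del: pscale_single)
   then have "dd n (pscale (sg i {..<n}) (tns (gen be) (gen ?T))) = gen x"
    using sg_sq[of i "{..<n}"] by (simp add: plin_simps[OF plin_dd])
   moreover have "tns (gen be) (gen ?T) : FS n (n - 1)"
    using i by (intro FS_tns) (auto simp: Lam_gen)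
   then have "pscale (sg i {..<n}) (tns (gen be) (gen ?T)) : FS n (n - 1)"
    by (rule pm.subspace_scale[OF subspace_FS])
   ultimately show ?case by (metis image_eqI)
  qed (auto intro: pm.subspace_0[OF dd_image_subspace] pm.subspace_add[OF dd_image_subspace] pm.subspace_scale[OF dd_image_subspace])
 qed
qed

lemma FS_beyond: "r > n ==> z : FS n r ==> z = 0"
proof -
 assume r: "r > n" "z : FS n r"
 have "False" if "S <= {..<n}" "card S = r" for S using card_mono[OF _ that(1)] that(2) r(1) by simp
 then have "{S. S <= {..<n} & card S = r} = {}" by blast
 then have "keys z = {}" using r(2) unfolding FS_def by (simp only: mem_Collect_eq Sigma_empty2 subset_empty)
 then show ?thesis by (simp add: poly_mapping_eq_iff fun_eq_iff in_keys_iff set_eq_iff)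
qed

lemma Ln_member: assumes "n \<ge> 1" shows "Ln n n = {z : carrier (F_ext n n). lookup (Fmap n z) (0, {..<n}) = 0}"
proof -
 note l = F_ext_liso[of n n]
 have im: "Fmap n ` Ln n n = {z : FS n n. lookup z (0, {..<n}) = 0}" using Ln_image[of n n] top_dd[OF assms] assms by simp
 show ?thesis
 proof (intro equalityI subsetI)
  fix z assume "z : Ln n n"
  then show "z : {z : carrier (F_ext n n). lookup (Fmap n z) (0, {..<n}) = 0}" using im Ln_carrier by blast
 next
  fix z assume z: "z : {z : carrier (F_ext n n). lookup (Fmap n z) (0, {..<n}) = 0}"
  then have "Fmap n z : Fmap n ` Ln n n" unfolding im using liso_in[OF l] by blast
  then obtain y where "y : Ln n n" "Fmap n z = Fmap n y" by blast
  then show "z : Ln n n" using liso_inj[OF l, of z y] z Ln_carrier by blast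
 qed
qed

text \<open>The coefficient of the volume form at exponent 0 is a functional with kernel
  \<open>Ln n n\<close>. In top degree every form is closed, so fields produce exact forms, on which
  the functional vanishes.\<close>

lemma Ln_top_one_dimensional: assumes "n \<ge> 1" shows "one_dimensional (quot_module (F_ext n n) (Ln n n))"
proof -
 note l = F_ext_liso[of n n]
 note lm = liso_lmap[OF l]
 \<comment> \<open>A scalar is encoded as a function on the unit type, so that the quotient lemma
   applies to a target of dimension one.\<close>
 define ph where "ph = (%z. single () (lookup (Fmap n z) (0, {..<n})))"
 have tr: "lookup (Fact n D z) (0, {..<n}) = 0" if "D : cDer n" "z : FS n n" for D z
 proof -
  have "dd n z = 0" using FS_beyond[of n "Suc n"] dd_FS[OF that(2)] by simp
  then have "lookup (FR n (D (pvar j)) j z) (0, {..<n}) = 0" if "j < n" for j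
   using cartan[of "D (pvar j)" n j z] that Der_polys[OF \<open>D : _\<close>] by (simp add: plin_simps[OF plin_inn] lookup_dd_0)
  then show ?thesis by (simp add: Fact_FR lookup_sum)
 qed
 have lp: "lmap (cDer n) (F_ext n n) (%_ _. 0) ph"
  unfolding lmap_def using lmap_module[OF lm]
  by (auto simp: ph_def lmap_add[OF lm] lmap_smult[OF lm] lmap_act[OF lm] lmap_closed[OF lm] lookup_add single_add tr liso_in[OF l])
 have N: "Ln n n = {z : carrier (F_ext n n). ph z = 0}"
  unfolding Ln_member[OF assms] ph_def by (auto simp: poly_mapping_eq_iff fun_eq_iff)
 note q = quot_liso[OF lp N]
 let ?Q = "quot_module (F_ext n n) (Ln n n)"
 have "gen (0, {..<n}) : FS n n" by (simp add: FS_def)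
 then have "gen (0, {..<n}) : Fmap n ` carrier (F_ext n n)" using liso_image[OF l] by simp
 then obtain z where z: "z : carrier (F_ext n n)" "Fmap n z = gen (0, {..<n})" by auto
 let ?v = "Ln n n +>\<^bsub>F_ext n n\<^esub> z"
 have v: "?v : carrier ?Q" "cmap ph ?v = gen ()" using q(2,3)[OF z(1)] z by (auto simp: ph_def)
 interpret Q: module CC ?Q using lmap_module[OF liso_lmap[OF q(1)]] .
 note qm = liso_lmap[OF q(1)]
 show ?thesis unfolding one_dimensional_def
 proof (rule bexI[OF _ v(1)], intro conjI)
  show "?v ~= \<zero>\<^bsub>?Q\<^esub>"
  proof
   assume "?v = \<zero>\<^bsub>?Q\<^esub>"
   then have "(gen () :: unit cv) = 0" using v(2) lmap_zero[OF qm] by simp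
   then have "lookup (gen () :: unit cv) () = 0" by simp
   then show False by simp
  qed
  show "carrier ?Q = {c \<odot>\<^bsub>?Q\<^esub> ?v |c. True}"
  proof (intro equalityI subsetI)
   fix u assume u: "u : carrier ?Q"
   have "cmap ph u = cmap ph (lookup (cmap ph u) () \<odot>\<^bsub>?Q\<^esub> ?v)"
    using v by (auto simp: lmap_smult[OF qm] poly_mapping_eq_iff fun_eq_iff)
   then have "u = lookup (cmap ph u) () \<odot>\<^bsub>?Q\<^esub> ?v" using liso_inj[OF q(1) u] v Q.smult_closed by auto
   then show "u : {c \<odot>\<^bsub>?Q\<^esub> ?v |c. True}" by blast
  next
   fix u assume "u : {c \<odot>\<^bsub>?Q\<^esub> ?v |c. True}"
   then show "u : carrier ?Q" using v Q.smult_closed by auto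
  qed
 qed
qed

section \<open>Representations of the general linear Lie algebra\<close>

definition glrep :: "nat => (nat => nat => 'x cv => 'x cv) => bool" where
 "glrep n e \<longleftrightarrow> (\<forall>i<n. \<forall>j<n. plin (e i j)) & (\<forall>i<n. \<forall>j<n. \<forall>k<n. \<forall>l<n. \<forall>u.
   e i j (e k l u) = e k l (e i j u) + (if j = k then e i l u else 0) - (if l = i then e k j u else 0))"

text \<open>These quadratic elements act by zero on the exterior powers of the natural representation.\<close>

definition TT :: "(nat => nat => 'x cv => 'x cv) => nat => nat => nat => nat => 'x cv => 'x cv" where
 "TT e k l i j u = e k i (e l j u) + e l i (e k j u) - (if i = l then e k j u else 0) - (if i = k then e l j u else 0)"

definition Tkilled :: "nat => (nat => nat => 'x cv => 'x cv) => 'x cv => bool" where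
 "Tkilled n e u \<longleftrightarrow> (\<forall>k<n. \<forall>l<n. \<forall>i<n. \<forall>j<n. TT e k l i j u = 0)"

lemma glrep_plin: "glrep n e ==> i < n ==> j < n ==> plin (e i j)"
 by (simp add: glrep_def)

lemma glrep_comm: "glrep n e ==> i < n ==> j < n ==> k < n ==> l < n ==>
   e i j (e k l u) = e k l (e i j u) + (if j = k then e i l u else 0) - (if l = i then e k j u else 0)"
 unfolding glrep_def by blast

lemma plin_TT: "glrep n e ==> k < n ==> l < n ==> i < n ==> j < n ==> plin (TT e k l i j)"
 unfolding plin_def TT_def
 by (auto simp: plin_simps[OF glrep_plin] pscale_simps pm.scale_right_diff_distrib)

lemma Tkilled_subspace: "glrep n e ==> pm.subspace {u. Tkilled n e u}"
 unfolding Tkilled_def pm.subspace_def by (auto simp: plin_simps[OF plin_TT])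

text \<open>The elements \<open>TT\<close> transform as a tensor, the commutator acting on the four
  indices one at a time. Hence the vectors killed by all of them form a submodule.\<close>

lemma TT_comm:
 assumes g: "glrep n e" and i: "k < n" "l < n" "i < n" "j < n" "p < n" "s < n"
 shows "e p s (TT e k l i j u) = TT e k l i j (e p s u) + (if s = k then TT e p l i j u else 0)
  + (if s = l then TT e k p i j u else 0) - (if p = i then TT e k l s j u else 0) - (if p = j then TT e k l i s u else 0)"
proof -
 define del :: "nat => nat => complex" where "del = (%a b. if a = b then 1 else 0)"
 have d: "(if a = b then v else 0) = pscale (del a b) v" for a b and v :: "'a cv"
  by (simp add: del_def)
 have T: "TT e k l i j v = e k i (e l j v) + e l i (e k j v) - pscale (del i l) (e k j v) - pscale (del i k) (e l j v)" for k l i j v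
  by (simp add: TT_def d)
 have c: "e p s (e a b v) = e a b (e p s v) + pscale (del s a) (e p b v) - pscale (del b p) (e a s v)" if "a < n" "b < n" for a b v
  using glrep_comm[OF g i(5,6) that, of v] by (simp add: d)
 have ds: "del a b = del b a" for a b by (simp add: del_def)
 note pl = plin_simps[OF glrep_plin[OF g]]
 show ?thesis
  unfolding d T using i
  by (simp add: c pl pscale_simps pm.scale_right_diff_distrib algebra_simps ds[of l s] ds[of k s] ds[of p i] ds[of p j] ds[of p k] ds[of p l] ds[of s i])
qed

lemma Tkilled_stable:
 assumes g: "glrep n e" and u: "Tkilled n e u" and ps: "p < n" "s < n" shows "Tkilled n e (e p s u)"
 unfolding Tkilled_def
proof (intro allI impI)
 fix k l i j assume i: "k < n" "l < n" "i < n" "j < n"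
 have z: "TT e k l i j u = 0" if "k < n" "l < n" "i < n" "j < n" for k l i j using u that by (simp add: Tkilled_def)
 show "TT e k l i j (e p s u) = 0"
  using i ps TT_comm[OF g i ps, of u] by (simp add: z plin_simps[OF glrep_plin[OF g]] split: if_splits)
qed

section \<open>The general linear algebra acting on \<open>filt 1\<close>\<close>

context smooth_drep
begin

text \<open>The fields \<open>t_i \<partial>_j\<close> satisfy the bracket relations of matrix
  units; adding the identity for \<open>i = j\<close> preserves them and matches the shift in
  \<open>singular\<close>.\<close>

definition ee :: "nat => nat => 'x cv => 'x cv" where
 "ee i j u = R (pvar i) j u + (if i = j then u else 0)"

lemma glrep_ee: "glrep n ee"
 unfolding glrep_def
proof (intro conjI allI impI)
 show "plin (ee i j)" if "i < n" "j < n" for i j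
  unfolding plin_def ee_def using that by (auto simp: R_simps pscale_simps)
 show "ee i j (ee k l u) = ee k l (ee i j u) + (if j = k then ee i l u else 0) - (if l = i then ee k j u else 0)"
  if i: "i < n" "j < n" "k < n" "l < n" for i j k l u
  using i R_bracket[of "pvar i" "pvar k" j l u]
  by (auto simp: ee_def R_simps pdiff_pvar R_0 if_distrib[of "%x. _ * x"] algebra_simps cong: if_cong)
qed

lemma ee_stable: "stable 1 N ==> i < n ==> j < n ==> u : N ==> ee i j u : N"
 unfolding ee_def
 by (intro pm.subspace_add[OF stable_subspace]) (auto simp: stableD[OF _ ordge_pvar] pm.subspace_0[OF stable_subspace])

text \<open>Monomials of degree at least 2 kill \<open>filt 1\<close>, so a field acts through its
  Taylor expansion up to order one.\<close>

lemma R_filt1: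
 assumes "f : polys n" "j < n" "m : filt 1"
 shows "R f j m = pscale (lookup f 0) (R 1 j m) + (\<Sum>i<n. pscale (lookup f (ex i)) (R (pvar i) j m))"
proof -
 have "keys f <= exponents n" using assms(1) by (simp add: polys_def)
 then have "f : polys n & R f j m = pscale (lookup f 0) (R 1 j m) + (\<Sum>i<n. pscale (lookup f (ex i)) (R (pvar i) j m))"
 proof (induction rule: pm_sup_induct)
  case (gen al)
  have inj: "ex i = ex k \<longleftrightarrow> i = k" for i k by (metis lookup_single_eq lookup_single_not_eq zero_neq_one)
  have nz: "ex i ~= 0" for i by (metis lookup_single_eq lookup_zero zero_neq_one)
  consider "al = 0" | i where "i < n" "al = ex i" | "2 <= deg n al"
  proof (cases "al = 0")
   case False
   then obtain i be where b: "i < n" "be : exponents n" "al = be + ex i" using exponents_cases gen by blast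
   show ?thesis
   proof (cases "be = 0")
    case True then show ?thesis using b that(2) by simp
   next
    case False
    then have "deg n be ~= 0" using deg_eq_0[OF b(2)] by simp
    then show ?thesis using b that(3) by (simp add: deg_add)
   qed
  qed (use that(1) in simp)
  then show ?case
  proof cases
   case 1
   have "ex i ~= 0" for i by (rule nz)
   then show ?thesis using 1 by (simp add: lookup_one)
  next
   case (2 i)
   have "(\<Sum>k<n. pscale (lookup (gen al) (ex k)) (R (pvar k) j m)) = (\<Sum>k<n. if k = i then R (pvar i) j m else 0)"
    by (intro sum.cong) (auto simp: 2 lookup_single when_def inj)
   then show ?thesis using 2 gen nz[of i] by (simp add: pvar_def lookup_single when_def)
  next
   case 3
   have "R (gen al) j m = 0" by (rule filt_kill[OF assms(3) ordge_gen assms(2)]) (use 3 gen in auto)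
   moreover have "al ~= 0" "al ~= ex k" if "k < n" for k using 3 that by auto
   moreover have "al ~= 0" using 3 by auto
   ultimately show ?thesis using gen by (auto simp: lookup_single when_def intro!: sum.neutral)
  qed
 qed (use assms(2) in \<open>auto simp: R_0 R_add R_scale lookup_add pscale_simps sum.distrib pm.scale_sum_right\<close>)
 then show ?thesis by blast
qed

lemma singular_filt1: assumes "stable 1 N" "N <= filt 1" shows "singular ee N"
 unfolding singular_def
proof (intro conjI allI impI ballI)
 show "pm.subspace N" by (rule stable_subspace[OF assms(1)])
 show "ee i j m : N" if "i < n" "j < n" "m : N" for i j m using ee_stable[OF assms(1) that] .
 show "R f j m = pscale (lookup f 0) (R 1 j m) + (\<Sum>i<n. pscale (lookup f (ex i)) (ee i j m - (if i = j then m else 0)))"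
  if "f : polys n" "j < n" "m : N" for f j m
  using R_filt1[of f j m] that assms(2) by (auto simp: ee_def)
qed

text \<open>Higher Taylor coefficients act by zero, so the linear fields decide stability.\<close>

lemma stable1_filt1:
 assumes "pm.subspace N" "N <= filt 1" "!!i j u. i < n ==> j < n ==> u : N ==> ee i j u : N"
 shows "stable 1 N"
 unfolding stable_def
proof (intro conjI assms(1) allI impI)
 fix f j u assume f: "ordge n 1 f" "j < n" "u : N"
 have r: "R (pvar i) j u : N" if "i < n" for i
  using pm.subspace_diff[OF assms(1) assms(3)[OF that f(2,3)], of "if i = j then u else 0"] f(3) pm.subspace_0[OF assms(1)]
  by (auto simp: ee_def split: if_splits)
 have "lookup f 0 = 0"
 proof (rule ccontr)
  assume "lookup f 0 ~= 0"
  then have "0 : keys f" by (simp add: in_keys_iff)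
  then show False using f(1) by (force simp: ordge_def)
 qed
 then have "R f j u = (\<Sum>i<n. pscale (lookup f (ex i)) (R (pvar i) j u))"
  using R_filt1[OF ordge_polys[OF f(1)] f(2), of u] f(3) assms(2) by auto
 then show "R f j u : N" using r by (auto intro!: pm.subspace_sum[OF assms(1)] pm.subspace_scale[OF assms(1)])
qed

text \<open>An alternating sum over the ways of distributing \<open>t_k\<close> and
  \<open>t_l\<close> between two fields. In the commutator with \<open>\<partial>_s\<close> the
  terms that differentiate \<open>t_k\<close> or \<open>t_l\<close> cancel, and only
  \<open>f\<close> is differentiated; so \<open>f\<close> can serve as a test function against a
  relation between translates.\<close>

definition Om :: "nat => nat => nat => nat => cpoly => 'x cv => 'x cv" where
 "Om k l i j f u = R f i (R (pvar k * pvar l) j u) - R (pvar k * f) i (R (pvar l) j u)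
   - R (pvar l * f) i (R (pvar k) j u) + R (pvar k * pvar l * f) i (R 1 j u)"

context
 fixes k l i j :: nat
 assumes klij: "k < n" "l < n" "i < n" "j < n"
begin

lemma plin_Om: "f : polys n ==> plin (Om k l i j f)"
 unfolding plin_def Om_def using klij by (simp add: R_simps pscale_simps pm.scale_right_diff_distrib algebra_simps)

lemma Om_lin: "f : polys n ==> g : polys n ==> Om k l i j (f + g) u = Om k l i j f u + Om k l i j g u"
 "f : polys n ==> Om k l i j (pscale c f) u = pscale c (Om k l i j f u)" "Om k l i j 0 u = 0"
 using klij by (simp_all add: Om_def R_add R_scale R_0 distrib_left pscale_mult pscale_simps pm.scale_right_diff_distrib)

lemma Om_comm:
 assumes f: "f : polys n" and s: "s < n"
 shows "Om k l i j f (R 1 s u) = R 1 s (Om k l i j f u) - Om k l i j (pdiff s f) u"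
proof -
 have c: "R g a (R h b (R 1 t u)) = R 1 t (R g a (R h b u)) - R (pdiff t g) a (R h b u) - R g a (R (pdiff t h) b u)"
  if "g : polys n" "h : polys n" "a < n" "b < n" "t < n" for g h a b t
  using that by (simp add: R_comm R_simps)
 have two: "R (2 * pvar k) j u = R (pvar k) j u + R (pvar k) j u"
  unfolding mult_2 using klij by (intro R_add) auto
 have Rd: "R (pvar a * (f + pvar b * pdiff b f)) i v = R (pvar a * f) i v + R (pvar a * (pvar b * pdiff b f)) i v"
  if "a < n" "b < n" for a b v
  using that klij f R_add[of "pvar a * f" "pvar a * (pvar b * pdiff b f)" i v] by (simp add: distrib_left)
 show ?thesis unfolding Om_def using klij s f
  by (cases "s = k"; cases "s = l"; simp add: c[of _ _ _ _ s] c[of _ _ _ _ k] c[of _ _ _ _ l] two Rd R_simps R_0 R_add pdiff_mult pdiff_pvar mult.assoc)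
qed

text \<open>When \<open>f\<close> vanishes at the origin, each summand contains a field of order at
  least 2 that either acts on \<open>filt 1\<close> directly or still has order at least 2 after
  passing a constant field.\<close>

lemma Om_filt_ord: assumes "m : filt 1" "ordge n 1 f" shows "Om k l i j f m = 0"
proof -
 have p: "ordge n 1 (pvar a)" if "a < n" for a by (rule ordge_pvar[OF that])
 have f: "f : polys n" by (rule ordge_polys[OF assms(2)])
 have kl: "ordge n 2 (pvar k * pvar l)" using ordge_mult[OF p[OF klij(1)] p[OF klij(2)]] by simp
 have 1: "R (pvar k * pvar l) j m = 0" using filt_kill[OF assms(1), of "pvar k * pvar l" j] kl klij by simp
 have g: "R (pvar a) j m : filt 1" if "a < n" for a using stableD[OF filt_stable p[OF that] klij(4) assms(1)] .
 have 2: "R (pvar a * f) i (R (pvar b) j m) = 0" if "a < n" "b < n" for a b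
  using filt_kill[OF g[OF that(2)], of "pvar a * f" i] ordge_mult[OF p[OF that(1)] assms(2)] klij by simp
 have o: "ordge n 3 (pvar k * pvar l * f)" using ordge_mult[OF kl assms(2)] by simp
 have "R (pvar k * pvar l * f) i (R 1 j m) = R 1 j (R (pvar k * pvar l * f) i m) - R (pdiff j (pvar k * pvar l * f)) i m"
  using klij f by (intro R_comm) auto
 also have "R (pvar k * pvar l * f) i m = 0" using filt_kill[OF assms(1) ordge_mono[OF o] klij(3)] by simp
 also have "R (pdiff j (pvar k * pvar l * f)) i m = 0" using filt_kill[OF assms(1) ordge_mono[OF ordge_pdiff[OF o]] klij(3)] by simp
 finally show ?thesis using klij 1 2 f by (simp add: Om_def R_simps)
qed

text \<open>With the constant test function the sum collapses to the quadratic element; its lower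
  order terms come from passing the constant field and from the shift in \<open>ee\<close>.\<close>

lemma Om_filt_1: assumes "m : filt 1" shows "Om k l i j 1 m = - TT ee k l i j m"
proof -
 have kl: "ordge n 2 (pvar k * pvar l)" using ordge_mult[OF ordge_pvar[OF klij(1)] ordge_pvar[OF klij(2)]] by simp
 have 1: "R (pvar k * pvar l) j' m = 0" if "j' < n" for j' using filt_kill[OF assms, of "pvar k * pvar l" j'] kl that by simp
 have "R (pvar k * pvar l) i (R 1 j m) = - R (pdiff j (pvar k * pvar l)) i m"
  using klij 1[of i] by (simp add: R_comm R_simps)
 then have 2: "R (pvar k * pvar l) i (R 1 j m) = - (if j = k then R (pvar l) i m else 0) - (if j = l then R (pvar k) i m else 0)"
  using klij by (auto simp: pdiff_mult pdiff_pvar R_add R_0)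
 show ?thesis unfolding Om_def TT_def ee_def using klij 1[of j] 2
  by (auto simp: R_simps algebra_simps)
qed

lemma Om_killed:
 assumes "m : filt 1" "TT ee k l i j m = 0" "f : polys n" "al : exponents n" shows "Om k l i j f (Dp al m) = 0"
 using assms(4,3)
proof (induction arbitrary: f rule: exponents_induct)
 case zero
 have "keys f <= exponents n" using zero by (simp add: polys_def)
 then have "f : polys n & Om k l i j f m = 0"
 proof (induction rule: pm_sup_induct)
  case (gen al)
  show ?case
  proof (cases "al = 0")
   case True
   then show ?thesis using Om_filt_1[OF assms(1)] assms(2) by simp
  next
   case False
   then have "ordge n 1 (gen al)" using gen deg_eq_0[OF gen] by (intro ordge_gen) auto
   then show ?thesis using Om_filt_ord[OF assms(1)] gen by simp
  qed
 qed (auto simp: Om_lin)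
 then show ?case by simp
next
 case (add al s)
 then show ?case using plin_0[OF R_plin[of 1 s]] by (simp add: Dp_add Om_comm)
qed

lemma Om_high:
 assumes "m : filt 1" "al : exponents n" "ordge n (deg n al) f"
 shows "Om k l i j f (Dp al m) = pscale ((- 1) ^ deg n al) (Om k l i j (opow n pdiff al f) m)"
 using assms(2,3)
proof (induction arbitrary: f rule: exponents_induct)
 case (add al s)
 have f: "ordge n (1 + deg n al) f" using add by (simp add: deg_add add_ac)
 have fp: "f : polys n" using f by (rule ordge_polys)
 have "Om k l i j f (Dp al m) = pscale ((- 1) ^ deg n al) (Om k l i j (opow n pdiff al f) m)"
  by (intro add.IH ordge_mono[OF f]) simp
 also have "... = 0" using Om_filt_ord[OF assms(1)] ordge_opow_pdiff[OF add.hyps(1) f] by simp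
 finally have 1: "Om k l i j f (Dp al m) = 0" .
 have "ordge n (deg n al) (pdiff s f)" using ordge_pdiff[OF f] by simp
 from add.IH[OF this] have 2: "Om k l i j (pdiff s f) (Dp al m) = pscale ((- 1) ^ deg n al) (Om k l i j (opow n pdiff al (pdiff s f)) m)" .
 have "opow n pdiff al (pdiff s f) = opow n pdiff (al + ex s) f"
  using add.hyps by (simp add: opow_add[OF comm_ops_pdiff] opow_commute[OF comm_ops_pdiff])
 then show ?case using 1 2 add.hyps fp plin_0[OF R_plin[of 1 s]]
  by (simp add: Dp_add Om_comm deg_add power_add)
qed simp

text \<open>Among the exponents whose coefficient is not killed take \<open>ga\<close> of maximal
  degree, and use its divided power as test function. Killed coefficients contribute nothing, other
  exponents leave a test function that is zero or vanishes at the origin, and only the value of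
  \<open>TT\<close> at \<open>x ga\<close> remains.\<close>

lemma relation_TT:
 assumes A: "finite A" "A <= exponents n" "!!al. al : A ==> x al : filt 1" "(\<Sum>al\<in>A. Dp al (x al)) = 0" and be: "be : A"
 shows "TT ee k l i j (x be) = 0"
proof (rule ccontr)
 assume nz: "TT ee k l i j (x be) ~= 0"
 let ?S = "{al\<in>A. TT ee k l i j (x al) ~= 0}"
 have fin: "finite (deg n ` ?S)" using A(1) by simp
 define d where "d = Max (deg n ` ?S)"
 have "d : deg n ` ?S" unfolding d_def using nz be by (intro Max_in[OF fin]) auto
 then obtain ga where ga: "ga : A" "TT ee k l i j (x ga) ~= 0" "deg n ga = d" by auto
 have max: "deg n al <= d" if "al : A" "TT ee k l i j (x al) ~= 0" for al
  unfolding d_def using that by (intro Max_ge[OF fin]) auto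
 have gae: "ga : exponents n" using ga A by auto
 have t: "Om k l i j (mono n ga) (Dp al (x al)) = (if al = ga then pscale ((- 1) ^ d) (- TT ee k l i j (x ga)) else 0)" if a: "al : A" for al
 proof (cases "TT ee k l i j (x al) = 0")
  case True
  then show ?thesis using Om_killed[OF A(3)[OF a] True] gae a A(2) ga(2) by auto
 next
  case False
  have ae: "al : exponents n" using a A(2) by auto
  have le: "deg n al <= d" by (rule max[OF a False])
  have o: "ordge n d (mono n ga)" using gae ga(3) by (intro ordge_mono_poly) auto
  have 1: "Om k l i j (mono n ga) (Dp al (x al)) = pscale ((- 1) ^ deg n al) (Om k l i j (opow n pdiff al (mono n ga)) (x al))"
   by (rule Om_high[OF A(3)[OF a] ae ordge_mono[OF o le]])
  show ?thesis
  proof (cases "al = ga")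
   case True
   then show ?thesis using 1 opow_pdiff_mono[OF ae, of 0] Om_filt_1[OF A(3)[OF a]] ga(3) by simp
  next
   case ne: False
   show ?thesis
   proof (cases "\<exists>de. ga = al + de")
    case True
    then obtain de where de: "ga = al + de" by blast
    have dee: "de : exponents n" using exponents_minus[OF gae, of al] de by simp
    have "de ~= 0" using ne de by auto
    then have "ordge n 1 (mono n de)" using deg_eq_0[OF dee] by (intro ordge_mono_poly dee) auto
    then show ?thesis using 1 ne opow_pdiff_mono[OF ae, of de] de Om_filt_ord[OF A(3)[OF a]] by simp
   next
    case False
    then have "opow n pdiff al (mono n ga) = 0" by (intro opow_pdiff_mono_0[OF ae]) auto
    then show ?thesis using 1 ne Om_lin(3) by simp
   qed
  qed
 qed
 have "0 = Om k l i j (mono n ga) (\<Sum>al\<in>A. Dp al (x al))" using A(4) plin_0[OF plin_Om[of "mono n ga"]] gae by simp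
 also have "... = (\<Sum>al\<in>A. Om k l i j (mono n ga) (Dp al (x al)))" using plin_sum[OF plin_Om[of "mono n ga"]] gae by simp
 also have "... = pscale ((- 1) ^ d) (- TT ee k l i j (x ga))" using A(1) ga(1) by (simp add: t)
 finally show False using ga(2) by simp
qed

end

definition filtT :: "'x cv set" where
 "filtT = {m : filt 1. Tkilled n ee m}"

lemma filtT_stable: "stable 1 filtT"
proof (rule stable1_filt1)
 have "filtT = filt 1 \<inter> {m. Tkilled n ee m}" by (auto simp: filtT_def)
 then show "pm.subspace filtT"
  using pm.subspace_inter[OF stable_subspace[OF filt_stable] Tkilled_subspace[OF glrep_ee]] by simp
 show "ee i j u : filtT" if "i < n" "j < n" "u : filtT" for i j u
  using that Tkilled_stable[OF glrep_ee] ee_stable[OF filt_stable] by (auto simp: filtT_def)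
qed (auto simp: filtT_def)

lemma indep_filt1: assumes "filtT = {0}" shows "indep (filt 1)"
 unfolding indep_def
proof (intro allI impI ballI)
 fix A x be assume A: "finite A" "A <= exponents n" "\<forall>al\<in>A. x al : filt 1" "(\<Sum>al\<in>A. Dp al (x al)) = 0" and be: "be : A"
 have "x be : filtT"
  unfolding filtT_def Tkilled_def using relation_TT[OF _ _ _ _ A(1,2) _ A(4) be] A(3) be by auto
 then show "x be = 0" using assms by simp
qed

text \<open>The translates of \<open>N\<close> already span \<open>W\<close>, so an element of
  \<open>E\<close> is a combination of them. Directness over \<open>E\<close> forces it to equal the
  coefficient at exponent 0, which lies in \<open>N\<close>.\<close>

lemma indep_simple:
 assumes E: "indep E" "stable 1 E" "E <= W" and N: "stable 1 N" "N <= E" "N ~= {0}"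
 shows "N = E"
proof
 show "E <= N"
 proof
  fix e assume e: "e : E"
  have "e : pm.span {Dp al m | al m. al : exponents n & m : N}"
   using span_Dp_W[OF N(1) _ N(3)] N(2) E(3) e by blast
  from span_Dp_sum[OF stable_subspace[OF N(1)] this]
  obtain A x where A: "finite A" "A <= exponents n" "!!al. x al : N" "e = (\<Sum>al\<in>A. Dp al (x al))" by metis
  \<comment> \<open>The difference of the two expressions for \<open>e\<close>, written as one
    relation with coefficients in \<open>E\<close>.\<close>
  define y where "y = (%al. (if al : A then x al else 0) - (if al = 0 then e else 0))"
  have E0: "0 : E" using E(2) by (intro pm.subspace_0 stable_subspace)
  have yE: "y al : E" for al unfolding y_def using A(3) N(2) e E0 by (intro pm.subspace_diff[OF stable_subspace[OF E(2)]]) auto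
  have "(\<Sum>al\<in>insert 0 A. Dp al (y al)) = (\<Sum>al\<in>insert 0 A. Dp al (if al : A then x al else 0) - (if al = 0 then e else 0))"
   using A(2) by (intro sum.cong refl) (auto simp: y_def plin_diff[OF plin_Dp] plin_0[OF plin_Dp])
  also have "... = (\<Sum>al\<in>insert 0 A. Dp al (if al : A then x al else 0)) - e" using A(1) by (simp add: sum_subtractf)
  also have "(\<Sum>al\<in>insert 0 A. Dp al (if al : A then x al else 0)) = e"
   unfolding A(4) using A(1) by (intro sum.mono_neutral_cong_right) auto
  finally have "y 0 = 0" using indepD[OF E(1), of "insert 0 A" y 0] A yE by auto
  then have "e = (if 0 : A then x 0 else 0)" by (simp add: y_def)
  then show "e : N" using A(3)[of 0] pm.subspace_0[OF stable_subspace[OF N(1)]] by auto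
 qed
qed (rule N(2))

end

lemma glrep_ei: "glrep n (%i j w. eps i (iot j w))"
 unfolding glrep_def
proof (intro conjI allI impI)
 show "plin (%w. eps i (iot j w))" for i j by (rule plin_ei)
 fix i j k l u
 have a: "eps i (iot j (eps k (iot l u))) = (if j = k then eps i (iot l u) else 0) - eps i (eps k (iot j (iot l u)))" for i j k l
 proof -
  have "iot j (eps k (iot l u)) = (if k = j then iot l u else 0) - eps k (iot j (iot l u))"
   using eps_iot[of k j "iot l u"] by simp
  then show ?thesis by (simp add: eps_simps)
 qed
 have "eps i (eps k (iot j (iot l u))) = eps k (eps i (iot l (iot j u)))"
  using eps_eps[of i k "iot j (iot l u)"] iot_iot[of j l u] by (simp add: eps_simps)
 then show "eps i (iot j (eps k (iot l u))) = eps k (iot l (eps i (iot j u))) +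
   (if j = k then eps i (iot l u) else 0) - (if l = i then eps k (iot j u) else 0)"
  unfolding a[of i j k l] a[of k l i j] by simp
qed

text \<open>Once the contractions stand on the right, the two quadratic parts differ only in the
  order of two multiplications and cancel by anticommutation; the exchange produces exactly the
  linear terms of \<open>TT\<close>.\<close>

lemma Tkilled_ei: "Tkilled n (%i j w. eps i (iot j w)) u"
proof -
 have a: "eps i (iot j (eps k (iot l u))) = (if j = k then eps i (iot l u) else 0) - eps i (eps k (iot j (iot l u)))" for i j k l
 proof -
  have "iot j (eps k (iot l u)) = (if k = j then iot l u else 0) - eps k (iot j (iot l u))"
   using eps_iot[of k j "iot l u"] by simp
  then show ?thesis by (simp add: eps_simps)
 qed
 show ?thesis unfolding Tkilled_def TT_def
 proof (intro allI impI)
  fix k l i j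
  have "eps k (eps l (iot i (iot j u))) = - eps l (eps k (iot i (iot j u)))" by (rule eps_eps)
  then show "eps k (iot i (eps l (iot j u))) + eps l (iot i (eps k (iot j u))) -
   (if i = l then eps k (iot j u) else 0) - (if i = k then eps l (iot j u) else 0) = 0"
   unfolding a[of k i l j] a[of l i k j] by simp
 qed
qed

lemma ei_diag: "eps k (iot k (gen S)) = (if k : S then gen S else 0)"
 by (auto simp: iot_single eps_single eps_simps sg_remove sg_sq insert_absorb)

section \<open>Eigenvalues below a given one\<close>

text \<open>Vectors killed by a product of factors \<open>H - (a - 1)\<close>, ...,
  \<open>H - (a - m)\<close>, that is, sums of eigenvectors with eigenvalues among
  \<open>a - 1\<close>, \<open>a - 2\<close> and so on. In this form the space is visibly linear and
  meets the eigenspace of \<open>a\<close> only in zero.\<close>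

definition below :: "('x cv => 'x cv) => complex => 'x cv set" where
 "below H a = {u. \<exists>m. foldr (%t u. H u - pscale (a - of_nat (Suc t)) u) [0..<m] u = 0}"

lemma below_props:
 assumes H: "plin H"
 shows "pm.subspace (below H a)"
  and "H u = pscale a u ==> u : below H a ==> u = 0"
  and "H u = pscale (a - of_nat (Suc s)) u ==> u : below H a"
proof -
 let ?K = "%t u. H u - pscale (a - of_nat (Suc t)) u"
 let ?F = "%m. foldr ?K [0..<m]"
 have K: "plin (?K t)" for t
  using H by (auto simp: plin_def pm.scale_right_diff_distrib pscale_simps mult.commute algebra_simps)
 have F: "plin (foldr ?K xs)" for xs
  by (induction xs) (use plin_comp[OF K] in \<open>auto simp: plin_id comp_def id_def\<close>)
 have comm: "?K t (?K s u) = ?K s (?K t u)" for t s u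
  by (simp add: plin_simps[OF H] pm.scale_right_diff_distrib algebra_simps)
 have cF: "?K t (foldr ?K xs u) = foldr ?K xs (?K t u)" for t xs u
 proof (induction xs)
  case (Cons s xs)
  have "?K t (foldr ?K (s # xs) u) = ?K s (?K t (foldr ?K xs u))" using comm[where t = t and s = s] by simp
  then show ?case using Cons by simp
 qed simp
 have mono: "?F (m + k) u = 0" if "?F m u = 0" for m k u
 proof (induction k)
  case (Suc k)
  have "?F (m + Suc k) u = ?K (m + k) (?F (m + k) u)"
  proof -
   have "?F (m + Suc k) u = foldr ?K [0..<m + k] (?K (m + k) u)" by (simp del: upt.simps add: upt_Suc_append)
   also have "... = ?K (m + k) (?F (m + k) u)" by (rule cF[symmetric])
   finally show ?thesis .
  qed
  then show ?case using Suc plin_0[OF K[of "m + k"]] by simp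
 qed (use that in simp)
 show "pm.subspace (below H a)"
  unfolding pm.subspace_def below_def
 proof (safe)
  show "\<exists>m. ?F m 0 = 0" using plin_0[OF F] by blast
  fix x y m k assume "?F m x = 0" "?F k y = 0"
  then have "?F (m + k) x = 0" "?F (m + k) y = 0" using mono[of m x k] mono[of k y m] by (auto simp: add.commute)
  then show "\<exists>m. ?F m (x + y) = 0" using plin_add[OF F, of "[0..<m + k]" x y] by (intro exI[of _ "m + k"]) simp
 next
  fix c x m assume "?F m x = 0"
  then show "\<exists>m. ?F m (pscale c x) = 0" using plin_scale[OF F, of "[0..<m]" c x] by (intro exI[of _ m]) simp
 qed
 have eig: "foldr ?K xs u = pscale (\<Prod>t\<leftarrow>xs. b - (a - of_nat (Suc t))) u" if "H u = pscale b u" for xs b u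
 proof (induction xs)
  case (Cons t xs)
  show ?case using Cons that by (simp add: plin_simps[OF H] pm.scale_left_diff_distrib[symmetric] algebra_simps)
 qed simp
 show "u = 0" if u: "H u = pscale a u" "u : below H a"
 proof -
  obtain m where "?F m u = 0" using u(2) by (auto simp: below_def)
  then have "pscale (\<Prod>t\<leftarrow>[0..<m]. a - (a - of_nat (Suc t))) u = 0" using eig[OF u(1)] by simp
  moreover have "(\<Prod>t\<leftarrow>[0..<m]. a - (a - of_nat (Suc t))) ~= 0"
   by (auto simp: prod_list_zero_iff simp del: of_nat_Suc)
  ultimately show ?thesis by simp
 qed
 show "u : below H a" if "H u = pscale (a - of_nat (Suc s)) u"
 proof -
  have "?F (Suc s) u = pscale (\<Prod>t\<leftarrow>[0..<Suc s]. (a - of_nat (Suc s)) - (a - of_nat (Suc t))) u" by (rule eig[OF that])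
  also have "(\<Prod>t\<leftarrow>[0..<Suc s]. (a - of_nat (Suc s)) - (a - of_nat (Suc t))) = 0"
   by (simp add: prod_list_zero_iff)
  finally have "?F (Suc s) u = 0" by (simp only: pm.scale_zero_left)
  then show ?thesis unfolding below_def by blast
 qed
qed

section \<open>Comparison of highest weight modules\<close>

definition hwvec :: "nat => (nat => nat => 'x cv => 'x cv) => (nat => complex) => 'x cv => bool" where
 "hwvec n e lam v \<longleftrightarrow> v ~= 0 & (\<forall>i<n. e i i v = pscale (lam i) v) & (\<forall>i<n. \<forall>j<n. i < j --> e i j v = 0)"

text \<open>A diagonal element on whose eigenvectors the matrix unit with indices
  \<open>i > j\<close> lowers the eigenvalue by \<open>i - j\<close>; one number then measures how
  far a weight lies below the highest one.\<close>

definition height :: "nat => (nat => nat => 'x cv => 'x cv) => 'x cv => 'x cv" where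
 "height n e u = (\<Sum>k<n. pscale (- of_nat k) (e k k u))"

lemma plin_height: "glrep n e ==> plin (height n e)"
 unfolding height_def by (intro plin_sumI plin_scaled glrep_plin) auto

lemma height_lower:
 assumes g: "glrep n e" and ij: "i < n" "j < n" "j < i" and h: "height n e u = pscale b u"
 shows "height n e (e i j u) = pscale (b - of_nat (i - j)) (e i j u)"
proof -
 have "height n e (e i j u) = (\<Sum>k<n. pscale (- of_nat k) (e i j (e k k u)) + (if k = i then pscale (- of_nat i) (e i j u) else 0)
   - (if k = j then pscale (- of_nat j) (e i j u) else 0))"
  unfolding height_def
 proof (rule sum.cong)
  fix k assume "k : {..<n}"
  then have "e k k (e i j u) = e i j (e k k u) + (if k = i then e k j u else 0) - (if j = k then e i k u else 0)"
   using ij by (intro glrep_comm[OF g]) auto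
  then show "pscale (- of_nat k) (e k k (e i j u)) = pscale (- of_nat k) (e i j (e k k u)) + (if k = i then pscale (- of_nat i) (e i j u) else 0)
   - (if k = j then pscale (- of_nat j) (e i j u) else 0)"
   by (auto simp: pscale_simps pm.scale_right_diff_distrib)
 qed simp
 also have "... = e i j (height n e u) + pscale (- of_nat i) (e i j u) - pscale (- of_nat j) (e i j u)"
  using ij by (simp add: sum.distrib sum_subtractf sum_negf height_def plin_simps[OF glrep_plin[OF g]])
 also have "... = pscale (b - of_nat i + of_nat j) (e i j u)"
  using ij by (simp add: h plin_simps[OF glrep_plin[OF g]] pscale_simps pm.scale_left_diff_distrib)
 also have "b - of_nat i + of_nat j = b - of_nat (i - j)" using ij by (simp add: of_nat_diff)
 finally show ?thesis .
qed

text \<open>The submodule of the direct sum generated by \<open>(v, w)\<close>, meant as the graph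
  of a homomorphism between the two generated modules. It is one as soon as \<open>(0, y)\<close>
  forces \<open>y = 0\<close>, and it is injective as soon as \<open>(x, 0)\<close> forces
  \<open>x = 0\<close>.\<close>

inductive_set gspan :: "nat => (nat => nat => 'x cv => 'x cv) => (nat => nat => 'y cv => 'y cv) => 'x cv => 'y cv => ('x cv \<times> 'y cv) set"
 for n e e' v w where
 base: "(v, w) : gspan n e e' v w"
| add: "(x, y) : gspan n e e' v w ==> (x', y') : gspan n e e' v w ==> (x + x', y + y') : gspan n e e' v w"
| scale: "(x, y) : gspan n e e' v w ==> (pscale c x, pscale c y) : gspan n e e' v w"
| act: "(x, y) : gspan n e e' v w ==> i < n ==> j < n ==> (e i j x, e' i j y) : gspan n e e' v w"

text \<open>The same lowering word applied to both generators; the number records the total drop of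
  height.\<close>

inductive_set lowers :: "nat => (nat => nat => 'x cv => 'x cv) => (nat => nat => 'y cv => 'y cv) => 'x cv => 'y cv => (nat \<times> 'x cv \<times> 'y cv) set"
 for n e e' v w where
 base: "(0, v, w) : lowers n e e' v w"
| low: "(s, x, y) : lowers n e e' v w ==> j < i ==> i < n ==> (s + (i - j), e i j x, e' i j y) : lowers n e e' v w"

inductive_set lspan :: "nat => (nat => nat => 'x cv => 'x cv) => (nat => nat => 'y cv => 'y cv) => 'x cv => 'y cv => ('x cv \<times> 'y cv) set"
 for n e e' v w where
 zero: "(0, 0) : lspan n e e' v w"
| add: "(x, y) : lspan n e e' v w ==> (s, x', y') : lowers n e e' v w ==> (x + pscale c x', y + pscale c y') : lspan n e e' v w"

lemma gspan_zero: "(0, 0) : gspan n e e' v w"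
proof -
 have "(pscale 0 v, pscale 0 w) : gspan n e e' v w" by (intro gspan.scale gspan.base)
 then show ?thesis by simp
qed

lemma gspan_sub:
 assumes "pm.subspace N" "!!i j u. i < n ==> j < n ==> u : N ==> e i j u : N" "v : N" "(x, y) : gspan n e e' v w"
 shows "x : N"
 using assms(4) by (induction rule: gspan.induct) (auto simp: assms pm.subspace_add pm.subspace_scale)

lemma gspan_kernel:
 assumes "!!i j. i < n ==> j < n ==> e' i j 0 = 0"
 shows "pm.subspace {x. (x, 0) : gspan n e e' v w}"
  and "!!i j u. i < n ==> j < n ==> u : {x. (x, 0) : gspan n e e' v w} ==> e i j u : {x. (x, 0) : gspan n e e' v w}"
proof -
 let ?Z = "{x. (x, 0) : gspan n e e' v w}"
 have ad: "a + b : ?Z" if ab: "a : ?Z" "b : ?Z" for a b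
 proof -
  have "(a + b, 0 + 0) : gspan n e e' v w" by (rule gspan.add) (use ab in auto)
  then show ?thesis by simp
 qed
 have sc: "pscale c a : ?Z" if a: "a : ?Z" for a c
 proof -
  have "(pscale c a, pscale c 0) : gspan n e e' v w" by (rule gspan.scale) (use a in auto)
  then show ?thesis by simp
 qed
 show "pm.subspace ?Z" using gspan_zero ad sc unfolding pm.subspace_def by blast
 show "e i j u : ?Z" if i: "i < n" "j < n" "u : ?Z" for i j u
 proof -
  have "(e i j u, e' i j 0) : gspan n e e' v w" by (rule gspan.act) (use i in auto)
  then show ?thesis using assms i by simp
 qed
qed

context
 fixes n :: nat and e :: "nat => nat => 'x cv => 'x cv" and e' :: "nat => nat => 'y cv => 'y cv"
  and v :: "'x cv" and w :: "'y cv" and lam :: "nat => complex"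
 assumes g: "glrep n e" and g': "glrep n e'" and v: "hwvec n e lam v" and w: "hwvec n e' lam w"
begin

abbreviation "LS \<equiv> lspan n e e' v w"
abbreviation "GS \<equiv> gspan n e e' v w"

lemma lspan_plus: "(x', y') : LS ==> (x, y) : LS ==> (x + x', y + y') : LS"
proof (induction rule: lspan.induct)
 case (add a b s a' b' c)
 then have "((x + a) + pscale c a', (y + b) + pscale c b') : LS" by (intro lspan.add)
 then show ?case by (simp add: add.assoc)
qed simp

lemma lspan_scale: "(x, y) : LS ==> (pscale c x, pscale c y) : LS"
proof (induction rule: lspan.induct)
 case zero
 then show ?case using lspan.zero[of n e e' v w] by simp
next
 case (add a b s a' b' d)
 have "(pscale c a + pscale (c * d) a', pscale c b + pscale (c * d) b') : LS"
  by (rule lspan.add[OF add.IH add.hyps(2)])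
 then show ?case by (simp add: pscale_simps)
qed

lemma lspan_low: "(s, x, y) : lowers n e e' v w ==> (x, y) : LS"
 using lspan.add[OF lspan.zero, where c = 1] by fastforce

lemma lspan_lower: "(x, y) : LS ==> j < i ==> i < n ==> (e i j x, e' i j y) : LS"
proof (induction rule: lspan.induct)
 case zero
 then show ?case using lspan.zero[of n e e' v w] by (simp add: plin_0[OF glrep_plin[OF g]] plin_0[OF glrep_plin[OF g']])
next
 case (add a b s a' b' d)
 have "(e i j a + pscale d (e i j a'), e' i j b + pscale d (e' i j b')) : LS"
  using add by (intro lspan.add[OF _ lowers.low]) auto
 then show ?case using add.prems by (simp add: plin_simps[OF glrep_plin[OF g]] plin_simps[OF glrep_plin[OF g']])
qed

text \<open>Lowering words already span a submodule: any matrix unit is commuted inwards until it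
  meets the highest weight vectors, where raising units vanish and diagonal ones act by the same
  scalar on both sides.\<close>

lemma lowers_act: "(s, x, y) : lowers n e e' v w ==> i < n ==> j < n ==> (e i j x, e' i j y) : LS"
proof (induction arbitrary: i j rule: lowers.induct)
 case base
 consider "j < i" | "i = j" | "i < j" by linarith
 then show ?case
 proof cases
  case 1
  then show ?thesis using lspan_lower[OF lspan_low[OF lowers.base]] base by blast
 next
  case 2
  then show ?thesis using lspan_scale[OF lspan_low[OF lowers.base], of "lam i"] base v w by (simp add: hwvec_def)
 next
  case 3
  then show ?thesis using lspan.zero[of n e e' v w] base v w by (simp add: hwvec_def)
 qed
next
 case (low s x y l k)
 have l: "l < n" using low by simp
 have 1: "(e k l (e i j x), e' k l (e' i j y)) : LS" by (rule lspan_lower[OF low.IH[OF low.prems] low.hyps(2,3)])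
 have 2: "(if j = k then e i l x else 0, if j = k then e' i l y else 0) : LS"
  using low.IH[OF low.prems(1) l] lspan.zero[of n e e' v w] by simp
 have 3: "(if l = i then e k j x else 0, if l = i then e' k j y else 0) : LS"
  using low.IH[OF low.hyps(3) low.prems(2)] lspan.zero[of n e e' v w] by simp
 from lspan_plus[OF lspan_scale[OF 3, of "-1"] lspan_plus[OF 2 1]]
 show ?case using glrep_comm[OF g low.prems low.hyps(3) l, of x] glrep_comm[OF g' low.prems low.hyps(3) l, of y] by simp
qed

lemma gspan_lspan: "(x, y) : GS ==> (x, y) : LS"
proof (induction rule: gspan.induct)
 case base
 show ?case by (rule lspan_low[OF lowers.base])
next
 case (add x y x' y') then show ?case by (intro lspan_plus)
next
 case (scale x y c) then show ?case by (intro lspan_scale)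
next
 case (act x y i j)
 from act.IH show ?case
 proof (induction rule: lspan.induct)
  case zero
  then show ?case using act lspan.zero[of n e e' v w] by (simp add: plin_0[OF glrep_plin[OF g]] plin_0[OF glrep_plin[OF g']])
 next
  case (add a b s a' b' d)
  have "(e i j a + pscale d (e i j a'), e' i j b + pscale d (e' i j b')) : LS"
   using lspan_plus[OF lspan_scale[OF lowers_act[OF add.hyps(2)]] add.IH] act by blast
  then show ?case using act by (simp add: plin_simps[OF glrep_plin[OF g]] plin_simps[OF glrep_plin[OF g']])
 qed
qed

definition topval :: complex where
 "topval = (\<Sum>k<n. - of_nat k * lam k)"

lemma height_top: "height n e v = pscale topval v" "height n e' w = pscale topval w"
 using v w by (auto simp: height_def topval_def hwvec_def pm.scale_sum_left)

lemma lowers_height: "(s, x, y) : lowers n e e' v w ==>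
  height n e x = pscale (topval - of_nat s) x & height n e' y = pscale (topval - of_nat s) y & (s = 0 --> x = v & y = w)"
proof (induction rule: lowers.induct)
 case base
 then show ?case by (simp add: height_top)
next
 case (low s x y j i)
 have a: "topval - of_nat (s + (i - j)) = topval - of_nat s - of_nat (i - j)" by (simp del: of_nat_diff)
 have j: "j < n" using low.hyps by simp
 have "height n e (e i j x) = pscale (topval - of_nat s - of_nat (i - j)) (e i j x)"
  by (rule height_lower[OF g low.hyps(3) j low.hyps(2)]) (use low.IH in blast)
 moreover have "height n e' (e' i j y) = pscale (topval - of_nat s - of_nat (i - j)) (e' i j y)"
  by (rule height_lower[OF g' low.hyps(3) j low.hyps(2)]) (use low.IH in blast)
 ultimately show ?case unfolding a using low.hyps(2) by simp
qed

text \<open>All words except the empty one lie strictly below the top eigenvalue, and the empty word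
  contributes the same multiple of the generators to both components.\<close>

lemma gspan_top: assumes "(x, y) : GS"
 shows "\<exists>c. x - pscale c v : below (height n e) topval & y - pscale c w : below (height n e') topval"
 using gspan_lspan[OF assms]
proof (induction rule: lspan.induct)
 case zero
 then show ?case
  using pm.subspace_0[OF below_props(1)[OF plin_height[OF g]]] pm.subspace_0[OF below_props(1)[OF plin_height[OF g']]]
  by (intro exI[of _ 0]) simp
next
 case (add x y s x' y' d)
 note sx = below_props(1)[OF plin_height[OF g]] and sy = below_props(1)[OF plin_height[OF g']]
 obtain c where c: "x - pscale c v : below (height n e) topval" "y - pscale c w : below (height n e') topval" using add.IH by blast
 show ?case
 proof (cases s)
  case 0
  then have "x' = v" "y' = w" using lowers_height[OF add.hyps(2)] by auto
  then show ?thesis using c by (intro exI[of _ "c + d"]) (simp add: pscale_simps algebra_simps)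
 next
  case (Suc t)
  then have "x' : below (height n e) topval" "y' : below (height n e') topval"
   using lowers_height[OF add.hyps(2)] below_props(3)[OF plin_height[OF g]] below_props(3)[OF plin_height[OF g']] by auto
  then have "(x - pscale c v) + pscale d x' : below (height n e) topval" "(y - pscale c w) + pscale d y' : below (height n e') topval"
   using c by (auto intro: pm.subspace_add[OF sx] pm.subspace_scale[OF sx] pm.subspace_add[OF sy] pm.subspace_scale[OF sy])
  then show ?thesis by (intro exI[of _ c]) (simp add: algebra_simps)
 qed
qed

text \<open>The zero in the second component makes the multiple of the generators zero; then
  \<open>x\<close> lies below the top eigenvalue and is at the same time an eigenvector for
  it.\<close>

lemma gspan_left_zero: assumes "(x, 0) : GS" "hwvec n e lam x" shows False
proof -
 obtain c where c: "x - pscale c v : below (height n e) topval" "0 - pscale c w : below (height n e') topval"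
  using gspan_top[OF assms(1)] by blast
 have "height n e' (0 - pscale c w) = pscale topval (0 - pscale c w)"
  by (simp add: plin_simps[OF plin_height[OF g']] height_top mult.commute)
 then have "0 - pscale c w = 0" using below_props(2)[OF plin_height[OF g']] c(2) by blast
 then have "c = 0" using w by (auto simp: hwvec_def)
 then have "x : below (height n e) topval" using c(1) by simp
 moreover have "height n e x = pscale topval x"
  using assms(2) by (auto simp: height_def topval_def hwvec_def pm.scale_sum_left)
 ultimately have "x = 0" using below_props(2)[OF plin_height[OF g]] by blast
 then show False using assms(2) by (simp add: hwvec_def)
qed

text \<open>The trace element is central, so on the whole graph it acts by its value on the
  generator.\<close>

lemma gspan_central: "(x, y) : GS ==> (\<Sum>k<n. e k k x) = pscale (\<Sum>k<n. lam k) x"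
proof (induction rule: gspan.induct)
 case base
 then show ?case using v by (simp add: hwvec_def pm.scale_sum_left)
next
 case (act x y i j)
 have "(\<Sum>k<n. e k k (e i j x)) = (\<Sum>k<n. e i j (e k k x) + (if k = i then e i j x else 0) - (if k = j then e i j x else 0))"
 proof (rule sum.cong)
  fix k assume "k : {..<n}"
  then show "e k k (e i j x) = e i j (e k k x) + (if k = i then e i j x else 0) - (if k = j then e i j x else 0)"
   using glrep_comm[OF g _ _ act.hyps(2,3), of k k x] by auto
 qed simp
 also have "... = e i j (\<Sum>k<n. e k k x)"
  using act.hyps by (simp add: sum.distrib sum_subtractf plin_simps[OF glrep_plin[OF g]])
 also have "... = pscale (\<Sum>k<n. lam k) (e i j x)"
  using act by (simp add: plin_simps[OF glrep_plin[OF g]])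
 finally show ?case .
qed (auto simp: plin_simps[OF glrep_plin[OF g]] sum.distrib pscale_simps pm.scale_sum_right[symmetric] mult.commute)

end

lemma gspan_swap: "(x, y) : gspan n e e' v w ==> (y, x) : gspan n e' e w v"
 by (induction rule: gspan.induct) (auto intro: gspan.intros)

abbreviation stepw :: "nat => nat => complex" where
 "stepw r k \<equiv> (if k < r then 1 else 0)"

text \<open>With all indices equal, the quadratic relation makes each diagonal unit idempotent.
  These units commute, so a common eigenvector with entries 0 and 1 exists; moving the ones to the
  front and testing idempotency on raised vectors gives a highest weight vector.\<close>

lemma Tkilled_hwvec:
 assumes g: "glrep n e" and Z: "pm.subspace Z" "Z ~= {0}"
  and st: "!!i j u. i < n ==> j < n ==> u : Z ==> e i j u : Z"
  and T: "!!u. u : Z ==> Tkilled n e u"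
 obtains r z where "r <= n" "z : Z" "hwvec n e (stepw r) z"
proof -
 note pl = plin_simps[OF glrep_plin[OF g]]
 have Z0: "0 : Z" by (rule pm.subspace_0[OF Z(1)])
 have TT0: "TT e k l i j u = 0" if "u : Z" "k < n" "l < n" "i < n" "j < n" for u k l i j
  using T[OF that(1)] that by (simp add: Tkilled_def)
 have idem: "e k k (e k k u) = e k k u" if "u : Z" "k < n" for k u
 proof -
  have "pscale 2 (e k k (e k k u) - e k k u) = 0"
   using TT0[OF that(1) that(2,2,2,2)] by (simp add: TT_def poly_mapping_eq_iff fun_eq_iff lookup_add lookup_minus algebra_simps)
  then show ?thesis by simp
 qed
 \<comment> \<open>If \<open>e m m z\<close> is nonzero it replaces \<open>z\<close>: it is fixed by
   \<open>e m m\<close> and keeps the eigenvalues found before.\<close>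
 have "\<exists>z\<in>Z. z ~= 0 & (\<forall>k<m. e k k z = z \<or> e k k z = 0)" if "m <= n" for m
  using that
 proof (induction m)
  case 0
  then show ?case using Z(2) Z0 by blast
 next
  case (Suc m)
  then obtain z where z: "z : Z" "z ~= 0" "!!k. k < m ==> e k k z = z \<or> e k k z = 0" by auto
  show ?case
  proof (cases "e m m z = 0")
   case True
   then show ?thesis using z by (auto simp: less_Suc_eq)
  next
   case False
   have "e k k (e m m z) = e m m z \<or> e k k (e m m z) = 0" if "k < Suc m" for k
   proof (cases "k = m")
    case True then show ?thesis using idem[OF z(1)] Suc.prems by simp
   next
    case False
    then have km: "k < m" using that by simp
    then show ?thesis using glrep_comm[OF g, of k k m m z] Suc.prems False z(3)[OF km] by (auto simp: pl)
   qed
   then show ?thesis using False st[OF _ _ z(1), of m m] Suc.prems by (intro bexI[of _ "e m m z"]) auto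
  qed
 qed
 from this[of n] obtain z0 where z0: "z0 : Z" "z0 ~= 0" "!!k. k < n ==> e k k z0 = z0 \<or> e k k z0 = 0" by auto
 define spt where "spt = (%z. {k. k < n & e k k z = z})"
 \<comment> \<open>Induction on the sum of the positions of the ones. The unit \<open>e i j\<close>
   moves a one from \<open>j\<close> to a free \<open>i < j\<close>, and the quadratic relation with
   indices \<open>j, i, i, j\<close> shows that the result is nonzero.\<close>
 have main: "\<exists>r\<le>n. \<exists>z\<in>Z. z ~= 0 & (\<forall>k<n. e k k z = z \<or> e k k z = 0) & spt z = {..<r}"
  if "z : Z" "z ~= 0" "!!k. k < n ==> e k k z = z \<or> e k k z = 0" for z
  using that
 proof (induction "\<Sum>(spt z)" arbitrary: z rule: less_induct)
  case (less z)
  have fin: "finite (spt z)" by (simp add: spt_def)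
  show ?case
  proof (cases "\<exists>i j. i < j & j : spt z & i ~: spt z")
   case True
   then obtain i j where ij: "i < j" "j : spt z" "i ~: spt z" by blast
   have jn: "j < n" "e j j z = z" using ij by (auto simp: spt_def)
   then have ii: "i < n" "e i i z = 0" using ij less.prems(3)[of i] by (auto simp: spt_def)
   let ?z = "e i j z"
   have "e j i ?z + e i i (e j j z) - e j j z = 0"
    using TT0[OF less.prems(1), of j i i j] ij(1) ii(1) jn(1) by (simp add: TT_def)
   then have "e j i ?z = z" using jn ii by simp
   then have nz: "?z ~= 0" using less.prems(2) jn ii by (auto simp: pl)
   have wt: "e k k ?z = (if k = i then ?z else if k = j then 0 else e i j (e k k z))" if "k < n" for k
    using glrep_comm[OF g that that ii(1) jn(1), of z] ij(1) jn ii that by (auto simp: pl)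
   have 1: "e k k ?z = ?z \<or> e k k ?z = 0" if "k < n" for k
    using wt[OF that] less.prems(3)[OF that] jn ii by (auto simp: pl)
   have "spt ?z = insert i (spt z - {j})"
   proof (rule subset_antisym; rule subsetI)
    fix k assume "k : spt ?z"
    then have k: "k < n" "e k k ?z = ?z" by (auto simp: spt_def)
    show "k : insert i (spt z - {j})"
     using wt[OF k(1)] k nz less.prems(3)[OF k(1)] ii jn by (auto simp: spt_def pl split: if_splits)
   next
    fix k assume "k : insert i (spt z - {j})"
    then show "k : spt ?z" using wt[of k] ii(1) by (auto simp: spt_def)
   qed
   then have "\<Sum>(spt ?z) = i + \<Sum>(spt z - {j})" using fin ij(3) by simp
   moreover have "\<Sum>(spt z) = j + \<Sum>(spt z - {j})" using fin ij(2) by (rule sum.remove)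
   ultimately have "\<Sum>(spt ?z) < \<Sum>(spt z)" using ij(1) by simp
   then show ?thesis using less.hyps[OF _ st[OF ii(1) jn(1) less.prems(1)] nz 1] by blast
  next
   case False
   have "spt z = {..<card (spt z)}"
   proof -
    have cl: "i : spt z" if "j : spt z" "i < j" for i j using False that by blast
    show ?thesis
    proof (cases "spt z = {}")
     case ne: False
     have "spt z = {..Max (spt z)}"
     proof
      show "spt z <= {..Max (spt z)}" using fin by auto
      show "{..Max (spt z)} <= spt z"
       using cl[OF Max_in[OF fin ne]] Max_in[OF fin ne] by (auto simp: le_less)
     qed
     then show ?thesis by (metis card_atMost lessThan_Suc_atMost)
    qed simp
   qed
   moreover have "card (spt z) <= n" using card_mono[of "{..<n}" "spt z"] by (auto simp: spt_def)
   ultimately show ?thesis using less.prems by blast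
  qed
 qed
 from main[OF z0] obtain r z where z: "r <= n" "z : Z" "z ~= 0" "!!k. k < n ==> e k k z = z \<or> e k k z = 0" "spt z = {..<r}" by blast
 have wt: "e k k z = pscale (stepw r k) z" if "k < n" for k
  using z(4)[OF that] z(5) that z(3) unfolding spt_def by auto
 \<comment> \<open>A nonzero raised vector would have diagonal eigenvalue -1 at \<open>j\<close> or
   2 at \<open>i\<close>, against idempotency.\<close>
 have "e i j z = 0" if "i < n" "j < n" "i < j" for i j
 proof (cases "j < r")
  case False
  let ?z = "e i j z"
  have a: "e j j ?z = - ?z" using glrep_comm[OF g that(2,2,1,2), of z] wt[OF that(2)] False that by (simp add: pl)
  have "e j j (e j j ?z) = e j j ?z" by (rule idem[OF st[OF that(1,2) z(2)] that(2)])
  then have "?z = - ?z" unfolding a using that by (simp add: a pl)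
  moreover have "pscale 2 ?z = ?z + ?z" by (metis one_add_one pm.scale_left_distrib pm.scale_one)
  ultimately have "pscale 2 ?z = 0" by (metis add.right_inverse)
  then show ?thesis by simp
 next
  case True
  let ?z = "e i j z"
  have "e i i ?z = pscale 2 ?z" using glrep_comm[OF g that(1,1,1,2), of z] wt[OF that(1)] True that
   by (simp add: pl poly_mapping_eq_iff fun_eq_iff lookup_add)
  moreover have "e i i (e i i ?z) = e i i ?z" by (rule idem[OF st[OF that(1,2) z(2)] that(1)])
  ultimately have "pscale 4 ?z = pscale 2 ?z" using that by (simp add: pl)
  then have "pscale 2 ?z = 0" by (simp add: poly_mapping_eq_iff fun_eq_iff)
  then show ?thesis by simp
 qed
 then show thesis using that[OF z(1,2)] wt z(3) by (auto simp: hwvec_def)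
qed

abbreviation ei :: "nat => nat => nat set cv => nat set cv" where
 "ei \<equiv> %i j w. eps i (iot j w)"

lemma hwvec_Lam: assumes "r <= n" shows "hwvec n ei (stepw r) (gen {..<r})"
 unfolding hwvec_def
proof (intro conjI allI impI)
 show "gen {..<r} ~= (0 :: nat set cv)" by (simp add: poly_mapping_eq_iff fun_eq_iff lookup_single when_def exI[of _ "{..<r}"])
 show "ei i i (gen {..<r}) = pscale (stepw r i) (gen {..<r})" for i by (simp add: ei_diag del: pscale_single)
 show "ei i j (gen {..<r}) = 0" if "i < j" for i j using that by (auto simp: iot_single eps_single eps_simps)
qed

text \<open>A nonzero kernel of the graph is a submodule killed by the quadratic elements, so it
  contains a highest weight vector with \<open>s\<close> ones. The trace gives \<open>s = r\<close>,
  and then \<open>gspan_left_zero\<close> is violated. The exterior power is killed as well, so the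
  argument applies to both projections.\<close>

lemma gspan_Lam_trivial:
 assumes g: "glrep n e" and r: "r <= n" and v: "hwvec n e (stepw r) v"
 defines "G \<equiv> gspan n e ei v (gen {..<r})"
 shows "(0, y) : G ==> y = 0"
  and "pm.subspace N ==> (!!i j u. i < n ==> j < n ==> u : N ==> e i j u : N) ==> v : N ==>
   (!!u. u : N ==> Tkilled n e u) ==> (x, 0) : G ==> x = 0"
  and "y : Lam n r ==> \<exists>x. (x, y) : G"
proof -
 note w = hwvec_Lam[OF r]
 have trivial: "x = 0" if g: "glrep n e" "glrep n e'" and v: "hwvec n e (stepw r) v" "hwvec n e' (stepw r) w"
   and N: "pm.subspace N" "!!i j u. i < n ==> j < n ==> u : N ==> e i j u : N" "v : N" "!!u. u : N ==> Tkilled n e u"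
   and x: "(x, 0) : gspan n e e' v w"
  for e :: "nat => nat => 'c cv => 'c cv" and e' :: "nat => nat => 'd cv => 'd cv" and v w N x
 proof (rule ccontr)
  assume "x ~= 0"
  let ?Z = "{x. (x, 0) : gspan n e e' v w}"
  have Z: "pm.subspace ?Z" by (rule gspan_kernel(1)) (rule plin_0[OF glrep_plin[OF g(2)]])
  have st: "e i j u : ?Z" if "i < n" "j < n" "u : ?Z" for i j u
   by (rule gspan_kernel(2)[OF _ that]) (rule plin_0[OF glrep_plin[OF g(2)]])
  have "u : N" if "u : ?Z" for u
   by (rule gspan_sub[OF N(1) _ N(3)]) (use that N(2) in auto)
  then have TZ: "Tkilled n e u" if "u : ?Z" for u using N(4) that by blast
  have "?Z ~= {0}" using x \<open>x ~= 0\<close> by auto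
  from Tkilled_hwvec[OF g(1) Z this st TZ] obtain s z where z: "s <= n" "z : ?Z" "hwvec n e (stepw s) z" by blast
  have su: "(\<Sum>k<n. stepw t k) = (of_nat t :: complex)" if "t <= n" for t
  proof -
   have "{..<n} \<inter> {k. k < t} = {..<t}" using that by auto
   then show ?thesis by (simp add: sum.If_cases)
  qed
  have "(\<Sum>k<n. e k k z) = pscale (\<Sum>k<n. stepw r k) z"
   by (rule gspan_central[OF g v]) (use z(2) in simp)
  moreover have "(\<Sum>k<n. e k k z) = pscale (\<Sum>k<n. stepw s k) z"
   using z(3) by (simp add: hwvec_def pm.scale_sum_left)
  ultimately have "pscale (of_nat r) z = pscale (of_nat s) z" by (simp only: su[OF z(1)] su[OF r])
  then have "r = s" using z(3) by (auto simp: hwvec_def)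
  then show False using gspan_left_zero[OF g v, of z] z by blast
 qed
 show "(0, y) : G ==> y = 0"
  unfolding G_def
  by (rule trivial[OF glrep_ei g w v, of UNIV]) (auto simp: pm.subspace_def Tkilled_ei dest: gspan_swap)
 show "x = 0" if "pm.subspace N" "!!i j u. i < n ==> j < n ==> u : N ==> e i j u : N" "v : N"
  "!!u. u : N ==> Tkilled n e u" "(x, 0) : G" for N x
  using trivial[OF g glrep_ei v w that(1-4)] that(5) unfolding G_def by blast
 let ?P = "{y. \<exists>x. (x, y) : G}"
 have P: "pm.subspace ?P"
  unfolding pm.subspace_def G_def using gspan_zero
  by (blast intro: gspan.add gspan.scale)
 \<comment> \<open>Induction on the number of indices outside \<open>{..<r}\<close>: one of them is
   exchanged for a missing small index, and a matrix unit leads back up to sign.\<close>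
 have gS: "gen S : ?P" if "S <= {..<n}" "card S = r" for S
  using that
 proof (induction "card (S - {..<r})" arbitrary: S rule: less_induct)
  case (less S)
  have fS: "finite S" using less.prems finite_subset by blast
  show ?case
  proof (cases "S <= {..<r}")
   case True
   then have "S = {..<r}" using less.prems by (intro card_subset_eq) auto
   then show ?thesis using gspan.base unfolding G_def by blast
  next
   case False
   then obtain i where i: "i : S" "\<not> i < r" by auto
   have "\<not> {..<r} <= S"
   proof
    assume "{..<r} <= S"
    then have "{..<r} = S" using less.prems fS by (intro card_subset_eq) auto
    then show False using False by blast
   qed
   then obtain j where j: "j < r" "j ~: S" by auto
   define S' where "S' = insert j (S - {i})"
   have S': "S' <= {..<n}" "card S' = r" using less.prems i j r fS by (auto simp: S'_def card_insert_if card_Diff_singleton)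
   have "S' - {..<r} = (S - {..<r}) - {i}" using j i by (auto simp: S'_def)
   then have "card (S' - {..<r}) < card (S - {..<r})"
    using i fS by (simp only:) (rule card_Diff1_less, auto)
   then obtain x where x: "(x, gen S') : G" using less.hyps[OF _ S'] by blast
   have "i < n" "j < n" using i less.prems j r by auto
   then have "(e i j x, ei i j (gen S')) : G" using x unfolding G_def by (intro gspan.act[where e = e and e' = ei])
   moreover have "\<exists>c. c ~= 0 & ei i j (gen S') = pscale c (gen S)"
   proof -
    have "insert i (S' - {j}) = S" "i ~: S'" using i j by (auto simp: S'_def)
    moreover have "j : S'" by (simp add: S'_def)
    moreover have "sg j S' * sg i (S' - {j}) ~= 0" by (simp add: sg_def)
    ultimately show ?thesis by (intro exI[of _ "sg j S' * sg i (S' - {j})"]) (simp add: iot_single eps_single)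
   qed
   then obtain c where c: "c ~= 0" "ei i j (gen S') = pscale c (gen S)" by blast
   ultimately have "pscale c (gen S) : ?P" by auto
   from pm.subspace_scale[OF P this, of "1 / c"] show ?thesis using c(1) by simp
  qed
 qed
 show "\<exists>x. (x, y) : G" if "y : Lam n r" for y
 proof -
  define Q where "Q = ?P"
  note P' = P[folded Q_def]
  have "y : Q" using that
   by (induction rule: Lam_induct) (auto intro: pm.subspace_0[OF P'] pm.subspace_add[OF P'] pm.subspace_scale[OF P'] gS[folded Q_def])
  then show ?thesis by (simp add: Q_def)
 qed
qed

text \<open>The graph with the exterior power is single-valued in both directions and projects onto
  all of \<open>Lam n r\<close>; read backwards it is an injective homomorphism.\<close>

lemma exterior_embedding:
 assumes g: "glrep n e" and N: "pm.subspace N" "N ~= {0}" "!!i j u. i < n ==> j < n ==> u : N ==> e i j u : N"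
  "!!u. u : N ==> Tkilled n e u"
 obtains r eta where "r <= n" "plin eta" "!!y. y : Lam n r ==> eta y : N" "!!y. y : Lam n r ==> eta y = 0 ==> y = 0"
  "!!i j y. i < n ==> j < n ==> y : Lam n r ==> eta (ei i j y) = e i j (eta y)"
proof -
 obtain r v where r: "r <= n" and v: "v : N" "hwvec n e (stepw r) v" using Tkilled_hwvec[OF g N] by blast
 define G where "G = gspan n e ei v (gen {..<r})"
 note tr = gspan_Lam_trivial[OF g r v(2), folded G_def]
 \<comment> \<open>A partner is chosen for each basis form; the value 0 on other index sets is a
   filler.\<close>
 define eta where "eta = lext (%S. if S <= {..<n} & card S = r then SOME x. (x, gen S) : G else 0)"
 have pe: "plin eta" unfolding eta_def by (rule plin_lext)
 have eG: "(eta y, y) : G" if "y : Lam n r" for y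
  using that
 proof (induction rule: Lam_induct)
  case zero
  then show ?case using gspan_zero by (simp add: G_def plin_0[OF pe])
 next
  case (add p q) then show ?case unfolding plin_add[OF pe] G_def by (rule gspan.add)
 next
  case (scale c p) then show ?case unfolding plin_scale[OF pe] G_def by (rule gspan.scale)
 next
  case (gen S)
  have "\<exists>x. (x, gen S) : G" by (rule tr(3)) (use gen in \<open>simp add: Lam_gen\<close>)
  then have "(SOME x. (x, gen S) : G, gen S) : G" by (rule someI_ex)
  then show ?case using gen by (simp add: eta_def)
 qed
 have uniq: "x = x'" if "(x, y) : G" "(x', y) : G" for x x' y
 proof -
  have "(x + pscale (-1) x', y + pscale (-1) y) : G" using that unfolding G_def by (intro gspan.add gspan.scale)
  then have "(x - x', 0) : G" by simp
  then have "x - x' = 0" by (intro tr(2)[OF N(1) _ v(1)]) (use N in auto)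
  then show ?thesis by simp
 qed
 show thesis
 proof (rule that[OF r pe])
  show "eta y : N" if "y : Lam n r" for y
   by (rule gspan_sub[OF N(1) _ v(1)]) (use eG[OF that] N(3) in \<open>auto simp: G_def\<close>)
  show "y = 0" if "y : Lam n r" "eta y = 0" for y using tr(1) eG[OF that(1)] that(2) by simp
  show "eta (ei i j y) = e i j (eta y)" if "i < n" "j < n" "y : Lam n r" for i j y
  proof (rule uniq)
   show "(eta (ei i j y), ei i j y) : G" by (rule eG[OF eps_iot_Lam[OF that(3,1)]])
   show "(e i j (eta y), ei i j y) : G" using eG[OF that(3)] that unfolding G_def by (intro gspan.act)
  qed
 qed
qed

text \<open>This excludes exterior powers in the tensor module case. By simplicity the graph with
  the exterior power has trivial kernel, so the quadratic relations of \<open>gen {..<r}\<close>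
  transfer to \<open>v\<close>.\<close>

lemma simple_hw_Tkilled:
 assumes g: "glrep n e" and r: "r <= n" and v: "v : N" "hwvec n e (stepw r) v"
  and N: "pm.subspace N" "!!i j u. i < n ==> j < n ==> u : N ==> e i j u : N"
  and simple: "!!N'. pm.subspace N' ==> N' <= N ==> (!!i j u. i < n ==> j < n ==> u : N' ==> e i j u : N') ==> N' = {0} \<or> N' = N"
 shows "Tkilled n e v"
proof -
 let ?G = "gspan n e ei v (gen {..<r})"
 let ?Z = "{x. (x, 0) : ?G}"
 have Z: "pm.subspace ?Z" by (rule gspan_kernel(1)) (rule plin_0[OF glrep_plin[OF glrep_ei]])
 have st: "e i j u : ?Z" if "i < n" "j < n" "u : ?Z" for i j u
  by (rule gspan_kernel(2)[OF _ that]) (rule plin_0[OF glrep_plin[OF glrep_ei]])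
 have ZN: "?Z <= N"
 proof
  fix u assume u: "u : ?Z"
  show "u : N" by (rule gspan_sub[OF N(1) _ v(1)]) (use u N(2) in auto)
 qed
 have "?Z ~= N"
 proof
  assume "?Z = N"
  then have "(v, 0) : ?G" using v(1) by blast
  then show False using gspan_left_zero[OF g glrep_ei v(2) hwvec_Lam[OF r]] v(2) by blast
 qed
 then have Z1: "?Z = {0}" using simple[OF Z ZN st] by blast
 show ?thesis unfolding Tkilled_def
 proof (intro allI impI)
  fix k l i j assume i: "k < n" "l < n" "i < n" "j < n"
  have b: "(v, gen {..<r}) : ?G" by (rule gspan.base)
  have 1: "(e k i (e l j v), ei k i (ei l j (gen {..<r}))) : ?G" "(e l i (e k j v), ei l i (ei k j (gen {..<r}))) : ?G"
   by (rule gspan.act[OF gspan.act[OF b]], use i in simp_all)+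
  have z: "(0, 0) : ?G" by (rule gspan_zero)
  have 2: "(if i = l then e k j v else 0, if i = l then ei k j (gen {..<r}) else 0) : ?G"
   "(if i = k then e l j v else 0, if i = k then ei l j (gen {..<r}) else 0) : ?G"
   using gspan.act[OF b i(1,4)] gspan.act[OF b i(2,4)] z by auto
  have "(e k i (e l j v) + e l i (e k j v) + pscale (-1) (if i = l then e k j v else 0) + pscale (-1) (if i = k then e l j v else 0),
    ei k i (ei l j (gen {..<r})) + ei l i (ei k j (gen {..<r})) + pscale (-1) (if i = l then ei k j (gen {..<r}) else 0) + pscale (-1) (if i = k then ei l j (gen {..<r}) else 0)) : ?G"
   by (intro gspan.add gspan.scale 1 2)
  then have "(TT e k l i j v, TT ei k l i j (gen {..<r})) : ?G" by (simp only: TT_def pm.scale_minus_left pm.scale_one diff_conv_add_uminus)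
  moreover have "TT ei k l i j (gen {..<r}) = 0" using Tkilled_ei[of n "gen {..<r}"] i by (simp add: Tkilled_def)
  ultimately have "TT e k l i j v : ?Z" by simp
  then show "TT e k l i j v = 0" using Z1 by blast
 qed
qed

section \<open>Exactness of the complex of tensor modules\<close>

text \<open>The action of the Euler field. It is diagonal on monomials with eigenvalue
  \<open>r - n - |\<alpha>|\<close> in form degree \<open>r\<close>.\<close>

definition Eul :: "nat => mix cv => mix cv" where
 "Eul n z = (\<Sum>i<n. FR n (pvar i) i z)"

lemma plin_Eul: "plin (Eul n)"
 unfolding Eul_def by (intro plin_sumI plin_FR)

lemma pdiff_pvar_times: "al : exponents n ==> (\<Sum>i<n. pdiff i (pvar i * gen al)) = pscale (of_nat n + of_nat (deg n al)) (gen al)"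
proof -
 have "pdiff i (pvar i * gen al) = pscale (1 + of_nat (lookup al i)) (gen al)" for i
  by (simp add: pvar_def gen_times pdiff_gen lookup_add)
 then have "(\<Sum>i<n. pdiff i (pvar i * gen al)) = pscale (\<Sum>i<n. 1 + of_nat (lookup al i)) (gen al)"
  by (simp only: pm.scale_sum_left)
 then show ?thesis by (simp add: sum.distrib deg_def)
qed

lemma ei_sum: "S <= {..<n} ==> (\<Sum>i<n. eps i (iot i (gen S))) = pscale (of_nat (card S)) (gen S)"
proof -
 assume S: "S <= {..<n}"
 have "(\<Sum>i<n. eps i (iot i (gen S))) = (\<Sum>i<n. if i : S then gen S else 0)"
  by (simp only: ei_diag)
 also have "... = (\<Sum>i\<in>S. gen S)" using S by (simp add: sum.If_cases Int_absorb1)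
 also have "... = pscale (\<Sum>i\<in>S. 1) (gen S)" by (simp only: pm.scale_sum_left pm.scale_one)
 also have "(\<Sum>i\<in>S. 1) = (of_nat (card S) :: complex)" by simp
 finally show ?thesis .
qed

lemma Eul_gen:
 assumes "al : exponents n" "S <= {..<n}"
 shows "Eul n (gen (al, S)) = pscale (of_nat (card S) - of_nat n - of_nat (deg n al)) (gen (al, S))"
proof -
 have "FR n (pvar i) i (gen (al, S)) = tns (gen al) (eps i (iot i (gen S))) - tns (pdiff i (pvar i * gen al)) (gen S)" if "i < n" for i
 proof -
  have "(\<Sum>k<n. tns (fT n (pdiff k (pvar i)) (gen al)) (eps k (iot i (gen S)))) = (\<Sum>k<n. if k = i then tns (gen al) (eps i (iot i (gen S))) else 0)"
   by (intro sum.cong refl) (auto simp: pdiff_pvar tns_simps1)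
  then show ?thesis unfolding tns_gen[symmetric] using that
   by (simp add: FR_tns fT_pvar tns_simps1)
 qed
 then have "Eul n (gen (al, S)) = tns (gen al) (\<Sum>i<n. eps i (iot i (gen S))) - tns (\<Sum>i<n. pdiff i (pvar i * gen al)) (gen S)"
  by (simp add: Eul_def sum_subtractf tns_simps1 tns_simps2)
 also have "... = pscale (of_nat (card S) - of_nat n - of_nat (deg n al)) (gen (al, S))"
  unfolding ei_sum[OF assms(2)] pdiff_pvar_times[OF assms(1)] tns_gen[symmetric]
  by (simp only: tns_simps1 tns_simps2 pm.scale_left_diff_distrib pm.scale_left_distrib diff_diff_add)
 finally show ?thesis .
qed

lemma lookup_Eul:
 assumes "z : FS n r"
 shows "lookup (Eul n z) (al, S) = (of_nat r - of_nat n - of_nat (deg n al)) * lookup z (al, S)"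
proof -
 have "keys z <= exponents n \<times> {S. S <= {..<n} & card S = r}" using assms by (simp add: FS_def)
 then show ?thesis
 proof (induction rule: pm_sup_induct)
  case (gen x)
  then obtain be T where x: "x = (be, T)" "be : exponents n" "T <= {..<n}" "card T = r" by auto
  show ?case unfolding x(1) Eul_gen[OF x(2,3)] x(4) by (auto simp: lookup_single when_def)
 qed (auto simp: plin_simps[OF plin_Eul] lookup_add distrib_left)
qed

lemma FR_dd: "f : polys n ==> j < n ==> FR n f j (dd n z) = dd n (FR n f j z)"
 by (simp add: cartan dd_dd plin_simps[OF plin_inn] plin_simps[OF plin_dd])

lemma Eul_dd: "Eul n (dd n z) = dd n (Eul n z)"
 by (simp add: Eul_def FR_dd plin_simps[OF plin_dd])

text \<open>In degree \<open>r + 1 \<le> n\<close> the Euler eigenvalue vanishes at most at exponent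
  0, and \<open>dd n z\<close> has no component there.\<close>

lemma dd_zeroI:
 assumes "z : FS n r" "r < n" "dd n (Eul n z) = 0" shows "dd n z = 0"
proof (rule poly_mapping_eqI)
 fix x :: mix
 obtain al S where x: "x = (al, S)" by force
 have "lookup (Eul n (dd n z)) x = 0" using assms(3) by (simp add: Eul_dd)
 then have "of_nat (Suc r) = (of_nat (n + deg n al) :: complex) \<or> lookup (dd n z) x = 0"
  unfolding x lookup_Eul[OF dd_FS[OF assms(1)]] by (simp only: mult_eq_0_iff diff_diff_add of_nat_add right_minus_eq)
 then have d: "Suc r = n + deg n al \<or> lookup (dd n z) x = 0" by (simp only: of_nat_eq_iff)
 show "lookup (dd n z) x = lookup 0 x"
 proof (cases "al = 0")
  case True then show ?thesis by (simp add: x lookup_dd_0)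
 next
  case False
  show ?thesis
  proof (cases "al : exponents n")
   case True
   then have "deg n al ~= 0" using deg_eq_0 False by blast
   then show ?thesis using d assms(2) by auto
  next
   case False
   then show ?thesis using dd_FS[OF assms(1)] by (auto simp: x FS_def in_keys_iff subset_iff)
  qed
 qed
qed

text \<open>For \<open>r < n\<close> the Euler field is invertible in degree \<open>r\<close>. The
  preimage \<open>y\<close> of a closed form is closed, and by Cartan's formula the form itself,
  being the Euler image of \<open>y\<close>, is exact.\<close>

lemma dd_exact:
 assumes z: "z : FS n r" "dd n z = 0" and r: "0 < r" "r < n"
 shows "z : dd n ` FS n (r - 1)"
proof -
 define c :: "(nat \<Rightarrow>\<^sub>0 nat) => complex" where "c = (%al. of_nat r - of_nat n - of_nat (deg n al))"
 have c: "c al ~= 0" for al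
 proof
  assume "c al = 0"
  then have "of_nat r = (of_nat (n + deg n al) :: complex)" by (simp add: c_def algebra_simps)
  then have "r = n + deg n al" by (simp only: of_nat_eq_iff)
  then show False using r by simp
 qed
 define y where "y = lext (%(al, S). pscale (1 / c al) (gen (al, S))) z"
 have ly: "lookup y (al, S) = lookup z (al, S) / c al" for al S
  unfolding y_def
  by (rule pm_sup_induct[of z UNIV "%z. lookup (lext (%(al, S). pscale (1 / c al) (gen (al, S))) z) (al, S) = lookup z (al, S) / c al"])
   (auto simp: plin_simps[OF plin_lext] lookup_add add_divide_distrib lookup_single when_def split: if_splits)
 have y: "y : FS n r" using z(1) by (auto simp: FS_def subset_iff in_keys_iff ly)
 have E: "Eul n y = z"
 proof (rule poly_mapping_eqI)
  fix x :: mix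
  obtain al S where x: "x = (al, S)" by force
  show "lookup (Eul n y) x = lookup z x" unfolding x lookup_Eul[OF y] ly using c[of al] by (simp add: c_def)
 qed
 have "dd n y = 0" by (rule dd_zeroI[OF y r(2)]) (simp add: E z(2))
 then have "FR n f j y : dd n ` FS n (r - 1)" if "f : polys n" "j < n" for f j
  using FR_ker_dd[of y n "r - 1"] y r that by simp
 then have "Eul n y : dd n ` FS n (r - 1)"
  unfolding Eul_def by (intro pm.subspace_sum[OF dd_image_subspace]) auto
 then show ?thesis by (simp add: E)
qed

text \<open>Contractions vanish in degree 0, so by Cartan's formula a closed element is killed by
  the Euler field, whose eigenvalues \<open>-(n + |\<alpha>|)\<close> are nonzero.\<close>

lemma FS_0_dd: assumes "z : FS n 0" "dd n z = 0" "n \<ge> 1" shows "z = 0"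
proof (rule poly_mapping_eqI)
 fix x :: mix
 obtain al S where x: "x = (al, S)" by force
 have i: "inn n f j z = 0" if "f : polys n" for f j
  using assms(1) by (induction rule: FS_induct) (use that in \<open>auto simp: plin_simps[OF plin_inn] inn_tns iot_Lam_0 tns_simps2\<close>)
 have "Eul n z = 0" unfolding Eul_def using assms(2) by (intro sum.neutral) (simp add: cartan i plin_simps[OF plin_dd] plin_simps[OF plin_inn])
 moreover have "lookup (Eul n z) (al, S) = - (of_nat (n + deg n al) * lookup z (al, S))"
  unfolding lookup_Eul[OF assms(1)] by (simp add: algebra_simps)
 ultimately have "(of_nat (n + deg n al) :: complex) * lookup z x = 0" by (simp add: x)
 then show "lookup z x = lookup 0 x" using assms(3) by (simp del: of_nat_add)
qed

text \<open>One direction is Cartan's formula. For the other, the Euler field sends the element to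
  an exact form; so the differential of this image vanishes, and \<open>dd_zeroI\<close>
  applies.\<close>

lemma Ln_tilde_iff:
 assumes r: "0 < r" "r < n" and z: "z : carrier (F_ext n r)"
 shows "z : Ln_tilde n r \<longleftrightarrow> dd n (Fmap n z) = 0"
proof -
 note l = F_ext_liso[of n r]
 note lm = liso_lmap[OF l]
 have zF: "Fmap n z : FS n r" by (rule liso_in[OF l z])
 have in_Ln: "v : Ln n r \<longleftrightarrow> Fmap n v : dd n ` FS n (r - 1)" if "v : carrier (F_ext n r)" for v
  unfolding Ln_image[OF r(1), symmetric] using that Ln_carrier[of n r] liso_inj[OF l that] by blast
 have mem: "z : Ln_tilde n r \<longleftrightarrow> (\<forall>D\<in>cDer n. Fact n D (Fmap n z) : dd n ` FS n (r - 1))"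
  unfolding Ln_tilde_def using z by (auto simp: in_Ln lmap_closed[OF lm] lmap_act[OF lm])
 show ?thesis
 proof
  assume "z : Ln_tilde n r"
  then have "FR n (pvar i) i (Fmap n z) : dd n ` FS n (r - 1)" if "i < n" for i
   using mem that Fact_dop[OF that, of "pvar i" "Fmap n z"] by (metis dop_Der polys_pvar)
  then have "Eul n (Fmap n z) : dd n ` FS n (r - 1)"
   unfolding Eul_def by (intro pm.subspace_sum[OF dd_image_subspace]) auto
  then have "dd n (Eul n (Fmap n z)) = 0" by (auto simp: dd_dd)
  then show "dd n (Fmap n z) = 0" by (rule dd_zeroI[OF zF r(2)])
 next
  assume d: "dd n (Fmap n z) = 0"
  have "FR n f j (Fmap n z) : dd n ` FS n (r - 1)" if "f : polys n" "j < n" for f j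
   using FR_ker_dd[of "Fmap n z" n "r - 1"] zF d r that by simp
  then show "z : Ln_tilde n r"
   unfolding mem Fact_FR using Der_polys by (auto intro!: pm.subspace_sum[OF dd_image_subspace])
 qed
qed

section \<open>Leading coefficients of forms\<close>

definition slice :: "(nat \<Rightarrow>\<^sub>0 nat) => mix cv => nat set cv" where
 "slice be = lext (%(al, S). if al = be then gen S else 0)"

lemma lookup_slice: "lookup (slice be z) S = lookup z (be, S)"
 unfolding slice_def
 by (rule pm_sup_induct[of z UNIV "%z. lookup (lext (%(al, S). if al = be then gen S else 0) z) S = lookup z (be, S)"])
  (auto simp: plin_simps[OF plin_lext] lookup_add lookup_single when_def split: if_splits)

lemma slice_Lam: "z : FS n r ==> slice be z : Lam n r"
 by (auto simp: FS_def Lam_def subset_iff in_keys_iff lookup_slice)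

lemma slice_sum: "z = (\<Sum>be\<in>fst ` keys z. tns (gen be) (slice be z))"
proof (rule poly_mapping_eqI)
 fix x :: mix
 obtain al S where x: "x = (al, S)" by force
 have "lookup (\<Sum>be\<in>fst ` keys z. tns (gen be) (slice be z)) x = (\<Sum>be\<in>fst ` keys z. if be = al then lookup z x else 0)"
  unfolding lookup_sum x by (intro sum.cong refl) (auto simp: lookup_tns lookup_slice lookup_single when_def)
 also have "... = (if al : fst ` keys z then lookup z x else 0)" by simp
 also have "... = lookup z x" by (force simp: x in_keys_iff)
 finally show "lookup z x = lookup (\<Sum>be\<in>fst ` keys z. tns (gen be) (slice be z)) x" by simp
qed

lemma fT_gen: "be : exponents n ==> fT n (gen be) p = pscale ((- 1) ^ deg n be) (opow n pdiff be p)"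
proof (induction rule: exponents_induct)
 case (add be i)
 have "fT n (gen (be + ex i)) p = - pdiff i (fT n (gen be) p)"
  using fT_pvar_times[OF add.hyps(2), of "gen be" p] by (simp add: pvar_def gen_times add.commute)
 then show ?case using add by (simp add: pdiff_simps opow_add[OF comm_ops_pdiff] deg_add power_add)
qed (simp add: gen_0)

lemma gen_mono: "gen ga = pscale (\<Prod>i<n. fact (lookup ga i)) (mono n ga)"
 by (simp add: mono_def)

lemma fT_gen_top:
 assumes "be : exponents n" "ga : exponents n" "deg n ga <= deg n be" "ga ~= be" shows "fT n (gen be) (gen ga) = 0"
proof -
 have "opow n pdiff be (mono n ga) = 0"
 proof (rule opow_pdiff_mono_0[OF assms(1)])
  fix de show "ga ~= be + de"
  proof
   assume d: "ga = be + de"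
   have "de : exponents n" using exponents_minus[OF assms(2), of be] d by simp
   moreover have "deg n de = 0" using assms(3) d by (simp add: deg_add)
   ultimately have "de = 0" using deg_eq_0 by blast
   then show False using assms(4) d by simp
  qed
 qed
 then show ?thesis unfolding fT_gen[OF assms(1)]
  by (subst gen_mono[of ga n]) (simp add: plin_scale[OF plin_opow[OF comm_ops_pdiff assms(1)]])
qed

lemma fT_gen_self:
 assumes "be : exponents n"
 obtains c where "c ~= 0" "fT n (gen be) (gen be) = pscale c 1"
proof -
 have "opow n pdiff be (mono n be) = 1" using opow_pdiff_mono[OF assms, of 0] by simp
 then have "fT n (gen be) (gen be) = pscale ((- 1) ^ deg n be * (\<Prod>i<n. fact (lookup be i))) 1"
  unfolding fT_gen[OF assms] by (subst gen_mono[of be n]) (simp add: plin_scale[OF plin_opow[OF comm_ops_pdiff assms]])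
 moreover have "(- 1) ^ deg n be * (\<Prod>i<n. fact (lookup be i)) ~= (0 :: complex)" by simp
 ultimately show thesis using that by blast
qed

section \<open>The exterior case\<close>

context smooth_drep
begin

context
 fixes r :: nat and eta :: "nat set cv => 'x cv"
 assumes r: "r <= n" and n: "n \<ge> 1" and plin_eta: "plin eta" and eta_T: "!!y. y : Lam n r ==> eta y : filtT"
  and eta_inj: "!!y. y : Lam n r ==> eta y = 0 ==> y = 0"
  and eta_ei: "!!i j y. i < n ==> j < n ==> y : Lam n r ==> eta (ei i j y) = ee i j (eta y)"
begin

text \<open>The homomorphism from the tensor module to \<open>W\<close> that sends
  \<open>t^\<alpha> \<otimes> w\<close> to \<open>\<partial>^\<alpha>\<close> applied to
  \<open>eta w\<close>.\<close>

definition Phi :: "mix cv => 'x cv" where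
 "Phi = lext (%(al, S). Dp al (eta (gen S)))"

lemma plin_Phi: "plin Phi"
 unfolding Phi_def by (rule plin_lext)

lemmas Phi_simps = plin_simps[OF plin_Phi]

lemma Phi_tns: assumes p: "p : polys n" shows "Phi (tns p w) = Psi p (eta w)"
proof -
 have "Phi (tns (gen al) w) = Dp al (eta w)" if "al : exponents n" for al
 proof (rule plin_eqI[of w UNIV])
  show "plin (%w. Phi (tns (gen al) w))" by (rule plin_comp[OF plin_Phi plin_tns2])
  show "plin (%w. Dp al (eta w))" by (rule plin_comp[OF plin_Dp[OF that] plin_eta])
  show "Phi (tns (gen al) (gen S)) = Dp al (eta (gen S))" for S by (simp add: tns_gen Phi_def)
 qed simp
 then show ?thesis using p unfolding polys_def
  by (intro plin_eqI[of p "exponents n" "%p. Phi (tns p w)" "%p. Psi p (eta w)"])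
   (auto intro: plin_comp[OF plin_Phi plin_tns1] plin_evp simp: evp_gen)
qed

lemma sing_T: "singular ee filtT"
 by (rule singular_filt1[OF filtT_stable]) (auto simp: filtT_def)

lemma Phi_FR: assumes z: "z : FS n r" and f: "f : polys n" "j < n" shows "Phi (FR n f j z) = R f j (Phi z)"
 using z
proof (induction rule: FS_induct)
 case (tns p w)
 have a: "pvar j * p : polys n" "fT n f (pvar j * p) : polys n" "!!i. fT n (pdiff i f) p : polys n" using f tns by auto
 have "R f j (Phi (tns p w)) = Psi (fT n f (pvar j * p)) (eta w) + (\<Sum>i<n. Psi (fT n (pdiff i f) p) (ee i j (eta w)))"
  unfolding Phi_tns[OF tns(1)] by (rule Psi_R[OF sing_T eta_T[OF tns(2)] tns(1) f])
 also have "... = Phi (FR n f j (tns p w))"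
  using f tns(2) a by (simp add: FR_tns Phi_simps Phi_tns eta_ei)
 finally show ?case by simp
qed (use f in \<open>auto simp: Phi_simps R_simps plin_simps[OF plin_FR]\<close>)

lemma Phi_image_stable:
 assumes "pm.subspace Z" "Z <= FS n r" "!!f j z. f : polys n ==> j < n ==> z : Z ==> FR n f j z : Z"
 shows "stable 0 (Phi ` Z)" "Phi ` Z <= W"
proof -
 show "stable 0 (Phi ` Z)"
  unfolding stable_def
 proof (intro conjI allI impI)
  show "pm.subspace (Phi ` Z)" by (rule subspace_plin_image[OF plin_Phi assms(1)])
  fix f j u assume "ordge n 0 f" "j < n" "u : Phi ` Z"
  then obtain z where z: "z : Z" "u = Phi z" "f : polys n" "j < n" by auto
  then have "R f j u = Phi (FR n f j z)" using Phi_FR[of z f j] assms(2) by auto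
  then show "R f j u : Phi ` Z" using assms(3)[OF z(3,4,1)] by blast
 qed
 have "Phi z : W" if "z : FS n r" for z
  using that
 proof (induction rule: FS_induct)
  case (tns p w)
  have "eta w : W" using eta_T[OF tns(2)] filt_W by (auto simp: filtT_def)
  then show ?case unfolding Phi_tns[OF tns(1)]
   by (intro evp_in[OF comm_R _ _ tns(1) W_sub]) (auto intro: W_stable)
 qed (auto simp: Phi_simps W_0 pm.subspace_add[OF W_sub] pm.subspace_scale[OF W_sub])
 then show "Phi ` Z <= W" using assms(2) by blast
qed

lemma Phi_1: "Phi (tns 1 w) = eta w"
 by (simp add: Phi_tns)

lemma Phi_top_nz: "Phi (tns 1 (gen {..<r})) ~= 0" "gen {..<r} : Lam n r"
proof -
 show L: "gen {..<r} : Lam n r" using r by (simp add: Lam_gen)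
 have "(gen {..<r} :: nat set cv) ~= 0" by (simp add: poly_mapping_eq_iff fun_eq_iff lookup_single when_def exI[of _ "{..<r}"])
 then show "Phi (tns 1 (gen {..<r})) ~= 0" unfolding Phi_1 using eta_inj[OF L] by blast
qed

lemma Phi_FS: "Phi ` FS n r = W"
proof -
 note st = Phi_image_stable[OF subspace_FS order_refl FR_FS]
 have "tns 1 (gen {..<r}) : FS n r" using Phi_top_nz(2) by (intro FS_tns) auto
 then have "Phi ` FS n r ~= {0}" using Phi_top_nz(1) by blast
 then show ?thesis using W_simple[OF st] by blast
qed

text \<open>The exact forms are stable under all fields, so their image is 0 or \<open>W\<close>.
  They involve only exponents of positive degree, hence their image lies strictly below the Euler
  eigenvalue of the nonzero vector \<open>Phi (tns 1 (gen {..<r}))\<close> and is not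
  \<open>W\<close>.\<close>

lemma Phi_dd: assumes z: "z : FS n (r - 1)" "0 < r" shows "Phi (dd n z) = 0"
proof -
 let ?Z = "dd n ` FS n (r - 1)"
 have sub: "?Z <= FS n r" using dd_FS[of _ n "r - 1"] z(2) by auto
 note st = Phi_image_stable[OF dd_image_subspace sub FR_dd_image]
 define H where "H u = (\<Sum>i<n. R (pvar i) i u)" for u
 have H: "plin H" unfolding H_def by (intro plin_sumI R_plin) auto
 have HP: "H (Phi y) = Phi (Eul n y)" if "y : FS n r" for y
  using that by (simp add: H_def Eul_def Phi_simps Phi_FR)
 \<comment> \<open>The Euler eigenvalue in form degree \<open>r\<close> at exponent 0.\<close>
 define a :: complex where "a = of_nat r - of_nat n"
 have He: "H (Phi (gen (al, S))) = pscale (a - of_nat (deg n al)) (Phi (gen (al, S)))"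
  if "al : exponents n" "S <= {..<n}" "card S = r" for al S
 proof -
  have "gen (al, S) : FS n r" using that by (simp add: FS_def)
  from HP[OF this] show ?thesis unfolding Eul_gen[OF that(1,2)] that(3) a_def by (simp only: Phi_simps)
 qed
 have bel: "Phi (dd n y) : below H a" if y: "y : FS n (r - 1)" for y
  using y[unfolded FS_def mem_Collect_eq]
 proof (induction rule: pm_sup_induct)
  case (gen x)
  then obtain be T where x: "x = (be, T)" "be : exponents n" "T <= {..<n}" "card T = r - 1" by auto
  have "Phi (tns (pvar k * gen be) (eps k (gen T))) : below H a" if k: "k < n" for k
  proof (cases "k : T")
   case True
   then show ?thesis by (simp add: eps_single tns_simps2 Phi_simps pm.subspace_0[OF below_props(1)[OF H]])
  next
   case False
   have e: "tns (pvar k * gen be) (eps k (gen T)) = pscale (sg k T) (gen (be + ex k, insert k T))"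
   proof -
    have "eps k (gen T) = pscale (sg k T) (gen (insert k T))" using False by (simp add: eps_single)
    moreover have "pvar k * gen be = gen (be + ex k)" by (simp add: pvar_def gen_times add.commute)
    ultimately show ?thesis by (simp only: tns_simps2 tns_gen)
   qed
   have "finite T" using x(3) finite_subset by blast
   then have "card (insert k T) = r" using False x(4) z(2) by simp
   then have "H (Phi (gen (be + ex k, insert k T))) = pscale (a - of_nat (Suc (deg n be))) (Phi (gen (be + ex k, insert k T)))"
    using He[of "be + ex k" "insert k T"] x k by (simp add: deg_add exponents_add)
   from below_props(3)[OF H this] show ?thesis unfolding e Phi_simps by (rule pm.subspace_scale[OF below_props(1)[OF H]])
  qed
  then show ?case unfolding x(1) tns_gen[symmetric] dd_tns Phi_simps by (intro pm.subspace_sum[OF below_props(1)[OF H]]) auto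
 qed (auto simp: plin_simps[OF plin_dd] Phi_simps intro: pm.subspace_0[OF below_props(1)[OF H]]
   pm.subspace_add[OF below_props(1)[OF H]] pm.subspace_scale[OF below_props(1)[OF H]])
 have "Phi ` ?Z ~= W"
 proof
  assume "Phi ` ?Z = W"
  moreover have top: "tns 1 (gen {..<r}) = gen (0, {..<r})" using tns_gen[of 0 "{..<r}"] by (simp add: gen_0)
  moreover have "Phi (gen (0, {..<r})) : W" using Phi_FS r by (auto simp: FS_def)
  ultimately have "Phi (gen (0, {..<r})) : below H a" using bel by auto
  moreover have "H (Phi (gen (0, {..<r}))) = pscale a (Phi (gen (0, {..<r})))" using He[of 0 "{..<r}"] r by simp
  ultimately have "Phi (gen (0, {..<r})) = 0" using below_props(2)[OF H] by blast
  then show False using Phi_top_nz(1) top by simp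
 qed
 then have "Phi ` ?Z = {0}" using W_simple[OF st] by blast
 then show ?thesis using z(1) by blast
qed

text \<open>Let \<open>y = dd n z\<close>. By Cartan's formula \<open>Phi\<close> kills every
  contraction of \<open>y\<close> with a field. Contraction with
  \<open>t^\<beta> \<partial>_j\<close>, for \<open>\<beta>\<close> of maximal degree in
  \<open>y\<close>, leaves only a nonzero constant times the contracted coefficient of
  \<open>t^\<beta>\<close>. As \<open>eta\<close> is injective, all contractions of this coefficient
  vanish; it has positive degree, so it is zero.\<close>

lemma Phi_ker_dd: assumes z: "z : FS n r" "Phi z = 0" shows "dd n z = 0"
proof (rule ccontr)
 let ?y = "dd n z"
 assume "?y ~= 0"
 have y: "?y : FS n (Suc r)" by (rule dd_FS[OF z(1)])
 have inn0: "Phi (inn n f j ?y) = 0" if f: "f : polys n" "j < n" for f j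
 proof -
  have "Phi (dd n (inn n f j z)) = 0"
  proof (cases r)
   case 0
   have "inn n f j z = 0" using z(1)[unfolded 0]
    by (induction rule: FS_induct) (use f in \<open>auto simp: plin_simps[OF plin_inn] inn_tns iot_Lam_0 tns_simps2\<close>)
   then show ?thesis by (simp add: plin_simps[OF plin_dd] Phi_simps)
  next
   case (Suc s)
   then show ?thesis using Phi_dd inn_FS[of z n s f j] z(1) f by simp
  qed
  moreover have "Phi (FR n f j z) = 0" using Phi_FR[OF z(1) f] z(2) f by (simp add: R_simps)
  ultimately show ?thesis using cartan[OF f, of z] by (simp add: Phi_simps)
 qed
 let ?B = "fst ` keys ?y"
 have B: "finite ?B" "?B ~= {}" using \<open>?y ~= 0\<close> by simp_all
 have Be: "be : exponents n" if "be : ?B" for be using that y by (auto simp: FS_def)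
 have fin: "finite (deg n ` ?B)" using B(1) by simp
 have "Max (deg n ` ?B) : deg n ` ?B" by (rule Max_in[OF fin]) (use B(2) in simp)
 then obtain be where be: "be : ?B" "deg n be = Max (deg n ` ?B)" by force
 have max: "deg n ga <= deg n be" if "ga : ?B" for ga unfolding be(2) using that by (intro Max_ge[OF fin]) auto
 obtain c where c: "c ~= 0" "fT n (gen be) (gen be) = pscale c 1"
  by (rule fT_gen_self[OF Be[OF be(1)]])
 have gp: "gen be : polys n" using Be[OF be(1)] by simp
 have "iot j (slice be ?y) = 0" if j: "j < n" for j
 proof -
  have "inn n (gen be) j ?y = (\<Sum>ga\<in>?B. tns (fT n (gen be) (gen ga)) (iot j (slice ga ?y)))"
   using gp by (subst (1) slice_sum[of ?y]) (simp add: plin_simps[OF plin_inn] inn_tns)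
  also have "... = (\<Sum>ga\<in>?B. if ga = be then pscale c (tns 1 (iot j (slice be ?y))) else 0)"
   using fT_gen_top[OF Be[OF be(1)] Be max] by (intro sum.cong refl) (auto simp: c(2) tns_simps1)
  also have "... = pscale c (tns 1 (iot j (slice be ?y)))" using B(1) be(1) by simp
  finally have "pscale c (eta (iot j (slice be ?y))) = 0" using inn0[OF gp j] by (simp add: Phi_simps Phi_1)
  then have "eta (iot j (slice be ?y)) = 0" using c(1) by simp
  then show ?thesis using eta_inj[OF iot_Lam[OF slice_Lam[OF y]]] by blast
 qed
 then have "slice be ?y = 0" by (rule iot_all_zero[OF slice_Lam[OF y]])
 moreover obtain S where "lookup ?y (be, S) ~= 0" using be(1) by (auto simp: in_keys_iff)
 ultimately show False using lookup_slice[of be ?y S] by simp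
qed

lemma exterior_lmap: "lmap (cDer n) (F_ext n r) \<rho> (%v. Phi (Fmap n v))"
proof -
 note l = F_ext_liso[of n r]
 note lm = liso_lmap[OF l]
 have "Phi (Fact n D z) = \<rho> D (Phi z)" if "D : cDer n" "z : FS n r" for D z
  using that Der_polys[OF that(1)] by (simp add: rho_R dact_def Fact_FR Phi_simps Phi_FR)
 then show ?thesis
  unfolding lmap_def using lmap_module[OF lm]
  by (auto simp: lmap_add[OF lm] lmap_smult[OF lm] lmap_act[OF lm] lmap_closed[OF lm] Phi_simps liso_in[OF l])
qed

lemma exterior_image: "(%v. Phi (Fmap n v)) ` carrier (F_ext n r) = W"
 using Phi_FS liso_image[OF F_ext_liso[of n r]] by (metis image_image)

text \<open>The kernel of \<open>Phi\<close> is zero in degree 0, consists of the closed forms for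
  \<open>0 < r < n\<close>, where they are exact, and is the image of the differential in top
  degree.\<close>

lemma exterior_liso:
 "(\<exists>fi. liso (cDer n) (F_ext n 0) \<rho> fi W) \<or>
  (\<exists>s\<in>{1..n - 1}. \<exists>fi. liso (cDer n) (quot_module (F_ext n s) (Ln_tilde n s)) \<rho> fi W) \<or>
  (\<exists>fi. liso (cDer n) (quot_module (F_ext n n) (Ln n n)) \<rho> fi W)"
proof -
 let ?N = "{v : carrier (F_ext n r). Phi (Fmap n v) = 0}"
 note l = F_ext_liso[of n r]
 note q = quot_liso(1)[OF exterior_lmap refl, unfolded exterior_image]
 consider "r = 0" | "0 < r" "r < n" | "r = n" using r by linarith
 then show ?thesis
 proof cases
  case 1
  have "inj_on (%v. Phi (Fmap n v)) (carrier (F_ext n r))"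
  proof (rule inj_onI)
   fix v w assume v: "v : carrier (F_ext n r)" "w : carrier (F_ext n r)" "Phi (Fmap n v) = Phi (Fmap n w)"
   then have "Fmap n v - Fmap n w : FS n r" "Phi (Fmap n v - Fmap n w) = 0"
    using liso_in[OF l] pm.subspace_diff[OF subspace_FS] by (auto simp: Phi_simps)
   then have "Fmap n v - Fmap n w = 0" using FS_0_dd[OF _ Phi_ker_dd n] 1 by blast
   then show "v = w" using liso_inj[OF l v(1,2)] by simp
  qed
  then have "liso (cDer n) (F_ext n r) \<rho> (%v. Phi (Fmap n v)) W"
   using exterior_lmap exterior_image by (auto simp: liso_def bij_betw_def)
  then show ?thesis using 1 by blast
 next
  case 2
  have "?N = Ln_tilde n r"
  proof -
   have "Phi z = 0 \<longleftrightarrow> dd n z = 0" if "z : FS n r" for z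
    using Phi_ker_dd[OF that] dd_exact[OF that _ 2] Phi_dd 2(1) by blast
   then have "?N = {v : carrier (F_ext n r). v : Ln_tilde n r}"
    using liso_in[OF l] Ln_tilde_iff[OF 2] by blast
   then show ?thesis by (auto simp: Ln_tilde_def)
  qed
  then show ?thesis using q 2 by (intro disjI2 disjI1 bexI[of _ r]) auto
 next
  case 3
  have rn: "0 < r" using 3 n by simp
  have Phi_top: "Phi z = 0 \<longleftrightarrow> lookup z (0, {..<n}) = 0" if z: "z : FS n n" for z
  proof -
   let ?c = "lookup z (0, {..<n})" and ?t = "tns 1 (gen {..<n})"
   have t: "?t : FS n n" by (intro FS_tns) (auto simp: Lam_gen)
   have "z - pscale ?c ?t : {z : FS n n. lookup z (0, {..<n}) = 0}"
    using z t by (auto simp: lookup_minus lookup_tns lookup_one intro!: pm.subspace_diff[OF subspace_FS] pm.subspace_scale[OF subspace_FS])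
   then obtain y where y: "z - pscale ?c ?t = dd n y" "y : FS n (n - 1)" unfolding top_dd[OF n, symmetric] by (rule imageE)
   have "Phi (z - pscale ?c ?t) = 0" unfolding y(1) using Phi_dd[OF _ rn] y(2) 3 by simp
   then show ?thesis using Phi_top_nz(1) 3 by (simp add: Phi_simps)
  qed
  have "?N = Ln n n" unfolding Ln_member[OF n] using liso_in[OF l] Phi_top 3 by auto
  then show ?thesis using q 3 by auto
 qed
qed

end

end

section \<open>Lie modules in coordinates\<close>

lemma liso_lie_module:
 assumes l: "liso (carrier L) M a fi N" and L: "module CC L" "!!x y. x : carrier L ==> y : carrier L ==> x \<otimes>\<^bsub>L\<^esub> y : carrier L"
  and a: "!!x. x : carrier L ==> plin (a x)"
  "!!x y u. x : carrier L ==> y : carrier L ==> u : N ==> a (x \<oplus>\<^bsub>L\<^esub> y) u = a x u + a y u"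
  "!!x c u. x : carrier L ==> u : N ==> a (c \<odot>\<^bsub>L\<^esub> x) u = pscale c (a x u)"
  "!!x y u. x : carrier L ==> y : carrier L ==> u : N ==> a (x \<otimes>\<^bsub>L\<^esub> y) u = a x (a y u) - a y (a x u)"
 shows "lie_module L M"
proof -
 note lm = liso_lmap[OF l]
 note cl = lmap_closed[OF lm]
 interpret L: module CC L by (rule L(1))
 interpret M: module CC M by (rule lmap_module[OF lm])
 have eq: "v = w" if "v : carrier M" "w : carrier M" "fi v = fi w" for v w using liso_inj[OF l that(1,2)] that(3) by simp
 show ?thesis
 proof (unfold_locales)
  fix x v w assume x: "x : carrier L" and v: "v : carrier M" and w: "w : carrier M"
  show "act M x (v \<oplus>\<^bsub>M\<^esub> w) = act M x v \<oplus>\<^bsub>M\<^esub> act M x w"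
   by (rule eq) (use x v w in \<open>auto simp: cl lmap_act[OF lm] lmap_add[OF lm] plin_simps[OF a(1)]\<close>)
 next
  fix x v c assume x: "x : carrier L" and v: "v : carrier M"
  show "act M x v : carrier M" using x v by (rule cl)
  show "act M x (c \<odot>\<^bsub>M\<^esub> v) = c \<odot>\<^bsub>M\<^esub> act M x v"
   by (rule eq) (use x v in \<open>auto simp: cl lmap_act[OF lm] lmap_smult[OF lm] plin_simps[OF a(1)]\<close>)
  show "act M (c \<odot>\<^bsub>L\<^esub> x) v = c \<odot>\<^bsub>M\<^esub> act M x v"
   by (rule eq) (use x v in \<open>auto simp: cl lmap_act[OF lm] lmap_smult[OF lm] a(3) liso_in[OF l]\<close>)
 next
  fix x y v assume x: "x : carrier L" and y: "y : carrier L" and v: "v : carrier M"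
  show "act M (x \<oplus>\<^bsub>L\<^esub> y) v = act M x v \<oplus>\<^bsub>M\<^esub> act M y v"
   by (rule eq) (use x y v in \<open>auto simp: cl lmap_act[OF lm] lmap_add[OF lm] a(2) liso_in[OF l]\<close>)
  show "act M (x \<otimes>\<^bsub>L\<^esub> y) v = act M x (act M y v) \<ominus>\<^bsub>M\<^esub> act M y (act M x v)"
   by (rule eq) (use x y v in \<open>auto simp: cl lmap_act[OF lm] lmap_diff[OF lm] a(4) liso_in[OF l] L(2)\<close>)
 qed
qed

lemma liso_submodule_image:
 assumes l: "liso S M a fi N" and N': "submodule N' CC M"
 shows "pm.subspace (fi ` N')"
proof -
 note lm = liso_lmap[OF l]
 have N: "N' <= carrier M" "\<zero>\<^bsub>M\<^esub> : N'" "!!v w. v : N' ==> w : N' ==> v \<oplus>\<^bsub>M\<^esub> w : N'" "!!c v. v : N' ==> c \<odot>\<^bsub>M\<^esub> v : N'"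
  using N' unfolding submodule_CC_iff[OF lmap_module[OF lm]] by auto
 show ?thesis
  unfolding pm.subspace_def
 proof (safe)
  show "0 : fi ` N'" using N(2) lmap_zero[OF lm] by (metis imageI)
  show "fi v + fi w : fi ` N'" if "v : N'" "w : N'" for v w
   using lmap_add[OF lm, of v w] N that by (metis imageI subsetD)
  show "pscale c (fi v) : fi ` N'" if "v : N'" for c v
   using lmap_smult[OF lm, of v c] N that by (metis imageI subsetD)
 qed
qed

lemma liso_simple:
 assumes l: "liso (carrier L) M a fi N" and L: "lie_module L M" and N: "N ~= {0}"
  and simple: "!!N'. pm.subspace N' ==> N' <= N ==> (!!x u. x : carrier L ==> u : N' ==> a x u : N') ==> N' = {0} \<or> N' = N"
 shows "simple_lie_module L M"
proof -
 note lm = liso_lmap[OF l]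
 interpret M: module CC M by (rule lmap_module[OF lm])
 show ?thesis
  unfolding simple_lie_module_def
 proof (intro conjI allI impI L)
  show "carrier M ~= {\<zero>\<^bsub>M\<^esub>}" using N liso_image[OF l] lmap_zero[OF lm] by auto
  fix N' assume "lie_submodule L M N'"
  then have N': "submodule N' CC M" "!!x v. x : carrier L ==> v : N' ==> act M x v : N'" by (auto simp: lie_submodule_def)
  have sub: "N' <= carrier M" using N'(1) by (simp add: submodule_CC_iff[OF lmap_module[OF lm]])
  have "a x u : fi ` N'" if x: "x : carrier L" "u : fi ` N'" for x u
  proof -
   obtain v where v: "v : N'" "u = fi v" using x(2) by blast
   then have "a x u = fi (act M x v)" using lmap_act[OF lm x(1), of v] sub by auto
   then show ?thesis using N'(2)[OF x(1) v(1)] by blast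
  qed
  moreover have "fi ` N' <= N" using sub liso_in[OF l] by blast
  ultimately have "fi ` N' = {0} \<or> fi ` N' = N" using simple liso_submodule_image[OF l N'(1)] by blast
  moreover have "inj_on fi (carrier M)" using liso_bij[OF l] by (rule bij_betw_imp_inj_on)
  ultimately have "fi ` N' = fi ` {\<zero>\<^bsub>M\<^esub>} \<or> fi ` N' = fi ` carrier M" using lmap_zero[OF lm] liso_image[OF l] by simp
  then show "N' = {\<zero>\<^bsub>M\<^esub>} \<or> N' = carrier M"
   using inj_on_image_eq_iff[OF \<open>inj_on fi (carrier M)\<close>] sub by blast
 qed
qed

lemma simple_liso:
 assumes l: "liso (carrier L) M a fi N" and s: "simple_lie_module L M"
  and N': "pm.subspace N'" "N' <= N" "!!x u. x : carrier L ==> u : N' ==> a x u : N'"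
 shows "N' = {0} \<or> N' = N" and "N ~= {0}"
proof -
 note lm = liso_lmap[OF l]
 interpret M: module CC M by (rule lmap_module[OF lm])
 let ?P = "{v : carrier M. fi v : N'}"
 have im: "fi ` ?P = N'" using liso_image[OF l] N'(2) by blast
 have "submodule ?P CC M" unfolding submodule_CC_iff[OF lmap_module[OF lm]]
  by (auto simp: lmap_add[OF lm] lmap_smult[OF lm] lmap_zero[OF lm] pm.subspace_0[OF N'(1)] pm.subspace_add[OF N'(1)] pm.subspace_scale[OF N'(1)])
 then have "lie_submodule L M ?P" unfolding lie_submodule_def by (auto simp: lmap_closed[OF lm] lmap_act[OF lm] N'(3))
 then have "?P = {\<zero>\<^bsub>M\<^esub>} \<or> ?P = carrier M" using s by (simp add: simple_lie_module_def)
 then show "N' = {0} \<or> N' = N"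
 proof
  assume P: "?P = {\<zero>\<^bsub>M\<^esub>}"
  show ?thesis using im[unfolded P] lmap_zero[OF lm] by auto
 next
  assume P: "?P = carrier M"
  show ?thesis using im[unfolded P] liso_image[OF l] by auto
 qed
 show "N ~= {0}"
 proof
  assume "N = {0}"
  then have "fi v = fi \<zero>\<^bsub>M\<^esub>" if "v : carrier M" for v using liso_in[OF l that] lmap_zero[OF lm] by simp
  then have "carrier M <= {\<zero>\<^bsub>M\<^esub>}" using liso_inj[OF l] M.zero_closed by blast
  then show False using s M.zero_closed by (auto simp: simple_lie_module_def)
 qed
qed

text \<open>A subspace of \<open>W\<close>, seen through \<open>fi\<close> as a set of vectors of
  \<open>V\<close>, with an action of another algebra. The new module keeps the element type of
  \<open>V\<close>, as the final statement requires; \<open>mult\<close> and \<open>one\<close> are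
  fillers.\<close>

definition rmod :: "(cop, 'v) lmod => ('v => 'w cv) => 'w cv set => ('s => 'w cv => 'w cv) => ('s, 'v) lmod" where
 "rmod V fi N a = \<lparr>carrier = {v : carrier V. fi v : N}, monoid.mult = (%_ _. \<zero>\<^bsub>V\<^esub>), one = \<zero>\<^bsub>V\<^esub>, zero = \<zero>\<^bsub>V\<^esub>,
   add = add V, module.smult = module.smult V, act = (%s v. the_inv_into (carrier V) fi (a s (fi v)))\<rparr>"

lemma rmod_liso:
 assumes l: "liso S V b fi W" and N: "pm.subspace N" "N <= W" "!!s u. s : S' ==> u : N ==> a s u : N"
 shows "liso S' (rmod V fi N a) a fi N"
proof -
 note lm = liso_lmap[OF l]
 interpret V: module CC V by (rule lmap_module[OF lm])
 let ?M = "rmod V fi N a"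
 have inj: "inj_on fi (carrier V)" using liso_bij[OF l] by (rule bij_betw_imp_inj_on)
 have im: "fi ` carrier ?M = N" using N(2) liso_image[OF l] by (auto simp: rmod_def)
 have inv: "the_inv_into (carrier V) fi u : carrier V" "fi (the_inv_into (carrier V) fi u) = u" if "u : N" for u
  using that N(2) liso_image[OF l] by (auto intro!: the_inv_into_into[OF inj] f_the_inv_into_f[OF inj])
 have inj': "inj_on fi (carrier ?M)" using inj by (rule inj_on_subset) (auto simp: rmod_def)
 have "module CC ?M"
  by (rule moduleI_inj[OF inj'])
   (auto simp: rmod_def lmap_add[OF lm] lmap_smult[OF lm] lmap_zero[OF lm] pm.subspace_0[OF N(1)] pm.subspace_add[OF N(1)] pm.subspace_scale[OF N(1)])
 then show ?thesis
  unfolding liso_def lmap_def bij_betw_def using inj' im N(3) inv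
  by (auto simp: rmod_def lmap_add[OF lm] lmap_smult[OF lm])
qed

section \<open>The tensor module case\<close>

lemma gl_simps: "carrier (gl n) = carrier_mat n n" "A \<oplus>\<^bsub>gl n\<^esub> B = A + B" "c \<odot>\<^bsub>gl n\<^esub> A = c \<cdot>\<^sub>m A" "A \<otimes>\<^bsub>gl n\<^esub> B = A * B - B * A"
 by (simp_all add: gl_def module_mat_def)

lemma gl_module: "module CC (gl n)"
proof (rule moduleI)
 show "abelian_group (gl n)"
 proof (rule abelian_groupI)
  show "\<exists>B\<in>carrier (gl n). B \<oplus>\<^bsub>gl n\<^esub> A = \<zero>\<^bsub>gl n\<^esub>" if "A : carrier (gl n)" for A
   using that by (intro bexI[of _ "- A"]) (auto simp: gl_def module_mat_def)
 qed (auto simp: gl_def module_mat_def)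
qed (auto simp: cring_CC gl_def module_mat_def add_smult_distrib_right_mat add_smult_distrib_left_mat mat_eq_iff)

context smooth_drep
begin

definition gla :: "complex mat => 'x cv => 'x cv" where
 "gla A u = (\<Sum>i<n. \<Sum>j<n. pscale (A $$ (i, j)) (ee i j u))"

lemma plin_ee: "i < n ==> j < n ==> plin (ee i j)"
 by (rule glrep_plin[OF glrep_ee])

lemma plin_gla: "plin (gla A)"
 unfolding gla_def by (intro plin_sumI plin_scaled plin_ee) auto

lemma gla_lin:
 assumes "A : carrier_mat n n" "B : carrier_mat n n"
 shows "gla (A + B) u = gla A u + gla B u" "gla (A - B) u = gla A u - gla B u" "gla (c \<cdot>\<^sub>m A) u = pscale c (gla A u)"
proof -
 have "gla (A + B) u = (\<Sum>i<n. \<Sum>j<n. pscale (A $$ (i, j)) (ee i j u) + pscale (B $$ (i, j)) (ee i j u))"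
  unfolding gla_def by (intro sum.cong refl) (use assms in \<open>auto simp: pm.scale_left_distrib\<close>)
 then show "gla (A + B) u = gla A u + gla B u" by (simp add: gla_def sum.distrib)
 have "gla (A - B) u = (\<Sum>i<n. \<Sum>j<n. pscale (A $$ (i, j)) (ee i j u) - pscale (B $$ (i, j)) (ee i j u))"
  unfolding gla_def by (intro sum.cong refl) (use assms in \<open>auto simp: pm.scale_left_diff_distrib\<close>)
 then show "gla (A - B) u = gla A u - gla B u" by (simp add: gla_def sum_subtractf)
 have "gla (c \<cdot>\<^sub>m A) u = (\<Sum>i<n. \<Sum>j<n. pscale c (pscale (A $$ (i, j)) (ee i j u)))"
  unfolding gla_def by (intro sum.cong refl) (use assms in auto)
 then show "gla (c \<cdot>\<^sub>m A) u = pscale c (gla A u)" by (simp only: gla_def pm.scale_sum_right)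
qed

lemma gla_mat_unit: assumes "i < n" "j < n" shows "gla (mat_unit n i j) u = ee i j u"
proof -
 have "gla (mat_unit n i j) u = (\<Sum>k<n. \<Sum>l<n. if k = i then (if l = j then ee i j u else 0) else 0)"
  unfolding gla_def by (intro sum.cong refl) (auto simp: mat_unit_def)
 also have "... = (\<Sum>k<n. if k = i then ee i j u else 0)"
  by (intro sum.cong refl) (use assms in auto)
 finally show ?thesis using assms by simp
qed

lemma gla_mult: assumes "A : carrier_mat n n" "B : carrier_mat n n"
 shows "gla (A * B) u = (\<Sum>i<n. \<Sum>j<n. \<Sum>l<n. pscale (A $$ (i, j) * B $$ (j, l)) (ee i l u))"
proof -
 have "gla (A * B) u = (\<Sum>i<n. \<Sum>l<n. \<Sum>j<n. pscale (A $$ (i, j) * B $$ (j, l)) (ee i l u))"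
  unfolding gla_def
  by (intro sum.cong refl) (use assms in \<open>simp add: scalar_prod_def row_def col_def pm.scale_sum_left atLeast0LessThan del: pm.scale_scale\<close>)
 also have "... = (\<Sum>i<n. \<Sum>j<n. \<Sum>l<n. pscale (A $$ (i, j) * B $$ (j, l)) (ee i l u))"
  by (intro sum.cong refl sum.swap)
 finally show ?thesis .
qed

lemma gla_gla: "gla A (gla B u) = (\<Sum>i<n. \<Sum>j<n. \<Sum>k<n. \<Sum>l<n. pscale (A $$ (i, j) * B $$ (k, l)) (ee i j (ee k l u)))"
 unfolding gla_def by (intro sum.cong refl) (simp add: plin_simps[OF plin_ee] pm.scale_sum_right)

lemma gla_bracket:
 assumes "A : carrier_mat n n" "B : carrier_mat n n"
 shows "gla (A * B - B * A) u = gla A (gla B u) - gla B (gla A u)"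
proof -
 let ?t = "%i j k l. pscale (A $$ (i, j) * B $$ (k, l))"
 have "gla B (gla A u) = (\<Sum>k<n. \<Sum>l<n. \<Sum>i<n. \<Sum>j<n. ?t i j k l (ee k l (ee i j u)))"
  unfolding gla_gla by (simp only: mult.commute)
 also have "... = (\<Sum>i<n. \<Sum>j<n. \<Sum>k<n. \<Sum>l<n. ?t i j k l (ee k l (ee i j u)))"
 proof -
  have "(\<Sum>k<n. \<Sum>l<n. \<Sum>i<n. \<Sum>j<n. f i j k l) = (\<Sum>i<n. \<Sum>j<n. \<Sum>k<n. \<Sum>l<n. f i j k l)" for f :: "nat => nat => nat => nat => 'x cv"
  proof -
   have "(\<Sum>k<n. \<Sum>l<n. \<Sum>i<n. \<Sum>j<n. f i j k l) = (\<Sum>k<n. \<Sum>i<n. \<Sum>l<n. \<Sum>j<n. f i j k l)"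
    by (rule sum.cong[OF refl], rule sum.swap)
   also have "... = (\<Sum>i<n. \<Sum>k<n. \<Sum>l<n. \<Sum>j<n. f i j k l)" by (rule sum.swap)
   also have "... = (\<Sum>i<n. \<Sum>k<n. \<Sum>j<n. \<Sum>l<n. f i j k l)"
    by (rule sum.cong[OF refl], rule sum.cong[OF refl], rule sum.swap)
   also have "... = (\<Sum>i<n. \<Sum>j<n. \<Sum>k<n. \<Sum>l<n. f i j k l)"
    by (rule sum.cong[OF refl], rule sum.swap)
   finally show ?thesis .
  qed
  then show ?thesis .
 qed
 finally have BA: "gla B (gla A u) = (\<Sum>i<n. \<Sum>j<n. \<Sum>k<n. \<Sum>l<n. ?t i j k l (ee k l (ee i j u)))" .
 have "gla A (gla B u) - gla B (gla A u) = (\<Sum>i<n. \<Sum>j<n. \<Sum>k<n. \<Sum>l<n. ?t i j k l (ee i j (ee k l u)) - ?t i j k l (ee k l (ee i j u)))"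
  unfolding BA unfolding gla_gla by (simp only: sum_subtractf)
 also have "... = (\<Sum>i<n. \<Sum>j<n. \<Sum>k<n. \<Sum>l<n. (if k = j then ?t i j j l (ee i l u) else 0) - (if l = i then ?t i j k i (ee k j u) else 0))"
 proof (intro sum.cong refl)
  fix i j k l assume "i : {..<n}" "j : {..<n}" "k : {..<n}" "l : {..<n}"
  then have "ee i j (ee k l u) = ee k l (ee i j u) + (if j = k then ee i l u else 0) - (if l = i then ee k j u else 0)"
   by (intro glrep_comm[OF glrep_ee]) auto
  then have "?t i j k l (ee i j (ee k l u)) - ?t i j k l (ee k l (ee i j u)) =
   ?t i j k l (if j = k then ee i l u else 0) - ?t i j k l (if l = i then ee k j u else 0)"
   by (simp only: pm.scale_right_diff_distrib pscale_simps) simp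
  then show "?t i j k l (ee i j (ee k l u)) - ?t i j k l (ee k l (ee i j u)) =
   (if k = j then ?t i j j l (ee i l u) else 0) - (if l = i then ?t i j k i (ee k j u) else 0)"
   by (auto split: if_splits)
 qed
 also have "... = (\<Sum>i<n. \<Sum>j<n. \<Sum>l<n. ?t i j j l (ee i l u)) - (\<Sum>i<n. \<Sum>j<n. \<Sum>k<n. ?t i j k i (ee k j u))"
 proof -
  have "(\<Sum>k<n. \<Sum>l<n. if k = j then ?t i j j l (ee i l u) else 0) = (\<Sum>l<n. ?t i j j l (ee i l u))" if "j < n" for i j
  proof -
   have "(\<Sum>k<n. \<Sum>l<n. if k = j then ?t i j j l (ee i l u) else 0) = (\<Sum>k<n. if k = j then (\<Sum>l<n. ?t i j j l (ee i l u)) else 0)"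
    by (intro sum.cong refl) auto
   then show ?thesis using that by simp
  qed
  then show ?thesis by (simp add: sum_subtractf)
 qed
 also have "(\<Sum>i<n. \<Sum>j<n. \<Sum>k<n. ?t i j k i (ee k j u)) = (\<Sum>k<n. \<Sum>i<n. \<Sum>j<n. ?t i j k i (ee k j u))"
 proof -
  have "(\<Sum>i<n. \<Sum>j<n. \<Sum>k<n. f i j k) = (\<Sum>k<n. \<Sum>i<n. \<Sum>j<n. f i j k)" for f :: "nat => nat => nat => 'x cv"
  proof -
   have "(\<Sum>i<n. \<Sum>j<n. \<Sum>k<n. f i j k) = (\<Sum>i<n. \<Sum>k<n. \<Sum>j<n. f i j k)"
    by (rule sum.cong[OF refl], rule sum.swap)
   also have "... = (\<Sum>k<n. \<Sum>i<n. \<Sum>j<n. f i j k)" by (rule sum.swap)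
   finally show ?thesis .
  qed
  then show ?thesis .
 qed
 also have "... = gla (B * A) u" by (simp add: gla_mult[OF assms(2,1)] mult.commute)
 also have "(\<Sum>i<n. \<Sum>j<n. \<Sum>l<n. ?t i j j l (ee i l u)) = gla (A * B) u" by (simp add: gla_mult[OF assms])
 also have "gla (A * B) u - gla (B * A) u = gla (A * B - B * A) u"
  using assms by (intro gla_lin(2)[symmetric]) auto
 finally show ?thesis by simp
qed

text \<open>The Cartan elements determine the weight up to a common shift, and the trace fixes the
  shift after division by \<open>n\<close>. For \<open>r = 0\<close> and \<open>r = n\<close> all
  differences vanish and the trace alone tells the two apart.\<close>

lemma weights_step:
 assumes n: "n \<ge> 1" and r: "r <= n"
  and c: "!!k. Suc k < n ==> ee k k u - ee (Suc k) (Suc k) u = pscale (fund_weight r k) u"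
  and s: "(\<Sum>k<n. ee k k u) = pscale (of_nat r) u" and i: "i < n"
 shows "ee i i u = pscale (stepw r i) u"
proof -
 have d: "ee k k u = ee 0 0 u - pscale (if 1 <= r & r <= k then 1 else 0) u" if "k < n" for k
  using that
 proof (induction k)
  case (Suc k)
  have "ee (Suc k) (Suc k) u = ee k k u - pscale (fund_weight r k) u" using c[OF Suc.prems] by (simp add: algebra_simps)
  then show ?case using Suc by (auto simp: fund_weight_def)
 qed auto
 have "(\<Sum>k<n. ee k k u) = (\<Sum>k<n. ee 0 0 u - pscale (if 1 <= r & r <= k then 1 else 0) u)"
  by (rule sum.cong[OF refl], rule d) simp
 also have "... = pscale (of_nat n) (ee 0 0 u) - pscale (\<Sum>k<n. if 1 <= r & r <= k then 1 else 0) u"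
 proof -
  have "(\<Sum>k<n. ee 0 0 u) = pscale (\<Sum>k<n. 1) (ee 0 0 u)" by (simp only: pm.scale_sum_left pm.scale_one)
  also have "... = pscale (of_nat n) (ee 0 0 u)" by simp
  finally show ?thesis by (simp only: sum_subtractf pm.scale_sum_left)
 qed
 also have "(\<Sum>k<n. if 1 <= r & r <= k then 1 else 0) = (of_nat (if 1 <= r then n - r else 0) :: complex)"
 proof (cases "1 <= r")
  case True
  have "{..<n} \<inter> {k. r <= k} = {r..<n}" by auto
  then show ?thesis using True by (simp add: sum.If_cases)
 qed simp
 finally have "pscale (of_nat n) (ee 0 0 u) = pscale (of_nat r + of_nat (if 1 <= r then n - r else 0)) u"
  using s by (simp add: pm.scale_left_distrib algebra_simps)
 also have "of_nat r + of_nat (if 1 <= r then n - r else 0) = (of_nat n * (if 1 <= r then 1 else 0) :: complex)"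
  using r by (simp add: of_nat_diff)
 finally have "pscale (of_nat n) (ee 0 0 u) = pscale (of_nat n) (pscale (if 1 <= r then 1 else 0) u)" by simp
 then have "ee 0 0 u = pscale (if 1 <= r then 1 else 0) u" using n by (simp only: pm.scale_cancel_left) simp
 then show ?thesis using d[OF i] by auto
qed

text \<open>\<open>M\<close> is \<open>filt 1\<close> with matrices acting through
  \<open>ee\<close>. It is simple by \<open>indep_simple\<close>, and it is no exterior power
  because a highest weight vector of such a weight would be killed by the quadratic elements,
  against \<open>filtT = {0}\<close>.\<close>

lemma tensor_case:
 fixes V :: "(cop, 'x) lmod"
 assumes n: "n \<ge> 1" and l: "liso (cDer n) V \<rho> fi W" and F: "filt 1 ~= {0}" "filtT = {0}"
 shows "\<exists>M :: (complex mat, 'x) lmod. simple_lie_module (gl n) M & (\<forall>r\<in>{0..n}. \<not> is_V n (fund_weight r) (of_nat r) M) &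
   lie_module_iso (Der n) V (F n (P0 n) M)"
proof -
 have F0: "pm.subspace (filt 1)" by (rule stable_subspace[OF filt_stable])
 have ind: "indep (filt 1)" by (rule indep_filt1[OF F(2)])
 have st: "gla A u : filt 1" if "u : filt 1" for A u
  unfolding gla_def using that by (intro pm.subspace_sum[OF F0] pm.subspace_scale[OF F0] ee_stable[OF filt_stable]) auto
 define M :: "(complex mat, 'x) lmod" where "M = rmod V fi (filt 1) gla"
 have lM: "liso (carrier (gl n)) M gla fi (filt 1)"
  unfolding M_def by (rule rmod_liso[OF l F0 filt_W st])
 note lmM = liso_lmap[OF lM]
 have lie: "lie_module (gl n) M"
  by (rule liso_lie_module[OF lM gl_module]) (auto simp: gl_simps plin_gla gla_lin(1,3) gla_bracket)
 have simp_ee: "N = {0} \<or> N = filt 1" if N: "pm.subspace N" "N <= filt 1" "!!i j u. i < n ==> j < n ==> u : N ==> ee i j u : N" for N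
  using indep_simple[OF ind filt_stable filt_W stable1_filt1[OF N] N(2)] by blast
 have simple: "simple_lie_module (gl n) M"
 proof (rule liso_simple[OF lM lie F(1)])
  fix N assume N: "pm.subspace N" "N <= filt 1" "!!x u. x : carrier (gl n) ==> u : N ==> gla x u : N"
  have "ee i j u : N" if "i < n" "j < n" "u : N" for i j u
   using N(3)[of "mat_unit n i j" u] that by (simp add: gl_simps gla_mat_unit)
  then show "N = {0} \<or> N = filt 1" by (rule simp_ee[OF N(1,2)])
 qed
 have notV: "\<not> is_V n (fund_weight r) (of_nat r) M" if r: "r <= n" for r
 proof
  assume V: "is_V n (fund_weight r) (of_nat r) M"
  then obtain v where v: "v : carrier M" "v ~= \<zero>\<^bsub>M\<^esub>" "!!i j. j < n ==> i < j ==> act M (mat_unit n i j) v = \<zero>\<^bsub>M\<^esub>"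
   "!!j. Suc j < n ==> act M (Defs.cartan n j) v = fund_weight r j \<odot>\<^bsub>M\<^esub> v" "act M (1\<^sub>m n) v = of_nat r \<odot>\<^bsub>M\<^esub> v"
   unfolding is_V_def by blast
  define u where "u = fi v"
  interpret M: module CC M by (rule lmap_module[OF lmM])
  have u: "u : filt 1" "u ~= 0"
   using liso_in[OF lM v(1)] liso_inj[OF lM v(1) M.zero_closed] v(2) lmap_zero[OF lmM] by (auto simp: u_def)
  have a: "fi (act M A v) = gla A u" if "A : carrier_mat n n" for A
   using lmap_act[OF lmM _ v(1), of A] that by (simp add: gl_simps u_def)
  have "ee i j u = 0" if "i < j" "j < n" for i j
   using v(3)[OF that(2,1)] a[of "mat_unit n i j"] that lmap_zero[OF lmM] by (simp add: gla_mat_unit)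
  moreover have "ee i i u = pscale (stepw r i) u" if "i < n" for i
  proof (rule weights_step[OF n r _ _ that])
   fix k assume k: "Suc k < n"
   have "gla (Defs.cartan n k) u = ee k k u - ee (Suc k) (Suc k) u"
    unfolding Defs.cartan_def using k by (simp add: gla_lin gla_mat_unit)
   moreover have "gla (Defs.cartan n k) u = pscale (fund_weight r k) u"
    using a[of "Defs.cartan n k"] v(4)[OF k] lmap_smult[OF lmM v(1)] minus_carrier_mat[of "mat_unit n (Suc k) (Suc k)" n n]
    by (simp add: Defs.cartan_def u_def)
   ultimately show "ee k k u - ee (Suc k) (Suc k) u = pscale (fund_weight r k) u" by simp
  next
   have "gla (1\<^sub>m n) u = (\<Sum>k<n. \<Sum>l<n. if l = k then ee k k u else 0)"
    unfolding gla_def by (intro sum.cong refl) auto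
   then have "gla (1\<^sub>m n) u = (\<Sum>k<n. ee k k u)" by simp
   then show "(\<Sum>k<n. ee k k u) = pscale (of_nat r) u"
    using a[of "1\<^sub>m n"] v(5) lmap_smult[OF lmM v(1)] by (simp add: u_def)
  qed
  ultimately have hw: "hwvec n ee (stepw r) u" using u(2) by (simp add: hwvec_def)
  have "Tkilled n ee u"
   by (rule simple_hw_Tkilled[OF glrep_ee r u(1) hw F0], (rule ee_stable[OF filt_stable]; assumption), (rule simp_ee; blast))
  then show False using u F(2) by (auto simp: filtT_def)
 qed
 have sing: "singular ee (fi ` carrier M)" unfolding liso_image[OF lM] by (rule singular_filt1[OF filt_stable order_refl])
 have lM': "liso (carrier_mat n n) M gla fi (fi ` carrier M)" using lM unfolding liso_image[OF lM] gl_simps .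
 have "liso (cDer n) (F n (P0 n) M) dact (cmap (lext (tmap fi))) (pm.span {Psi p m | p m. p : polys n & m : fi ` carrier M})"
  by (rule F_liso(1)[OF sing lM' _ ind[folded liso_image[OF lM]]]) (simp add: gla_mat_unit)
 moreover have "pm.span {Psi p m | p m. p : polys n & m : fi ` carrier M} = W" (is "pm.span ?X = W")
 proof
  show "pm.span ?X <= W"
   unfolding liso_image[OF lM] using filt_W
   by (intro pm.span_minimal[OF _ W_sub]) (auto intro!: evp_in[OF comm_R] W_stable W_sub)
  have "{Dp al e | al e. al : exponents n & e : filt 1} <= ?X"
   unfolding liso_image[OF lM]
  proof clarify
   fix al e assume "al : exponents n" "e : filt 1"
   then show "\<exists>p m. Dp al e = Psi p m & p : polys n & m : filt 1"
    by (intro exI[of _ "gen al"] exI[of _ e]) (simp add: evp_gen)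
  qed
  from pm.span_mono[OF this] show "W <= pm.span ?X" unfolding span_Dp_W[OF filt_stable filt_W F(1)] .
 qed
 ultimately have "liso (cDer n) (F n (P0 n) M) dact (cmap (lext (tmap fi))) W" by simp
 then have "liso (cDer n) (F n (P0 n) M) \<rho> (cmap (lext (tmap fi))) W"
  by (rule liso_cong) (simp add: rho_R)
 then have "lie_module_iso (Der n) V (F n (P0 n) M)" by (rule liso_trans[OF l])
 then show ?thesis using simple notV by auto
qed

end

section \<open>Enveloping algebras\<close>

definition fmul :: "'g list cv => 'g list cv => 'g list cv" where
 "fmul p q = lext (%u. lext (%w. gen (u @ w)) q) p"

definition words :: "'g set => 'g list cv set" where
 "words B = {p. keys p <= {w. set w <= B}}"

lemma free_alg_simps [simp]:
 "carrier (free_alg B) = words B" "p \<otimes>\<^bsub>free_alg B\<^esub> q = fmul p q" "p \<oplus>\<^bsub>free_alg B\<^esub> q = p + q"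
 "\<zero>\<^bsub>free_alg B\<^esub> = 0" "\<one>\<^bsub>free_alg B\<^esub> = gen []" "c \<odot>\<^bsub>free_alg B\<^esub> p = pscale c p"
 by (auto simp: free_alg_def words_def fmul_def lext_def pm.scale_sum_right)

lemma plin_fmul1: "plin (%p. fmul p q)"
 unfolding fmul_def by (rule plin_lext)

lemma plin_fmul2: "plin (fmul p)"
 unfolding fmul_def lext_def[of _ p] by (intro plin_sumI plin_scaled plin_lext)

lemmas fmul_simps = plin_simps[OF plin_fmul1] plin_simps[OF plin_fmul2]

lemma fmul_gen: "fmul (gen u) (gen w) = gen (u @ w)"
 by (simp add: fmul_def)

lemma fmul_eqI: "plin f ==> plin g ==> (!!w. f (gen w) = g (gen w)) ==> f p = g p"
 by (rule plin_eqI[of p UNIV]) auto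

lemma fmul_assoc: "fmul (fmul p q) r = fmul p (fmul q r)"
proof -
 have a: "fmul (gen u) (fmul (gen w) r) = fmul (gen (u @ w)) r" for u w
  by (rule fmul_eqI[of _ _ r]) (auto intro: plin_comp[OF plin_fmul2 plin_fmul2] plin_fmul2 simp: fmul_gen)
 have b: "fmul (fmul (gen u) q) r = fmul (gen u) (fmul q r)" for u
  by (rule fmul_eqI[of "%q. fmul (fmul (gen u) q) r" "%q. fmul (gen u) (fmul q r)" q])
   (auto intro: plin_comp[OF plin_fmul1 plin_fmul2] plin_comp[OF plin_fmul2 plin_fmul1] simp: fmul_gen a)
 show ?thesis
  by (rule fmul_eqI[of "%p. fmul (fmul p q) r" "%p. fmul p (fmul q r)" p])
   (auto intro: plin_comp[OF plin_fmul1 plin_fmul1] plin_fmul1 simp: b)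
qed

lemma fmul_one: "fmul (gen []) p = p" "fmul p (gen []) = p"
proof -
 show "fmul (gen []) p = p" by (simp add: fmul_def lext_id)
 show "fmul p (gen []) = p" by (simp add: fmul_def lext_id)
qed

lemma subspace_words: "pm.subspace (words B)"
 unfolding words_def by (rule subspace_keys)

lemma words_gen: "gen w : words B \<longleftrightarrow> set w <= B"
 by (simp add: words_def)

lemma words_induct [consumes 1, case_names zero add scale gen]:
 assumes "p : words B" "P 0" "!!p q. P p ==> P q ==> P (p + q)" "!!c p. P p ==> P (pscale c p)"
  "!!w. set w <= B ==> P (gen w)"
 shows "P p"
 using assms unfolding words_def by (auto intro: pm_sup_induct[of p "{w. set w <= B}" P])

lemma words_fmul: "p : words B ==> q : words B ==> fmul p q : words B"
proof (induction rule: words_induct)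
 case (gen u)
 show ?case using gen(2)
  by (induction rule: words_induct)
   (use gen(1) in \<open>auto simp: fmul_simps fmul_gen words_gen intro: pm.subspace_0[OF subspace_words] pm.subspace_add[OF subspace_words] pm.subspace_scale[OF subspace_words]\<close>)
qed (auto simp: fmul_simps intro: pm.subspace_0[OF subspace_words] pm.subspace_add[OF subspace_words] pm.subspace_scale[OF subspace_words])

lemma ring_free_alg: "ring (free_alg B)"
proof (rule ringI)
 show "abelian_group (free_alg B)"
 proof (rule abelian_groupI)
  show "\<exists>y\<in>carrier (free_alg B). y \<oplus>\<^bsub>free_alg B\<^esub> x = \<zero>\<^bsub>free_alg B\<^esub>" if "x : carrier (free_alg B)" for x
   using that pm.subspace_neg[OF subspace_words] by (intro bexI[of _ "- x"]) auto
 qed (auto simp: add_ac intro: pm.subspace_0[OF subspace_words] pm.subspace_add[OF subspace_words])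
 show "monoid (free_alg B)"
  by (rule monoidI) (auto simp: words_gen words_fmul fmul_assoc fmul_one)
qed (auto simp: fmul_simps)

text \<open>Ring ideals are closed under scalars, since a scalar acts as multiplication by a
  multiple of the empty word.\<close>

lemma ideal_free_alg_iff:
 "ideal J (free_alg B) \<longleftrightarrow> pm.subspace J & J <= words B & (\<forall>a\<in>J. \<forall>x\<in>words B. fmul x a : J & fmul a x : J)"
proof
 assume "ideal J (free_alg B)"
 then interpret ideal J "free_alg B" .
 have s: "pscale c a : J" if "a : J" for c a
 proof -
  have "pscale c (gen []) : words B" by (intro pm.subspace_scale[OF subspace_words]) (simp add: words_gen)
  then have "fmul (pscale c (gen [])) a : J" using I_l_closed[OF that] by simp
  then show ?thesis by (simp only: fmul_simps fmul_one)
 qed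
 show "pm.subspace J & J <= words B & (\<forall>a\<in>J. \<forall>x\<in>words B. fmul x a : J & fmul a x : J)"
  using a_subset additive_subgroup.zero_closed[OF is_additive_subgroup] additive_subgroup.a_closed[OF is_additive_subgroup]
   s I_l_closed I_r_closed unfolding pm.subspace_def by auto
next
 assume J: "pm.subspace J & J <= words B & (\<forall>a\<in>J. \<forall>x\<in>words B. fmul x a : J & fmul a x : J)"
 interpret ring "free_alg B" by (rule ring_free_alg)
 have inv: "inv\<^bsub>add_monoid (free_alg B)\<^esub> x = - x" if "x : words B" for x
  using minus_equality[of "- x" x] that pm.subspace_neg[OF subspace_words that] unfolding a_inv_def by simp
 show "ideal J (free_alg B)"
 proof (rule idealI[OF ring_free_alg])
  show "subgroup J (add_monoid (free_alg B))"
  proof (rule subgroup.intro)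
   show "inv\<^bsub>add_monoid (free_alg B)\<^esub> x : J" if x: "x : J" for x
   proof -
    have "x : words B" using x J by blast
    from inv[OF this] show ?thesis using pm.subspace_neg[OF conjunct1[OF J] x] by (simp only:)
   qed
  qed (use J in \<open>auto intro: pm.subspace_0 pm.subspace_add\<close>)
 qed (use J in auto)
qed

definition lie_closed :: "(complex, 'g) module => bool" where
 "lie_closed L \<longleftrightarrow> (\<forall>x\<in>carrier L. \<forall>y\<in>carrier L. \<forall>c. x \<oplus>\<^bsub>L\<^esub> y : carrier L & c \<odot>\<^bsub>L\<^esub> x : carrier L & x \<otimes>\<^bsub>L\<^esub> y : carrier L)"

definition env_rels :: "(complex, 'g) module => 'g list cv set" where
 "env_rels L = {gen [x \<oplus>\<^bsub>L\<^esub> y] - gen [x] - gen [y] | x y. x : carrier L & y : carrier L} \<union>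
   {gen [c \<odot>\<^bsub>L\<^esub> x] - pscale c (gen [x]) | c x. x : carrier L} \<union>
   {gen [x, y] - gen [y, x] - gen [x \<otimes>\<^bsub>L\<^esub> y] | x y. x : carrier L & y : carrier L}"

lemma env_ideal_rels: "env_ideal L = Idl\<^bsub>free_alg (carrier L)\<^esub> (env_rels L)"
 unfolding env_ideal_def env_rels_def ..

lemma env_rels_words: "lie_closed L ==> env_rels L <= words (carrier L)"
 unfolding env_rels_def lie_closed_def
 by (auto simp: words_gen simp del: pscale_single intro!: pm.subspace_diff[OF subspace_words] pm.subspace_scale[OF subspace_words])

lemma env_ideal_ideal: "lie_closed L ==> ideal (env_ideal L) (free_alg (carrier L))"
 unfolding env_ideal_rels by (rule ring.genideal_ideal[OF ring_free_alg]) (simp add: env_rels_words)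

lemma env_ideal_least: "ideal J (free_alg (carrier L)) ==> env_rels L <= J ==> env_ideal L <= J"
 unfolding env_ideal_rels genideal_def by blast

lemma env_rels_ideal: "env_rels L <= env_ideal L"
 unfolding env_ideal_rels genideal_def by blast

definition ucl :: "(complex, 'g) module => 'g list cv => 'g list cv set" where
 "ucl L p = (%i. i + p) ` env_ideal L"

lemma ucl_coset: "env_ideal L +>\<^bsub>free_alg B\<^esub> p = ucl L p"
 by (auto simp: ucl_def a_r_coset_def')

context
 fixes L :: "(complex, 'g) module"
 assumes L: "lie_closed L"
begin

lemma env_sub: "pm.subspace (env_ideal L)" and env_words: "env_ideal L <= words (carrier L)"
 and env_l: "a : env_ideal L ==> x : words (carrier L) ==> fmul x a : env_ideal L"
 and env_r: "a : env_ideal L ==> x : words (carrier L) ==> fmul a x : env_ideal L"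
 using env_ideal_ideal[OF L] unfolding ideal_free_alg_iff by blast+

lemma ucl_self: "p : ucl L p"
 unfolding ucl_def using pm.subspace_0[OF env_sub] by (force intro!: image_eqI[of _ _ 0])

lemma ucl_mem: "q : ucl L p \<longleftrightarrow> q - p : env_ideal L"
 unfolding ucl_def by (auto intro!: image_eqI[of _ _ "q - p"])

lemma ucl_eq: "ucl L p = ucl L q \<longleftrightarrow> p - q : env_ideal L"
proof
 assume "ucl L p = ucl L q" then show "p - q : env_ideal L" using ucl_self[of p] by (simp add: ucl_mem)
next
 assume a: "p - q : env_ideal L"
 show "ucl L p = ucl L q"
 proof (rule Set.set_eqI)
  fix x
  have "x - q = (x - p) + (p - q)" "x - p = (x - q) - (p - q)" by simp_all
  then show "x : ucl L p \<longleftrightarrow> x : ucl L q"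
   unfolding ucl_mem using a pm.subspace_add[OF env_sub] pm.subspace_diff[OF env_sub] by metis
 qed
qed

lemma env_carrier: "carrier (env_alg L) = ucl L ` words (carrier L)"
 by (auto simp: env_alg_def vquot_def FactRing_def A_RCOSETS_def' ring.defs module.defs ucl_coset)

lemma env_mult:
 assumes "p : words (carrier L)" "q : words (carrier L)"
 shows "ucl L p \<otimes>\<^bsub>env_alg L\<^esub> ucl L q = ucl L (fmul p q)"
 using ideal.rcoset_mult_add[OF env_ideal_ideal[OF L], of p q] assms
 by (simp add: env_alg_def vquot_def FactRing_def ring.defs module.defs ucl_coset)

lemma env_add: "ucl L p \<oplus>\<^bsub>env_alg L\<^esub> ucl L q = ucl L (p + q)"
proof -
 have "ucl L p \<oplus>\<^bsub>env_alg L\<^esub> ucl L q = {a + b | a b. a : ucl L p & b : ucl L q}"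
  by (auto simp: env_alg_def vquot_def FactRing_def ring.defs module.defs set_add_def set_mult_def)
 also have "... = ucl L (p + q)"
 proof (rule Set.set_eqI)
  fix x
  show "x : {a + b | a b. a : ucl L p & b : ucl L q} \<longleftrightarrow> x : ucl L (p + q)"
  proof
   assume "x : {a + b | a b. a : ucl L p & b : ucl L q}"
   then obtain a b where x: "x = a + b" and "a - p : env_ideal L" "b - q : env_ideal L" by (auto simp: ucl_mem)
   then have "(a - p) + (b - q) : env_ideal L" by (intro pm.subspace_add[OF env_sub])
   then show "x : ucl L (p + q)" by (simp add: ucl_mem x algebra_simps)
  next
   assume "x : ucl L (p + q)"
   then have "x - q : ucl L p" by (simp add: ucl_mem algebra_simps)
   then show "x : {a + b | a b. a : ucl L p & b : ucl L q}"
    using ucl_self[of q] by (intro CollectI exI[of _ "x - q"] exI[of _ q]) simp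
  qed
 qed
 finally show ?thesis .
qed

lemma env_smult: "c \<odot>\<^bsub>env_alg L\<^esub> ucl L p = ucl L (pscale c p)"
proof -
 have u: "c \<odot>\<^bsub>env_alg L\<^esub> ucl L p = (\<Union>a\<in>ucl L p. ucl L (pscale c a))"
  by (simp add: env_alg_def vquot_def ring.defs module.defs ucl_coset)
 have eq: "ucl L (pscale c a) = ucl L (pscale c p)" if "a : ucl L p" for a
  using that pm.subspace_scale[OF env_sub, of "a - p" c] by (simp add: ucl_eq ucl_mem pm.scale_right_diff_distrib)
 show ?thesis unfolding u by (rule UN_constant_eq[OF ucl_self]) (use eq in blast)
qed

lemma ucl_rep: "u : carrier (env_alg L) ==> \<exists>p\<in>words (carrier L). u = ucl L p"
 by (auto simp: env_carrier)

end

section \<open>Brackets and the filtration by degree\<close>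

lemma gr_ordge: "gr n (%d. int k <= int d) = {D : cDer n. \<forall>j<n. ordge n k (D (pvar j))}"
 using Der_polys[of _ n] unfolding gr_def ordge_def by auto

lemma grade_ge_ordge: "grade_ge n (int l) = {D : cDer n. \<forall>j<n. ordge n (l + 1) (D (pvar j))}"
proof -
 have "(%d. int l + 1 <= int d) = (%d. int (l + 1) <= int d)" by (simp add: add.commute)
 then show ?thesis unfolding grade_ge_gr by (simp only: gr_ordge)
qed

lemma ordge_0_poly: "ordge n k 0"
 by (simp add: ordge_def)

lemma ordge_add: assumes "ordge n k f" "ordge n k g" shows "ordge n k (f + g)"
 using assms pm_keys_add[of f g] by (auto simp: ordge_def)

lemma ordge_scale: "ordge n k f ==> ordge n k (pscale c f)"
 using keys_pscale[of c f] by (auto simp: ordge_def)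

lemma ordge_diff: assumes "ordge n k f" "ordge n k g" shows "ordge n k (f - g)"
 using ordge_add[OF assms(1) ordge_scale[OF assms(2), of "-1"]] by simp

lemma ordge_sum: "(!!i. i : A ==> ordge n k (f i)) ==> ordge n k (\<Sum>i\<in>A. f i)"
 by (induction A rule: infinite_finite_induct) (auto simp: ordge_0_poly ordge_add)

lemma ordge_Der_apply:
 assumes "D : cDer n" "!!j. j < n ==> ordge n 1 (D (pvar j))" "ordge n k f" shows "ordge n k (D f)"
  and "D' : cDer n ==> (!!j. j < n ==> ordge n k (D' (pvar j))) ==> ordge n 1 g ==> ordge n k (D' g)"
proof -
 have a: "ordge n (a + b - 1) (E f)" if E: "E : cDer n" "!!j. j < n ==> ordge n a (E (pvar j))" "ordge n b f" "1 <= b" for E a b f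
 proof -
  have "E f = (\<Sum>j<n. E (pvar j) * pdiff j f)"
   using fun_cong[OF Der_eq_vf[OF E(1)], of f] ordge_polys[OF E(3)] by (simp add: vf_def)
  moreover have "ordge n (a + b - 1) (E (pvar j) * pdiff j f)" if "j < n" for j
  proof -
   have "a + b - 1 = a + (b - 1)" using E(4) by simp
   then show ?thesis using ordge_mult[OF E(2)[OF that] ordge_pdiff[OF E(3), of j]] by (simp only:)
  qed
  ultimately show ?thesis by (auto intro: ordge_sum)
 qed
 show "ordge n k (D f)"
 proof (cases k)
  case 0
  then show ?thesis using assms Der_polys[OF assms(1)] ordge_polys[OF assms(3)] by simp
 next
  case (Suc m)
  then show ?thesis using a[OF assms] by (simp add: plus_1_eq_Suc)
 qed
 show "D' : cDer n ==> (!!j. j < n ==> ordge n k (D' (pvar j))) ==> ordge n 1 g ==> ordge n k (D' g)"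
  using a[of D' k 1 g] by simp
qed

lemma grade_ge_bracket:
 assumes "x : grade_ge n 0" "y : grade_ge n (int l)"
 shows "x \<otimes>\<^bsub>Der n\<^esub> y : grade_ge n (int l)" "y \<otimes>\<^bsub>Der n\<^esub> x : grade_ge n (int l)"
proof -
 have x: "x : cDer n" "!!j. j < n ==> ordge n 1 (x (pvar j))" using assms(1) grade_ge_ordge[of n 0] by auto
 have y: "y : cDer n" "!!j. j < n ==> ordge n (l + 1) (y (pvar j))" using assms(2) by (auto simp: grade_ge_ordge)
 have "ordge n (l + 1) (x (y (pvar j)))" "ordge n (l + 1) (y (x (pvar j)))" if "j < n" for j
  using ordge_Der_apply[OF x y(2)[OF that]] y x(2)[OF that] by auto
 then show "x \<otimes>\<^bsub>Der n\<^esub> y : grade_ge n (int l)" "y \<otimes>\<^bsub>Der n\<^esub> x : grade_ge n (int l)"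
  unfolding grade_ge_ordge using Der_bracket_closed[OF x(1) y(1)] Der_bracket_closed[OF y(1) x(1)]
  by (auto simp: Der_simps intro: ordge_diff)
qed

lemma grade_ge_closed:
 assumes "x : grade_ge n (int l)" "y : grade_ge n (int l)"
 shows "x \<oplus>\<^bsub>Der n\<^esub> y : grade_ge n (int l)" "c \<odot>\<^bsub>Der n\<^esub> x : grade_ge n (int l)"
 using assms Der_add_closed[of x n y] Der_smult_closed[of x n c]
 unfolding grade_ge_ordge by (auto simp: Der_simps intro: ordge_add ordge_scale)

lemma grade_ge_carrier: "grade_ge n (int l) <= cDer n"
 by (auto simp: grade_ge_ordge)

lemma grade_ge_mono: "l <= m ==> grade_ge n (int m) <= grade_ge n (int l)"
 by (auto simp: grade_ge_ordge intro: ordge_mono)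

lemma subalg_simps [simp]: "carrier (subalg L S) = S" "x \<oplus>\<^bsub>subalg L S\<^esub> y = x \<oplus>\<^bsub>L\<^esub> y" "c \<odot>\<^bsub>subalg L S\<^esub> x = c \<odot>\<^bsub>L\<^esub> x"
 "x \<otimes>\<^bsub>subalg L S\<^esub> y = x \<otimes>\<^bsub>L\<^esub> y" "\<zero>\<^bsub>subalg L S\<^esub> = \<zero>\<^bsub>L\<^esub>"
 by (simp_all add: subalg_def)

abbreviation HH :: "nat => (complex, cop) module" where "HH n \<equiv> subalg (Der n) (grade_ge n 0)"

lemma lie_closed_Der: "lie_closed (Der n)"
 by (auto simp: lie_closed_def Der_add_closed Der_smult_closed Der_bracket_closed)

lemma lie_closed_HH: "lie_closed (HH n)"
 using grade_ge_closed[of _ n 0] grade_ge_bracket(1)[of _ n _ 0] by (auto simp: lie_closed_def)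

lemma HH_words: "words (carrier (HH n)) <= words (cDer n)"
 using grade_ge_carrier[of n 0] by (auto simp: words_def)

text \<open>The ideal of the larger algebra, cut down to words in the smaller one, is an ideal
  containing the relations of the smaller one. This makes \<open>env_incl\<close> independent of
  representatives.\<close>

lemma env_HH: "env_ideal (HH n) <= env_ideal (Der n)"
proof -
 let ?J = "env_ideal (Der n) \<inter> words (carrier (HH n))"
 have w: "x : words (cDer n)" if "x : words (carrier (HH n))" for x using HH_words that by blast
 have "ideal ?J (free_alg (carrier (HH n)))"
  unfolding ideal_free_alg_iff
 proof (intro conjI ballI)
  show "pm.subspace ?J" by (rule pm.subspace_inter[OF env_sub[OF lie_closed_Der] subspace_words])
  show "fmul x a : ?J" "fmul a x : ?J" if "a : ?J" "x : words (carrier (HH n))" for a x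
   using that env_l[OF lie_closed_Der _ w[OF that(2)]] env_r[OF lie_closed_Der _ w[OF that(2)]] by (auto simp del: subalg_simps intro: words_fmul)
 qed blast
 moreover have "env_rels (HH n) <= env_rels (Der n)"
 proof -
  have "grade_ge n 0 <= cDer n" using grade_ge_carrier[of n 0] by simp
  then show ?thesis unfolding env_rels_def subalg_simps by (intro Un_mono Collect_mono) blast+
 qed
 then have "env_rels (HH n) <= ?J" using env_rels_ideal env_rels_words[OF lie_closed_HH] by blast
 ultimately show ?thesis using env_ideal_least by blast
qed

lemma env_incl_ucl: "env_incl (Der n) (ucl (HH n) p) = ucl (Der n) p"
proof -
 have "env_incl (Der n) (ucl (HH n) p) = {a + b | a b. a : env_ideal (Der n) & b : ucl (HH n) p}"
  by (auto simp: env_incl_def set_add_def set_mult_def)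
 also have "... = ucl (Der n) p"
 proof (rule Set.set_eqI)
  fix x
  show "x : {a + b | a b. a : env_ideal (Der n) & b : ucl (HH n) p} \<longleftrightarrow> x : ucl (Der n) p"
  proof
   assume "x : {a + b | a b. a : env_ideal (Der n) & b : ucl (HH n) p}"
   then obtain a b where x: "x = a + b" "a : env_ideal (Der n)" "b : ucl (HH n) p" by blast
   have "b - p : env_ideal (Der n)" using x(3) env_HH unfolding ucl_mem[OF lie_closed_HH] by blast
   with x(2) have "a + (b - p) : env_ideal (Der n)" by (rule pm.subspace_add[OF env_sub[OF lie_closed_Der]])
   then show "x : ucl (Der n) p" unfolding ucl_mem[OF lie_closed_Der] x(1) by (simp only: add_diff_eq)
  next
   assume "x : ucl (Der n) p"
   then show "x : {a + b | a b. a : env_ideal (Der n) & b : ucl (HH n) p}"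
    using ucl_self[OF lie_closed_HH, where p = p]
    unfolding ucl_mem[OF lie_closed_Der] by (intro CollectI exI[of _ "x - p"] exI[of _ p] conjI) simp_all
  qed
 qed
 finally show ?thesis .
qed

section \<open>The action of the enveloping algebra\<close>

context drep
begin

definition wact :: "cop list cv => 'x cv => 'x cv" where
 "wact p v = lext (%w. foldr \<rho> w v) p"

lemma plin_wact1: "plin (%p. wact p v)"
 unfolding wact_def by (rule plin_lext)

lemma wact_gen: "wact (gen w) v = foldr \<rho> w v"
 by (simp add: wact_def)

lemma plin_foldr_rho: "set w <= cDer n ==> plin (foldr \<rho> w)"
proof (induction w)
 case Nil then show ?case by (simp add: plin_def)
next
 case (Cons x w)
 then show ?case using plin_comp[OF rho_plin[of x]] by (simp add: comp_def)
qed

lemma plin_wact2: assumes "p : words (cDer n)" shows "plin (wact p)"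
proof -
 have "set w <= cDer n" if "w : keys p" for w using assms that by (auto simp: words_def)
 then show ?thesis unfolding wact_def lext_def by (intro plin_sumI plin_scaled plin_foldr_rho)
qed

lemma wact_fmul: assumes "p : words (cDer n)" shows "wact (fmul p q) v = wact p (wact q v)"
 using assms
proof (induction rule: words_induct)
 case (gen u)
 show ?case
 proof (rule fmul_eqI[of "%q. wact (fmul (gen u) q) v" "%q. wact (gen u) (wact q v)" q])
  show "plin (%q. wact (fmul (gen u) q) v)" by (rule plin_comp[OF plin_wact1 plin_fmul2])
  have "gen u : words (cDer n)" using gen by (simp add: words_gen)
  then show "plin (%q. wact (gen u) (wact q v))" by (rule plin_comp[OF plin_wact2 plin_wact1])
 qed (simp add: fmul_gen wact_gen)
qed (auto simp: fmul_simps plin_simps[OF plin_wact1])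

text \<open>The word polynomials acting by zero on every vector form a two-sided ideal that contains
  the defining relations.\<close>

lemma wact_env: assumes "p : env_ideal (Der n)" shows "wact p v = 0"
proof -
 let ?J = "{p : words (cDer n). \<forall>v. wact p v = 0}"
 have "ideal ?J (free_alg (cDer n))"
  unfolding ideal_free_alg_iff pm.subspace_def
  by (auto simp: plin_simps[OF plin_wact1] wact_fmul words_fmul plin_0[OF plin_wact2]
   intro: pm.subspace_0[OF subspace_words] pm.subspace_add[OF subspace_words] pm.subspace_scale[OF subspace_words])
 moreover have "wact r v = 0" if "r : env_rels (Der n)" for r v
  using that unfolding env_rels_def
  by (auto simp: plin_simps[OF plin_wact1] wact_gen rho_add rho_smult rho_bracket simp del: pscale_single)
 then have "env_rels (Der n) <= ?J" using env_rels_words[OF lie_closed_Der] by blast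
 ultimately show ?thesis using assms env_ideal_least by blast
qed

definition uact :: "cop list cv set => 'x cv => 'x cv" where
 "uact A = wact (SOME p. p : A)"

lemma wact_mem: "q : ucl (Der n) p ==> wact q v = wact p v"
 using wact_env[of "q - p" v] by (simp add: ucl_mem[OF lie_closed_Der] plin_simps[OF plin_wact1])

lemma uact_ucl: "uact (ucl (Der n) p) = wact p"
 using someI[of "%q. q : ucl (Der n) p", OF ucl_self[OF lie_closed_Der]] by (auto simp: uact_def fun_eq_iff intro: wact_mem)

end

section \<open>Induced modules\<close>

lemma expo_mset:
 fixes ks js :: "nat list"
 assumes "(\<Sum>i\<leftarrow>ks. ex i) = (\<Sum>i\<leftarrow>js. ex i)" shows "mset ks = mset js"
proof -
 have "count (mset ks) k = lookup (\<Sum>i\<leftarrow>ks. ex i) k" for k and ks :: "nat list"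
  by (induction ks) (auto simp: lookup_add lookup_single when_def)
 then show ?thesis using assms by (simp add: multiset_eq_iff)
qed

abbreviation pd :: "nat => nat => cop" where "pd n i \<equiv> dop n 1 i"

abbreviation dword :: "nat => nat list => cop list cv" where "dword n ks \<equiv> gen (map (pd n) ks)"

lemma env_idealI:
 assumes "x : carrier L"
 shows "y : carrier L ==> gen [x \<oplus>\<^bsub>L\<^esub> y] - gen [x] - gen [y] : env_ideal L"
  and "gen [c \<odot>\<^bsub>L\<^esub> x] - pscale c (gen [x]) : env_ideal L"
  and "y : carrier L ==> gen [x, y] - gen [y, x] - gen [x \<otimes>\<^bsub>L\<^esub> y] : env_ideal L"
 unfolding atomize_imp
 by (rule impI, rule subsetD[OF env_rels_ideal], unfold env_rels_def, rule UnI1, rule UnI1, rule CollectI, intro exI conjI, rule refl, rule assms, assumption)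
  (rule subsetD[OF env_rels_ideal], unfold env_rels_def, rule UnI1, rule UnI2, rule CollectI, intro exI conjI, rule refl, rule assms,
   rule impI, rule subsetD[OF env_rels_ideal], unfold env_rels_def, rule UnI2, rule CollectI, intro exI conjI, rule refl, rule assms, assumption)

lemma ucl_exchange:
 assumes "x : cDer n" "y : cDer n" "p : words (cDer n)"
 shows "ucl (Der n) (fmul (gen [x, y]) p) = ucl (Der n) (fmul (gen [y, x]) p + fmul (gen [x \<otimes>\<^bsub>Der n\<^esub> y]) p)"
proof -
 have "gen [x, y] - gen [y, x] - gen [x \<otimes>\<^bsub>Der n\<^esub> y] : env_ideal (Der n)"
  by (rule env_idealI(3)[OF assms(1,2)])
 from env_r[OF lie_closed_Der this assms(3)] show ?thesis
  unfolding ucl_eq[OF lie_closed_Der] fmul_simps by (simp only: diff_diff_add)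
qed

lemma ucl_lin:
 assumes "x : cDer n"
 shows "y : cDer n ==> ucl (Der n) (gen [x \<oplus>\<^bsub>Der n\<^esub> y]) = ucl (Der n) (gen [x] + gen [y])"
  and "ucl (Der n) (gen [c \<odot>\<^bsub>Der n\<^esub> x]) = ucl (Der n) (pscale c (gen [x]))"
proof -
 assume "y : cDer n"
 then have "gen [x \<oplus>\<^bsub>Der n\<^esub> y] - gen [x] - gen [y] : env_ideal (Der n)" by (rule env_idealI(1)[OF assms])
 then show "ucl (Der n) (gen [x \<oplus>\<^bsub>Der n\<^esub> y]) = ucl (Der n) (gen [x] + gen [y])"
  unfolding ucl_eq[OF lie_closed_Der] by (simp only: diff_diff_add)
next
 have "gen [c \<odot>\<^bsub>Der n\<^esub> x] - pscale c (gen [x]) : env_ideal (Der n)"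
  by (rule env_idealI(2)[OF assms])
 then show "ucl (Der n) (gen [c \<odot>\<^bsub>Der n\<^esub> x]) = ucl (Der n) (pscale c (gen [x]))"
  unfolding ucl_eq[OF lie_closed_Der] .
qed

lemma ucl_pd_commute:
 assumes "i < n" "j < n" "p : words (cDer n)"
 shows "ucl (Der n) (fmul (gen [pd n i, pd n j]) p) = ucl (Der n) (fmul (gen [pd n j, pd n i]) p)"
proof -
 \<comment> \<open>The vanishing bracket is written as a zero multiple, so that the scalar relation
   puts it into the ideal.\<close>
 have z: "pd n i \<otimes>\<^bsub>Der n\<^esub> pd n j = 0 \<odot>\<^bsub>Der n\<^esub> pd n i"
 proof (rule Der_eqI[of _ n])
  show "pd n i \<otimes>\<^bsub>Der n\<^esub> pd n j : cDer n" "0 \<odot>\<^bsub>Der n\<^esub> pd n i : cDer n"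
   by (auto intro: Der_bracket_closed Der_smult_closed)
  have "pdiff a (pdiff b (pvar k)) = 0" for a b k by (simp add: pdiff_pvar)
  then show "(pd n i \<otimes>\<^bsub>Der n\<^esub> pd n j) (pvar k) = (0 \<odot>\<^bsub>Der n\<^esub> pd n i) (pvar k)" if "k < n" for k
   using assms that by (simp add: Der_simps dop_apply)
 qed
 have "gen [0 \<odot>\<^bsub>Der n\<^esub> pd n i] : env_ideal (Der n)"
  using env_idealI(2)[of "pd n i" "Der n" 0] by simp
 then have "fmul (gen [pd n i \<otimes>\<^bsub>Der n\<^esub> pd n j]) p : env_ideal (Der n)" unfolding z by (rule env_r[OF lie_closed_Der _ assms(3)])
 then have "ucl (Der n) (fmul (gen [pd n j, pd n i]) p + fmul (gen [pd n i \<otimes>\<^bsub>Der n\<^esub> pd n j]) p) = ucl (Der n) (fmul (gen [pd n j, pd n i]) p)"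
  unfolding ucl_eq[OF lie_closed_Der] by simp
 then show ?thesis using ucl_exchange[of "pd n i" n "pd n j" p] assms by simp
qed

text \<open>Lists with the same exponent are permutations of each other, and left multiplications by
  constant fields commute in the enveloping algebra; so the fold over them is independent of the
  order.\<close>

lemma ucl_dword_cong:
 assumes "set ks <= {..<n}" "(\<Sum>i\<leftarrow>ks. ex i) = (\<Sum>i\<leftarrow>js. ex i)"
 shows "ucl (Der n) (dword n ks) = ucl (Der n) (dword n js)"
proof -
 let ?U = "env_alg (Der n)"
 define st where "st = (%i u. ucl (Der n) (gen [pd n i]) \<otimes>\<^bsub>?U\<^esub> u)"
 have w: "gen [pd n i] : words (cDer n)" for i by (simp add: words_gen)
 have s: "st i (ucl (Der n) p) = ucl (Der n) (fmul (gen [pd n i]) p)" if "p : words (cDer n)" for i p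
  unfolding st_def by (rule env_mult[OF lie_closed_Der w that])
 have f: "fold st ks (ucl (Der n) (gen w)) = ucl (Der n) (gen (map (pd n) (rev ks) @ w))" if "set w <= cDer n" for ks w
  using that
 proof (induction ks arbitrary: w)
  case (Cons a ks)
  have "fold st (a # ks) (ucl (Der n) (gen w)) = fold st ks (ucl (Der n) (gen (pd n a # w)))"
   using Cons.prems by (simp add: s words_gen fmul_gen)
  then show ?case using Cons by simp
 qed simp
 have e: "(\<Sum>i\<leftarrow>rev ks. ex i) = (\<Sum>i\<leftarrow>rev js. ex i)" using assms(2) by (simp add: rev_map[symmetric])
 have "fold st (rev ks) (ucl (Der n) (gen [])) = fold st (rev js) (ucl (Der n) (gen []))"
 proof (rule fold_permuted_eq[OF expo_mset[OF e], where P = "%u. u : carrier ?U"])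
  show "ucl (Der n) (gen []) : carrier ?U" by (auto simp: env_carrier[OF lie_closed_Der] words_gen)
 next
  fix i u assume "u : carrier ?U"
  then obtain p where p: "p : words (cDer n)" "u = ucl (Der n) p" using ucl_rep[OF lie_closed_Der] by blast
  show "st i u : carrier ?U" unfolding p(2) s[OF p(1)] env_carrier[OF lie_closed_Der] using words_fmul[OF w p(1)] by blast
 next
  fix i j u assume i: "i : set (rev ks)" "j : set (rev ks)" and "u : carrier ?U"
  then obtain p where p: "p : words (cDer n)" "u = ucl (Der n) p" using ucl_rep[OF lie_closed_Der] by blast
  have 2: "st i (st j u) = ucl (Der n) (fmul (gen [pd n i, pd n j]) p)" for i j
   unfolding p(2) s[OF p(1)] s[OF words_fmul[OF w p(1)]] by (simp add: fmul_assoc[symmetric] fmul_gen)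
  show "st i (st j u) = st j (st i u)" unfolding 2 using i assms(1) by (intro ucl_pd_commute p(1)) auto
 qed
 then show ?thesis using f[of "[]" "rev ks"] f[of "[]" "rev js"] by simp
qed

context smooth_drep
begin

context
 fixes E :: "(cop, 'v) lmod" and fi :: "'v => 'x cv" and N :: "'x cv set"
 assumes lE: "liso (grade_ge n 0) E \<rho> fi N" and N: "stable 1 N" "N <= W" "N ~= {0}" and ind: "indep N"
begin

abbreviation "WD \<equiv> words (cDer n)"
abbreviation "cl \<equiv> ucl (Der n)"
abbreviation "g p e \<equiv> gen (cl p, e) :: (cop list cv set \<times> 'v) cv"
abbreviation "IB \<equiv> carrier (env_alg (Der n)) \<times> carrier E"

definition ind_rels :: "(cop list cv set \<times> 'v) cv set" where
 "ind_rels = tensor_rels (env_alg (Der n)) E \<union>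
   {gen (u \<otimes>\<^bsub>env_alg (Der n)\<^esub> env_incl (Der n) a, e) - gen (u, env_act E a e) | u a e.
     u : carrier (env_alg (Der n)) & a : carrier (env_alg (HH n)) & e : carrier E}"

definition ind_h :: "cop list cv set \<times> 'v => 'x cv" where
 "ind_h = (%(u, e). uact u (fi e))"

definition ind_f :: "cop => cop list cv set \<times> 'v => (cop list cv set \<times> 'v) cv" where
 "ind_f = (%x (u, e). gen (env_emb (Der n) x \<otimes>\<^bsub>env_alg (Der n)\<^esub> u, e))"

lemmas lmE = liso_lmap[OF lE]

lemma E_module: "module CC E" by (rule lmap_module[OF lmE])

lemma WD_HH: "p : words (grade_ge n 0) ==> p : WD"
 using HH_words by auto

lemma cl_carrier: "p : WD ==> cl p : carrier (env_alg (Der n))"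
 by (simp add: env_carrier[OF lie_closed_Der])

lemma IB_cases:
 assumes "b : IB"
 obtains p e where "b = (cl p, e)" "p : WD" "e : carrier E"
proof -
 obtain u e where b: "b = (u, e)" "u : carrier (env_alg (Der n))" "e : carrier E" using assms by auto
 obtain p where "p : WD" "u = cl p" using ucl_rep[OF lie_closed_Der b(2)] by blast
 then show thesis using that b by blast
qed

lemma ind_h_cl: "ind_h (cl p, e) = wact p (fi e)"
 by (simp add: ind_h_def uact_ucl)

lemma foldr_act: "set w <= grade_ge n 0 ==> e : carrier E ==> foldr (act E) w e : carrier E & fi (foldr (act E) w e) = foldr \<rho> w (fi e)"
 by (induction w) (auto simp: lmap_closed[OF lmE] lmap_act[OF lmE])

lemma word_act_E:
 assumes p: "p : words (grade_ge n 0)" and e: "e : carrier E"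
 shows "word_act E p e : carrier E" "fi (word_act E p e) = wact p (fi e)"
proof -
 interpret E: module CC E by (rule E_module)
 have w: "set w <= grade_ge n 0" if "w : keys p" for w using p that by (auto simp: words_def)
 have c: "lookup p w \<odot>\<^bsub>E\<^esub> foldr (act E) w e : carrier E" if "w : keys p" for w
  using foldr_act[OF w[OF that] e] by simp
 show "word_act E p e : carrier E" unfolding word_act_def by (rule E.M.finsum_closed) (use c in auto)
 have "fi (word_act E p e) = (\<Sum>w\<in>keys p. fi (lookup p w \<odot>\<^bsub>E\<^esub> foldr (act E) w e))"
  unfolding word_act_def by (rule lmap_finsum[OF lmE]) (use c in auto)
 also have "... = (\<Sum>w\<in>keys p. pscale (lookup p w) (foldr \<rho> w (fi e)))"
  by (intro sum.cong refl) (use foldr_act[OF w e] in \<open>simp add: lmap_smult[OF lmE]\<close>)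
 finally show "fi (word_act E p e) = wact p (fi e)" by (simp add: wact_def lext_def)
qed

text \<open>By \<open>wact_env\<close> all representatives of a class act alike, so the image taken
  in \<open>env_act\<close> is a single vector.\<close>

lemma env_act_E:
 assumes q: "q : words (grade_ge n 0)" and e: "e : carrier E"
 shows "env_act E (ucl (HH n) q) e : carrier E" "fi (env_act E (ucl (HH n) q) e) = wact q (fi e)"
proof -
 have "word_act E p e = word_act E q e" if "p : ucl (HH n) q" for p
 proof -
  have d: "p - q : env_ideal (HH n)" using that unfolding ucl_mem[OF lie_closed_HH] .
  then have "p - q : words (grade_ge n 0)" using env_words[OF lie_closed_HH] by auto
  from pm.subspace_add[OF subspace_words this q] have p: "p : words (grade_ge n 0)" by simp
  have "wact (p - q) (fi e) = 0" using wact_env env_HH d by blast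
  then have "wact p (fi e) = wact q (fi e)" by (simp add: plin_simps[OF plin_wact1])
  then show ?thesis using liso_inj[OF lE] word_act_E[OF p e] word_act_E[OF q e] by metis
 qed
 then have "(%a. word_act E a e) ` ucl (HH n) q = {word_act E q e}"
  using ucl_self[OF lie_closed_HH, where p = q] by blast
 then have "env_act E (ucl (HH n) q) e = word_act E q e" by (simp add: env_act_def)
 then show "env_act E (ucl (HH n) q) e : carrier E" "fi (env_act E (ucl (HH n) q) e) = wact q (fi e)"
  using word_act_E[OF q e] by auto
qed

text \<open>The relations with word polynomials in place of classes, so that later case analyses
  compute with \<open>fmul\<close> alone.\<close>

lemma ind_rels_cases [consumes 1, case_names addl addr scalel scaler bal]:
 assumes "r : ind_rels"
  and "!!p q e. p : WD ==> q : WD ==> e : carrier E ==> P (g (p + q) e - g p e - g q e)"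
  and "!!p e e'. p : WD ==> e : carrier E ==> e' : carrier E ==> P (g p (e \<oplus>\<^bsub>E\<^esub> e') - g p e - g p e')"
  and "!!p c e. p : WD ==> e : carrier E ==> P (g (pscale c p) e - pscale c (g p e))"
  and "!!p c e. p : WD ==> e : carrier E ==> P (g p (c \<odot>\<^bsub>E\<^esub> e) - pscale c (g p e))"
  and "!!p q e. p : WD ==> q : words (grade_ge n 0) ==> e : carrier E ==> P (g (fmul p q) e - g p (env_act E (ucl (HH n) q) e))"
 shows "P r"
 using assms(1) unfolding ind_rels_def tensor_rels_def
proof (elim UnE CollectE exE conjE)
 fix a a' b assume r: "r = gen (a \<oplus>\<^bsub>env_alg (Der n)\<^esub> a', b) - gen (a, b) - gen (a', b)" "a : carrier (env_alg (Der n))" "a' : carrier (env_alg (Der n))" "b : carrier E"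
 then obtain p q where "p : WD" "a = cl p" "q : WD" "a' = cl q" using ucl_rep[OF lie_closed_Der] by metis
 then show "P r" using assms(2)[of p q b] r by (simp add: env_add[OF lie_closed_Der])
next
 fix a b b' assume r: "r = gen (a, b \<oplus>\<^bsub>E\<^esub> b') - gen (a, b) - gen (a, b')" "a : carrier (env_alg (Der n))" "b : carrier E" "b' : carrier E"
 then obtain p where "p : WD" "a = cl p" using ucl_rep[OF lie_closed_Der] by metis
 then show "P r" using assms(3)[of p b b'] r by simp
next
 fix c a b assume r: "r = gen (c \<odot>\<^bsub>env_alg (Der n)\<^esub> a, b) - pscale c (gen (a, b))" "a : carrier (env_alg (Der n))" "b : carrier E"
 then obtain p where "p : WD" "a = cl p" using ucl_rep[OF lie_closed_Der] by metis
 then show "P r" using assms(4)[of p b c] r by (simp add: env_smult[OF lie_closed_Der])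
next
 fix c a b assume r: "r = gen (a, c \<odot>\<^bsub>E\<^esub> b) - pscale c (gen (a, b))" "a : carrier (env_alg (Der n))" "b : carrier E"
 then obtain p where "p : WD" "a = cl p" using ucl_rep[OF lie_closed_Der] by metis
 then show "P r" using assms(5)[of p b c] r by simp
next
 fix u a e assume r: "r = gen (u \<otimes>\<^bsub>env_alg (Der n)\<^esub> env_incl (Der n) a, e) - gen (u, env_act E a e)" "u : carrier (env_alg (Der n))"
  "a : carrier (env_alg (HH n))" "e : carrier E"
 obtain p where p: "p : WD" "u = cl p" using r(2) ucl_rep[OF lie_closed_Der] by metis
 obtain q where q: "q : words (grade_ge n 0)" "a = ucl (HH n) q" using ucl_rep[OF lie_closed_HH r(3)] by auto
 show "P r" using assms(6)[OF p(1) q(1) r(4)]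
  unfolding r(1) p(2) q(2) env_incl_ucl env_mult[OF lie_closed_Der p(1) WD_HH[OF q(1)]] .
qed

lemma ind_relsI:
 "p : WD ==> q : WD ==> e : carrier E ==> g (p + q) e - g p e - g q e : pm.span ind_rels"
 "p : WD ==> e : carrier E ==> e' : carrier E ==> g p (e \<oplus>\<^bsub>E\<^esub> e') - g p e - g p e' : pm.span ind_rels"
 "p : WD ==> e : carrier E ==> g (pscale c p) e - pscale c (g p e) : pm.span ind_rels"
 "p : WD ==> e : carrier E ==> g p (c \<odot>\<^bsub>E\<^esub> e) - pscale c (g p e) : pm.span ind_rels"
 "p : WD ==> q : words (grade_ge n 0) ==> e : carrier E ==> g (fmul p q) e - g p (env_act E (ucl (HH n) q) e) : pm.span ind_rels"
proof -
 note C = cl_carrier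
 show "g (p + q) e - g p e - g q e : pm.span ind_rels" if "p : WD" "q : WD" "e : carrier E"
  unfolding env_add[OF lie_closed_Der, symmetric] ind_rels_def tensor_rels_def
  by (rule pm.span_base, rule UnI1, rule UnI1, rule UnI1, rule UnI1, rule CollectI, intro exI conjI, rule refl) (use C that in auto)
 show "g p (e \<oplus>\<^bsub>E\<^esub> e') - g p e - g p e' : pm.span ind_rels" if "p : WD" "e : carrier E" "e' : carrier E"
  unfolding ind_rels_def tensor_rels_def
  by (rule pm.span_base, rule UnI1, rule UnI1, rule UnI1, rule UnI2, rule CollectI, intro exI conjI, rule refl) (use C that in auto)
 show "g (pscale c p) e - pscale c (g p e) : pm.span ind_rels" if "p : WD" "e : carrier E"
  unfolding env_smult[OF lie_closed_Der, symmetric] ind_rels_def tensor_rels_def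
  by (rule pm.span_base, rule UnI1, rule UnI1, rule UnI2, rule CollectI, intro exI conjI, rule refl) (use C that in auto)
 show "g p (c \<odot>\<^bsub>E\<^esub> e) - pscale c (g p e) : pm.span ind_rels" if "p : WD" "e : carrier E"
  unfolding ind_rels_def tensor_rels_def
  by (rule pm.span_base, rule UnI1, rule UnI2, rule CollectI, intro exI conjI, rule refl) (use C that in auto)
 show "g (fmul p q) e - g p (env_act E (ucl (HH n) q) e) : pm.span ind_rels" if "p : WD" "q : words (grade_ge n 0)" "e : carrier E"
 proof -
  have "ucl (HH n) q : carrier (env_alg (HH n))" using that(2) by (simp add: env_carrier[OF lie_closed_HH])
  then have "gen (cl p \<otimes>\<^bsub>env_alg (Der n)\<^esub> env_incl (Der n) (ucl (HH n) q), e) - g p (env_act E (ucl (HH n) q) e) : pm.span ind_rels"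
   unfolding ind_rels_def
   by (intro pm.span_base UnI2 CollectI exI conjI refl) (use C that in auto)
  then show ?thesis by (simp only: env_incl_ucl env_mult[OF lie_closed_Der that(1) WD_HH[OF that(2)]])
 qed
qed

lemma ind_rels_IB: "ind_rels <= {p. keys p <= IB}"
proof
 fix r assume "r : ind_rels"
 interpret E: module CC E by (rule E_module)
 note sub = pm.subspace_diff[OF subspace_keys] pm.subspace_scale[OF subspace_keys]
 have gB: "g p e : {p. keys p <= IB}" if "p : WD" "e : carrier E" for p e using that cl_carrier by simp
 have W: "p + q : WD" "pscale c p : WD" if "p : WD" "q : WD" for p q c
  using that pm.subspace_add[OF subspace_words] pm.subspace_scale[OF subspace_words] by auto
 show "r : {p. keys p <= IB}" using \<open>r : ind_rels\<close>
 proof (induction rule: ind_rels_cases)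
  case (addl p q e) then show ?case by (intro sub gB W)
 next
  case (addr p e e') then show ?case by (intro sub gB E.a_closed)
 next
  case (scalel p c e) show ?case by (rule sub(1)[OF gB sub(2)[OF gB]]) (use scalel W in auto)
 next
  case (scaler p c e) show ?case by (rule sub(1)[OF gB sub(2)[OF gB]]) (use scaler in auto)
 next
  case (bal p q e) show ?case by (rule sub(1)[OF gB gB]) (use bal words_fmul WD_HH env_act_E in auto)
 qed
qed

lemma ind_rels_zero: "r : ind_rels ==> lext ind_h r = 0"
proof (induction rule: ind_rels_cases)
 case (bal p q e)
 then show ?case by (simp add: plin_simps[OF plin_lext] ind_h_cl wact_fmul env_act_E)
qed (auto simp: plin_simps[OF plin_lext] ind_h_cl plin_simps[OF plin_wact1] plin_simps[OF plin_wact2] lmap_add[OF lmE] lmap_smult[OF lmE] simp del: pscale_single)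

lemma ind_f_cl: "x : cDer n ==> p : WD ==> lext (ind_f x) (g p e) = g (fmul (gen [x]) p) e"
 by (simp add: ind_f_def env_emb_def ucl_coset env_mult[OF lie_closed_Der] words_gen)

lemma ind_f_rels: assumes x: "x : cDer n" and r: "r : pm.span ind_rels" shows "lext (ind_f x) r : pm.span ind_rels"
proof -
 have X: "gen [x] : WD" using x by (simp add: words_gen)
 note F = words_fmul[OF X] and sW = pm.subspace_add[OF subspace_words] pm.subspace_scale[OF subspace_words]
 have "lext (ind_f x) r : pm.span ind_rels" if "r : ind_rels" for r
  using that
 proof (induction rule: ind_rels_cases)
  case (addl p q e)
  then show ?case using ind_relsI(1)[OF F F, of p q e] by (simp add: plin_simps[OF plin_lext] ind_f_cl[OF x] sW fmul_simps del: lext_gen)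
 next
  case (addr p e e')
  then show ?case using ind_relsI(2)[OF F, of p e e'] by (simp add: plin_simps[OF plin_lext] ind_f_cl[OF x] del: lext_gen)
 next
  case (scalel p c e)
  then show ?case using ind_relsI(3)[OF F, of p e c] by (simp add: plin_simps[OF plin_lext] ind_f_cl[OF x] sW fmul_simps del: lext_gen pscale_single)
 next
  case (scaler p c e)
  then show ?case using ind_relsI(4)[OF F, of p e c] by (simp add: plin_simps[OF plin_lext] ind_f_cl[OF x] del: lext_gen pscale_single)
 next
  case (bal p q e)
  then show ?case using ind_relsI(5)[OF F, of p q e] words_fmul[OF bal(1) WD_HH[OF bal(2)]]
   by (simp add: plin_simps[OF plin_lext] ind_f_cl[OF x] fmul_assoc del: lext_gen)
 qed
 then have "lext (ind_f x) ` ind_rels <= pm.span ind_rels" by blast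
 then have "pm.span (lext (ind_f x) ` ind_rels) <= pm.span ind_rels" by (rule pm.span_minimal[OF _ pm.subspace_span])
 then show ?thesis using r span_plin_image[OF plin_lext, of "ind_f x" ind_rels] by blast
qed

text \<open>The normal forms: a word in constant fields tensor a vector of \<open>E\<close>. That
  they span modulo the relations is the spanning half of a Poincare-Birkhoff-Witt theorem relative
  to \<open>grade_ge n 0\<close>; the independence half is supplied by \<open>indep N\<close> inside
  \<open>W\<close>.\<close>

definition YG :: "(cop list cv set \<times> 'v) cv set" where
 "YG = {g (dword n ks) e | ks e. set ks <= {..<n} & e : carrier E}"

abbreviation "YY \<equiv> pm.span (ind_rels \<union> YG)"

lemma rels_YY: "r : pm.span ind_rels ==> r : YY"
 using pm.span_mono[of ind_rels "ind_rels \<union> YG"] by blast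

lemma dword_WD: "dword n ks : WD"
 by (auto simp: words_gen)

lemma YG_YY: "set ks <= {..<n} ==> e : carrier E ==> g (dword n ks) e : YY"
 by (rule pm.span_base) (auto simp: YG_def)

lemma YY_map:
 assumes x: "x : cDer n" and G: "!!ks e. set ks <= {..<n} ==> e : carrier E ==> g (fmul (gen [x]) (dword n ks)) e : YY"
  and y: "y : YY"
 shows "lext (ind_f x) y : YY"
proof -
 have "lext (ind_f x) ` (ind_rels \<union> YG) <= YY"
 proof
  fix z assume "z : lext (ind_f x) ` (ind_rels \<union> YG)"
  then consider r where "r : ind_rels" "z = lext (ind_f x) r" | ks e where "set ks <= {..<n}" "e : carrier E" "z = lext (ind_f x) (g (dword n ks) e)"
   by (auto simp only: YG_def image_iff)
  then show "z : YY"
  proof cases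
   case 1 then show ?thesis using rels_YY[OF ind_f_rels[OF x pm.span_base]] by blast
  next
   case 2 then show ?thesis using G by (simp add: ind_f_cl[OF x dword_WD] del: lext_gen)
  qed
 qed
 then have "pm.span (lext (ind_f x) ` (ind_rels \<union> YG)) <= YY" by (rule pm.span_minimal[OF _ pm.subspace_span])
 then show ?thesis using y span_plin_image[OF plin_lext, of "ind_f x" "ind_rels \<union> YG"] by blast
qed

lemma YY_pd: assumes "i < n" "y : YY" shows "lext (ind_f (pd n i)) y : YY"
proof (rule YY_map[OF _ _ assms(2)])
 fix ks e assume "set ks <= {..<n}" "e : carrier E"
 then show "g (fmul (gen [pd n i]) (dword n ks)) e : YY" using YG_YY[of "i # ks" e] assms(1) by (simp add: fmul_gen)
qed auto

lemma YY_linear: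
 assumes "p : WD" "q : WD" "e : carrier E"
 shows "g p e : YY ==> g q e : YY ==> g (p + q) e : YY" "g p e : YY ==> g (pscale c p) e : YY"
proof -
 assume a: "g p e : YY"
 show "g (p + q) e : YY" if b: "g q e : YY"
  using pm.span_add[OF pm.span_add[OF rels_YY[OF ind_relsI(1)[OF assms]] b] a] by simp
 show "g (pscale c p) e : YY"
  using pm.span_add[OF rels_YY[OF ind_relsI(3)[OF assms(1,3), of c]] pm.span_scale[OF a, of c]] by simp
qed

text \<open>Constant fields are themselves normal words, fields vanishing at the origin cross the
  tensor sign and act on \<open>e\<close>, and these two kinds span all fields.\<close>

lemma YY_letter: assumes x: "x : cDer n" and e: "e : carrier E" shows "g (gen [x]) e : YY"
proof -
 let ?Q = "{x : cDer n. g (gen [x]) e : YY}"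
 have w: "gen [x] : WD" if "x : cDer n" for x using that by (simp add: words_gen)
 have pd: "g (gen [pd n i]) e : YY" if "i < n" for i using YG_YY[of "[i]" e] that e by simp
 have low: "g (gen [y]) e : YY" if y: "y : grade_ge n 0" for y
 proof -
  have yw: "gen [y] : words (grade_ge n 0)" using y by (simp add: words_gen)
  have "g (fmul (gen []) (gen [y])) e - g (gen []) (env_act E (ucl (HH n) (gen [y])) e) : YY"
   by (rule rels_YY[OF ind_relsI(5)[OF _ yw e]]) (simp add: words_gen)
  moreover have "g (gen []) (env_act E (ucl (HH n) (gen [y])) e) : YY"
   using YG_YY[of "[]"] env_act_E(1)[OF yw e] by simp
  ultimately show ?thesis using pm.span_add[of _ "ind_rels \<union> YG" "g (gen []) (env_act E (ucl (HH n) (gen [y])) e)"]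
   by (metis diff_add_cancel fmul_one(1))
 qed
 have zer: "\<zero>\<^bsub>Der n\<^esub> : grade_ge n 0" using ordge_0_poly Der_zero by (simp add: grade_ge_ordge[of n 0, simplified] Der_simps)
 have "submodule ?Q CC (Der n)"
  unfolding submodule_CC_iff[OF Der_module]
 proof (intro conjI ballI allI)
  show "\<zero>\<^bsub>Der n\<^esub> : ?Q" using low[OF zer] by (simp add: Der_simps Der_zero)
  show "y \<oplus>\<^bsub>Der n\<^esub> z : ?Q" if "y : ?Q" "z : ?Q" for y z
  proof -
   have yz: "y : cDer n" "z : cDer n" using that by auto
   then show ?thesis using that YY_linear(1)[OF w[OF yz(1)] w[OF yz(2)] e] by (simp add: Der_add_closed ucl_lin(1))
  qed
  show "c \<odot>\<^bsub>Der n\<^esub> y : ?Q" if "y : ?Q" for c y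
  proof -
   have y: "y : cDer n" using that by auto
   then show ?thesis using that YY_linear(2)[OF w[OF y] w[OF y] e, of c] by (simp add: Der_smult_closed ucl_lin(2) del: pscale_single)
  qed
 qed auto
 moreover have "{der_gen n al i | al i. al : exponents n & i < n & True} <= ?Q"
 proof clarify
  fix al i assume a: "al : exponents n" "i < n"
  show "der_gen n al i : cDer n & g (gen [der_gen n al i]) e : YY"
  proof (cases "al = 0")
   case True
   then show ?thesis using pd a by (simp add: der_gen_dop gen_0)
  next
   case False
   then have "deg n al ~= 0" using deg_eq_0 a by blast
   then have "ordge n 1 (gen al)" using a by (intro ordge_gen) auto
   then have "der_gen n al i : grade_ge n 0" using a ordge_0_poly
    by (auto simp: grade_ge_ordge[of n 0, simplified] der_gen_dop dop_pvar)
   then show ?thesis using low grade_ge_carrier[of n 0] by auto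
  qed
 qed
 ultimately have "gr n (%_. True) <= ?Q" unfolding gr_span by (rule vspan_least)
 then show ?thesis using x by (auto simp: gr_def)
qed

text \<open>Exchange \<open>x\<close> with the first constant field. Behind \<open>x\<close> the
  word becomes shorter, and in the correction term the bracket takes the place of \<open>x\<close>;
  hence \<open>x\<close> is arbitrary in the induction.\<close>

lemma YY_dword:
 assumes "set ks <= {..<n}" "x : cDer n" "e : carrier E" shows "g (gen (x # map (pd n) ks)) e : YY"
 using assms(1,2)
proof (induction ks arbitrary: x)
 case Nil
 then show ?case using YY_letter assms(3) by simp
next
 case (Cons i ks)
 have i: "i < n" "set ks <= {..<n}" using Cons.prems by auto
 have b: "x \<otimes>\<^bsub>Der n\<^esub> pd n i : cDer n" using Cons.prems by (intro Der_bracket_closed) auto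
 have w1: "gen (x # map (pd n) ks) : WD" "gen (pd n i # x # map (pd n) ks) : WD" "gen ((x \<otimes>\<^bsub>Der n\<^esub> pd n i) # map (pd n) ks) : WD"
  using Cons.prems b by (auto simp: words_gen)
 have "cl (gen (x # map (pd n) (i # ks))) = cl (gen (pd n i # x # map (pd n) ks) + gen ((x \<otimes>\<^bsub>Der n\<^esub> pd n i) # map (pd n) ks))"
  using ucl_exchange[OF Cons.prems(2) _ dword_WD, of "pd n i" ks] by (simp add: fmul_gen)
 moreover have "g (gen (pd n i # x # map (pd n) ks)) e : YY"
  using YY_pd[OF i(1) Cons.IH[OF i(2) Cons.prems(2)]] ind_f_cl[OF _ w1(1), of "pd n i" e] by (simp add: fmul_gen)
 ultimately show ?case using YY_linear(1)[OF w1(2,3) assms(3)] Cons.IH[OF i(2) b] by simp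
qed

lemma YY_all: assumes "p : WD" "e : carrier E" shows "g p e : YY"
proof -
 have wd: "g (gen w) e : YY" if "set w <= cDer n" for w
  using that
 proof (induction w)
  case Nil
  then show ?case using YG_YY[of "[]" e] assms(2) by simp
 next
  case (Cons x w)
  have "lext (ind_f x) (g (gen w) e) : YY"
   by (rule YY_map) (use Cons YY_dword in \<open>auto simp: fmul_gen\<close>)
  then show ?case using ind_f_cl[of x "gen w" e] Cons.prems by (simp add: fmul_gen words_gen)
 qed
 have "p : WD & g p e : YY" using assms(1)
 proof (induction rule: words_induct)
  case zero
  have w0: "gen [] : WD" by (simp add: words_gen)
  have "g (pscale 0 (gen [])) e : YY" by (rule YY_linear(2)[OF w0 w0 assms(2) wd]) simp
  then show ?case using pm.subspace_0[OF subspace_words] by simp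
 next
  case (add p q) then show ?case using YY_linear(1)[of p q e] assms(2) pm.subspace_add[OF subspace_words] by blast
 next
  case (scale c p) then show ?case using YY_linear(2)[of p p e c] assms(2) pm.subspace_scale[OF subspace_words] by blast
 next
  case (gen w) then show ?case using wd by (simp add: words_gen)
 qed
 then show ?thesis by blast
qed

text \<open>One ordering of the constant fields is chosen for each exponent; by
  \<open>ucl_dword_cong\<close> the class does not depend on the choice.\<close>

definition nword :: "(nat \<Rightarrow>\<^sub>0 nat) => cop list cv" where
 "nword al = dword n (SOME ks. set ks <= {..<n} & (\<Sum>i\<leftarrow>ks. ex i) = al)"

lemma nword_dword: assumes "set ks <= {..<n}" shows "cl (nword (\<Sum>i\<leftarrow>ks. ex i)) = cl (dword n ks)"
proof -
 let ?P = "%js. set js <= {..<n} & (\<Sum>i\<leftarrow>js. ex i) = (\<Sum>i\<leftarrow>ks. ex i)"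
 have "?P (SOME js. ?P js)" by (rule someI[of ?P ks]) (use assms in auto)
 then show ?thesis unfolding nword_def by (intro ucl_dword_cong) auto
qed

lemma wact_dword: "set ks <= {..<n} ==> wact (dword n ks) v = Dp (\<Sum>i\<leftarrow>ks. ex i) v"
proof (induction ks)
 case (Cons i ks)
 then have "Dp ((\<Sum>i\<leftarrow>ks. ex i) + ex i) v = R 1 i (wact (dword n ks) v)" by (simp add: Dp_add)
 then show ?case by (simp add: wact_gen R_def[symmetric] add.commute)
qed (simp add: wact_gen)

lemma expo_list: "al : exponents n ==> \<exists>ks. set ks <= {..<n} & (\<Sum>i\<leftarrow>ks. ex i) = al"
proof (induction rule: exponents_induct)
 case zero then show ?case by (intro exI[of _ "[]"]) simp
next
 case (add al i)
 then obtain ks where "set ks <= {..<n} & (\<Sum>i\<leftarrow>ks. ex i) = al" by blast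
 then show ?case using add by (intro exI[of _ "i # ks"]) (auto simp: add.commute)
qed

lemma expo_list_exponents: "set ks <= {..<n} ==> (\<Sum>i\<leftarrow>ks. ex i) : exponents n"
 by (induction ks) (auto intro: exponents_add)

lemma ind_h_nword: assumes "al : exponents n" shows "ind_h (cl (nword al), e) = Dp al (fi e)"
proof -
 obtain ks where ks: "set ks <= {..<n}" "(\<Sum>i\<leftarrow>ks. ex i) = al" using expo_list[OF assms] by blast
 show ?thesis using nword_dword[OF ks(1)] wact_dword[OF ks(1)] ind_h_cl[of "dword n ks" e] ks(2) by simp
qed

lemma nword_WD: "nword al : WD"
 unfolding nword_def by (rule dword_WD)

lemma YY_normal:
 assumes "z : YY"
 shows "\<exists>A x. finite A & A <= exponents n & (\<forall>al. x al : carrier E) & z - (\<Sum>al\<in>A. g (nword al) (x al)) : pm.span ind_rels"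
 using assms
proof (induction rule: pm.span_induct_alt)
 case base
 interpret E: module CC E by (rule E_module)
 show ?case by (intro exI[of _ "{}"] exI[of _ "%_. \<zero>\<^bsub>E\<^esub>"]) (simp add: pm.span_zero)
next
 case (step c y v)
 interpret E: module CC E by (rule E_module)
 let ?S = "pm.span ind_rels"
 obtain A x where A: "finite A" "A <= exponents n" "!!al. x al : carrier E" "v - (\<Sum>al\<in>A. g (nword al) (x al)) : ?S"
  using step.IH by blast
 from step.hyps show ?case
 proof
  assume "y : ind_rels"
  then have "pscale c y + (v - (\<Sum>al\<in>A. g (nword al) (x al))) : ?S" by (intro pm.span_add[OF pm.span_scale A(4)] pm.span_base)
  then show ?thesis using A by (intro exI[of _ A] exI[of _ x]) (simp add: add_diff_eq)
 next
  assume "y : YG"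
  then obtain ks e where ks: "y = g (dword n ks) e" "set ks <= {..<n}" "e : carrier E" by (auto simp: YG_def)
  define be where "be = (\<Sum>i\<leftarrow>ks. ex i)"
  have y: "y = g (nword be) e" unfolding ks(1) be_def nword_dword[OF ks(2)] ..
  have be: "be : exponents n" unfolding be_def by (rule expo_list_exponents[OF ks(2)])
  define B where "B = insert be A"
  \<comment> \<open>Padding with the zero vector, so that the term at \<open>be\<close> can be
    adjusted whether or not \<open>be\<close> lies in \<open>A\<close>.\<close>
  define x0 where "x0 = (%al. if al : A then x al else \<zero>\<^bsub>E\<^esub>)"
  define x' where "x' = x0(be := c \<odot>\<^bsub>E\<^esub> e \<oplus>\<^bsub>E\<^esub> x0 be)"
  have x0: "x0 al : carrier E" for al using A(3) by (simp add: x0_def)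
  have x': "x' al : carrier E" for al using x0 ks(3) by (simp add: x'_def)
  have z: "g p \<zero>\<^bsub>E\<^esub> : ?S" if "p : WD" for p
   using ind_relsI(4)[OF that E.zero_closed, of 0] by (simp add: E.smult_l_null[of "\<zero>\<^bsub>E\<^esub>", simplified] )
  have a1: "(\<Sum>al\<in>B. g (nword al) (x0 al)) - (\<Sum>al\<in>A. g (nword al) (x al)) : ?S"
  proof (cases "be : A")
   case True
   then have "B = A" by (auto simp: B_def)
   then have "(\<Sum>al\<in>B. g (nword al) (x0 al)) = (\<Sum>al\<in>A. g (nword al) (x al))" by (simp add: x0_def)
   then show ?thesis by (simp only: diff_self pm.span_zero)
  next
   case False
   have "(\<Sum>al\<in>A. g (nword al) (x0 al)) = (\<Sum>al\<in>A. g (nword al) (x al))" by (rule sum.cong) (auto simp: x0_def)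
   then show ?thesis using False A(1) z[OF nword_WD] by (simp add: B_def x0_def)
  qed
  have a2: "g (nword be) (x' be) - g (nword be) (c \<odot>\<^bsub>E\<^esub> e) - g (nword be) (x0 be) : ?S"
   unfolding x'_def fun_upd_same by (rule ind_relsI(2)[OF nword_WD]) (use x0 ks(3) in auto)
  have a3: "g (nword be) (c \<odot>\<^bsub>E\<^esub> e) - pscale c y : ?S" unfolding y by (rule ind_relsI(4)[OF nword_WD ks(3)])
  have a4: "(\<Sum>al\<in>B. g (nword al) (x' al)) = g (nword be) (x' be) - g (nword be) (x0 be) + (\<Sum>al\<in>B. g (nword al) (x0 al))"
  proof -
   have "finite B" "be : B" using A(1) by (auto simp: B_def)
   moreover have "(\<Sum>al\<in>B - {be}. g (nword al) (x' al)) = (\<Sum>al\<in>B - {be}. g (nword al) (x0 al))" by (rule sum.cong) (auto simp: x'_def)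
   ultimately show ?thesis by (simp add: sum.remove[of B be])
  qed
  have "(v - (\<Sum>al\<in>A. g (nword al) (x al))) - ((\<Sum>al\<in>B. g (nword al) (x0 al)) - (\<Sum>al\<in>A. g (nword al) (x al)))
    - (g (nword be) (x' be) - g (nword be) (c \<odot>\<^bsub>E\<^esub> e) - g (nword be) (x0 be)) - (g (nword be) (c \<odot>\<^bsub>E\<^esub> e) - pscale c y) : ?S" (is "?e : ?S")
   by (rule pm.span_diff[OF pm.span_diff[OF pm.span_diff[OF A(4) a1] a2] a3])
  moreover have "?e = pscale c y + v - (\<Sum>al\<in>B. g (nword al) (x' al))"
   unfolding a4 by (simp only: algebra_simps)
  ultimately have r: "pscale c y + v - (\<Sum>al\<in>B. g (nword al) (x' al)) : ?S" by (simp only:)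
  show ?thesis by (intro exI[of _ B] exI[of _ x'] conjI allI r x') (use A(1,2) be in \<open>auto simp: B_def\<close>)
 qed
qed

text \<open>After reduction to normal form, \<open>ind_h\<close> turns the element into a relation
  between translates in \<open>W\<close>. Independence makes all coefficients zero vectors, and
  tensors with a zero vector lie in the span of the relations.\<close>

lemma ind_kernel: assumes z: "keys z <= IB" "lext ind_h z = 0" shows "z : pm.span ind_rels"
proof -
 interpret E: module CC E by (rule E_module)
 let ?S = "pm.span ind_rels"
 have "gen b : YY" if "b : IB" for b
  using that by (rule IB_cases) (simp add: YY_all)
 then have "gen ` IB <= YY" by blast
 then have "pm.span (gen ` IB) <= YY" by (rule pm.span_minimal[OF _ pm.subspace_span])
 then have "z : YY" using z(1) unfolding span_gen by blast
 from YY_normal[OF this] obtain A x where A: "finite A" "A <= exponents n" "!!al. x al : carrier E"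
  "z - (\<Sum>al\<in>A. g (nword al) (x al)) : ?S" by (elim exE conjE) blast
 have S0: "?S <= {p. lext ind_h p = 0}" using ind_rels_zero by (intro pm.span_minimal subspace_plin_ker plin_lext) blast
 have "lext ind_h (z - (\<Sum>al\<in>A. g (nword al) (x al))) = 0" using subsetD[OF S0 A(4)] by (simp only: mem_Collect_eq)
 then have "(\<Sum>al\<in>A. ind_h (cl (nword al), x al)) = 0" using z(2) by (simp add: plin_simps[OF plin_lext])
 moreover have "(\<Sum>al\<in>A. ind_h (cl (nword al), x al)) = (\<Sum>al\<in>A. Dp al (fi (x al)))"
  by (rule sum.cong) (use A(2) ind_h_nword in auto)
 ultimately have s0: "(\<Sum>al\<in>A. Dp al (fi (x al))) = 0" by (simp only:)
 have "fi (x al) = 0" if "al : A" for al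
  by (rule indepD[OF ind A(1,2) _ s0 that]) (rule liso_in[OF lE A(3)])
 then have x0: "x al = \<zero>\<^bsub>E\<^esub>" if "al : A" for al
  using liso_inj[OF lE A(3) E.zero_closed] lmap_zero[OF lmE] that by simp
 have "g p \<zero>\<^bsub>E\<^esub> : ?S" if "p : WD" for p
  using ind_relsI(4)[OF that E.zero_closed, of 0] by (simp add: E.smult_l_null[of "\<zero>\<^bsub>E\<^esub>", simplified])
 then have "g (nword al) (x al) : ?S" if "al : A" for al unfolding x0[OF that] using nword_WD by blast
 then have "(\<Sum>al\<in>A. g (nword al) (x al)) : ?S" by (rule pm.span_sum)
 from pm.span_add[OF A(4) this] show ?thesis by simp
qed

lemma Ind_liso: "liso (cDer n) (Ind (Der n) (grade_ge n 0) E) \<rho> (cmap (lext ind_h)) W"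
proof -
 have f: "keys (ind_f x b) <= IB & lext ind_h (ind_f x b) = \<rho> x (ind_h b)" if x: "x : cDer n" and b: "b : IB" for x b
 proof -
  obtain p e where p: "b = (cl p, e)" "p : WD" "e : carrier E" using b ucl_rep[OF lie_closed_Der] by (cases b) auto
  have xw: "gen [x] : WD" using x by (simp add: words_gen)
  have "ind_f x b = g (fmul (gen [x]) p) e" using ind_f_cl[OF x p(2), of e] by (simp add: p(1))
  then show ?thesis using p cl_carrier[OF words_fmul[OF xw p(2)]] by (simp add: ind_h_cl wact_fmul[OF xw] wact_gen)
 qed
 have "Ind (Der n) (grade_ge n 0) E = presented_module IB ind_rels ind_f"
  unfolding Ind_def ind_rels_def ind_f_def ..
 moreover have "liso (cDer n) (presented_module IB ind_rels ind_f) \<rho> (cmap (lext ind_h)) (pm.span (ind_h ` IB))"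
  by (rule presented_liso(1)[OF ind_rels_IB ind_rels_zero ind_kernel f rho_plin])
 moreover have "pm.span (ind_h ` IB) = W"
 proof
  have w: "wact p (fi e) : W" if "p : WD" "e : carrier E" for p e
   using that(1)
  proof (induction rule: words_induct)
   case (gen w)
   have eW: "fi e : W" using liso_in[OF lE that(2)] N(2) by blast
   have rW: "\<rho> x u : W" if "x : cDer n" "u : W" for x u
    unfolding rho_R[OF that(1)] dact_def using that Der_polys[OF that(1)] by (intro pm.subspace_sum[OF W_sub] W_stable) auto
   from gen have "foldr \<rho> w (fi e) : W" by (induction w) (auto simp: eW rW)
   then show ?case by (simp add: wact_gen)
  qed (auto simp: plin_simps[OF plin_wact1] W_0 pm.subspace_add[OF W_sub] pm.subspace_scale[OF W_sub])
  have "ind_h b : W" if "b : IB" for b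
   by (rule IB_cases[OF that]) (simp add: ind_h_cl w)
  then show "pm.span (ind_h ` IB) <= W" by (intro pm.span_minimal[OF _ W_sub]) blast
  have "{Dp al u | al u. al : exponents n & u : N} <= ind_h ` IB"
  proof clarify
   fix al u assume a: "al : exponents n" "u : N"
   then obtain e where e: "e : carrier E" "u = fi e" using liso_image[OF lE] by blast
   show "Dp al u : ind_h ` IB"
    unfolding e(2) ind_h_nword[OF a(1), symmetric] using e(1) cl_carrier[OF nword_WD] by (intro imageI) simp
  qed
  from pm.span_mono[OF this] show "W <= pm.span (ind_h ` IB)" unfolding span_Dp_W[OF N] .
 qed
 ultimately show ?thesis by simp
qed

end

end

section \<open>Modules over the truncated Lie algebra\<close>

text \<open>The Taylor coefficients of a field up to degree \<open>l\<close>. On fields vanishing at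
  the origin their common kernel is \<open>grade_ge n (int l)\<close>, so jets are coordinates on
  the truncated algebra.\<close>

definition jet :: "nat => nat => cop => ((nat \<Rightarrow>\<^sub>0 nat) \<times> nat) cv" where
 "jet n l D = (\<Sum>j<n. lext (%al. if deg n al <= l then gen (al, j) else 0) (D (pvar j)))"

lemma lookup_jet: "lookup (jet n l D) (al, j) = (if j < n & deg n al <= l then lookup (D (pvar j)) al else 0)"
proof -
 have a: "lookup (lext (%al. if deg n al <= l then gen (al, k) else 0) p) (al, j) = (if k = j then if deg n al <= l then lookup p al else 0 else 0)" for k and p :: cpoly
  by (rule pm_sup_induct[of p UNIV "%p. lookup (lext (%al. if deg n al <= l then gen (al, k) else 0) p) (al, j) = (if k = j then if deg n al <= l then lookup p al else 0 else 0)"])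
   (auto simp: plin_simps[OF plin_lext] lookup_add lookup_single when_def)
 show ?thesis unfolding jet_def lookup_sum a by simp
qed

lemma jet_zero_iff: assumes "D : grade_ge n 0" shows "jet n l D = 0 \<longleftrightarrow> D : grade_ge n (int l)"
proof -
 have D: "D : cDer n" using assms grade_ge_carrier[of n 0] by auto
 have "jet n l D = 0 \<longleftrightarrow> (\<forall>al j. lookup (jet n l D) (al, j) = 0)" by (auto simp: poly_mapping_eq_iff fun_eq_iff)
 also have "... \<longleftrightarrow> (\<forall>j<n. \<forall>al\<in>keys (D (pvar j)). l + 1 <= deg n al)"
 proof -
  have e: "l + 1 <= d \<longleftrightarrow> \<not> d <= l" for d by linarith
  show ?thesis unfolding lookup_jet e Ball_def in_keys_iff by auto
 qed
 finally show ?thesis using D Der_polys[OF D] by (auto simp: grade_ge_ordge ordge_def)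
qed

lemma jet_lin: "D : cDer n ==> D' : cDer n ==> jet n l (D \<oplus>\<^bsub>Der n\<^esub> D') = jet n l D + jet n l D'"
 "D : cDer n ==> jet n l (c \<odot>\<^bsub>Der n\<^esub> D) = pscale c (jet n l D)"
 by (simp_all add: jet_def Der_simps plin_simps[OF plin_lext] sum.distrib pm.scale_sum_right)

definition tcl :: "nat => nat => cop => cop set" where
 "tcl n l x = grade_ge n (int l) +>\<^bsub>Der n\<^esub> x"

lemma tcl_mem: "y : tcl n l x \<longleftrightarrow> (\<exists>h\<in>grade_ge n (int l). y = h \<oplus>\<^bsub>Der n\<^esub> x)"
 by (auto simp: tcl_def a_r_coset_def')

lemma grade_ge_zero: "\<zero>\<^bsub>Der n\<^esub> : grade_ge n (int l)"
 using ordge_0_poly Der_zero by (simp add: grade_ge_ordge Der_simps)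

lemma tcl_self: "x : cDer n ==> x : tcl n l x"
proof -
 assume x: "x : cDer n"
 interpret module CC "Der n" by (rule Der_module)
 show ?thesis unfolding tcl_mem using x by (intro bexI[OF _ grade_ge_zero]) simp
qed

lemma tcl_grade: "x : grade_ge n 0 ==> y : tcl n l x ==> y : grade_ge n 0"
 using grade_ge_mono[of 0 l n] grade_ge_closed(1)[of _ n 0] by (auto simp: tcl_mem)

lemma trunc_carrier: "carrier (g_trunc n l) = tcl n l ` grade_ge n 0"
 by (auto simp: g_trunc_def vquot_def FactRing_def A_RCOSETS_def' a_r_coset_def' tcl_def ring.defs module.defs)

lemma trunc_ops:
 "A \<oplus>\<^bsub>g_trunc n l\<^esub> B = {a \<oplus>\<^bsub>Der n\<^esub> b | a b. a : A & b : B}"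
 "c \<odot>\<^bsub>g_trunc n l\<^esub> A = (\<Union>a\<in>A. tcl n l (c \<odot>\<^bsub>Der n\<^esub> a))"
 "A \<otimes>\<^bsub>g_trunc n l\<^esub> B = (\<Union>a\<in>A. \<Union>b\<in>B. tcl n l (a \<otimes>\<^bsub>Der n\<^esub> b))"
 by (auto simp: g_trunc_def vquot_def FactRing_def rcoset_mult_def set_add_def set_mult_def a_r_coset_def' tcl_def ring.defs module.defs)

lemma trunc_zero: "\<zero>\<^bsub>g_trunc n l\<^esub> = tcl n l \<zero>\<^bsub>Der n\<^esub>"
proof -
 interpret module CC "Der n" by (rule Der_module)
 have "\<zero>\<^bsub>g_trunc n l\<^esub> = grade_ge n (int l)" by (simp add: g_trunc_def vquot_def FactRing_def ring.defs module.defs)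
 also have "... = tcl n l \<zero>\<^bsub>Der n\<^esub>"
  using grade_ge_carrier[of n l] M.r_zero by (auto simp: tcl_mem subset_iff)
 finally show ?thesis .
qed

lemma tcl_jet: assumes "x : grade_ge n 0" "y : grade_ge n 0" shows "tcl n l x = tcl n l y \<longleftrightarrow> jet n l x = jet n l y"
proof -
 interpret module CC "Der n" by (rule Der_module)
 note C = subsetD[OF grade_ge_carrier[of n 0, simplified]] subsetD[OF grade_ge_carrier[of n l]]
 have j: "jet n l y = jet n l x" if "y : tcl n l x" "x : grade_ge n 0" for x y
  using that C jet_zero_iff[of _ n l] grade_ge_mono[of 0 l n] by (auto simp: tcl_mem jet_lin)
 have sub: "tcl n l x <= tcl n l y" if xy: "jet n l x = jet n l y" "x : grade_ge n 0" "y : grade_ge n 0" for x y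
 proof
  fix z assume z: "z : tcl n l x"
  have zG: "z : grade_ge n 0" by (rule tcl_grade[OF xy(2) z])
  define h where "h = z \<oplus>\<^bsub>Der n\<^esub> ((-1) \<odot>\<^bsub>Der n\<^esub> y)"
  have hG: "h : grade_ge n 0" unfolding h_def using zG xy(3) grade_ge_closed[of _ n 0] by simp
  have "jet n l h = 0" unfolding h_def using j[OF z xy(2)] xy(1) C(1)[OF zG] C(1)[OF xy(3)] by (simp add: jet_lin)
  then have "h : grade_ge n (int l)" using jet_zero_iff[OF hG] by simp
  moreover have "z = h \<oplus>\<^bsub>Der n\<^esub> y"
   by (rule Der_eqI[OF C(1)[OF zG] Der_add_closed[OF C(1)[OF hG] C(1)[OF xy(3)]]]) (simp add: h_def Der_simps)
  ultimately show "z : tcl n l y" by (auto simp: tcl_mem)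
 qed
 show ?thesis
 proof
  assume "tcl n l x = tcl n l y"
  moreover have "x : tcl n l x" by (rule tcl_self[OF C(1)[OF assms(1)]])
  ultimately have "x : tcl n l y" by simp
  then show "jet n l x = jet n l y" by (rule j[OF _ assms(2)])
 next
  assume xy: "jet n l x = jet n l y"
  show "tcl n l x = tcl n l y" by (rule subset_antisym[OF sub[OF xy assms] sub[OF xy[symmetric] assms(2,1)]])
 qed
qed

text \<open>Scalar multiples and brackets of classes are unions over representatives, and comparing
  jets shows that all representatives give the same class. For the bracket this rests on
  \<open>grade_ge n (int l)\<close> being an ideal of \<open>grade_ge n 0\<close>.\<close>

lemma trunc_lin:
 assumes "x : grade_ge n 0" "y : grade_ge n 0"
 shows "tcl n l x \<oplus>\<^bsub>g_trunc n l\<^esub> tcl n l y = tcl n l (x \<oplus>\<^bsub>Der n\<^esub> y)"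
  and "c \<odot>\<^bsub>g_trunc n l\<^esub> tcl n l x = tcl n l (c \<odot>\<^bsub>Der n\<^esub> x)"
  and "tcl n l x \<otimes>\<^bsub>g_trunc n l\<^esub> tcl n l y = tcl n l (x \<otimes>\<^bsub>Der n\<^esub> y)"
proof -
 interpret module CC "Der n" by (rule Der_module)
 note C = subsetD[OF grade_ge_carrier[of n 0, simplified]] subsetD[OF grade_ge_carrier[of n l]]
 note x = C(1)[OF assms(1)] and y = C(1)[OF assms(2)]
 have cl: "a \<oplus>\<^bsub>Der n\<^esub> b : grade_ge n 0" "c \<odot>\<^bsub>Der n\<^esub> a : grade_ge n 0" "a \<otimes>\<^bsub>Der n\<^esub> b : grade_ge n 0"
  if "a : grade_ge n 0" "b : grade_ge n 0" for a b c
  using that grade_ge_closed[of a n 0 b] grade_ge_bracket(1)[of a n b 0] by auto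
 show "tcl n l x \<oplus>\<^bsub>g_trunc n l\<^esub> tcl n l y = tcl n l (x \<oplus>\<^bsub>Der n\<^esub> y)"
 proof (rule Set.set_eqI, rule iffI)
  fix z assume "z : tcl n l x \<oplus>\<^bsub>g_trunc n l\<^esub> tcl n l y"
  then obtain h h' where h: "h : grade_ge n (int l)" "h' : grade_ge n (int l)" "z = (h \<oplus>\<^bsub>Der n\<^esub> x) \<oplus>\<^bsub>Der n\<^esub> (h' \<oplus>\<^bsub>Der n\<^esub> y)"
   by (auto simp: trunc_ops tcl_mem)
  then have "z = (h \<oplus>\<^bsub>Der n\<^esub> h') \<oplus>\<^bsub>Der n\<^esub> (x \<oplus>\<^bsub>Der n\<^esub> y)" using C(2) x y by (simp add: M.a_ac)
  then show "z : tcl n l (x \<oplus>\<^bsub>Der n\<^esub> y)" using grade_ge_closed(1)[OF h(1,2)] by (auto simp: tcl_mem)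
 next
  fix z assume "z : tcl n l (x \<oplus>\<^bsub>Der n\<^esub> y)"
  then obtain h where h: "h : grade_ge n (int l)" "z = h \<oplus>\<^bsub>Der n\<^esub> (x \<oplus>\<^bsub>Der n\<^esub> y)" by (auto simp: tcl_mem)
  then have "z = (h \<oplus>\<^bsub>Der n\<^esub> x) \<oplus>\<^bsub>Der n\<^esub> y" using C(2) x y by (simp add: M.a_ac)
  moreover have "h \<oplus>\<^bsub>Der n\<^esub> x : tcl n l x" using h(1) by (auto simp: tcl_mem)
  ultimately show "z : tcl n l x \<oplus>\<^bsub>g_trunc n l\<^esub> tcl n l y"
   unfolding trunc_ops using tcl_self[OF y] by blast
 qed
 show "c \<odot>\<^bsub>g_trunc n l\<^esub> tcl n l x = tcl n l (c \<odot>\<^bsub>Der n\<^esub> x)"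
  unfolding trunc_ops
 proof (rule UN_constant_eq[OF tcl_self[OF x]])
  have "tcl n l (c \<odot>\<^bsub>Der n\<^esub> a) = tcl n l (c \<odot>\<^bsub>Der n\<^esub> x)" if a: "a : tcl n l x" for a
  proof -
   have aG: "a : grade_ge n 0" by (rule tcl_grade[OF assms(1) a])
   obtain h where h: "h : grade_ge n (int l)" "a = h \<oplus>\<^bsub>Der n\<^esub> x" using a by (auto simp: tcl_mem)
   have "jet n l h = 0" using h(1) jet_zero_iff[of h n l] grade_ge_mono[of 0 l n] by auto
   then show ?thesis using tcl_jet[OF cl(2) cl(2)] aG assms C(1)[OF aG] x C(2)[OF h(1)] by (simp add: jet_lin h(2))
  qed
  then show "\<forall>a\<in>tcl n l x. tcl n l (c \<odot>\<^bsub>Der n\<^esub> a) = tcl n l (c \<odot>\<^bsub>Der n\<^esub> x)" by blast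
 qed
 have br: "jet n l (a \<otimes>\<^bsub>Der n\<^esub> b) = jet n l (x \<otimes>\<^bsub>Der n\<^esub> y)" if ab: "a : tcl n l x" "b : tcl n l y" for a b
 proof -
  obtain h h' where h: "h : grade_ge n (int l)" "a = h \<oplus>\<^bsub>Der n\<^esub> x" "h' : grade_ge n (int l)" "b = h' \<oplus>\<^bsub>Der n\<^esub> y" using ab by (auto simp: tcl_mem)
  note hD = C(2)[OF h(1)] C(2)[OF h(3)]
  have bG: "b : grade_ge n 0" by (rule tcl_grade[OF assms(2) ab(2)])
  have lin: "D (p + q) = D p + D q" if "D : cDer n" "p : polys n" "q : polys n" for D p q using that by (simp add: Der_iff)
  have pol: "D p : polys n" if "D : cDer n" "p : polys n" for D p by (rule Der_polys[OF that])
  have Bc: "D \<otimes>\<^bsub>Der n\<^esub> D' : cDer n" if "D : cDer n" "D' : cDer n" for D D' by (rule Der_bracket_closed[OF that])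
  have aD: "a : cDer n" and bD: "b : cDer n" using hD x y by (auto simp: h(2,4) Der_add_closed)
  have e: "a p = h p + x p" "b p = h' p + y p" if "p : polys n" for p using that by (simp_all add: h(2,4) Der_simps)
  \<comment> \<open>The bracket is split so that each correction \<open>h\<close>, \<open>h'\<close>
    stands alone in a bracket with an element of \<open>grade_ge n 0\<close>.\<close>
  have 1: "a \<otimes>\<^bsub>Der n\<^esub> b = (h \<otimes>\<^bsub>Der n\<^esub> b) \<oplus>\<^bsub>Der n\<^esub> ((x \<otimes>\<^bsub>Der n\<^esub> h') \<oplus>\<^bsub>Der n\<^esub> (x \<otimes>\<^bsub>Der n\<^esub> y))" (is "_ = ?r")
  proof (rule Der_eqI)
   show "a \<otimes>\<^bsub>Der n\<^esub> b : cDer n" by (rule Bc[OF aD bD])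
   show "?r : cDer n" by (intro Der_add_closed Bc hD x y bD)
   fix k assume k: "k < n"
   let ?p = "pvar k"
   have p: "?p : polys n" using k by simp
   have f1: "a (b ?p) = h (b ?p) + (x (h' ?p) + x (y ?p))"
    using e(1)[OF pol[OF bD p]] lin[OF x pol[OF hD(2) p] pol[OF y p]] by (simp only: e(2)[OF p])
   have f2: "b (a ?p) = b (h ?p) + (h' (x ?p) + y (x ?p))"
    using lin[OF bD pol[OF hD(1) p] pol[OF x p]] e(2)[OF pol[OF x p]] by (simp only: e(1)[OF p])
   have f3: "(a \<otimes>\<^bsub>Der n\<^esub> b) ?p = a (b ?p) - b (a ?p)" using p by (simp add: Der_simps)
   have f4: "?r ?p = (h (b ?p) - b (h ?p)) + ((x (h' ?p) - h' (x ?p)) + (x (y ?p) - y (x ?p)))" using p by (simp add: Der_simps)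
   show "(a \<otimes>\<^bsub>Der n\<^esub> b) ?p = ?r ?p" unfolding f3 f4 f1 f2 by simp
  qed
  have "jet n l (h \<otimes>\<^bsub>Der n\<^esub> b) = 0" "jet n l (x \<otimes>\<^bsub>Der n\<^esub> h') = 0"
   using grade_ge_bracket[OF bG h(1)] grade_ge_bracket[OF assms(1) h(3)] jet_zero_iff[of _ n l] grade_ge_mono[of 0 l n] by auto
  then show ?thesis
   unfolding 1 using hD C(1)[OF bG] x y by (simp add: jet_lin Bc Der_add_closed)
 qed
 show "tcl n l x \<otimes>\<^bsub>g_trunc n l\<^esub> tcl n l y = tcl n l (x \<otimes>\<^bsub>Der n\<^esub> y)"
  unfolding trunc_ops
 proof (rule UN_constant_eq[OF tcl_self[OF x]], rule ballI, rule UN_constant_eq[OF tcl_self[OF y]], rule ballI)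
  fix a b assume ab: "a : tcl n l x" "b : tcl n l y"
  have G: "a : grade_ge n 0" "b : grade_ge n 0" by (rule tcl_grade[OF assms(1) ab(1)], rule tcl_grade[OF assms(2) ab(2)])
  show "tcl n l (a \<otimes>\<^bsub>Der n\<^esub> b) = tcl n l (x \<otimes>\<^bsub>Der n\<^esub> y)"
   unfolding tcl_jet[OF cl(3)[OF G] cl(3)[OF assms]] by (rule br[OF ab])
 qed
qed

text \<open>Jets embed the quotient into a space of finitely supported functions, from which the
  axioms are inherited.\<close>

lemma trunc_module: "module CC (g_trunc n l)"
proof -
 note C = subsetD[OF grade_ge_carrier[of n 0, simplified]]
 have cl: "a \<oplus>\<^bsub>Der n\<^esub> b : grade_ge n 0" "c \<odot>\<^bsub>Der n\<^esub> a : grade_ge n 0" if "a : grade_ge n 0" "b : grade_ge n 0" for a b c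
  using that grade_ge_closed[of a n 0 b] by auto
 define f where "f A = jet n l (SOME x. x : grade_ge n 0 & A = tcl n l x)" for A
 have f: "f (tcl n l x) = jet n l x" if "x : grade_ge n 0" for x
 proof -
  define y where "y = (SOME y. y : grade_ge n 0 & tcl n l x = tcl n l y)"
  have y: "y : grade_ge n 0 & tcl n l x = tcl n l y"
   unfolding y_def by (rule someI[of "%y. y : grade_ge n 0 & tcl n l x = tcl n l y" x]) (use that in auto)
  then show ?thesis unfolding f_def y_def[symmetric] using tcl_jet[OF that conjunct1[OF y], of l] by simp
 qed
 have z: "\<zero>\<^bsub>Der n\<^esub> : grade_ge n 0" using grade_ge_zero[of n 0] by simp
 show ?thesis
 proof (rule moduleI_inj[of f])
  show "inj_on f (carrier (g_trunc n l))" unfolding trunc_carrier by (auto simp: inj_on_def f tcl_jet)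
  show "A \<oplus>\<^bsub>g_trunc n l\<^esub> B : carrier (g_trunc n l) & f (A \<oplus>\<^bsub>g_trunc n l\<^esub> B) = f A + f B"
   if "A : carrier (g_trunc n l)" "B : carrier (g_trunc n l)" for A B
   using that unfolding trunc_carrier by (auto simp: trunc_lin f cl jet_lin C)
  show "c \<odot>\<^bsub>g_trunc n l\<^esub> A : carrier (g_trunc n l) & f (c \<odot>\<^bsub>g_trunc n l\<^esub> A) = pscale c (f A)" if "A : carrier (g_trunc n l)" for c A
   using that unfolding trunc_carrier by (auto simp: trunc_lin f cl jet_lin C)
  show "\<zero>\<^bsub>g_trunc n l\<^esub> : carrier (g_trunc n l)" unfolding trunc_carrier trunc_zero using z by blast
  have "jet n l \<zero>\<^bsub>Der n\<^esub> = 0" using jet_zero_iff[OF z] grade_ge_zero by simp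
  then show "f \<zero>\<^bsub>g_trunc n l\<^esub> = 0" unfolding trunc_zero f[OF z] .
 qed
qed

context smooth_drep
begin

lemma rho_filt: assumes "x : grade_ge n (int l)" "u : filt l" shows "\<rho> x u = 0"
proof -
 have x: "x : cDer n" "!!j. j < n ==> ordge n (l + 1) (x (pvar j))" using assms(1) by (auto simp: grade_ge_ordge)
 show ?thesis unfolding rho_R[OF x(1)] dact_def by (rule sum.neutral) (use filt_kill[OF assms(2)] x(2) in auto)
qed

lemma rho_stable: assumes "x : grade_ge n 0" "u : N" "stable 1 N" shows "\<rho> x u : N"
proof -
 have x: "x : cDer n" "!!j. j < n ==> ordge n 1 (x (pvar j))" using assms(1) grade_ge_ordge[of n 0] by auto
 show ?thesis unfolding rho_R[OF x(1)] dact_def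
  by (rule pm.subspace_sum[OF stable_subspace[OF assms(3)]]) (use stableD[OF assms(3)] x(2) assms(2) in auto)
qed

text \<open>On \<open>filt l\<close> any representative may be used, since
  \<open>grade_ge n (int l)\<close> acts by zero there.\<close>

definition tact :: "cop set => 'x cv => 'x cv" where
 "tact A u = \<rho> (SOME x. x : A) u"

lemma tact_tcl: assumes x: "x : grade_ge n 0" and u: "u : filt l" shows "tact (tcl n l x) u = \<rho> x u"
proof -
 have xD: "x : cDer n" using x grade_ge_carrier[of n 0] by auto
 have "(SOME y. y : tcl n l x) : tcl n l x" by (rule someI[of "%y. y : tcl n l x", OF tcl_self[OF xD]])
 then obtain h where h: "h : grade_ge n (int l)" "(SOME y. y : tcl n l x) = h \<oplus>\<^bsub>Der n\<^esub> x" by (auto simp: tcl_mem)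
 have "h : cDer n" using h(1) grade_ge_carrier by blast
 then show ?thesis unfolding tact_def h(2) using rho_add[of h x u] xD rho_filt[OF h(1) u] by simp
qed

text \<open>\<open>E\<close> is \<open>filt l\<close> as a module over the truncation. Its
  translates are independent, which gives simplicity through \<open>indep_simple\<close> and the
  isomorphism through \<open>Ind_liso\<close>.\<close>

lemma induced_case:
 fixes V :: "(cop, 'x) lmod"
 assumes l: "liso (cDer n) V \<rho> fi W" and F: "2 <= l" "filt l ~= {0}" "filt (l - 1) = {0}"
 shows "\<exists>E :: (cop set, 'x) lmod. simple_lie_module (g_trunc n l) E &
   (let E' = inflate (Der n) (grade_ge n (int l)) E in
    (\<exists>x\<in>grade n (int l - 1). \<exists>e\<in>carrier E. act E' x e ~= \<zero>\<^bsub>E\<^esub>) &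
    lie_module_iso (Der n) V (Ind (Der n) (grade_ge n 0) E'))"
proof -
 note st = filt_stable[of l]
 have F0: "pm.subspace (filt l)" by (rule stable_subspace[OF st])
 have ind: "indep (filt l)" by (rule indep_filt[OF F(1,3)])
 have GD: "x : cDer n" if "x : grade_ge n 0" for x using that grade_ge_carrier[of n 0] by auto
 have cl: "a \<oplus>\<^bsub>Der n\<^esub> b : grade_ge n 0" "c \<odot>\<^bsub>Der n\<^esub> a : grade_ge n 0" "a \<otimes>\<^bsub>Der n\<^esub> b : grade_ge n 0"
  if "a : grade_ge n 0" "b : grade_ge n 0" for a b c
  using that grade_ge_closed[of a n 0 b] grade_ge_bracket(1)[of a n b 0] by auto
 define E :: "(cop set, 'x) lmod" where "E = rmod V fi (filt l) tact"
 have lE: "liso (carrier (g_trunc n l)) E tact fi (filt l)"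
  unfolding E_def
 proof (rule rmod_liso[OF l F0 filt_W])
  fix A u assume "A : carrier (g_trunc n l)" "u : filt l"
  then show "tact A u : filt l" unfolding trunc_carrier using rho_stable[OF _ _ st] by (auto simp: tact_tcl)
 qed
 note lmE = liso_lmap[OF lE]
 have lie: "lie_module (g_trunc n l) E"
 proof (rule liso_lie_module[OF lE trunc_module])
  fix A B assume "A : carrier (g_trunc n l)" "B : carrier (g_trunc n l)"
  then obtain x y where x: "x : grade_ge n 0" "A = tcl n l x" and y: "y : grade_ge n 0" "B = tcl n l y" unfolding trunc_carrier by blast
  show "A \<otimes>\<^bsub>g_trunc n l\<^esub> B : carrier (g_trunc n l)" using x y cl(3)[OF x(1) y(1)] by (simp add: trunc_carrier trunc_lin)
  have "(SOME z. z : A) : cDer n"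
   using someI[of "%z. z : A" x] tcl_self[OF GD[OF x(1)]] tcl_grade[OF x(1)] GD unfolding x(2) by blast
  then show "plin (tact A)" using rho_plin unfolding tact_def by blast
  fix u c assume u: "u : filt l"
  note t = tact_tcl[OF _ u]
  show "tact (A \<oplus>\<^bsub>g_trunc n l\<^esub> B) u = tact A u + tact B u"
   using x y by (simp add: trunc_lin t cl rho_add GD)
  show "tact (c \<odot>\<^bsub>g_trunc n l\<^esub> A) u = pscale c (tact A u)"
   using x by (simp add: trunc_lin t cl(2)[OF x(1) x(1)] rho_smult GD)
  have "\<rho> x u : filt l" "\<rho> y u : filt l" using x y u rho_stable[OF _ _ st] by auto
  then show "tact (A \<otimes>\<^bsub>g_trunc n l\<^esub> B) u = tact A (tact B u) - tact B (tact A u)"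
   using x y by (simp add: trunc_lin t tact_tcl cl rho_bracket GD)
 qed
 have simple: "simple_lie_module (g_trunc n l) E"
 proof (rule liso_simple[OF lE lie F(2)])
  fix N assume N: "pm.subspace N" "N <= filt l" "!!A u. A : carrier (g_trunc n l) ==> u : N ==> tact A u : N"
  have "stable 1 N" unfolding stable_def
  proof (intro conjI allI impI N(1))
   fix f j u assume f: "ordge n 1 f" "j < n" "u : N"
   have D: "dop n f j : grade_ge n 0" using f ordge_polys[OF f(1)] ordge_0_poly by (auto simp: grade_ge_ordge[of n 0, simplified] dop_pvar)
   have "tact (tcl n l (dop n f j)) u : N" using N(3) f(3) D unfolding trunc_carrier by blast
   then show "R f j u : N" using tact_tcl[OF D, of u l] N(2) f(3) by (auto simp: R_def)
  qed
  then show "N = {0} \<or> N = filt l" using indep_simple[OF ind st filt_W _ N(2)] by blast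
 qed
 define E' where "E' = inflate (Der n) (grade_ge n (int l)) E"
 have E'_simps: "carrier E' = carrier E" "add E' = add E" "module.smult E' = module.smult E" "\<zero>\<^bsub>E'\<^esub> = \<zero>\<^bsub>E\<^esub>" "act E' x = act E (tcl n l x)" for x
  by (simp_all add: E'_def inflate_def tcl_def module.defs lmod.defs)
 have "module CC E'"
  by (rule moduleI_inj[of fi])
   (use liso_bij[OF lE] lmap_module[OF lmE] in \<open>auto simp: E'_simps bij_betw_def lmap_add[OF lmE] lmap_smult[OF lmE] lmap_zero[OF lmE]
    module.smult_closed abelian_monoid.a_closed abelian_monoid.zero_closed abelian_group.axioms(1) module.axioms(2)\<close>)
 have t: "tcl n l x : carrier (g_trunc n l)" if "x : grade_ge n 0" for x using that by (auto simp: trunc_carrier)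
 have lE': "liso (grade_ge n 0) E' \<rho> fi (filt l)"
  unfolding liso_def lmap_def E'_simps
  using \<open>module CC E'\<close> liso_bij[OF lE] lmap_add[OF lmE] lmap_smult[OF lmE] lmap_closed[OF lmE t] lmap_act[OF lmE t] tact_tcl liso_in[OF lE] by auto
 have "lie_module_iso (Der n) V (Ind (Der n) (grade_ge n 0) E')"
  by (rule liso_trans[OF l Ind_liso[OF lE' st filt_W F(2) ind]])
 \<comment> \<open>Fields of degree \<open>l - 1\<close> have coefficients of degree
   \<open>l\<close>. If all of them acted by zero, \<open>filt l\<close> would be contained in
   \<open>filt (l - 1)\<close>, which is zero.\<close>
 moreover have "\<exists>x\<in>grade n (int l - 1). \<exists>e\<in>carrier E. act E' x e ~= \<zero>\<^bsub>E\<^esub>"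
 proof (rule ccontr)
  assume "\<not> ?thesis"
  then have z: "act E' x e = \<zero>\<^bsub>E\<^esub>" if "x : grade n (int l - 1)" "e : carrier E" for x e using that by blast
  have "u : filt (l - 1)" if u: "u : filt l" for u
  proof (rule mono_zero_filt)
   show "u : filt (Suc (l - 1))" using u F(1) by simp
   fix \<mu> j assume m: "\<mu> : exponents n" "deg n \<mu> = Suc (l - 1)" "j < n"
   have ml: "deg n \<mu> = l" using m(2) F(1) by simp
   have k: "keys (mono n \<mu>) <= {\<mu>}" by (simp add: mono_def)
   have mp: "mono n \<mu> : polys n" using m by auto
   have D: "dop n (mono n \<mu>) j : grade n (int l - 1)"
    unfolding grade_gr gr_def using m(3) mp k ml by (auto simp: dop_pvar)
   have D0: "dop n (mono n \<mu>) j : grade_ge n 0"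
    using m mp ml F(1) ordge_0_poly by (auto simp: grade_ge_ordge[of n 0, simplified] dop_pvar intro: ordge_mono_poly)
   obtain e where e: "e : carrier E" "u = fi e" using u liso_image[OF lE] by blast
   have "\<rho> (dop n (mono n \<mu>) j) u = fi (act E' (dop n (mono n \<mu>) j) e)"
    using lmap_act[OF liso_lmap[OF lE'] D0, of e] e by (simp add: E'_simps)
   then show "R (mono n \<mu>) j u = 0" using z[OF D e(1)] lmap_zero[OF lmE] by (simp add: R_def)
  qed
  then show False using F(2,3) pm.subspace_0[OF F0] by blast
 qed
 ultimately show ?thesis using simple unfolding E'_def by (intro exI[of _ E]) (simp add: Let_def)
qed

end

section \<open>Classification\<close>

text \<open>The operators \<open>\<rho> D\<close> are defined on all finitely supported functions
  through the total map \<open>ev\<close>, so the axioms of \<open>drep\<close> hold on the whole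
  ambient space; simplicity and smoothness are transported to \<open>W\<close>.\<close>

lemma smooth_coordinates:
 fixes V :: "(cop, 'v) lmod"
 assumes V: "simple_lie_module (Der n) V" "smooth n V"
 obtains \<rho> W and fi :: "'v => 'v cv" where "smooth_drep n \<rho> W" "liso (cDer n) V \<rho> fi W"
proof -
 have lie: "lie_module (Der n) V" using V(1) by (simp add: simple_lie_module_def)
 interpret V: lie_module "Der n" V by (rule lie)
 have mod: "module CC V" ..
 show thesis
 proof (rule vector_space_coordinates[OF mod])
 fix B :: "'v set" and fi :: "'v => 'v cv" and ev :: "'v cv => 'v"
 assume ev: "!!p. ev p : carrier V" "!!p q. ev (p + q) = ev p \<oplus>\<^bsub>V\<^esub> ev q" "!!c p. ev (pscale c p) = c \<odot>\<^bsub>V\<^esub> ev p"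
  and fi: "!!v. v : carrier V ==> keys (fi v) <= B & ev (fi v) = v" "!!p. keys p <= B ==> fi (ev p) = p"
 define W where "W = {p :: 'v cv. keys p <= B}"
 have sW: "pm.subspace W" unfolding W_def by (rule subspace_keys)
 have fiW: "fi v : W" if "v : carrier V" for v using fi(1)[OF that] by (simp add: W_def)
 have fie: "fi (ev p) = p" if "p : W" for p using fi(2) that by (simp add: W_def)
 have add: "fi (v \<oplus>\<^bsub>V\<^esub> w) = fi v + fi w" if "v : carrier V" "w : carrier V" for v w
  using fie[OF pm.subspace_add[OF sW fiW[OF that(1)] fiW[OF that(2)]]] fi(1) that by (simp add: ev)
 have smult: "fi (c \<odot>\<^bsub>V\<^esub> v) = pscale c (fi v)" if "v : carrier V" for c v
  using fie[OF pm.subspace_scale[OF sW fiW[OF that]], of c] fi(1) that by (simp add: ev)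
 define \<rho> where "\<rho> = (%D u. fi (act V D (ev u)))"
 have lm: "lmap (cDer n) V \<rho> fi"
  unfolding lmap_def using mod fi(1) by (auto simp: add smult V.act_closed \<rho>_def)
 have bij: "bij_betw fi (carrier V) W"
  by (rule bij_betw_byWitness[of _ ev]) (use fi fiW fie ev in auto)
 have l: "liso (cDer n) V \<rho> fi W" using lm bij by (simp add: liso_def)
 interpret d: drep n \<rho>
 proof
  fix D assume D: "D : cDer n"
  show "plin (\<rho> D)"
   by (rule plinI) (use D in \<open>simp_all add: \<rho>_def ev V.act_add V.act_smult add smult V.act_closed\<close>)
  show "\<rho> (c \<odot>\<^bsub>Der n\<^esub> D) u = pscale c (\<rho> D u)" for c u
   using D by (simp add: \<rho>_def ev V.smult_act smult V.act_closed)
  fix D' u assume D': "D' : cDer n"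
  show "\<rho> (D \<oplus>\<^bsub>Der n\<^esub> D') u = \<rho> D u + \<rho> D' u"
   using D D' by (simp add: \<rho>_def ev V.add_act add V.act_closed)
  have "ev (fi v) = v" if "v : carrier V" for v using fi(1)[OF that] by simp
  then show "\<rho> (D \<otimes>\<^bsub>Der n\<^esub> D') u = \<rho> D (\<rho> D' u) - \<rho> D' (\<rho> D u)"
   using D D' by (simp add: \<rho>_def ev V.bracket_act V.act_closed lmap_diff[OF lm])
 qed
 have "smooth_drep n \<rho> W"
 proof
  have WD: "\<rho> D u : W" if "D : cDer n" for D u
   unfolding \<rho>_def using that by (intro fiW V.act_closed ev)
  show "d.stable 0 W" unfolding d.stable_def using sW by (auto simp: d.R_def intro!: WD)
  show "W ~= {0}" by (rule simple_liso(2)[OF l V(1) sW order_refl WD])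
  fix N assume N: "d.stable 0 N" "N <= W"
  have "\<rho> D u : N" if "D : cDer n" "u : N" for D u
   unfolding d.rho_R[OF that(1)] d.dact_def
   by (rule pm.subspace_sum[OF d.stable_subspace[OF N(1)]]) (use that Der_polys[OF that(1)] d.stableD[OF N(1)] in auto)
  then show "N = {0} \<or> N = W" by (rule simple_liso(1)[OF l V(1) d.stable_subspace[OF N(1)] N(2)])
 next
  fix u assume u: "u : W"
  obtain m :: nat where m: "!!i x. i \<ge> int m ==> x : grade n i ==> act V x (ev u) = \<zero>\<^bsub>V\<^esub>"
   using V(2) ev(1)[of u] unfolding smooth_def by blast
  have dR: "d.R f j u = fi (act V (dop n f j) (ev u))" for f j unfolding d.R_def by (simp add: \<rho>_def)
  \<comment> \<open>Order \<open>m + 1\<close> of the coefficient corresponds to degree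
    \<open>m\<close> in the grading.\<close>
  have "d.R f j u = 0" if f: "ordge n (m + 1) f" "j < n" for f j
  proof -
   have "keys f <= {al : exponents n. m + 1 <= deg n al}" using f(1) by (auto simp: ordge_def polys_def)
   then have "f : polys n & d.R f j u = 0"
   proof (induction rule: pm_sup_induct)
    case (gen al)
    have "dop n (gen al) j : grade n (int (deg n al) - 1)"
     unfolding grade_gr gr_def using gen f(2) by (auto simp: dop_pvar)
    then have "act V (dop n (gen al) j) (ev u) = \<zero>\<^bsub>V\<^esub>" using m[of "int (deg n al) - 1"] gen by auto
    then show ?case using gen lmap_zero[OF lm] by (simp add: dR)
   qed (use f(2) in \<open>auto simp: d.R_0 d.R_add d.R_scale\<close>)
   then show ?thesis by blast
  qed
  then show "\<exists>m. \<forall>f j. ordge n m f --> j < n --> d.R f j u = 0" by blast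
 qed
 then show thesis using l by (rule that)
 qed
qed

theorem theorem5p6:
  fixes n :: nat and V :: "(cop, 'v) lmod"
  assumes "n \<ge> 1"
    and "simple_lie_module (Der n) V"
    and "smooth n V"
  shows "((\<exists>M :: (complex mat, 'v) lmod. simple_lie_module (gl n) M \<and>
             (\<forall>r\<in>{0..n}. \<not> is_V n (fund_weight r) (of_nat r) M) \<and>
             lie_module_iso (Der n) V (F n (P0 n) M))
        \<or> lie_module_iso (Der n) V (F_ext n 0)
        \<or> (\<exists>r\<in>{1..n - 1}. lie_module_iso (Der n) V (quot_module (F_ext n r) (Ln_tilde n r)))
        \<or> lie_module_iso (Der n) V (quot_module (F_ext n n) (Ln n n))
        \<or> (\<exists>l\<ge>2. \<exists>E :: (cop set, 'v) lmod. simple_lie_module (g_trunc n l) E \<and>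
             (let E' = inflate (Der n) (grade_ge n (int l)) E in
                (\<exists>x\<in>grade n (int l - 1). \<exists>e\<in>carrier E. act E' x e \<noteq> \<zero>\<^bsub>E\<^esub>) \<and>
                lie_module_iso (Der n) V (Ind (Der n) (grade_ge n 0) E'))))
      \<and> lie_module_iso (Der n) (F_ext n 0) (P0 n)
      \<and> one_dimensional (quot_module (F_ext n n) (Ln n n))"
proof (intro conjI)
 show "lie_module_iso (Der n) (F_ext n 0) (P0 n)" by (rule F_ext_0_P0)
 show "one_dimensional (quot_module (F_ext n n) (Ln n n))" by (rule Ln_top_one_dimensional[OF assms(1)])
 obtain \<rho> W and fi :: "'v => 'v cv" where sd: "smooth_drep n \<rho> W" and l: "liso (cDer n) V \<rho> fi W"
  by (rule smooth_coordinates[OF assms(2,3)])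
 interpret smooth_drep n \<rho> W by (rule sd)
 define k where "k = (LEAST k. filt k ~= {0})"
 have k: "filt k ~= {0}" unfolding k_def by (rule LeastI_ex[OF filt_nonzero])
 have below_k: "filt i = {0}" if "i < k" for i using not_less_Least[of i "%k. filt k ~= {0}"] that by (auto simp: k_def)
 show "(\<exists>M :: (complex mat, 'v) lmod. simple_lie_module (gl n) M &
       (\<forall>r\<in>{0..n}. \<not> is_V n (fund_weight r) (of_nat r) M) &
       lie_module_iso (Der n) V (F n (P0 n) M))
    \<or> lie_module_iso (Der n) V (F_ext n 0)
    \<or> (\<exists>r\<in>{1..n - 1}. lie_module_iso (Der n) V (quot_module (F_ext n r) (Ln_tilde n r)))
    \<or> lie_module_iso (Der n) V (quot_module (F_ext n n) (Ln n n))
    \<or> (\<exists>l\<ge>2. \<exists>E :: (cop set, 'v) lmod. simple_lie_module (g_trunc n l) E &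
       (let E' = inflate (Der n) (grade_ge n (int l)) E in
        (\<exists>x\<in>grade n (int l - 1). \<exists>e\<in>carrier E. act E' x e ~= \<zero>\<^bsub>E\<^esub>) &
        lie_module_iso (Der n) V (Ind (Der n) (grade_ge n 0) E')))"
  (is "?A \<or> ?B \<or> ?C \<or> ?D \<or> ?I")
 proof (cases "2 <= k")
  case True
  have "filt (k - 1) = {0}" using below_k True by simp
  from induced_case[OF l True k this] have ?I using True by blast
  then show ?thesis by blast
 next
  case False
  \<comment> \<open>The indices 0 and 1 are treated together through \<open>filt 1\<close>; index 0
    is the case in which the linear fields, too, kill some nonzero vector.\<close>
  have sub: "filt k <= filt 1"
  proof -
   have "ordge n (k + 1) f" if "ordge n 2 f" for f by (rule ordge_mono[OF that]) (use False in simp)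
   then show ?thesis by (auto simp: filt_def)
  qed
  have F1: "filt 1 ~= {0}"
  proof
   assume "filt 1 = {0}"
   then have "filt k <= {0}" using sub by simp
   then show False using k pm.subspace_0[OF stable_subspace[OF filt_stable[of k]]] by blast
  qed
  show ?thesis
  proof (cases "filtT = {0}")
   case True
   show ?thesis using tensor_case[OF assms(1) l F1 True] by (rule disjI1)
  next
   case False
   note st = filtT_stable
   obtain r eta where r: "r <= n" "plin eta" "!!y. y : Lam n r ==> eta y : filtT" "!!y. y : Lam n r ==> eta y = 0 ==> y = 0"
    "!!i j y. i < n ==> j < n ==> y : Lam n r ==> eta (ei i j y) = ee i j (eta y)"
    by (rule exterior_embedding[OF glrep_ee stable_subspace[OF st] False ee_stable[OF st]]) (auto simp: filtT_def)
   have "(\<exists>fi. liso (cDer n) (F_ext n 0) \<rho> fi W) \<or>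
     (\<exists>s\<in>{1..n - 1}. \<exists>fi. liso (cDer n) (quot_module (F_ext n s) (Ln_tilde n s)) \<rho> fi W) \<or>
     (\<exists>fi. liso (cDer n) (quot_module (F_ext n n) (Ln n n)) \<rho> fi W)"
    by (rule exterior_liso[OF r(1) assms(1) r(2)]; fact r)
   then have "?B \<or> ?C \<or> ?D"
    by (elim disjE bexE exE) (blast intro: liso_trans[OF l])+
   then show ?thesis by blast
  qed
 qed
qed

end
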